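(* Under the standing assumptions given in the context, let $\hat Z\sim\sigma\, GOE(n)$ be independent of $A_n,Z_n$. For $T=(t_1,\dots,t_n)^\intercal\in\mathbb{R}^n$ with $t_1\ge\dots\ge t_n$, let $\hat t_1\ge\dots\ge\hat t_n$ be the eigenvalues of $\operatorname{diag}(T)+n^{-1/2}\hat Z$. Consider the problem of minimizing $n^{-1}\sum_{i=1}^n(\hat t_i-\hat\lambda_i)^2$ over all such $T$, where $\hat\lambda_1\ge\dots\ge\hat\lambda_n$ are the eigenvalues of $\hat A_n$. Then: 1. $$\min_T\frac1n\sum_{i=1}^n\left(\hat t_i-\hat\lambda_i\right)^2\longrightarrow 0\quad\text{almost surely as } n\to\infty.$$ 2. If $T^*=(t_1^*,\dots,t_n^* )^\intercal$, $t_1^*\ge\dots\ge t_n^*$, is a minimizer of this optimization problem, then $$\frac1n\sum_{i=1}^n(t_i^*-\lambda_i)^2\longrightarrow 0\quad\text{almost surely as } n\to\infty,$$ where $\lambda_1\ge\dots\ge\lambda_n$ are the eigenvalues of $A_n$.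
   Context: Standing assumptions. For each $n$, $A_n\in\mathbb{R}^{n\times n}$ is a real symmetric matrix (deterministic or random), $\sigma>0$ is fixed (and known), and $\hat{A}_n=A_n+\sigma n^{-1/2}Z_n$, with $n\to\infty$. (i) The empirical spectral distribution $n^{-1}\sum_{k=1}^n\delta_{\lambda_k}$ of the eigenvalues of $A_n$ converges weakly almost surely to a deterministic probability measure $H$. (ii) $H$ is supported on a compact interval of $\mathbb{R}$, and eventually (for all large $n$) all eigenvalues of $A_n$ lie in a compact interval $[h_1,h_2]\subset\mathbb{R}$. (iii) $Z_n$ is real symmetric and independent of $A_n$; it is the top-left $n\times n$ submatrix of an infinite symmetric matrix $(Z_{ij})_{i,j\ge1}$ whose entries on and above the diagonal are i.i.d. with mean $0$, variance $1$ and finite fourth moment. $GOE(n)$ denotes the Gaussian Orthogonal Ensemble on real symmetric $n\times n$ matrices (independent centered Gaussian entries on and above the diagonal, off-diagonal variance $1$, diagonal variance $2$). *)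

theory Defs
  imports "HOL-Probability.Probability" "Jordan_Normal_Form.Char_Poly"
begin

definition real_symmetric :: "nat \<Rightarrow> real mat \<Rightarrow> bool" where
  "real_symmetric n B \<longleftrightarrow> B \<in> carrier_mat n n \<and> transpose_mat B = B"

text \<open>
  Eigenvalues with multiplicity in decreasing order, indexed from 0. For a real symmetric
  \<open>n\<close> by \<open>n\<close> matrix the characteristic polynomial splits over the reals, so that all
  \<open>n\<close> eigenvalues are listed.
\<close>
definition eig_desc :: "real mat \<Rightarrow> nat \<Rightarrow> real" where
  "eig_desc B k = rev (sorted_list_of_multiset (proots (char_poly B))) ! k"

definition esd :: "real mat \<Rightarrow> real measure" where
  "esd B = distr (uniform_count_measure {..<dim_row B}) borel (eig_desc B)"

text \<open>
  There is no sigma-algebra on the type of matrices; a random \<open>n\<close> by \<open>n\<close> matrix is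
  viewed as a random element of the product space of its entries.
\<close>
definition entry_space :: "nat \<Rightarrow> (nat \<times> nat \<Rightarrow> real) measure" where
  "entry_space n = PiM ({..<n} \<times> {..<n}) (\<lambda>_. borel)"

definition entries :: "nat \<Rightarrow> real mat \<Rightarrow> nat \<times> nat \<Rightarrow> real" where
  "entries n B = restrict (\<lambda>ij. B $$ ij) ({..<n} \<times> {..<n})"

definition top_left :: "nat \<Rightarrow> (nat \<Rightarrow> nat \<Rightarrow> real) \<Rightarrow> real mat" where
  "top_left n z = mat n n (\<lambda>(i, j). z i j)"

context prob_space
begin

text \<open>
  Independence of random elements with values in spaces of different types, which
  \<^const>\<open>indep_var\<close> does not allow: the generated sigma-algebras are independent.
\<close>
definition indep_elements ::
    "'b measure \<Rightarrow> ('a \<Rightarrow> 'b) \<Rightarrow> 'c measure \<Rightarrow> ('a \<Rightarrow> 'c) \<Rightarrow> bool" where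
  "indep_elements N X N' Y \<longleftrightarrow>
     random_variable N X \<and> random_variable N' Y \<and>
     indep_set (sets (vimage_algebra (space M) X N)) (sets (vimage_algebra (space M) Y N'))"

definition wigner_array :: "('a \<Rightarrow> nat \<Rightarrow> nat \<Rightarrow> real) \<Rightarrow> bool" where
  "wigner_array Z \<longleftrightarrow>
     (\<forall>\<omega>\<in>space M. \<forall>i j. Z \<omega> i j = Z \<omega> j i) \<and>
     indep_vars (\<lambda>_. borel) (\<lambda>(i, j) \<omega>. Z \<omega> i j) {(i, j). i \<le> j} \<and>
     (\<forall>i j. i \<le> j \<longrightarrow> distr M borel (\<lambda>\<omega>. Z \<omega> i j) = distr M borel (\<lambda>\<omega>. Z \<omega> 0 0)) \<and>
     integrable M (\<lambda>\<omega>. Z \<omega> 0 0 ^ 4) \<and>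
     expectation (\<lambda>\<omega>. Z \<omega> 0 0) = 0 \<and>
     variance (\<lambda>\<omega>. Z \<omega> 0 0) = 1"

text \<open>The parameter of \<^const>\<open>normal_density\<close> is the standard deviation, not the variance.\<close>
definition GOE :: "nat \<Rightarrow> ('a \<Rightarrow> real mat) \<Rightarrow> bool" where
  "GOE n X \<longleftrightarrow>
     (\<forall>\<omega>\<in>space M. real_symmetric n (X \<omega>)) \<and>
     indep_vars (\<lambda>_. borel) (\<lambda>(i, j) \<omega>. X \<omega> $$ (i, j)) {(i, j). i \<le> j \<and> j < n} \<and>
     (\<forall>i j. i \<le> j \<and> j < n \<longrightarrow>
        distributed M lborel (\<lambda>\<omega>. X \<omega> $$ (i, j))
          (normal_density 0 (if i = j then sqrt 2 else 1)))"

end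

definition ordered_vecs :: "nat \<Rightarrow> real vec set" where
  "ordered_vecs n = {T \<in> carrier_vec n. \<forall>i j. i \<le> j \<and> j < n \<longrightarrow> vec_index T j \<le> vec_index T i}"

definition fit_error :: "nat \<Rightarrow> real mat \<Rightarrow> real mat \<Rightarrow> real vec \<Rightarrow> real" where
  "fit_error n Zh Ah T =
     (1 / real n) *
       (\<Sum>i<n. (eig_desc (mat_diag n (vec_index T) + (1 / sqrt (real n)) \<cdot>\<^sub>m Zh) i
              - eig_desc Ah i)\<^sup>2)"

end

theory Submission
  imports Defs "Jordan_Normal_Form.Spectral_Radius" "HOL-Real_Asymp.Real_Asymp"
begin

text \<open>
  Let \<open>T = \<sigma>\<^sup>2\<close>, and write \<open>s\<^sub>x(z) = 1/n \<Sum> 1 / (x\<^sub>k - z)\<close> for the Stieltjes transform of a sample. Adding to a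
  symmetric matrix \<open>B\<close> independent noise of entry variance \<open>T / n\<close> changes its spectrum in a way that is
  asymptotically deterministic: if \<open>S\<close> is the Stieltjes transform of the perturbed matrix, then
  \<open>S - s\<^sub>B(z + T S)\<close> tends to zero (Pastur's equation, free convolution with a semicircle). The law of
  the noise enters only through its mean and variance, so Gaussian noise and the given noise act in
  the same way.

  This equation can be solved in both directions in the half-plane \<open>Im z \<ge> 2 \<sigma>\<close>. Forwards, \<open>S\<close> is the
  fixed point of a contraction of factor \<open>1/4\<close> (\<open>fixed_point_stable\<close>), so that two matrices with the same
  spectrum, perturbed by the two noises, have asymptotically equal transforms. Hence the true
  spectrum, taken as the vector to be fitted, has vanishing fitting error (\<open>fit_true_spectrum\<close>).
  Backwards, the transform of the unperturbed matrix at \<open>z + T S\<close> is read off from \<open>S\<close>. A minimizer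
  fits at least as well as the true spectrum, its perturbed spectrum is therefore close to that of the
  data, and reading both equations backwards shows that the minimizer and the true spectrum have the same
  limiting transform (\<open>good_fit_is_close\<close>). Here the weak limit \<open>H\<close> supplies points \<open>z\<close> which do not
  depend on \<open>n\<close>.

  Four facts carry this argument.

  \<^item> The equation holds almost surely, with summable probabilities of failure: \<open>variance_stieltjes_le\<close>
    (an Efron--Stein bound of order \<open>1/n\<^sup>2\<close> for the variance) and \<open>bias_le\<close> (an expansion of the mean, one
    entry at a time) give \<open>self_consistency_probability\<close>, and then \<open>AE_residual_tendsto_zero\<close>.

  \<^item> The minimizer depends on the noise, so the equation is needed for all diagonal matrices at once.
    Decreasing vectors of bounded second moment are totally bounded in normalized \<open>l\<^sup>1\<close>-distance,
    uniformly in \<open>n\<close>: finitely many rational step functions approximate all of them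
    (\<open>finite_profile_net\<close>), and a countable union of null sets is null (\<open>residual_tendsto_uniformly\<close>).

  \<^item> For sorted samples, convergence of the differences of Stieltjes transforms on a part of the
    imaginary axis, of the second moments, and uniform integrability of one sample imply that the
    normalized \<open>l\<^sup>2\<close>-distance vanishes (\<open>sorted_distance_tendsto_zero\<close>). This replaces weak convergence
    and Wasserstein distances.

  \<^item> The noise has only four moments, so the perturbed spectrum need not be bounded. Its uniform
    integrability is extracted from the equation itself, at a high point of the imaginary axis
    (\<open>uniformly_integrable_perturbed\<close>).

  A minimizer exists because the fitting error is continuous, by the Hoffman--Wielandt inequality,
  and tends to infinity with the length of the vector.
\<close>

section \<open>Spectral theorem and Hoffman--Wielandt inequality\<close>

text \<open>
  The rows of \<open>u\<close> are the vectors. Both orthogonality of the rows and completeness are recorded, since for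
  square matrices each follows from the other only by a dimension argument.
\<close>
definition orthonormal :: "nat \<Rightarrow> (nat \<Rightarrow> nat \<Rightarrow> real) \<Rightarrow> bool" where
  "orthonormal n u \<longleftrightarrow>
     (\<forall>k<n. \<forall>l<n. (\<Sum>i<n. u k i * u l i) = of_bool (k = l)) \<and>
     (\<forall>i<n. \<forall>j<n. (\<Sum>k<n. u k i * u k j) = of_bool (i = j))"

text \<open>
  The characteristic polynomial has a complex root by the fundamental theorem of algebra. For a real symmetric matrix the
  quadratic form of an eigenvector is real, so the root is real, and the real or the imaginary part of the eigenvector is a
  real eigenvector.
\<close>
lemma symmetric_has_eigenvector:
  fixes f :: "nat \<Rightarrow> nat \<Rightarrow> real"
  assumes sym: "\<And>i j. i < n \<Longrightarrow> j < n \<Longrightarrow> f i j = f j i" and n: "n > 0"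
  shows "\<exists>l v. (\<exists>i<n. v i \<noteq> 0) \<and> (\<forall>i<n. (\<Sum>j<n. f i j * v j) = l * v i)"
proof -
  define C where "C = mat n n (\<lambda>(i, j). complex_of_real (f i j))"
  have C: "C \<in> carrier_mat n n" by (simp add: C_def)
  have "degree (char_poly C) = n" using degree_monic_char_poly[OF C] by simp
  then have "\<not> constant (poly (char_poly C))" using n by (simp add: constant_degree)
  then obtain e where "poly (char_poly C) e = 0"
    using fundamental_theorem_of_algebra by blast
  then have "eigenvalue C e" using eigenvalue_root_char_poly[OF C] by simp
  then obtain v where v: "v \<in> carrier_vec n" "v \<noteq> 0\<^sub>v n" "C *\<^sub>v v = e \<cdot>\<^sub>v v"
    unfolding eigenvalue_def eigenvector_def using C by auto
  define w where "w = vec_index v"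
  have ev: "(\<Sum>j<n. of_real (f i j) * w j) = e * w i" if "i < n" for i
  proof -
    have "(C *\<^sub>v v) $ i = (\<Sum>j<n. of_real (f i j) * w j)"
      using that v(1) C by (simp add: C_def scalar_prod_def w_def atLeast0LessThan)
    then show ?thesis using v that by (simp add: w_def)
  qed
  obtain i0 where i0: "i0 < n" "w i0 \<noteq> 0"
  proof (rule ccontr)
    assume "\<not> thesis"
    then have "v = 0\<^sub>v n" using that v(1) by (intro eq_vecI) (auto simp: w_def)
    with v(2) show False by simp
  qed
  define q where "q = (\<Sum>i<n. \<Sum>j<n. cnj (w i) * of_real (f i j) * w j)"
  have q1: "q = e * of_real (\<Sum>i<n. (cmod (w i))\<^sup>2)"
  proof -
    have "q = (\<Sum>i<n. cnj (w i) * (e * w i))"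
      unfolding q_def by (intro sum.cong refl) (simp add: ev[symmetric] sum_distrib_left mult.assoc)
    also have "\<dots> = (\<Sum>i<n. e * of_real ((cmod (w i))\<^sup>2))"
      by (intro sum.cong refl) (simp only: complex_norm_square mult_ac)
    finally show ?thesis by (simp add: sum_distrib_left)
  qed
  have "cnj q = (\<Sum>i<n. \<Sum>j<n. w i * of_real (f i j) * cnj (w j))"
    by (simp add: q_def)
  also have "\<dots> = (\<Sum>j<n. \<Sum>i<n. w i * of_real (f i j) * cnj (w j))" by (rule sum.swap)
  also have "\<dots> = q" unfolding q_def
    by (intro sum.cong refl) (simp add: sym[symmetric] mult_ac)
  finally have "cnj q = q" .
  then have "Im q = 0" by (metis complex_cnj_cancel_iff Im_complex_of_real Reals_cnj_iff complex_is_Real_iff)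
  have pos: "(\<Sum>i<n. (cmod (w i))\<^sup>2) > 0"
    using i0 by (intro sum_pos2[of _ i0]) auto
  have "Im e = 0" using \<open>Im q = 0\<close> pos unfolding q1 by simp
  then have e: "e = of_real (Re e)" by (simp add: complex_eq_iff)
  have re: "(\<Sum>j<n. f i j * Re (w j)) = Re e * Re (w i)" if "i < n" for i
    using arg_cong[OF ev[OF that], of Re] \<open>Im e = 0\<close> by simp
  have im: "(\<Sum>j<n. f i j * Im (w j)) = Re e * Im (w i)" if "i < n" for i
    using arg_cong[OF ev[OF that], of Im] \<open>Im e = 0\<close> by simp
  show ?thesis
  proof (cases "Re (w i0) = 0")
    case False
    then show ?thesis using re i0 by (intro exI[of _ "Re e"] exI[of _ "\<lambda>j. Re (w j)"]) auto
  next
    case True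
    then have "Im (w i0) \<noteq> 0" using i0 by (simp add: complex_eq_iff)
    then show ?thesis using im i0 by (intro exI[of _ "Re e"] exI[of _ "\<lambda>j. Im (w j)"]) auto
  qed
qed

lemma sum_of_bool_mult:
  assumes "i < (n::nat)"
  shows "(\<Sum>j<n. of_bool (i = j) * g j) = (g i :: 'a :: semiring_1)"
    "(\<Sum>j<n. of_bool (j = i) * g j) = g i"
    "(\<Sum>j<n. g j * of_bool (i = j)) = g i"
    "(\<Sum>j<n. g j * of_bool (j = i)) = g i"
proof -
  have 1: "(\<Sum>j<n. if j = i then g j else 0) = g i" using assms by (simp add: sum.delta)
  show "(\<Sum>j<n. of_bool (i = j) * g j) = g i"
    by (rule trans[OF sum.cong 1]) auto
  show "(\<Sum>j<n. of_bool (j = i) * g j) = g i"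
    by (rule trans[OF sum.cong 1]) auto
  show "(\<Sum>j<n. g j * of_bool (i = j)) = g i"
    by (rule trans[OF sum.cong 1]) auto
  show "(\<Sum>j<n. g j * of_bool (j = i)) = g i"
    by (rule trans[OF sum.cong 1]) auto
qed

lemma sum_triple_swap:
  "(\<Sum>i\<in>A. \<Sum>j\<in>B. \<Sum>k\<in>C. f i j k) = (\<Sum>k\<in>C. \<Sum>i\<in>A. \<Sum>j\<in>B. (f i j k :: 'a :: comm_monoid_add))"
proof -
  have "(\<Sum>i\<in>A. \<Sum>j\<in>B. \<Sum>k\<in>C. f i j k) = (\<Sum>i\<in>A. \<Sum>k\<in>C. \<Sum>j\<in>B. f i j k)"
    by (intro sum.cong refl) (rule sum.swap)
  also have "\<dots> = (\<Sum>k\<in>C. \<Sum>i\<in>A. \<Sum>j\<in>B. f i j k)" by (rule sum.swap)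
  finally show ?thesis .
qed

lemma sum_quad_swap:
  "(\<Sum>i\<in>A. \<Sum>j\<in>B. \<Sum>k\<in>C. \<Sum>l\<in>D. f i j k l)
   = (\<Sum>k\<in>C. \<Sum>l\<in>D. \<Sum>i\<in>A. \<Sum>j\<in>B. (f i j k l :: 'a :: comm_monoid_add))"
proof -
  have "(\<Sum>i\<in>A. \<Sum>j\<in>B. \<Sum>k\<in>C. \<Sum>l\<in>D. f i j k l)
      = (\<Sum>k\<in>C. \<Sum>i\<in>A. \<Sum>j\<in>B. \<Sum>l\<in>D. f i j k l)" by (rule sum_triple_swap)
  also have "\<dots> = (\<Sum>k\<in>C. \<Sum>l\<in>D. \<Sum>i\<in>A. \<Sum>j\<in>B. f i j k l)"
    by (intro sum.cong refl) (rule sum_triple_swap)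
  finally show ?thesis .
qed

text \<open>
  The reflection that exchanges a unit vector with the first coordinate vector. It turns an eigenvector into a coordinate
  vector without Gram--Schmidt. If the two vectors agree then \<open>s = 0\<close>, and division by zero makes the formula
  the identity, as it should be.
\<close>
lemma householder:
  fixes v :: "nat \<Rightarrow> real"
  assumes v: "(\<Sum>i<n. (v i)\<^sup>2) = 1" and n: "n > 0"
  shows "\<exists>h. (\<forall>i j. h i j = h j i) \<and>
             (\<forall>i<n. \<forall>j<n. (\<Sum>k<n. h i k * h k j) = of_bool (i = j)) \<and> (\<forall>i<n. h i 0 = v i)"
proof -
  define w where "w i = v i - of_bool (i = 0)" for i
  define s where "s = 1 - v 0"
  define h where "h i j = of_bool (i = j) - w i * w j / s" for i j :: nat
  have ww: "(\<Sum>k<n. w k * w k) = 2 * s"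
  proof -
    have "(\<Sum>k<n. w k * w k) = (\<Sum>k<n. (v k)\<^sup>2 - 2 * (of_bool (k = 0) * v k) + of_bool (k = 0) * 1)"
      by (intro sum.cong refl) (auto simp: w_def power2_eq_square algebra_simps)
    also have "\<dots> = 1 - 2 * v 0 + 1"
      unfolding sum.distrib sum_subtractf sum_distrib_left[symmetric] v sum_of_bool_mult[OF n] by simp
    finally show ?thesis by (simp add: s_def)
  qed
  have s0: "w i = 0" if "s = 0" "i < n" for i
  proof -
    have "(\<Sum>k<n. w k * w k) = 0" using ww that by simp
    then show ?thesis using that by (subst (asm) sum_nonneg_eq_0_iff) auto
  qed
  have "(\<Sum>k<n. h i k * h k j) = of_bool (i = j)" if "i < n" "j < n" for i j
  proof -
    have "(\<Sum>k<n. h i k * h k j) = (\<Sum>k<n. of_bool (i = k) * of_bool (k = j)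
        - of_bool (i = k) * (w k * w j / s) - of_bool (k = j) * (w i * w k / s)
        + (w i * w j / s\<^sup>2) * (w k * w k))"
      by (intro sum.cong refl) (simp add: h_def algebra_simps power2_eq_square)
    also have "\<dots> = of_bool (i = j) - w i * w j / s - w i * w j / s + (w i * w j / s\<^sup>2) * (2 * s)"
      unfolding sum.distrib sum_subtractf sum_distrib_left[symmetric] ww
        sum_of_bool_mult[OF that(1)] sum_of_bool_mult[OF that(2)] by simp
    also have "\<dots> = of_bool (i = j)"
      by (cases "s = 0") (auto simp: power2_eq_square field_simps)
    finally show ?thesis .
  qed
  moreover have "h i 0 = v i" if "i < n" for i
  proof (cases "s = 0")
    case True
    then show ?thesis using s0[OF True that] by (simp add: h_def w_def)
  next
    case False
    have "w 0 = - s" by (simp add: w_def s_def)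
    then show ?thesis using False by (simp add: h_def) (simp add: w_def)
  qed
  moreover have "h i j = h j i" for i j by (auto simp: h_def)
  ultimately show ?thesis by (intro exI[of _ h]) auto
qed

text \<open>
  Induction on the size: conjugation by the reflection of an eigenvector splits off a block of size one, because by symmetry
  the first row vanishes off the diagonal together with the first column.
\<close>
lemma spectral_theorem_fun:
  fixes f :: "nat \<Rightarrow> nat \<Rightarrow> real"
  assumes "\<And>i j. i < n \<Longrightarrow> j < n \<Longrightarrow> f i j = f j i"
  shows "\<exists>l u. orthonormal n u \<and> (\<forall>i<n. \<forall>j<n. f i j = (\<Sum>k<n. l k * u k i * u k j))"
  using assms
proof (induction n arbitrary: f)
  case 0
  then show ?case by (simp add: orthonormal_def)
next
  case (Suc n)
  let ?N = "Suc n"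
  obtain e v0 i0 where v0: "i0 < ?N" "v0 i0 \<noteq> 0" "\<And>i. i < ?N \<Longrightarrow> (\<Sum>j<?N. f i j * v0 j) = e * v0 i"
    using symmetric_has_eigenvector[of ?N f] Suc.prems by blast
  define r where "r = sqrt (\<Sum>j<?N. (v0 j)\<^sup>2)"
  have r: "r > 0" unfolding r_def real_sqrt_gt_0_iff using v0 by (intro sum_pos2[of _ i0]) auto
  define v where "v i = v0 i / r" for i
  have v1: "(\<Sum>i<?N. (v i)\<^sup>2) = 1"
    using r unfolding v_def power_divide sum_divide_distrib[symmetric]
    by (simp add: r_def sum_nonneg del: sum.lessThan_Suc)
  have ev: "(\<Sum>j<?N. f i j * v j) = e * v i" if "i < ?N" for i
    using v0(3)[OF that] unfolding v_def times_divide_eq_right sum_divide_distrib[symmetric] by simp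
  obtain h where h: "\<And>i j. h i j = h j i"
      "\<And>i j. i < ?N \<Longrightarrow> j < ?N \<Longrightarrow> (\<Sum>k<?N. h i k * h k j) = of_bool (i = j)"
      "\<And>i. i < ?N \<Longrightarrow> h i 0 = v i"
    using householder[OF v1] by blast
  define g where "g p q = (\<Sum>i<?N. \<Sum>j<?N. h p i * f i j * h j q)" for p q
  have gsym: "g p q = g q p" for p q
  proof -
    have "g p q = (\<Sum>j<?N. \<Sum>i<?N. h p i * f i j * h j q)" unfolding g_def by (rule sum.swap)
    also have "\<dots> = g q p" unfolding g_def
      by (intro sum.cong refl) (simp add: Suc.prems h(1)[of p] h(1)[of _ q] mult_ac)
    finally show ?thesis .
  qed
  have g0: "g p 0 = e * of_bool (p = 0)" if "p < ?N" for p
  proof -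
    have "g p 0 = (\<Sum>i<?N. h p i * (\<Sum>j<?N. f i j * v j))"
      unfolding g_def sum_distrib_left by (intro sum.cong refl) (simp add: h(3) mult_ac)
    also have "\<dots> = (\<Sum>i<?N. e * (h p i * h i 0))"
      by (intro sum.cong refl) (use ev h(3) in \<open>simp add: mult_ac\<close>)
    also have "\<dots> = e * of_bool (p = 0)" using h(2)[OF that, of 0]
      by (simp only: sum_distrib_left[symmetric])
    finally show ?thesis .
  qed
  have fg: "f i j = (\<Sum>p<?N. \<Sum>q<?N. h i p * g p q * h q j)" if ij: "i < ?N" "j < ?N" for i j
  proof -
    have "(\<Sum>p<?N. \<Sum>q<?N. h i p * g p q * h q j)
        = (\<Sum>p<?N. \<Sum>q<?N. \<Sum>a<?N. \<Sum>b<?N. (h i p * h p a) * (h b q * h q j) * f a b)"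
      unfolding g_def sum_distrib_left sum_distrib_right by (intro sum.cong refl) (simp add: mult_ac)
    also have "\<dots> = (\<Sum>a<?N. \<Sum>b<?N. \<Sum>p<?N. \<Sum>q<?N. (h i p * h p a) * (h b q * h q j) * f a b)"
      by (rule sum_quad_swap)
    also have "\<dots> = (\<Sum>a<?N. \<Sum>b<?N. (\<Sum>p<?N. h i p * h p a) * (\<Sum>q<?N. h b q * h q j) * f a b)"
      by (intro sum.cong refl) (simp only: sum_product[symmetric] sum_distrib_right[symmetric])
    also have "\<dots> = (\<Sum>a<?N. \<Sum>b<?N. of_bool (i = a) * of_bool (b = j) * f a b)"
      by (intro sum.cong refl) (simp only: h(2) ij lessThan_iff)
    also have "\<dots> = (\<Sum>a<?N. of_bool (i = a) * f a j)"
      by (intro sum.cong refl) (simp only: mult.assoc sum_distrib_left[symmetric] sum_of_bool_mult[OF ij(2)])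
    also have "\<dots> = f i j" by (simp only: sum_of_bool_mult[OF ij(1)])
    finally show ?thesis by simp
  qed
  obtain l' u' where u': "orthonormal n u'"
      "\<And>i j. i < n \<Longrightarrow> j < n \<Longrightarrow> g (Suc i) (Suc j) = (\<Sum>k<n. l' k * u' k i * u' k j)"
    using Suc.IH[of "\<lambda>i j. g (Suc i) (Suc j)"] gsym by blast
  define U where "U k q = (case k of 0 \<Rightarrow> of_bool (q = 0) | Suc k' \<Rightarrow> (case q of 0 \<Rightarrow> 0 | Suc q' \<Rightarrow> u' k' q'))" for k q :: nat
  define L where "L k = (case k of 0 \<Rightarrow> e | Suc k' \<Rightarrow> l' k')" for k :: nat
  have U: "orthonormal ?N U"
    unfolding orthonormal_def
  proof (intro conjI allI impI)
    fix k l assume "k < ?N" "l < ?N"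
    then show "(\<Sum>i<?N. U k i * U l i) = of_bool (k = l)"
      using u'(1) unfolding sum.lessThan_Suc_shift orthonormal_def U_def
      by (cases k; cases l) auto
  next
    fix i j assume "i < ?N" "j < ?N"
    then show "(\<Sum>k<?N. U k i * U k j) = of_bool (i = j)"
      using u'(1) unfolding sum.lessThan_Suc_shift orthonormal_def U_def
      by (cases i; cases j) auto
  qed
  have gU: "g p q = (\<Sum>k<?N. L k * U k p * U k q)" if "p < ?N" "q < ?N" for p q
    using that g0[of p] g0[of q] gsym[of 0 q] u'(2)
    unfolding sum.lessThan_Suc_shift U_def L_def
    by (cases p; cases q) auto
  define u where "u k i = (\<Sum>p<?N. h i p * U k p)" for k i
  have "orthonormal ?N u"
    unfolding orthonormal_def
  proof (intro conjI allI impI)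
    fix k l assume kl: "k < ?N" "l < ?N"
    have "(\<Sum>i<?N. u k i * u l i) = (\<Sum>i<?N. \<Sum>p<?N. \<Sum>q<?N. (h p i * h i q) * (U k p * U l q))"
      unfolding u_def sum_product by (intro sum.cong refl) (simp add: h(1) mult_ac)
    also have "\<dots> = (\<Sum>p<?N. \<Sum>q<?N. (\<Sum>i<?N. h p i * h i q) * (U k p * U l q))"
      unfolding sum_distrib_right by (rule sum_triple_swap[symmetric])
    also have "\<dots> = (\<Sum>p<?N. \<Sum>q<?N. of_bool (p = q) * (U k p * U l q))"
      by (intro sum.cong refl) (simp only: h(2) lessThan_iff)
    also have "\<dots> = (\<Sum>p<?N. U k p * U l p)"
      by (intro sum.cong refl sum_of_bool_mult) simp
    also have "\<dots> = of_bool (k = l)" using U kl unfolding orthonormal_def by blast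
    finally show "(\<Sum>i<?N. u k i * u l i) = of_bool (k = l)" .
  next
    fix i j assume ij: "i < ?N" "j < ?N"
    have "(\<Sum>k<?N. u k i * u k j) = (\<Sum>k<?N. \<Sum>p<?N. \<Sum>q<?N. (U k p * U k q) * (h i p * h q j))"
      unfolding u_def sum_product by (intro sum.cong refl) (simp add: h(1) mult_ac)
    also have "\<dots> = (\<Sum>p<?N. \<Sum>q<?N. (\<Sum>k<?N. U k p * U k q) * (h i p * h q j))"
      unfolding sum_distrib_right by (rule sum_triple_swap[symmetric])
    also have "\<dots> = (\<Sum>p<?N. \<Sum>q<?N. of_bool (p = q) * (h i p * h q j))"
      by (intro sum.cong refl arg_cong2[where f = "(*)"]) (use U in \<open>simp add: orthonormal_def\<close>)
    also have "\<dots> = (\<Sum>p<?N. h i p * h p j)"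
      by (intro sum.cong refl sum_of_bool_mult) simp
    also have "\<dots> = of_bool (i = j)" using h(2) ij by blast
    finally show "(\<Sum>k<?N. u k i * u k j) = of_bool (i = j)" .
  qed
  moreover have "f i j = (\<Sum>k<?N. L k * u k i * u k j)" if ij: "i < ?N" "j < ?N" for i j
  proof -
    have "f i j = (\<Sum>p<?N. \<Sum>q<?N. \<Sum>k<?N. L k * (h i p * U k p) * (h j q * U k q))"
      unfolding fg[OF ij] using gU
      by (intro sum.cong refl) (simp add: sum_distrib_left sum_distrib_right h(1)[of _ j] mult_ac del: sum.lessThan_Suc)
    also have "\<dots> = (\<Sum>k<?N. \<Sum>p<?N. \<Sum>q<?N. L k * (h i p * U k p) * (h j q * U k q))"
      by (rule sum_triple_swap)
    also have "\<dots> = (\<Sum>k<?N. L k * u k i * u k j)"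
      unfolding u_def by (simp only: sum_distrib_left sum_distrib_right mult_ac)
    finally show ?thesis .
  qed
  ultimately show ?case by blast
qed

text \<open>
  The eigenvalues are fixed to be the ones in decreasing order, so that only the orthonormal basis has to be chosen.
\<close>
definition spectral :: "nat \<Rightarrow> real mat \<Rightarrow> (nat \<Rightarrow> nat \<Rightarrow> real) \<Rightarrow> bool" where
  "spectral n B u \<longleftrightarrow> orthonormal n u \<and>
     (\<forall>i<n. \<forall>j<n. B $$ (i, j) = (\<Sum>k<n. eig_desc B k * u k i * u k j))"

lemma char_poly_of_orthonormal:
  assumes B: "B \<in> carrier_mat n n" and u: "orthonormal n u"
    and eq: "\<And>i j. i < n \<Longrightarrow> j < n \<Longrightarrow> B $$ (i, j) = (\<Sum>k<n. l k * u k i * u k j)"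
  shows "char_poly B = (\<Prod>k\<leftarrow>[0..<n]. [:- l k, 1:])"
proof -
  define U where "U = mat n n (\<lambda>(i, k). u k i)"
  define V where "V = mat n n (\<lambda>(k, i). u k i)"
  define D where "D = mat n n (\<lambda>(i, j). if i = j then l i else 0)"
  have car: "U \<in> carrier_mat n n" "V \<in> carrier_mat n n" "D \<in> carrier_mat n n"
    by (auto simp: U_def V_def D_def)
  have UV: "U * V = 1\<^sub>m n"
    using u by (intro eq_matI) (auto simp: U_def V_def scalar_prod_def orthonormal_def atLeast0LessThan)
  have VU: "V * U = 1\<^sub>m n"
    using u by (intro eq_matI) (auto simp: U_def V_def scalar_prod_def orthonormal_def atLeast0LessThan)
  have UD: "U * D = mat n n (\<lambda>(i, k). u k i * l k)"
  proof (intro eq_matI)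
    fix i k assume "i < dim_row (mat n n (\<lambda>(i, k). u k i * l k))" "k < dim_col (mat n n (\<lambda>(i, k). u k i * l k))"
    then have ik: "i < n" "k < n" by auto
    have "(U * D) $$ (i, k) = (\<Sum>j<n. u j i * (if j = k then l j else 0))"
      using ik by (simp add: U_def D_def scalar_prod_def atLeast0LessThan)
    also have "\<dots> = (\<Sum>j<n. if j = k then u j i * l j else 0)" by (intro sum.cong) auto
    also have "\<dots> = u k i * l k" using ik by (simp add: sum.delta)
    finally show "(U * D) $$ (i, k) = mat n n (\<lambda>(i, k). u k i * l k) $$ (i, k)" using ik by simp
  qed (use car in auto)
  have "B = U * D * V"
    unfolding UD using B eq
    by (intro eq_matI) (auto simp: V_def scalar_prod_def atLeast0LessThan mult_ac intro!: sum.cong)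
  then have "similar_mat B D"
    unfolding similar_mat_def similar_mat_wit_def Let_def
    using car B UV VU by (intro exI[of _ U] exI[of _ V]) auto
  then have "char_poly B = char_poly D" by (rule char_poly_similar)
  also have "\<dots> = (\<Prod>a\<leftarrow>diag_mat D. [:- a, 1:])"
    by (rule char_poly_upper_triangular[OF car(3)]) (auto simp: D_def)
  also have "diag_mat D = map l [0..<n]"
    by (auto simp: diag_mat_def D_def)
  finally show ?thesis by (simp add: o_def)
qed

lemma proots_prod_list_linear:
  "proots (\<Prod>a\<leftarrow>xs. [:- a, 1:]) = mset (xs :: real list)"
proof (induction xs)
  case (Cons a xs)
  have nz: "(\<Prod>a\<leftarrow>xs. [:- a, 1:]) \<noteq> 0"
    by (auto simp: prod_list_zero_iff)
  show ?case using Cons nz by (simp add: proots_mult del: mult_pCons_left)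
qed simp

text \<open>
  Any orthogonal diagonalization determines the characteristic polynomial, hence the multiset of its roots; the function
  \<open>eig_desc\<close> only sorts this multiset.
\<close>
lemma eig_desc_of_orthonormal:
  assumes B: "B \<in> carrier_mat n n" and u: "orthonormal n u"
    and eq: "\<And>i j. i < n \<Longrightarrow> j < n \<Longrightarrow> B $$ (i, j) = (\<Sum>k<n. l k * u k i * u k j)"
  shows "map (eig_desc B) [0..<n] = rev (sort (map l [0..<n]))"
proof -
  have "char_poly B = (\<Prod>k\<leftarrow>[0..<n]. [:- l k, 1:])"
    by (rule char_poly_of_orthonormal[OF B u]) (rule eq)
  then have "proots (char_poly B) = mset (map l [0..<n])"
    by (simp only: proots_prod_list_linear[symmetric] map_map o_def)
  then have "eig_desc B k = rev (sort (map l [0..<n])) ! k" for k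
    by (simp only: eig_desc_def sorted_list_of_multiset_mset)
  then show ?thesis by (intro nth_equalityI) auto
qed

lemma spectral_theorem:
  assumes B: "real_symmetric n B"
  shows "\<exists>u. spectral n B u" and "i \<le> j \<Longrightarrow> j < n \<Longrightarrow> eig_desc B j \<le> eig_desc B i"
proof -
  have Bc: "B \<in> carrier_mat n n" using B by (simp add: real_symmetric_def)
  have "B $$ (i, j) = B $$ (j, i)" if "i < n" "j < n" for i j
    using B that unfolding real_symmetric_def by (metis carrier_matD index_transpose_mat(1))
  then obtain l u where u: "orthonormal n u"
      "\<And>i j. i < n \<Longrightarrow> j < n \<Longrightarrow> B $$ (i, j) = (\<Sum>k<n. l k * u k i * u k j)"
    using spectral_theorem_fun[of n "\<lambda>i j. B $$ (i, j)"] by blast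
  have eig: "map (eig_desc B) [0..<n] = rev (sort (map l [0..<n]))"
    by (rule eig_desc_of_orthonormal[OF Bc u(1)]) (rule u(2))
  have "mset (map (eig_desc B) [0..<n]) = mset (map l [0..<n])" unfolding eig by (simp only: mset_rev mset_sort)
  then obtain p where p: "p permutes {..<n}" "permute_list p (map l [0..<n]) = map (eig_desc B) [0..<n]"
    using mset_eq_permutation by (metis length_map length_upt diff_zero)
  have lp: "eig_desc B k = l (p k)" if "k < n" for k
  proof -
    have "permute_list p (map l [0..<n]) ! k = l (p k)"
      using p(1) that permutes_in_image[OF p(1)] by (simp add: permute_list_nth)
    then show ?thesis using p(2) that by simp
  qed
  have re: "(\<Sum>k<n. f (p k)) = (\<Sum>k<n. f k)" for f :: "nat \<Rightarrow> real"
    using sum.permute[OF p(1), of f] by (simp add: o_def)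
  have "spectral n B (\<lambda>k. u (p k))"
    unfolding spectral_def orthonormal_def
  proof (intro conjI allI impI)
    fix k l assume kl: "k < n" "l < n"
    then have "p k < n" "p l < n" using permutes_in_image[OF p(1)] by auto
    then show "(\<Sum>i<n. u (p k) i * u (p l) i) = of_bool (k = l)"
      using u(1) permutes_inj[OF p(1)] unfolding orthonormal_def by (auto simp: inj_eq)
  next
    fix i j assume ij: "i < n" "j < n"
    show "(\<Sum>k<n. u (p k) i * u (p k) j) = of_bool (i = j)"
      using u(1) ij re[of "\<lambda>k. u k i * u k j"] unfolding orthonormal_def by simp
    show "B $$ (i, j) = (\<Sum>k<n. eig_desc B k * u (p k) i * u (p k) j)"
      using ij re[of "\<lambda>k. l k * u k i * u k j"] by (simp add: u(2) lp)
  qed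
  then show "\<exists>u. spectral n B u" by blast
  assume ij: "i \<le> j" "j < n"
  have "sorted (rev (map (eig_desc B) [0..<n]))" unfolding eig by simp
  then show "eig_desc B j \<le> eig_desc B i"
    unfolding sorted_rev_iff_nth_mono using ij by auto
qed

lemma real_symmetric_diag: "real_symmetric n (mat_diag n f)"
  unfolding real_symmetric_def by (auto simp: mat_diag_def)

text \<open>
  Both vectors are constants plus nonnegative combinations of indicators of initial segments, which reduces the inequality to
  the mass of a doubly stochastic matrix on a rectangle of initial segments; this mass is at most the shorter side.
\<close>
lemma doubly_stochastic_rearrangement:
  fixes a b :: "nat \<Rightarrow> real"
  assumes a: "\<And>i j. i \<le> j \<Longrightarrow> j < n \<Longrightarrow> a j \<le> a i" and b: "\<And>i j. i \<le> j \<Longrightarrow> j < n \<Longrightarrow> b j \<le> b i"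
    and d: "\<And>i j. i < n \<Longrightarrow> j < n \<Longrightarrow> d i j \<ge> 0"
    and row: "\<And>i. i < n \<Longrightarrow> (\<Sum>j<n. d i j) = 1" and col: "\<And>j. j < n \<Longrightarrow> (\<Sum>i<n. d i j) = 1"
  shows "(\<Sum>i<n. \<Sum>j<n. d i j * a i * b j) \<le> (\<Sum>i<n. a i * b i)"
proof -
  \<comment> \<open>a decreasing vector is a constant plus a nonnegative combination of indicators of initial segments\<close>
  have layer: "c i = c (n - 1) + (\<Sum>k<n - 1. (c k - c (Suc k)) * of_bool (i \<le> k))" if "i < n" for c :: "nat \<Rightarrow> real" and i
  proof -
    have "(\<Sum>k<n - 1. (c k - c (Suc k)) * of_bool (i \<le> k)) = (\<Sum>k\<in>{i..<n - 1}. c k - c (Suc k))"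
      by (intro sum.mono_neutral_cong_right) auto
    also have "\<dots> = c i - c (n - 1)"
      using that sum_Suc_diff'[of i "n - 1" "\<lambda>k. - c k"] by simp
    finally show ?thesis by simp
  qed
  define al where "al k = a k - a (Suc k)" for k
  define be where "be k = b k - b (Suc k)" for k
  define e where "e i j = of_bool (i = j) - d i j" for i j
  have erow: "(\<Sum>j<n. e i j) = 0" if "i < n" for i
    using row[OF that] sum_of_bool_mult(1)[OF that, of "\<lambda>_. 1::real"] by (simp add: e_def sum_subtractf)
  have ecol: "(\<Sum>i<n. e i j) = 0" if "j < n" for j
    using col[OF that] sum_of_bool_mult(2)[OF that, of "\<lambda>_. 1::real"] by (simp add: e_def sum_subtractf)
  have seg: "(\<Sum>i<n. \<Sum>j<n. e i j * of_bool (i \<le> k) * of_bool (j \<le> l)) \<ge> 0" (is "?S \<ge> 0")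
    if kl: "k < n - 1" "l < n - 1" for k l
  proof -
    have 1: "(\<Sum>i<n. \<Sum>j<n. of_bool (i = j) * of_bool (i \<le> k) * of_bool (j \<le> l)) = real (Suc (min k l))"
    proof -
      have "(\<Sum>i<n. \<Sum>j<n. of_bool (i = j) * of_bool (i \<le> k) * of_bool (j \<le> l))
          = (\<Sum>i<n. of_bool (i \<le> k) * of_bool (i \<le> l) :: real)"
        by (intro sum.cong refl) (simp only: mult.assoc sum_of_bool_mult lessThan_iff)
      also have "\<dots> = (\<Sum>i\<in>{..min k l}. 1)"
        using kl by (intro sum.mono_neutral_cong_right) auto
      finally show ?thesis by simp
    qed
    have 2: "(\<Sum>i<n. \<Sum>j<n. d i j * of_bool (i \<le> k) * of_bool (j \<le> l)) \<le> real (Suc k)"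
    proof -
      have "(\<Sum>i<n. \<Sum>j<n. d i j * of_bool (i \<le> k) * of_bool (j \<le> l)) \<le> (\<Sum>i<n. \<Sum>j<n. d i j * of_bool (i \<le> k))"
        using d by (intro sum_mono) auto
      also have "\<dots> = (\<Sum>i<n. of_bool (i \<le> k))"
        by (intro sum.cong refl) (simp only: sum_distrib_right[symmetric] row lessThan_iff mult_1)
      also have "\<dots> = (\<Sum>i\<in>{..k}. 1)"
        using kl by (intro sum.mono_neutral_cong_right) auto
      finally show ?thesis by simp
    qed
    have 3: "(\<Sum>i<n. \<Sum>j<n. d i j * of_bool (i \<le> k) * of_bool (j \<le> l)) \<le> real (Suc l)"
    proof -
      have "(\<Sum>i<n. \<Sum>j<n. d i j * of_bool (i \<le> k) * of_bool (j \<le> l)) \<le> (\<Sum>i<n. \<Sum>j<n. d i j * of_bool (j \<le> l))"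
        using d by (intro sum_mono) auto
      also have "\<dots> = (\<Sum>j<n. \<Sum>i<n. d i j * of_bool (j \<le> l))" by (rule sum.swap)
      also have "\<dots> = (\<Sum>j<n. of_bool (j \<le> l))"
        by (intro sum.cong refl) (simp only: sum_distrib_right[symmetric] col lessThan_iff mult_1)
      also have "\<dots> = (\<Sum>i\<in>{..l}. 1)"
        using kl by (intro sum.mono_neutral_cong_right) auto
      finally show ?thesis by simp
    qed
    have "?S = (\<Sum>i<n. \<Sum>j<n. of_bool (i = j) * of_bool (i \<le> k) * of_bool (j \<le> l))
        - (\<Sum>i<n. \<Sum>j<n. d i j * of_bool (i \<le> k) * of_bool (j \<le> l))"
      by (simp add: e_def left_diff_distrib sum_subtractf)
    then show ?thesis unfolding 1 using 2 3 by (simp add: min_def)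
  qed
  have e0: "(\<Sum>i<n. \<Sum>j<n. e i j * x i) = 0" for x
    by (simp only: sum_distrib_right[symmetric]) (simp add: erow)
  have e0': "(\<Sum>i<n. \<Sum>j<n. e i j * x j) = 0" for x
    by (subst sum.swap) (simp only: sum_distrib_right[symmetric], simp add: ecol)
  have "(\<Sum>i<n. \<Sum>j<n. e i j * a i * b j)
      = (\<Sum>i<n. \<Sum>j<n. e i j * (a i * b (n - 1)) + e i j * (a (n - 1) * (b j - b (n - 1)))
          + e i j * ((a i - a (n - 1)) * (b j - b (n - 1))))"
    by (intro sum.cong refl) (simp add: algebra_simps)
  also have "\<dots> = (\<Sum>i<n. \<Sum>j<n. e i j * ((a i - a (n - 1)) * (b j - b (n - 1))))"
    unfolding sum.distrib e0[of "\<lambda>i. a i * b (n - 1)"] e0'[of "\<lambda>j. a (n - 1) * (b j - b (n - 1))"] by simp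
  also have "\<dots> = (\<Sum>i<n. \<Sum>j<n. \<Sum>k<n - 1. \<Sum>l<n - 1. al k * be l * (e i j * of_bool (i \<le> k) * of_bool (j \<le> l)))"
  proof (intro sum.cong refl)
    fix i j assume "i \<in> {..<n}" "j \<in> {..<n}"
    then have ab: "a i - a (n - 1) = (\<Sum>k<n - 1. al k * of_bool (i \<le> k))"
      "b j - b (n - 1) = (\<Sum>k<n - 1. be k * of_bool (j \<le> k))"
      using layer[of i a] layer[of j b] by (simp_all add: al_def be_def)
    show "e i j * ((a i - a (n - 1)) * (b j - b (n - 1)))
        = (\<Sum>k<n - 1. \<Sum>l<n - 1. al k * be l * (e i j * of_bool (i \<le> k) * of_bool (j \<le> l)))"
      unfolding ab unfolding sum_product unfolding sum_distrib_left by (intro sum.cong refl) (simp only: mult_ac)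
  qed
  also have "\<dots> = (\<Sum>k<n - 1. \<Sum>l<n - 1. \<Sum>i<n. \<Sum>j<n. al k * be l * (e i j * of_bool (i \<le> k) * of_bool (j \<le> l)))"
    by (rule sum_quad_swap)
  also have "\<dots> \<ge> 0"
  proof (rule sum_nonneg, rule sum_nonneg)
    fix k l assume kl: "k \<in> {..<n - 1}" "l \<in> {..<n - 1}"
    have "al k \<ge> 0" "be l \<ge> 0" using a[of k "Suc k"] b[of l "Suc l"] kl by (auto simp: al_def be_def)
    then show "(\<Sum>i<n. \<Sum>j<n. al k * be l * (e i j * of_bool (i \<le> k) * of_bool (j \<le> l))) \<ge> 0"
      using seg[of k l] kl by (simp only: sum_distrib_left[symmetric]) simp
  qed
  finally have "(\<Sum>i<n. \<Sum>j<n. e i j * a i * b j) \<ge> 0" .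
  moreover have "(\<Sum>i<n. \<Sum>j<n. e i j * a i * b j) = (\<Sum>i<n. a i * b i) - (\<Sum>i<n. \<Sum>j<n. d i j * a i * b j)"
  proof -
    have "(\<Sum>i<n. \<Sum>j<n. of_bool (i = j) * a i * b j) = (\<Sum>i<n. a i * b i)"
      by (intro sum.cong refl) (simp only: mult.assoc sum_of_bool_mult lessThan_iff)
    then show ?thesis by (simp add: e_def left_diff_distrib sum_subtractf)
  qed
  ultimately show ?thesis by simp
qed

text \<open>
  The squared inner products of the two eigenbases are the doubly stochastic weights of the Hoffman--Wielandt argument.
\<close>
lemma spectral_inner:
  assumes A: "spectral n A u" and B: "spectral n B v"
  shows "(\<Sum>i<n. \<Sum>j<n. A $$ (i, j) * B $$ (i, j))
       = (\<Sum>k<n. \<Sum>l<n. (\<Sum>i<n. u k i * v l i)\<^sup>2 * eig_desc A k * eig_desc B l)"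
proof -
  have "(\<Sum>i<n. \<Sum>j<n. A $$ (i, j) * B $$ (i, j))
      = (\<Sum>i<n. \<Sum>j<n. \<Sum>k<n. \<Sum>l<n. eig_desc A k * eig_desc B l * ((u k i * v l i) * (u k j * v l j)))"
    using A B unfolding spectral_def
    by (intro sum.cong refl) (simp add: sum_product mult_ac)
  also have "\<dots> = (\<Sum>k<n. \<Sum>l<n. \<Sum>i<n. \<Sum>j<n. eig_desc A k * eig_desc B l * ((u k i * v l i) * (u k j * v l j)))"
    by (rule sum_quad_swap)
  also have "\<dots> = (\<Sum>k<n. \<Sum>l<n. (\<Sum>i<n. u k i * v l i)\<^sup>2 * eig_desc A k * eig_desc B l)"
    by (intro sum.cong refl)
      (simp only: sum_distrib_left[symmetric] power2_eq_square sum_product mult_ac)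
  finally show ?thesis .
qed

text \<open>
  The Frobenius norm is unitarily invariant. This turns second moments of spectra into quadratic forms in the entries.
\<close>
lemma sum_eig_desc_squares:
  assumes "real_symmetric n A"
  shows "(\<Sum>k<n. (eig_desc A k)\<^sup>2) = (\<Sum>i<n. \<Sum>j<n. (A $$ (i, j))\<^sup>2)"
proof -
  obtain u where u: "spectral n A u" using spectral_theorem[OF assms] by blast
  have "(\<Sum>i<n. \<Sum>j<n. (A $$ (i, j))\<^sup>2)
      = (\<Sum>k<n. \<Sum>l<n. (\<Sum>i<n. u k i * u l i)\<^sup>2 * eig_desc A k * eig_desc A l)"
    unfolding spectral_inner[OF u u, symmetric] by (simp add: power2_eq_square)
  also have "\<dots> = (\<Sum>k<n. \<Sum>l<n. of_bool (k = l) * (eig_desc A k * eig_desc A l))"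
    using u unfolding spectral_def orthonormal_def by (intro sum.cong refl) simp
  also have "\<dots> = (\<Sum>k<n. (eig_desc A k)\<^sup>2)"
    by (intro sum.cong refl) (simp only: sum_of_bool_mult lessThan_iff power2_eq_square)
  finally show ?thesis by simp
qed

text \<open>
  After expanding the squares, only the inner product of the two matrices has to be bounded by that of the two decreasing
  spectra, and by \<open>spectral_inner\<close> this is the rearrangement inequality for doubly stochastic weights.
\<close>
theorem hoffman_wielandt:
  assumes A: "real_symmetric n A" and B: "real_symmetric n B"
  shows "(\<Sum>k<n. (eig_desc A k - eig_desc B k)\<^sup>2) \<le> (\<Sum>i<n. \<Sum>j<n. (A $$ (i, j) - B $$ (i, j))\<^sup>2)"
proof -
  obtain u where u: "spectral n A u" using spectral_theorem[OF A] by blast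
  obtain v where v: "spectral n B v" using spectral_theorem[OF B] by blast
  define d where "d k l = (\<Sum>i<n. u k i * v l i)\<^sup>2" for k l
  have d_eq: "d k l = (\<Sum>i<n. \<Sum>j<n. (u k i * u k j) * (v l i * v l j))" for k l
    unfolding d_def power2_eq_square sum_product by (simp add: mult_ac)
  have row: "(\<Sum>l<n. d k l) = 1" if "k < n" for k
  proof -
    have "(\<Sum>l<n. d k l) = (\<Sum>i<n. \<Sum>j<n. (u k i * u k j) * (\<Sum>l<n. v l i * v l j))"
      unfolding d_eq sum_distrib_left by (rule sum_triple_swap[symmetric])
    also have "\<dots> = (\<Sum>i<n. \<Sum>j<n. of_bool (i = j) * (u k i * u k j))"
      using v unfolding spectral_def orthonormal_def by (intro sum.cong refl) simp
    also have "\<dots> = (\<Sum>i<n. u k i * u k i)"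
      by (intro sum.cong refl) (simp only: sum_of_bool_mult lessThan_iff)
    also have "\<dots> = 1" using u that unfolding spectral_def orthonormal_def by simp
    finally show ?thesis .
  qed
  have col: "(\<Sum>k<n. d k l) = 1" if "l < n" for l
  proof -
    have "(\<Sum>k<n. d k l) = (\<Sum>i<n. \<Sum>j<n. (\<Sum>k<n. u k i * u k j) * (v l i * v l j))"
      unfolding d_eq sum_distrib_right by (rule sum_triple_swap[symmetric])
    also have "\<dots> = (\<Sum>i<n. \<Sum>j<n. of_bool (i = j) * (v l i * v l j))"
      using u unfolding spectral_def orthonormal_def by (intro sum.cong refl) simp
    also have "\<dots> = (\<Sum>i<n. v l i * v l i)"
      by (intro sum.cong refl) (simp only: sum_of_bool_mult lessThan_iff)
    also have "\<dots> = 1" using v that unfolding spectral_def orthonormal_def by simp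
    finally show ?thesis .
  qed
  have "(\<Sum>i<n. \<Sum>j<n. A $$ (i, j) * B $$ (i, j)) \<le> (\<Sum>k<n. eig_desc A k * eig_desc B k)"
    unfolding spectral_inner[OF u v] d_def[symmetric]
    by (rule doubly_stochastic_rearrangement)
      (use spectral_theorem(2)[OF A] spectral_theorem(2)[OF B] row col in \<open>auto simp: d_def\<close>)
  then show ?thesis
    using sum_eig_desc_squares[OF A] sum_eig_desc_squares[OF B]
    by (simp add: power2_diff sum.distrib sum_subtractf mult.assoc sum_distrib_left[symmetric])
qed

section \<open>Stieltjes transforms and resolvents\<close>

text \<open>With this sign the transform maps the upper half-plane to itself.\<close>
definition stieltjes :: "nat \<Rightarrow> (nat \<Rightarrow> real) \<Rightarrow> complex \<Rightarrow> complex" where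
  "stieltjes n x z = (\<Sum>k<n. 1 / (of_real (x k) - z)) / of_nat n"

text \<open>
  The inverse of \<open>B - z\<close>, in spectral form. It is a function of two indices and not a matrix because all later
  computations are with entries.
\<close>
definition resolvent :: "real mat \<Rightarrow> complex \<Rightarrow> nat \<Rightarrow> nat \<Rightarrow> complex" where
  "resolvent B z i j =
     (let u = (SOME u. spectral (dim_row B) B u)
      in \<Sum>k<dim_row B. of_real (u k i * u k j) / (of_real (eig_desc B k) - z))"

lemma norm_inverse_real_diff_le:
  assumes "0 < e" "e \<le> Im z" shows "cmod (1 / (of_real x - z)) \<le> 1 / e"
proof -
  have "e \<le> \<bar>Im (of_real x - z)\<bar>" using assms by simp
  also have "\<dots> \<le> cmod (of_real x - z)" by (rule abs_Im_le_cmod)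
  finally show ?thesis using assms(1) by (simp add: norm_divide frac_le)
qed

lemma norm_inverse_real_diff_lipschitz:
  assumes "0 < e" "e \<le> Im z" "e \<le> Im w"
  shows "cmod (1 / (of_real x - z) - 1 / (of_real y - w)) \<le> (\<bar>x - y\<bar> + cmod (z - w)) / e\<^sup>2"
proof -
  have nz: "of_real x - z \<noteq> 0" "of_real y - w \<noteq> 0"
    using assms by (auto simp: complex_eq_iff)
  have "1 / (of_real x - z) - 1 / (of_real y - w)
      = (of_real (y - x) + (z - w)) * ((1 / (of_real x - z)) * (1 / (of_real y - w)))"
    using nz by (simp add: field_simps)
  then have "cmod (1 / (of_real x - z) - 1 / (of_real y - w))
      = cmod (of_real (y - x) + (z - w)) * (cmod (1 / (of_real x - z)) * cmod (1 / (of_real y - w)))"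
    by (simp only: norm_mult)
  also have "\<dots> \<le> (\<bar>x - y\<bar> + cmod (z - w)) * ((1 / e) * (1 / e))"
  proof (intro mult_mono norm_inverse_real_diff_le assms)
    have "cmod (of_real (y - x) + (z - w)) \<le> cmod (of_real (y - x)) + cmod (z - w)" by (rule norm_triangle_ineq)
    then show "cmod (of_real (y - x) + (z - w)) \<le> \<bar>x - y\<bar> + cmod (z - w)" by (simp only: norm_of_real abs_minus_commute)
  qed (use assms in auto)
  finally show ?thesis by (simp add: power2_eq_square)
qed

lemma norm_stieltjes_le:
  assumes "0 < e" "e \<le> Im z" shows "cmod (stieltjes n x z) \<le> 1 / e"
proof (cases "n = 0")
  case True
  then show ?thesis using assms by (simp add: stieltjes_def)
next
  case False
  have "cmod (\<Sum>k<n. 1 / (of_real (x k) - z)) \<le> (\<Sum>k<n. 1 / e)"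
    using assms by (intro sum_norm_le norm_inverse_real_diff_le)
  then show ?thesis using False assms by (simp add: stieltjes_def norm_divide field_simps)
qed

text \<open>
  The contraction property, the continuity in \<open>z\<close> and the stability under a change of the sample all come from
  this one estimate.
\<close>
lemma stieltjes_lipschitz:
  assumes "0 < e" "e \<le> Im z" "e \<le> Im w"
  shows "cmod (stieltjes n x z - stieltjes n y w) \<le> ((\<Sum>k<n. \<bar>x k - y k\<bar>) / n + cmod (z - w)) / e\<^sup>2"
proof (cases "n = 0")
  case True
  then show ?thesis using assms by (simp add: stieltjes_def)
next
  case False
  have "cmod ((\<Sum>k<n. 1 / (of_real (x k) - z)) - (\<Sum>k<n. 1 / (of_real (y k) - w)))
     \<le> (\<Sum>k<n. (\<bar>x k - y k\<bar> + cmod (z - w)) / e\<^sup>2)"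
    unfolding sum_subtractf[symmetric]
    by (intro sum_norm_le norm_inverse_real_diff_lipschitz assms)
  also have "\<dots> = ((\<Sum>k<n. \<bar>x k - y k\<bar>) + n * cmod (z - w)) / e\<^sup>2"
    by (simp add: sum.distrib sum_divide_distrib[symmetric])
  finally have "cmod ((\<Sum>k<n. 1 / (of_real (x k) - z)) - (\<Sum>k<n. 1 / (of_real (y k) - w))) / n
     \<le> ((\<Sum>k<n. \<bar>x k - y k\<bar>) + n * cmod (z - w)) / e\<^sup>2 / n"
    by (rule divide_right_mono) simp
  then show ?thesis using False assms(1)
    unfolding stieltjes_def diff_divide_distrib[symmetric] norm_divide
    by (simp add: add_divide_distrib mult.commute)
qed

lemma Im_stieltjes_nonneg:
  assumes "0 < Im z" shows "0 \<le> Im (stieltjes n x z)"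
proof -
  have "0 \<le> Im (1 / (of_real (x k) - z))" for k
    using assms by (simp add: Im_divide)
  then have "0 \<le> (\<Sum>k<n. Im (1 / (of_real (x k) - z)))" by (intro sum_nonneg)
  then show ?thesis by (simp add: stieltjes_def)
qed

lemma resolvent_spectral:
  assumes B: "real_symmetric n B"
  obtains u where "spectral n B u"
    "\<And>z i j. resolvent B z i j = (\<Sum>k<n. of_real (u k i * u k j) / (of_real (eig_desc B k) - z))"
proof -
  have n: "dim_row B = n" using B by (auto simp: real_symmetric_def)
  have "spectral n B (SOME u. spectral n B u)" using spectral_theorem(1)[OF B] by (rule someI_ex)
  then show ?thesis by (rule that) (simp add: resolvent_def n Let_def)
qed

lemma resolvent_symmetric: "resolvent B z i j = resolvent B z j i"
  by (simp add: resolvent_def Let_def mult_ac)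

lemma sum_of_bool_complex:
  assumes "spectral n B u"
  shows "i < n \<Longrightarrow> j < n \<Longrightarrow> (\<Sum>k<n. complex_of_real (u k i) * of_real (u k j)) = of_bool (i = j)"
    "k < n \<Longrightarrow> l < n \<Longrightarrow> (\<Sum>i<n. complex_of_real (u k i) * of_real (u l i)) = of_bool (k = l)"
proof -
  assume "i < n" "j < n"
  then have "(\<Sum>k<n. u k i * u k j) = of_bool (i = j)"
    using assms unfolding spectral_def orthonormal_def by blast
  then have "complex_of_real (\<Sum>k<n. u k i * u k j) = of_real (of_bool (i = j))" by (rule arg_cong)
  then show "(\<Sum>k<n. complex_of_real (u k i) * of_real (u k j)) = of_bool (i = j)" by simp
next
  assume "k < n" "l < n"
  then have "(\<Sum>i<n. u k i * u l i) = of_bool (k = l)"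
    using assms unfolding spectral_def orthonormal_def by blast
  then have "complex_of_real (\<Sum>i<n. u k i * u l i) = of_real (of_bool (k = l))" by (rule arg_cong)
  then show "(\<Sum>i<n. complex_of_real (u k i) * of_real (u l i)) = of_bool (k = l)" by simp
qed

text \<open>
  Functional calculus: the product of two functions of \<open>B\<close> is the function given by the pointwise product.
\<close>
lemma spectral_compose:
  assumes u: "spectral n B u"
  shows "(\<Sum>l<n. (\<Sum>k<n. f k * of_real (u k i) * of_real (u k l)) * (\<Sum>k<n. g k * of_real (u k l) * of_real (u k j)))
       = (\<Sum>k<n. f k * g k * complex_of_real (u k i) * of_real (u k j))"
proof -
  have "(\<Sum>l<n. (\<Sum>k<n. f k * of_real (u k i) * of_real (u k l)) * (\<Sum>k<n. g k * of_real (u k l) * of_real (u k j)))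
      = (\<Sum>l<n. \<Sum>k<n. \<Sum>m<n. (f k * of_real (u k i)) * (g m * of_real (u m j)) * (complex_of_real (u k l) * of_real (u m l)))"
    unfolding sum_product by (intro sum.cong refl) (simp only: mult_ac)
  also have "\<dots> = (\<Sum>k<n. \<Sum>m<n. \<Sum>l<n. (f k * of_real (u k i)) * (g m * of_real (u m j)) * (complex_of_real (u k l) * of_real (u m l)))"
    by (rule sum_triple_swap[symmetric])
  also have "\<dots> = (\<Sum>k<n. \<Sum>m<n. (f k * of_real (u k i)) * (g m * of_real (u m j)) * of_bool (k = m))"
    by (intro sum.cong refl) (simp only: sum_distrib_left[symmetric] sum_of_bool_complex[OF u] lessThan_iff)
  also have "\<dots> = (\<Sum>k<n. (f k * of_real (u k i)) * (g k * of_real (u k j)))"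
    by (intro sum.cong refl) (simp only: sum_of_bool_mult lessThan_iff)
  finally show ?thesis by (simp add: mult_ac)
qed

lemma resolvent_inverse:
  assumes B: "real_symmetric n B" and z: "Im z \<noteq> 0" and ij: "i < n" "j < n"
  shows "(\<Sum>l<n. (of_real (B $$ (i, l)) - z * of_bool (i = l)) * resolvent B z l j) = of_bool (i = j)"
    and "(\<Sum>l<n. resolvent B z i l * (of_real (B $$ (l, j)) - z * of_bool (l = j))) = of_bool (i = j)"
proof -
  obtain u where u: "spectral n B u"
    "\<And>i j. resolvent B z i j = (\<Sum>k<n. of_real (u k i * u k j) / (of_real (eig_desc B k) - z))"
    using resolvent_spectral[OF B] by metis
  have b: "of_real (B $$ (i, l)) - z * of_bool (i = l)
      = (\<Sum>k<n. (of_real (eig_desc B k) - z) * of_real (u k i) * of_real (u k l))" if "i < n" "l < n" for i l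
  proof -
    have "(\<Sum>k<n. (of_real (eig_desc B k) - z) * of_real (u k i) * of_real (u k l))
        = (\<Sum>k<n. of_real (eig_desc B k * u k i * u k l) - z * (of_real (u k i) * of_real (u k l)))"
      by (intro sum.cong refl) (simp add: algebra_simps)
    also have "\<dots> = of_real (\<Sum>k<n. eig_desc B k * u k i * u k l) - z * of_bool (i = l)"
      by (simp only: sum_subtractf of_real_sum sum_distrib_left[symmetric] sum_of_bool_complex[OF u(1)] that)
    finally show ?thesis using u(1) that unfolding spectral_def by simp
  qed
  have g: "resolvent B z l j = (\<Sum>k<n. (1 / (of_real (eig_desc B k) - z)) * of_real (u k l) * of_real (u k j))" for l j
    by (simp add: u(2))
  have nz: "of_real x - z \<noteq> 0" for x using z by (auto simp: complex_eq_iff)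
  have one: "(\<Sum>k<n. complex_of_real (u k i) * of_real (u k j)) = of_bool (i = j)"
    using sum_of_bool_complex[OF u(1)] ij by blast
  have "(\<Sum>l<n. (of_real (B $$ (i, l)) - z * of_bool (i = l)) * resolvent B z l j)
     = (\<Sum>l<n. (\<Sum>k<n. (of_real (eig_desc B k) - z) * of_real (u k i) * of_real (u k l)) *
         (\<Sum>k<n. (1 / (of_real (eig_desc B k) - z)) * of_real (u k l) * of_real (u k j)))"
    by (intro sum.cong refl) (simp only: b[OF ij(1)] g lessThan_iff)
  then show "(\<Sum>l<n. (of_real (B $$ (i, l)) - z * of_bool (i = l)) * resolvent B z l j) = of_bool (i = j)"
    unfolding spectral_compose[OF u(1)] using nz one by simp
  have "(\<Sum>l<n. resolvent B z i l * (of_real (B $$ (l, j)) - z * of_bool (l = j)))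
     = (\<Sum>l<n. (\<Sum>k<n. (1 / (of_real (eig_desc B k) - z)) * of_real (u k i) * of_real (u k l)) *
         (\<Sum>k<n. (of_real (eig_desc B k) - z) * of_real (u k l) * of_real (u k j)))"
    by (intro sum.cong refl) (simp only: b[OF _ ij(2)] g lessThan_iff)
  then show "(\<Sum>l<n. resolvent B z i l * (of_real (B $$ (l, j)) - z * of_bool (l = j))) = of_bool (i = j)"
    unfolding spectral_compose[OF u(1)] using nz one by simp
qed

lemma resolvent_trace:
  assumes B: "real_symmetric n B"
  shows "(\<Sum>i<n. resolvent B z i i) = of_nat n * stieltjes n (eig_desc B) z"
proof (cases "n = 0")
  case False
  obtain u where u: "spectral n B u"
    "\<And>i j. resolvent B z i j = (\<Sum>k<n. of_real (u k i * u k j) / (of_real (eig_desc B k) - z))"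
    using resolvent_spectral[OF B] by metis
  have "(\<Sum>i<n. resolvent B z i i) = (\<Sum>k<n. \<Sum>i<n. of_real (u k i * u k i) / (of_real (eig_desc B k) - z))"
    unfolding u(2) by (rule sum.swap)
  also have "\<dots> = (\<Sum>k<n. of_bool (k = k) / (of_real (eig_desc B k) - z))"
    by (intro sum.cong refl)
      (simp only: sum_divide_distrib[symmetric] of_real_mult sum_of_bool_complex[OF u(1)] lessThan_iff)
  finally show ?thesis using False by (simp add: stieltjes_def)
qed simp

lemma parseval:
  fixes x :: "nat \<Rightarrow> complex" and v :: "nat \<Rightarrow> nat \<Rightarrow> real"
  assumes v: "\<And>k l. k < n \<Longrightarrow> l < n \<Longrightarrow> (\<Sum>i<n. v k i * v l i) = of_bool (k = l)"
  shows "(\<Sum>i<n. (cmod (\<Sum>k<n. x k * of_real (v k i)))\<^sup>2) = (\<Sum>k<n. (cmod (x k))\<^sup>2)"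
proof -
  have "complex_of_real (\<Sum>i<n. (cmod (\<Sum>k<n. x k * of_real (v k i)))\<^sup>2)
      = (\<Sum>i<n. \<Sum>k<n. \<Sum>l<n. x k * cnj (x l) * of_real (v k i * v l i))"
    unfolding of_real_sum complex_norm_square cnj_sum sum_product
    by (intro sum.cong refl) (simp add: mult_ac)
  also have "\<dots> = (\<Sum>k<n. \<Sum>l<n. x k * cnj (x l) * of_real (\<Sum>i<n. v k i * v l i))"
    unfolding of_real_sum sum_distrib_left by (rule sum_triple_swap[symmetric])
  also have "\<dots> = (\<Sum>k<n. \<Sum>l<n. x k * cnj (x l) * of_bool (k = l))"
    by (intro sum.cong refl) (simp add: v)
  also have "\<dots> = (\<Sum>k<n. x k * cnj (x k))"
    by (intro sum.cong refl) (simp only: sum_of_bool_mult lessThan_iff)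
  also have "\<dots> = complex_of_real (\<Sum>k<n. (cmod (x k))\<^sup>2)"
    by (simp only: of_real_sum complex_norm_square)
  finally show ?thesis using of_real_eq_iff by blast
qed

text \<open>
  In the eigenbasis the resolvent multiplies each coordinate by a number of modulus at most \<open>1 / e\<close>; Parseval's
  identity transports this to the standard basis.
\<close>
lemma resolvent_operator_norm:
  assumes B: "real_symmetric n B" and e: "0 < e" "e \<le> Im z"
  shows "(\<Sum>i<n. (cmod (\<Sum>j<n. resolvent B z i j * x j))\<^sup>2) \<le> (1 / e)\<^sup>2 * (\<Sum>j<n. (cmod (x j))\<^sup>2)"
proof -
  obtain u where u: "spectral n B u"
    "\<And>i j. resolvent B z i j = (\<Sum>k<n. of_real (u k i * u k j) / (of_real (eig_desc B k) - z))"
    using resolvent_spectral[OF B] by metis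
  define q where "q k = 1 / (of_real (eig_desc B k) - z)" for k
  define c where "c k = (\<Sum>j<n. x j * of_real (u k j))" for k
  have "(\<Sum>j<n. resolvent B z i j * x j) = (\<Sum>k<n. (q k * c k) * of_real (u k i))" for i
  proof -
    have "(\<Sum>j<n. resolvent B z i j * x j) = (\<Sum>j<n. \<Sum>k<n. q k * (x j * of_real (u k j)) * of_real (u k i))"
      unfolding u(2) q_def sum_distrib_right by (intro sum.cong refl) (simp add: mult_ac)
    also have "\<dots> = (\<Sum>k<n. \<Sum>j<n. q k * (x j * of_real (u k j)) * of_real (u k i))" by (rule sum.swap)
    finally show ?thesis by (simp add: c_def sum_distrib_left sum_distrib_right)
  qed
  then have "(\<Sum>i<n. (cmod (\<Sum>j<n. resolvent B z i j * x j))\<^sup>2) = (\<Sum>k<n. (cmod (q k * c k))\<^sup>2)"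
    using u(1) unfolding spectral_def orthonormal_def by (simp add: parseval)
  also have "\<dots> \<le> (\<Sum>k<n. (1 / e)\<^sup>2 * (cmod (c k))\<^sup>2)"
    unfolding norm_mult power_mult_distrib q_def
    using e by (intro sum_mono mult_right_mono power_mono norm_inverse_real_diff_le) auto
  also have "(\<Sum>k<n. (1 / e)\<^sup>2 * (cmod (c k))\<^sup>2) = (1 / e)\<^sup>2 * (\<Sum>k<n. (cmod (c k))\<^sup>2)"
    by (simp only: sum_distrib_left)
  also have "(\<Sum>k<n. (cmod (c k))\<^sup>2) = (\<Sum>j<n. (cmod (x j))\<^sup>2)"
    using parseval[of n "\<lambda>j k. u k j" x] u(1) unfolding c_def spectral_def orthonormal_def by simp
  finally show ?thesis .
qed

lemma resolvent_row_norm: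
  assumes B: "real_symmetric n B" and e: "0 < e" "e \<le> Im z" and i: "i < n"
  shows "(\<Sum>j<n. (cmod (resolvent B z i j))\<^sup>2) \<le> (1 / e)\<^sup>2"
proof -
  have "(\<Sum>j<n. (cmod (resolvent B z i j))\<^sup>2) = (\<Sum>j<n. (cmod (\<Sum>k<n. resolvent B z j k * of_bool (k = i)))\<^sup>2)"
    by (simp only: sum_of_bool_mult[OF i] resolvent_symmetric[of B z i])
  also have "\<dots> \<le> (1 / e)\<^sup>2 * (\<Sum>k<n. (cmod (of_bool (k = i)))\<^sup>2)"
    by (rule resolvent_operator_norm[OF B e])
  also have "(\<Sum>k<n. (cmod (of_bool (k = i)))\<^sup>2) = (\<Sum>k<n. of_bool (k = i) * 1)"
    by (intro sum.cong refl) simp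
  also have "\<dots> = (1::real)" by (rule sum_of_bool_mult[OF i])
  finally show ?thesis by simp
qed

lemma norm_sum_mult_le:
  fixes f g :: "nat \<Rightarrow> complex"
  assumes "(\<Sum>j<n. (cmod (f j))\<^sup>2) \<le> a\<^sup>2" "(\<Sum>j<n. (cmod (g j))\<^sup>2) \<le> b\<^sup>2" "0 \<le> a" "0 \<le> b"
  shows "cmod (\<Sum>j<n. f j * g j) \<le> a * b"
proof -
  have "cmod (\<Sum>j<n. f j * g j) \<le> (\<Sum>j<n. \<bar>cmod (f j)\<bar> * \<bar>cmod (g j)\<bar>)"
    by (rule sum_norm_le) (simp add: norm_mult)
  also have "\<dots> \<le> L2_set (\<lambda>j. cmod (f j)) {..<n} * L2_set (\<lambda>j. cmod (g j)) {..<n}"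
    by (rule L2_set_mult_ineq)
  also have "\<dots> \<le> a * b"
    unfolding L2_set_def using assms by (intro mult_mono real_le_lsqrt) (auto intro: sum_nonneg)
  finally show ?thesis .
qed

lemma resolvent_norm_le:
  assumes B: "real_symmetric n B" and e: "0 < e" "e \<le> Im z" and ij: "i < n" "j < n"
  shows "cmod (resolvent B z i j) \<le> 1 / e"
proof -
  have "(cmod (resolvent B z i j))\<^sup>2 \<le> (\<Sum>j<n. (cmod (resolvent B z i j))\<^sup>2)"
    using ij(2) by (intro member_le_sum[of j _ "\<lambda>j. (cmod (resolvent B z i j))\<^sup>2"]) auto
  also have "\<dots> \<le> (1 / e)\<^sup>2" by (rule resolvent_row_norm[OF B e ij(1)])
  finally show ?thesis using e(1) by (simp add: power2_le_iff_abs_le)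
qed

text \<open>
  \<open>G' - G = G (B - B' + (z' - z)) G'\<close> for the resolvents \<open>G\<close> and \<open>G'\<close>.
\<close>
lemma resolvent_identity:
  assumes B: "real_symmetric n B" "real_symmetric n B'" and z: "Im z \<noteq> 0" "Im z' \<noteq> 0"
    and ij: "i < n" "j < n"
  shows "resolvent B' z' i j - resolvent B z i j =
    (\<Sum>k<n. \<Sum>l<n. resolvent B z i k *
       (of_real (B $$ (k, l) - B' $$ (k, l)) + (z' - z) * of_bool (k = l)) * resolvent B' z' l j)"
proof -
  let ?G = "resolvent B z" and ?H = "resolvent B' z'"
  let ?b = "\<lambda>k l. of_real (B $$ (k, l)) - z * of_bool (k = l)"
  let ?c = "\<lambda>k l. of_real (B' $$ (k, l)) - z' * of_bool (k = l)"
  have "(\<Sum>k<n. \<Sum>l<n. ?G i k * (of_real (B $$ (k, l) - B' $$ (k, l)) + (z' - z) * of_bool (k = l)) * ?H l j)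
     = (\<Sum>k<n. \<Sum>l<n. ?G i k * ?b k l * ?H l j) - (\<Sum>k<n. \<Sum>l<n. ?G i k * ?c k l * ?H l j)"
    unfolding sum_subtractf[symmetric] by (intro sum.cong refl) (simp add: algebra_simps)
  also have "(\<Sum>k<n. \<Sum>l<n. ?G i k * ?b k l * ?H l j) = (\<Sum>l<n. (\<Sum>k<n. ?G i k * ?b k l) * ?H l j)"
    unfolding sum_distrib_right by (rule sum.swap)
  also have "\<dots> = (\<Sum>l<n. of_bool (i = l) * ?H l j)"
    by (intro sum.cong refl) (simp only: resolvent_inverse(2)[OF B(1) z(1) ij(1)] lessThan_iff)
  also have "\<dots> = ?H i j" by (rule sum_of_bool_mult[OF ij(1)])
  also have "(\<Sum>k<n. \<Sum>l<n. ?G i k * ?c k l * ?H l j) = (\<Sum>k<n. ?G i k * (\<Sum>l<n. ?c k l * ?H l j))"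
    by (simp only: sum_distrib_left mult.assoc)
  also have "\<dots> = (\<Sum>k<n. ?G i k * of_bool (k = j))"
    by (intro sum.cong refl) (simp only: resolvent_inverse(1)[OF B(2) z(2) _ ij(2)] lessThan_iff)
  also have "\<dots> = ?G i j" by (rule sum_of_bool_mult[OF ij(2)])
  finally show ?thesis by simp
qed

text \<open>
  The spectral definition involves a choice of eigenvectors, so that it does not show any measurability in the entries.
  Cramer's rule gives the resolvent as a quotient of polynomials in the entries.
\<close>
lemma resolvent_cramer:
  assumes B: "real_symmetric n B" and z: "Im z \<noteq> 0" and ij: "i < n" "j < n"
  defines "C \<equiv> mat n n (\<lambda>(k, l). of_real (B $$ (k, l)) - z * of_bool (k = l))"
  shows "resolvent B z i j = adj_mat C $$ (i, j) / det C"
proof -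
  define G where "G = mat n n (\<lambda>(i, j). resolvent B z i j)"
  have car: "C \<in> carrier_mat n n" "G \<in> carrier_mat n n" by (auto simp: C_def G_def)
  have GC: "G * C = 1\<^sub>m n"
    using resolvent_inverse(2)[OF B z]
    by (intro eq_matI) (auto simp: G_def C_def scalar_prod_def atLeast0LessThan)
  have "det G * det C = 1" using det_mult[OF car(2,1)] GC by simp
  then have d: "det C \<noteq> 0" by auto
  note adj = adj_mat[OF car(1)]
  have "det C \<cdot>\<^sub>m G = G * (C * adj_mat C)"
    unfolding adj(2) using car mult_smult_distrib[OF car(2), of "1\<^sub>m n" n "det C"] by simp
  also have "\<dots> = adj_mat C"
    using assoc_mult_mat[OF car(2,1) adj(1)] GC adj(1) by simp
  finally have "det C * G $$ (i, j) = adj_mat C $$ (i, j)" using ij car by (metis index_smult_mat(1) carrier_matD)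
  then show ?thesis using d ij by (simp add: G_def field_simps)
qed

lemma borel_measurable_det:
  fixes X :: "'x \<Rightarrow> complex mat"
  assumes m: "\<And>i j. i < n \<Longrightarrow> j < n \<Longrightarrow> (\<lambda>x. X x $$ (i, j)) \<in> borel_measurable N"
    and c: "\<And>x. X x \<in> carrier_mat n n"
  shows "(\<lambda>x. det (X x)) \<in> borel_measurable N"
proof -
  have "(\<lambda>x. det (X x)) = (\<lambda>x. \<Sum>p\<in>{p. p permutes {0..<n}}. signof p * (\<Prod>i = 0..<n. X x $$ (i, p i)))"
    by (rule ext) (rule det_def'[OF c])
  also have "\<dots> \<in> borel_measurable N"
  proof (intro borel_measurable_sum borel_measurable_times borel_measurable_const borel_measurable_prod)
    fix p i assume "p \<in> {p. p permutes {0..<n}}" "i \<in> {0..<n}"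
    then show "(\<lambda>x. X x $$ (i, p i)) \<in> borel_measurable N"
      using permutes_in_image[of p "{0..<n}" i] by (intro m) auto
  qed
  finally show ?thesis .
qed

lemma borel_measurable_resolvent:
  fixes X :: "'x \<Rightarrow> real mat"
  assumes m: "\<And>i j. i < n \<Longrightarrow> j < n \<Longrightarrow> (\<lambda>x. X x $$ (i, j)) \<in> borel_measurable N"
    and z: "z \<in> borel_measurable N"
    and s: "\<And>x. x \<in> space N \<Longrightarrow> real_symmetric n (X x)" "\<And>x. x \<in> space N \<Longrightarrow> Im (z x) \<noteq> 0" and ij: "i < n" "j < n"
  shows "(\<lambda>x. resolvent (X x) (z x) i j) \<in> borel_measurable N"
proof -
  define C where "C x = mat n n (\<lambda>(k, l). of_real (X x $$ (k, l)) - z x * of_bool (k = l))" for x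
  have C: "C x \<in> carrier_mat n n" for x by (simp add: C_def)
  have Cm: "(\<lambda>x. C x $$ (k, l)) \<in> borel_measurable N" if "k < n" "l < n" for k l
    using that m[OF that] z by (auto simp: C_def intro!: borel_measurable_diff borel_measurable_times borel_measurable_of_real)
  have "(\<lambda>x. det (mat_delete (C x) j i)) \<in> borel_measurable N"
  proof (rule borel_measurable_det)
    show "mat_delete (C x) j i \<in> carrier_mat (n - 1) (n - 1)" for x
      using C by (rule mat_delete_carrier)
    fix k l assume kl: "k < n - 1" "l < n - 1"
    have "mat_delete (C x) j i $$ (k, l) = C x $$ (insert_index j k, insert_index i l)" for x
      using kl C[of x] ij by (cases n) (auto simp: mat_delete_index[symmetric])
    moreover have "insert_index j k < n" "insert_index i l < n" using kl by (auto simp: insert_index_def)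
    ultimately show "(\<lambda>x. mat_delete (C x) j i $$ (k, l)) \<in> borel_measurable N" using Cm by simp
  qed
  moreover have "adj_mat (C x) $$ (i, j) = (- 1) ^ (j + i) * det (mat_delete (C x) j i)" for x
    using C[of x] ij by (auto simp: adj_mat_def cofactor_def)
  ultimately have a: "(\<lambda>x. adj_mat (C x) $$ (i, j) / det (C x)) \<in> borel_measurable N"
    using borel_measurable_det[OF Cm C] by simp
  show ?thesis
    by (rule measurable_cong[THEN iffD1, OF _ a]) (simp add: resolvent_cramer[OF s ij] C_def)
qed

lemma borel_measurable_stieltjes:
  fixes X :: "'x \<Rightarrow> real mat"
  assumes m: "\<And>i j. i < n \<Longrightarrow> j < n \<Longrightarrow> (\<lambda>x. X x $$ (i, j)) \<in> borel_measurable N"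
    and z: "z \<in> borel_measurable N"
    and s: "\<And>x. x \<in> space N \<Longrightarrow> real_symmetric n (X x)" "\<And>x. x \<in> space N \<Longrightarrow> Im (z x) \<noteq> 0"
  shows "(\<lambda>x. stieltjes n (eig_desc (X x)) (z x)) \<in> borel_measurable N"
proof (cases "n = 0")
  case True
  then show ?thesis by (simp add: stieltjes_def)
next
  case False
  have a: "(\<lambda>x. (\<Sum>i<n. resolvent (X x) (z x) i i) / of_nat n) \<in> borel_measurable N"
    by (intro borel_measurable_divide borel_measurable_sum borel_measurable_resolvent[OF assms]) auto
  show ?thesis
    by (rule measurable_cong[THEN iffD1, OF _ a]) (use False in \<open>simp add: resolvent_trace[OF s(1)]\<close>)
qed

section \<open>Resampling one coordinate of a product measure\<close>

text \<open>
  All members of the family are probability measures on the Borel sets, also outside the index set, so that subsets of the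
  index set give product measures of the same kind.
\<close>
locale independent_reals =
  fixes I :: "'i set" and \<nu> :: "'i \<Rightarrow> real measure"
  assumes finite_index [simp]: "finite I"
    and prob [simp]: "\<And>i. prob_space (\<nu> i)"
    and sets_borel [measurable_cong, simp]: "\<And>i. sets (\<nu> i) = sets borel"

sublocale independent_reals \<subseteq> product_prob_space \<nu> I
  unfolding product_prob_space_def product_prob_space_axioms_def product_sigma_finite_def
  by (simp add: prob_space_imp_sigma_finite)

context independent_reals
begin

lemma space_real [simp]: "space (\<nu> i) = UNIV"
  using sets_eq_imp_space_eq[OF sets_borel] by simp

lemma prob_UNIV [simp]: "measure (\<nu> i) UNIV = 1"
  using prob_space.prob_space[OF prob[of i]] by simp

lemma measurable_upd [measurable]:
  "i \<in> I \<Longrightarrow> (\<lambda>w. w(i := y)) \<in> measurable (PiM I \<nu>) (PiM I \<nu>)"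
  by (rule measurable_fun_upd[where J = I]) auto

lemma measurable_upd_pair:
  assumes i: "i \<in> I"
  shows "(\<lambda>x. (fst x)(i := snd x)) \<in> measurable (PiM I \<nu> \<Otimes>\<^sub>M \<nu> i) (PiM I \<nu>)"
  by (rule measurable_fun_upd[where J = I]) (use i in auto)

lemma integrable_bounded:
  fixes f :: "('i \<Rightarrow> real) \<Rightarrow> 'b :: {banach, second_countable_topology}"
  assumes "f \<in> borel_measurable (PiM I \<nu>)" "\<And>w. norm (f w) \<le> b"
  shows "integrable (PiM I \<nu>) f"
  using assms by (intro P.integrable_const_bound[of _ b]) auto

text \<open>
  Redrawing one coordinate independently does not change the distribution. This is the form in which Fubini's theorem is used
  below.
\<close>
lemma integral_resample:
  fixes f :: "('i \<Rightarrow> real) \<Rightarrow> 'b :: {banach, second_countable_topology}"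
  assumes i: "i \<in> I" and f: "integrable (PiM I \<nu>) f"
  shows "(\<integral>w. f w \<partial>PiM I \<nu>) = (\<integral>w. (\<integral>y. f (w(i := y)) \<partial>\<nu> i) \<partial>PiM I \<nu>)"
    and "integrable (PiM I \<nu>) (\<lambda>w. \<integral>y. f (w(i := y)) \<partial>\<nu> i)"
proof -
  define J where "J = I - {i}"
  have J: "finite J" "i \<notin> J" "insert i J = I" using i by (auto simp: J_def)
  interpret J: prob_space "PiM J \<nu>" by (rule prob_space_PiM) simp
  interpret Ji: pair_sigma_finite "PiM J \<nu>" "\<nu> i"
    by (intro pair_sigma_finite.intro prob_space_imp_sigma_finite J.prob_space_axioms) simp
  have m: "(\<lambda>(x, y). x(i := y)) \<in> measurable (PiM J \<nu> \<Otimes>\<^sub>M \<nu> i) (PiM I \<nu>)"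
    using measurable_add_dim[of i J \<nu>] unfolding J(3) .
  have m': "(\<lambda>(y, x). x(i := y)) \<in> measurable (\<nu> i \<Otimes>\<^sub>M PiM J \<nu>) (PiM I \<nu>)"
    using measurable_compose[OF measurable_pair_swap' m] by (simp add: case_prod_beta')
  have swap: "\<nu> i \<Otimes>\<^sub>M PiM J \<nu> = distr (PiM J \<nu> \<Otimes>\<^sub>M \<nu> i) (\<nu> i \<Otimes>\<^sub>M PiM J \<nu>) (\<lambda>(x, y). (y, x))"
    by (rule pair_sigma_finite.distr_pair_swap)
      (intro pair_sigma_finite.intro prob_space_imp_sigma_finite J.prob_space_axioms prob)
  have dist: "distr (PiM J \<nu> \<Otimes>\<^sub>M \<nu> i) (PiM I \<nu>) (\<lambda>(x, y). x(i := y)) = PiM I \<nu>"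
  proof -
    have "PiM I \<nu> = distr (\<nu> i \<Otimes>\<^sub>M PiM J \<nu>) (PiM I \<nu>) (\<lambda>(y, x). x(i := y))"
      using distr_pair_PiM_eq_PiM[of J \<nu> i] unfolding J(3) by simp
    also have "\<dots> = distr (PiM J \<nu> \<Otimes>\<^sub>M \<nu> i) (PiM I \<nu>) ((\<lambda>(y, x). x(i := y)) \<circ> (\<lambda>(x, y). (y, x)))"
      unfolding distr_distr[OF m' measurable_pair_swap', symmetric] swap[symmetric] ..
    also have "(\<lambda>(y, x). x(i := y)) \<circ> (\<lambda>(x, y). (y, x)) = (\<lambda>(x, y). x(i := y))"
      by (simp add: fun_eq_iff)
    finally show ?thesis by simp
  qed
  have int: "integrable (PiM J \<nu> \<Otimes>\<^sub>M \<nu> i) (\<lambda>(x, y). f (x(i := y)))"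
    using f integrable_distr[OF m, of f] unfolding dist by (simp add: case_prod_beta')
  define g where "g x = (\<integral>y. f (x(i := y)) \<partial>\<nu> i)" for x
  have gJ: "integrable (PiM J \<nu>) g"
    unfolding g_def using Ji.integrable_fst[OF int] by simp
  have fm: "f \<in> borel_measurable (PiM I \<nu>)" using f by auto
  have gm: "g \<in> borel_measurable (PiM I \<nu>)"
    unfolding g_def
    by (rule sigma_finite_measure.borel_measurable_lebesgue_integral[OF prob_space_imp_sigma_finite[OF prob]])
      (use measurable_compose[OF measurable_upd_pair[OF i] fm] in \<open>simp add: case_prod_beta'\<close>)
  have gupd: "g (x(i := y)) = g x" for x y by (simp add: g_def)
  have "distr (PiM I \<nu>) (PiM J \<nu>) (\<lambda>x. restrict x J) = PiM J \<nu>"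
    by (rule distr_PiM_restrict_finite) (use J in auto)
  moreover have res: "(\<lambda>x. restrict x J) \<in> measurable (PiM I \<nu>) (PiM J \<nu>)"
    by (rule measurable_restrict_subset) (use J in auto)
  moreover have gres: "g (restrict x J) = g x" if "x \<in> space (PiM I \<nu>)" for x
  proof -
    have "(restrict x J)(i := x i) = x" using that J
      by (auto simp: space_PiM PiE_def extensional_def fun_eq_iff)
    then show ?thesis using gupd by metis
  qed
  ultimately have gI: "integrable (PiM I \<nu>) (\<lambda>x. g (restrict x J))"
    and gIJ: "(\<integral>x. g (restrict x J) \<partial>PiM I \<nu>) = (\<integral>x. g x \<partial>PiM J \<nu>)"
    using gJ integrable_distr[OF res, of g] integral_distr[OF res, of g] by auto
  have cong: "integrable (PiM I \<nu>) (\<lambda>x. g (restrict x J)) \<longleftrightarrow> integrable (PiM I \<nu>) g"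
    by (rule Bochner_Integration.integrable_cong) (auto simp: gres)
  show "integrable (PiM I \<nu>) (\<lambda>w. \<integral>y. f (w(i := y)) \<partial>\<nu> i)"
    using gI unfolding cong by (simp only: g_def[abs_def])
  have "(\<integral>x. g (restrict x J) \<partial>PiM I \<nu>) = (\<integral>x. g x \<partial>PiM I \<nu>)"
    by (rule Bochner_Integration.integral_cong) (auto simp: gres)
  moreover have "(\<integral>w. f w \<partial>PiM I \<nu>) = (\<integral>x. g x \<partial>PiM J \<nu>)"
    using product_integral_insert[of J i f] f J unfolding g_def by simp
  ultimately show "(\<integral>w. f w \<partial>PiM I \<nu>) = (\<integral>w. (\<integral>y. f (w(i := y)) \<partial>\<nu> i) \<partial>PiM I \<nu>)"
    using gIJ by (simp add: g_def)
qed

lemma integrable_component: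
  fixes h :: "real \<Rightarrow> 'b :: {banach, second_countable_topology}"
  assumes "i \<in> I" and h: "h \<in> borel_measurable borel"
  shows "integrable (PiM I \<nu>) (\<lambda>w. h (w i)) \<longleftrightarrow> integrable (\<nu> i) h"
    and "(\<integral>w. h (w i) \<partial>PiM I \<nu>) = (\<integral>y. h y \<partial>\<nu> i)"
proof -
  have m: "(\<lambda>w. w i) \<in> measurable (PiM I \<nu>) (\<nu> i)" using assms by simp
  have hm: "h \<in> borel_measurable (\<nu> i)" using h by (simp add: measurable_cong_sets[OF sets_borel refl])
  show "integrable (PiM I \<nu>) (\<lambda>w. h (w i)) \<longleftrightarrow> integrable (\<nu> i) h"
    using integrable_distr_eq[OF m hm] PiM_component[OF assms(1)] by simp
  show "(\<integral>w. h (w i) \<partial>PiM I \<nu>) = (\<integral>y. h y \<partial>\<nu> i)"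
    using integral_distr[OF m hm] PiM_component[OF assms(1)] by simp
qed

end

text \<open>The mean minimizes the mean square deviation.\<close>
lemma (in prob_space) square_integral_le:
  fixes f :: "'a \<Rightarrow> real"
  assumes f: "integrable M f" "integrable M (\<lambda>x. (f x)\<^sup>2)"
  shows "(\<integral>x. (f x)\<^sup>2 \<partial>M) - (\<integral>x. f x \<partial>M)\<^sup>2 \<le> (\<integral>x. (f x - c)\<^sup>2 \<partial>M)"
proof -
  have "(\<integral>x. (f x - c)\<^sup>2 \<partial>M) = (\<integral>x. (f x)\<^sup>2 - 2 * c * f x + c\<^sup>2 \<partial>M)"
    by (intro Bochner_Integration.integral_cong refl) (simp add: power2_diff algebra_simps)
  also have "\<dots> = (\<integral>x. (f x)\<^sup>2 \<partial>M) - 2 * c * (\<integral>x. f x \<partial>M) + c\<^sup>2"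
    using f by (simp add: prob_space)
  finally have "(\<integral>x. (f x - c)\<^sup>2 \<partial>M) = (\<integral>x. (f x)\<^sup>2 \<partial>M) - (\<integral>x. f x \<partial>M)\<^sup>2 + ((\<integral>x. f x \<partial>M) - c)\<^sup>2"
    by (simp add: power2_diff mult_ac)
  then show ?thesis by simp
qed

text \<open>
  The variance is at most the sum of the contributions of the coordinates. The usual statement compares with an independent
  copy of a coordinate or with its conditional mean; comparison with the fixed value \<open>0\<close> is weaker, but
  sufficient, and avoids a second copy of the space. The induction splits off one coordinate: its own fluctuation is bounded
  by \<open>square_integral_le\<close>, the rest is the variance of the conditional mean.
\<close>
lemma efron_stein:
  fixes \<nu> :: "'i \<Rightarrow> real measure" and F :: "('i \<Rightarrow> real) \<Rightarrow> real"
  assumes "finite I" and nu: "\<And>i. prob_space (\<nu> i)" "\<And>i. sets (\<nu> i) = sets borel"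
    and "F \<in> borel_measurable (PiM I \<nu>)" and "\<And>w. \<bar>F w\<bar> \<le> b"
  shows "(\<integral>w. (F w)\<^sup>2 \<partial>PiM I \<nu>) - (\<integral>w. F w \<partial>PiM I \<nu>)\<^sup>2
       \<le> (\<Sum>i\<in>I. \<integral>w. (F w - F (w(i := 0)))\<^sup>2 \<partial>PiM I \<nu>)"
  using assms(1,4,5)
proof (induction I arbitrary: F)
  case empty
  interpret prob_space "PiM {} \<nu>" by (rule prob_space_PiM) simp
  show ?case by (simp add: PiM_empty lebesgue_integral_count_space_finite power2_eq_square)
next
  case (insert i J F)
  interpret nu: prob_space "\<nu> i" by (rule nu)
  interpret K: independent_reals "insert i J" \<nu> by (simp add: independent_reals_def insert.hyps nu)
  interpret J: independent_reals J \<nu> by (simp add: independent_reals_def insert.hyps nu)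
  let ?P = "PiM (insert i J) \<nu>" and ?Q = "PiM J \<nu>"
  note [measurable] = insert.prems(1)
  have Fb: "\<bar>F w\<bar> \<le> b" for w by (rule insert.prems(2))
  have b0: "0 \<le> b" using Fb[of undefined] by simp
  have updm: "(\<lambda>p. (fst p)(i := snd p)) \<in> measurable (?Q \<Otimes>\<^sub>M \<nu> i) ?P"
    using measurable_add_dim[of i J \<nu>] by (simp add: case_prod_beta')
  have upd1: "(\<lambda>y. x(i := y)) \<in> measurable (\<nu> i) ?P" if "x \<in> space ?Q" for x
    by (rule measurable_component_update[OF that insert.hyps(2)])
  define g where "g x = (\<integral>y. F (x(i := y)) \<partial>\<nu> i)" for x
  have gm: "g \<in> borel_measurable ?Q"
    unfolding g_def using measurable_compose[OF updm insert.prems(1)]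
    by (intro nu.borel_measurable_lebesgue_integral) (simp add: case_prod_beta')
  have gb: "\<bar>g x\<bar> \<le> b" for x
  proof -
    have "\<bar>g x\<bar> \<le> (\<integral>y. \<bar>F (x(i := y))\<bar> \<partial>\<nu> i)" unfolding g_def by (rule integral_abs_bound)
    also have "\<dots> \<le> b"
    proof (cases "integrable (\<nu> i) (\<lambda>y. \<bar>F (x(i := y))\<bar>)")
      case True
      then have "(\<integral>y. \<bar>F (x(i := y))\<bar> \<partial>\<nu> i) \<le> (\<integral>y. b \<partial>\<nu> i)"
        by (intro integral_mono) (auto simp: Fb)
      then show ?thesis by (simp add: nu.prob_space)
    next
      case False
      then show ?thesis using b0 by (simp add: not_integrable_integral_eq)
    qed
    finally show ?thesis .
  qed
  have sq: "\<bar>a\<^sup>2\<bar> \<le> c\<^sup>2" if "\<bar>a\<bar> \<le> c" for a c :: real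
    using that by (metis abs_of_nonneg power2_abs power_mono abs_ge_zero zero_le_power2)
  have db: "\<bar>F u - F v\<bar> \<le> 2 * b" for u v using Fb[of u] Fb[of v] by simp
  have bnd: "\<bar>(F u - F v)\<^sup>2\<bar> \<le> (2 * b)\<^sup>2" "\<bar>(F u)\<^sup>2\<bar> \<le> b\<^sup>2" for u v using sq db Fb by blast+
  have intF2: "integrable ?P (\<lambda>w. (F w)\<^sup>2)" and intF: "integrable ?P F"
    using bnd(2) Fb by (auto intro!: K.integrable_bounded)
  have intd: "integrable ?P (\<lambda>w. (F w - F (w(j := 0)))\<^sup>2)" if "j \<in> insert i J" for j
  proof -
    have "(\<lambda>w. F (w(j := 0))) \<in> borel_measurable ?P"
      by (rule measurable_compose[OF K.measurable_upd[OF that] insert.prems(1)])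
    then show ?thesis using bnd(1) by (intro K.integrable_bounded[of _ "(2 * b)\<^sup>2"]) auto
  qed
  have intf: "integrable (\<nu> i) (\<lambda>y. F (x(i := y)))" "integrable (\<nu> i) (\<lambda>y. (F (x(i := y)))\<^sup>2)"
    if "x \<in> space ?Q" for x
  proof -
    have [measurable]: "(\<lambda>y. F (x(i := y))) \<in> borel_measurable (\<nu> i)"
      by (rule measurable_compose[OF upd1[OF that] insert.prems(1)])
    show "integrable (\<nu> i) (\<lambda>y. F (x(i := y)))"
      using Fb by (intro nu.integrable_const_bound[of _ b]) auto
    show "integrable (\<nu> i) (\<lambda>y. (F (x(i := y)))\<^sup>2)"
      using bnd(2) by (intro nu.integrable_const_bound[of _ "b\<^sup>2"]) auto
  qed
  have fold: "(\<integral>w. h w \<partial>?P) = (\<integral>x. (\<integral>y. h (x(i := y)) \<partial>\<nu> i) \<partial>?Q)" "integrable ?Q (\<lambda>x. \<integral>y. h (x(i := y)) \<partial>\<nu> i)"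
    if "integrable ?P h" "\<And>w. \<bar>h w\<bar> \<le> c" for h :: "('i \<Rightarrow> real) \<Rightarrow> real" and c
  proof -
    show "(\<integral>w. h w \<partial>?P) = (\<integral>x. (\<integral>y. h (x(i := y)) \<partial>\<nu> i) \<partial>?Q)"
      using K.product_integral_insert[OF insert.hyps that(1)] .
    have hm: "h \<in> borel_measurable ?P" using that(1) by auto
    have "0 \<le> c" using that(2)[of undefined] by simp
    have "\<bar>\<integral>y. h (x(i := y)) \<partial>\<nu> i\<bar> \<le> c" for x
    proof -
      have "\<bar>\<integral>y. h (x(i := y)) \<partial>\<nu> i\<bar> \<le> (\<integral>y. \<bar>h (x(i := y))\<bar> \<partial>\<nu> i)" by (rule integral_abs_bound)
      also have "\<dots> \<le> c"
      proof (cases "integrable (\<nu> i) (\<lambda>y. \<bar>h (x(i := y))\<bar>)")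
        case True
        then have "(\<integral>y. \<bar>h (x(i := y))\<bar> \<partial>\<nu> i) \<le> (\<integral>y. c \<partial>\<nu> i)"
          by (intro integral_mono) (auto simp: that(2))
        then show ?thesis by (simp add: nu.prob_space)
      next
        case False
        then show ?thesis using \<open>0 \<le> c\<close> by (simp add: not_integrable_integral_eq)
      qed
      finally show ?thesis .
    qed
    moreover have "(\<lambda>x. \<integral>y. h (x(i := y)) \<partial>\<nu> i) \<in> borel_measurable ?Q"
      using measurable_compose[OF updm hm]
      by (intro nu.borel_measurable_lebesgue_integral) (simp add: case_prod_beta')
    ultimately show "integrable ?Q (\<lambda>x. \<integral>y. h (x(i := y)) \<partial>\<nu> i)"
      by (intro J.integrable_bounded[of _ c]) auto
  qed
  have intg2: "integrable ?Q (\<lambda>x. (g x)\<^sup>2)" and intg: "integrable ?Q g"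
    using gm gb sq[OF gb] by (auto intro!: J.integrable_bounded)
  \<comment> \<open>the fluctuation in the coordinate \<open>i\<close>\<close>
  have one: "(\<integral>w. (F w)\<^sup>2 \<partial>?P) - (\<integral>x. (g x)\<^sup>2 \<partial>?Q) \<le> (\<integral>w. (F w - F (w(i := 0)))\<^sup>2 \<partial>?P)"
  proof -
    have "(\<integral>w. (F w)\<^sup>2 \<partial>?P) - (\<integral>x. (g x)\<^sup>2 \<partial>?Q) = (\<integral>x. (\<integral>y. (F (x(i := y)))\<^sup>2 \<partial>\<nu> i) - (g x)\<^sup>2 \<partial>?Q)"
      using fold[OF intF2 bnd(2)] intg2 by simp
    also have "\<dots> \<le> (\<integral>x. (\<integral>y. (F (x(i := y)) - F ((x(i := y))(i := 0)))\<^sup>2 \<partial>\<nu> i) \<partial>?Q)"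
    proof (rule integral_mono)
      show "integrable ?Q (\<lambda>x. (\<integral>y. (F (x(i := y)))\<^sup>2 \<partial>\<nu> i) - (g x)\<^sup>2)"
        using fold(2)[OF intF2 bnd(2)] intg2 by simp
      show "integrable ?Q (\<lambda>x. \<integral>y. (F (x(i := y)) - F ((x(i := y))(i := 0)))\<^sup>2 \<partial>\<nu> i)"
        by (rule fold(2)[OF intd bnd(1)]) simp
      show "(\<integral>y. (F (x(i := y)))\<^sup>2 \<partial>\<nu> i) - (g x)\<^sup>2 \<le> (\<integral>y. (F (x(i := y)) - F ((x(i := y))(i := 0)))\<^sup>2 \<partial>\<nu> i)"
        if "x \<in> space ?Q" for x
        unfolding g_def fun_upd_upd by (rule nu.square_integral_le[OF intf[OF that]])
    qed
    also have "\<dots> = (\<integral>w. (F w - F (w(i := 0)))\<^sup>2 \<partial>?P)"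
      by (rule fold(1)[OF intd bnd(1), symmetric]) simp
    finally show ?thesis .
  qed
  \<comment> \<open>the fluctuations in the other coordinates survive averaging over \<open>i\<close> by Jensen's inequality\<close>
  have two: "(\<integral>x. (g x - g (x(j := 0)))\<^sup>2 \<partial>?Q) \<le> (\<integral>w. (F w - F (w(j := 0)))\<^sup>2 \<partial>?P)" if j: "j \<in> J" for j
  proof -
    have ij: "i \<noteq> j" using j insert.hyps by auto
    have "(\<integral>x. (g x - g (x(j := 0)))\<^sup>2 \<partial>?Q) \<le> (\<integral>x. (\<integral>y. (F (x(i := y)) - F ((x(i := y))(j := 0)))\<^sup>2 \<partial>\<nu> i) \<partial>?Q)"
    proof (rule integral_mono)
      have "(\<lambda>x. g (x(j := 0))) \<in> borel_measurable ?Q"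
        by (rule measurable_compose[OF J.measurable_upd[OF j] gm])
      moreover have "\<bar>(g x - g (x(j := 0)))\<^sup>2\<bar> \<le> (2 * b)\<^sup>2" for x
        using gb[of x] gb[of "x(j := 0)"] by (intro sq) linarith
      ultimately show "integrable ?Q (\<lambda>x. (g x - g (x(j := 0)))\<^sup>2)"
        using gm by (intro J.integrable_bounded[of _ "(2 * b)\<^sup>2"]) auto
      show "integrable ?Q (\<lambda>x. \<integral>y. (F (x(i := y)) - F ((x(i := y))(j := 0)))\<^sup>2 \<partial>\<nu> i)"
        by (rule fold(2)[OF intd bnd(1)]) (use j in simp)
      fix x assume x: "x \<in> space ?Q"
      have x': "x(j := 0) \<in> space ?Q" using measurable_space[OF J.measurable_upd[OF j] x] .
      define d where "d y = F (x(i := y)) - F ((x(j := 0))(i := y))" for y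
      have d: "integrable (\<nu> i) d" using intf[OF x] intf[OF x'] by (simp add: d_def[abs_def])
      moreover have d2: "integrable (\<nu> i) (\<lambda>y. (d y)\<^sup>2)"
      proof (rule nu.integrable_const_bound)
        show "AE y in \<nu> i. norm ((d y)\<^sup>2) \<le> (2 * b)\<^sup>2"
          unfolding d_def real_norm_def using bnd(1) by blast
        show "(\<lambda>y. (d y)\<^sup>2) \<in> borel_measurable (\<nu> i)"
          by (intro borel_measurable_power borel_measurable_integrable[OF d])
      qed
      ultimately have "(\<integral>y. d y \<partial>\<nu> i)\<^sup>2 \<le> (\<integral>y. (d y)\<^sup>2 \<partial>\<nu> i)"
        using nu.variance_eq[of d] nu.variance_positive[of d] by simp
      moreover have "(\<integral>y. d y \<partial>\<nu> i) = g x - g (x(j := 0))"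
        unfolding d_def g_def using intf(1)[OF x] intf(1)[OF x'] by simp
      ultimately show "(g x - g (x(j := 0)))\<^sup>2 \<le> (\<integral>y. (F (x(i := y)) - F ((x(i := y))(j := 0)))\<^sup>2 \<partial>\<nu> i)"
        by (simp add: d_def fun_upd_twist[OF ij])
    qed
    also have "\<dots> = (\<integral>w. (F w - F (w(j := 0)))\<^sup>2 \<partial>?P)"
      by (rule fold(1)[OF intd bnd(1), symmetric]) (use j in simp)
    finally show ?thesis .
  qed
  have "(\<integral>x. (g x)\<^sup>2 \<partial>?Q) - (\<integral>x. g x \<partial>?Q)\<^sup>2 \<le> (\<Sum>j\<in>J. \<integral>x. (g x - g (x(j := 0)))\<^sup>2 \<partial>?Q)"
    by (rule insert.IH[OF gm gb])
  also have "\<dots> \<le> (\<Sum>j\<in>J. \<integral>w. (F w - F (w(j := 0)))\<^sup>2 \<partial>?P)"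
    by (intro sum_mono two)
  finally have "(\<integral>x. (g x)\<^sup>2 \<partial>?Q) - (\<integral>x. g x \<partial>?Q)\<^sup>2 \<le> (\<Sum>j\<in>J. \<integral>w. (F w - F (w(j := 0)))\<^sup>2 \<partial>?P)" .
  moreover have eq: "(\<integral>w. F w \<partial>?P) = (\<integral>x. g x \<partial>?Q)"
    unfolding g_def by (rule fold(1)[OF intF Fb])
  ultimately show ?case using one unfolding sum.insert[OF insert.hyps] eq by linarith
qed

text \<open>
  A function that is close to one with vanishing integral has a small integral. This is how cancellation in the moments of an
  entry enters.
\<close>
lemma norm_integral_le_of_centered:
  fixes f g :: "'a \<Rightarrow> 'b :: {banach, second_countable_topology}"
  assumes "integrable M f" "integrable M g" "integrable M b" and g: "(\<integral>x. g x \<partial>M) = 0"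
    and le: "\<And>x. x \<in> space M \<Longrightarrow> norm (f x - g x) \<le> b x"
  shows "norm (\<integral>x. f x \<partial>M) \<le> (\<integral>x. b x \<partial>M)"
proof -
  have "(\<integral>x. f x \<partial>M) = (\<integral>x. f x - g x \<partial>M)" using assms by simp
  also have "norm \<dots> \<le> (\<integral>x. norm (f x - g x) \<partial>M)" by (rule integral_norm_bound)
  also have "\<dots> \<le> (\<integral>x. b x \<partial>M)" using assms by (intro integral_mono) auto
  finally show ?thesis .
qed

context independent_reals
begin

text \<open>It suffices to bound the mean over one coordinate, uniformly in the others.\<close>
lemma norm_integral_le_resample:
  fixes f :: "('i \<Rightarrow> real) \<Rightarrow> 'b :: {banach, second_countable_topology}"
  assumes i: "i \<in> I" and f: "integrable (PiM I \<nu>) f"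
    and le: "\<And>w. w \<in> space (PiM I \<nu>) \<Longrightarrow> norm (\<integral>y. f (w(i := y)) \<partial>\<nu> i) \<le> c"
  shows "norm (\<integral>w. f w \<partial>PiM I \<nu>) \<le> c"
proof -
  have "norm (\<integral>w. f w \<partial>PiM I \<nu>) \<le> (\<integral>w. norm (\<integral>y. f (w(i := y)) \<partial>\<nu> i) \<partial>PiM I \<nu>)"
    unfolding integral_resample(1)[OF i f] by (rule integral_norm_bound)
  also have "\<dots> \<le> (\<integral>w. c \<partial>PiM I \<nu>)"
    using integral_resample(2)[OF i f] le by (intro integral_mono) auto
  finally show ?thesis by (simp add: P.prob_space)
qed

lemma measurable_upd_const:
  assumes "i \<in> I" "w \<in> space (PiM I \<nu>)"
  shows "(\<lambda>y. w(i := y)) \<in> measurable (\<nu> i) (PiM I \<nu>)"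
  by (rule measurable_fun_upd[where J = I]) (use assms in auto)

end

section \<open>Symmetric matrices with independent entries\<close>

text \<open>
  The independent entries of a symmetric matrix are those on and above the diagonal. They index the noise, while matrices are
  read off through \<open>pos\<close>.
\<close>
definition upper :: "nat \<Rightarrow> (nat \<times> nat) set" where
  "upper n = {(i, j). i \<le> j \<and> j < n}"

lemma upper_subset: "upper n \<subseteq> {..<n} \<times> {..<n}" by (auto simp: upper_def)

lemma finite_upper [simp]: "finite (upper n)"
  by (rule finite_subset[OF upper_subset]) simp

lemma card_upper_le: "card (upper n) \<le> n\<^sup>2"
  using card_mono[OF _ upper_subset, of n] by (simp add: power2_eq_square)

definition pos :: "nat \<Rightarrow> nat \<Rightarrow> nat \<times> nat" where
  "pos i j = (min i j, max i j)"

lemma pos_upper [simp]: "i < n \<Longrightarrow> j < n \<Longrightarrow> pos i j \<in> upper n"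
  by (auto simp: pos_def upper_def)

lemma pos_commute: "pos i j = pos j i" by (simp add: pos_def min.commute max.commute)

definition perturbed :: "nat \<Rightarrow> real mat \<Rightarrow> real \<Rightarrow> (nat \<times> nat \<Rightarrow> real) \<Rightarrow> real mat" where
  "perturbed n a t w = mat n n (\<lambda>(i, j). a $$ (i, j) + t * w (pos i j))"

lemma perturbed_symmetric:
  assumes "real_symmetric n a" shows "real_symmetric n (perturbed n a t w)"
proof -
  have "a $$ (i, j) = a $$ (j, i)" if "i < n" "j < n" for i j
    using assms that unfolding real_symmetric_def by (metis carrier_matD index_transpose_mat(1))
  then show ?thesis unfolding real_symmetric_def perturbed_def
    by (auto intro!: eq_matI simp: pos_commute)
qed

text \<open>Matrix multiplication for entry functions, of size \<open>n\<close>.\<close>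
definition mprod :: "nat \<Rightarrow> (nat \<Rightarrow> nat \<Rightarrow> complex) \<Rightarrow> (nat \<Rightarrow> nat \<Rightarrow> complex) \<Rightarrow> nat \<Rightarrow> nat \<Rightarrow> complex" where
  "mprod n X Y i j = (\<Sum>r<n. X i r * Y r j)"

text \<open>
  The product \<open>X E Y\<close> where \<open>E\<close> is the derivative of the symmetric matrix with respect to its entry
  \<open>p\<close>: a single unit on the diagonal, or a symmetric pair of units off the diagonal.
\<close>
definition sandwich :: "nat \<times> nat \<Rightarrow> (nat \<Rightarrow> nat \<Rightarrow> complex) \<Rightarrow> (nat \<Rightarrow> nat \<Rightarrow> complex) \<Rightarrow> nat \<Rightarrow> nat \<Rightarrow> complex" where
  "sandwich p X Y r c = (case p of (i, j) \<Rightarrow>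
     if i = j then X r i * Y i c else X r i * Y j c + X r j * Y i c)"

lemma sandwich_mprod:
  "mprod n (\<lambda>r c. u * sandwich p X Y r c) Z = (\<lambda>r c. u * sandwich p X (mprod n Y Z) r c)"
  "mprod n Z (\<lambda>r c. u * sandwich p X Y r c) = (\<lambda>r c. u * sandwich p (mprod n Z X) Y r c)"
  by (auto simp: fun_eq_iff mprod_def sandwich_def split_beta sum_distrib_left sum_distrib_right
      distrib_left distrib_right sum.distrib mult_ac)

lemma norm_sandwich_le:
  assumes p: "p \<in> upper n" and X: "\<And>i j. i < n \<Longrightarrow> j < n \<Longrightarrow> cmod (X i j) \<le> x"
    and Y: "\<And>i j. i < n \<Longrightarrow> j < n \<Longrightarrow> cmod (Y i j) \<le> y" and rc: "r < n" "c < n"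
  shows "cmod (sandwich p X Y r c) \<le> 2 * (x * y)"
proof -
  obtain i j where ij: "p = (i, j)" "i < n" "j < n" using p by (auto simp: upper_def)
  have "0 \<le> x" using X[OF rc] norm_ge_zero order_trans by blast
  have b: "cmod (X r a * Y b c) \<le> x * y" if "a < n" "b < n" for a b
    unfolding norm_mult using X Y rc that \<open>0 \<le> x\<close> by (intro mult_mono) auto
  have xy: "0 \<le> x * y" using b[OF ij(2,3)] norm_ge_zero order_trans by blast
  show ?thesis
  proof (cases "i = j")
    case True
    then show ?thesis using b[OF ij(2,2)] xy by (simp add: sandwich_def ij(1))
  next
    case False
    have "cmod (X r i * Y j c + X r j * Y i c) \<le> x * y + x * y"
      by (intro norm_triangle_le add_mono b ij)
    then show ?thesis using False by (simp add: sandwich_def ij(1))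
  qed
qed

lemma sandwich_diff:
  "sandwich p X Y r c - sandwich p X' Y' r c
   = sandwich p (\<lambda>i j. X i j - X' i j) Y r c + sandwich p X' (\<lambda>i j. Y i j - Y' i j) r c"
  by (auto simp: sandwich_def split_beta algebra_simps)

lemma sum_pos_indicator:
  assumes p: "p \<in> upper n"
  shows "(\<Sum>k<n. \<Sum>l<n. X r k * of_bool (pos k l = p) * Y l c) = sandwich p X Y r c"
proof -
  obtain i j where ij: "p = (i, j)" "i \<le> j" "i < n" "j < n" using p by (auto simp: upper_def)
  show ?thesis
  proof (cases "i = j")
    case True
    have eq: "of_bool (pos k l = p) = (of_bool (k = i) * of_bool (l = i) :: complex)" for k l
      using ij True by (auto simp: pos_def min_def max_def)
    have "(\<Sum>k<n. \<Sum>l<n. X r k * of_bool (pos k l = p) * Y l c)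
        = (\<Sum>k<n. of_bool (k = i) * (X r k * (\<Sum>l<n. of_bool (l = i) * Y l c)))"
      unfolding eq sum_distrib_left by (intro sum.cong refl) (simp only: mult_ac)
    then show ?thesis using True ij by (simp only: sum_of_bool_mult) (simp add: sandwich_def)
  next
    case False
    have eq: "of_bool (pos k l = p) = (of_bool (k = i) * of_bool (l = j) + of_bool (k = j) * of_bool (l = i) :: complex)" for k l
      using ij False by (auto simp: pos_def min_def max_def)
    have "(\<Sum>k<n. \<Sum>l<n. X r k * of_bool (pos k l = p) * Y l c)
        = (\<Sum>k<n. of_bool (k = i) * (X r k * (\<Sum>l<n. of_bool (l = j) * Y l c)))
        + (\<Sum>k<n. of_bool (k = j) * (X r k * (\<Sum>l<n. of_bool (l = i) * Y l c)))"
      unfolding eq sum_distrib_left sum.distrib[symmetric]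
      by (intro sum.cong refl) (simp only: distrib_left distrib_right mult_ac)
    then show ?thesis using False ij by (simp only: sum_of_bool_mult) (simp add: sandwich_def)
  qed
qed

text \<open>
  The resolvent identity for a change of one entry. It is exact, because \<open>B\<close> depends linearly on the entry.
\<close>
lemma resolvent_perturbed_upd:
  fixes t :: real and w :: "nat \<times> nat \<Rightarrow> real"
  assumes a: "real_symmetric n a" and z: "Im z \<noteq> 0" and p: "p \<in> upper n" and rc: "r < n" "c < n"
  defines "G \<equiv> \<lambda>y. resolvent (perturbed n a t (w(p := y))) z"
  shows "G y r c - G y' r c = of_real (- t * (y - y')) * sandwich p (G y') (G y) r c"
proof -
  let ?B = "\<lambda>y. perturbed n a t (w(p := y))"
  note s = perturbed_symmetric[OF a]
  have "G y r c - G y' r c = (\<Sum>k<n. \<Sum>l<n. G y' r k * (of_real (?B y' $$ (k, l) - ?B y $$ (k, l)) + (z - z) * of_bool (k = l)) * G y l c)"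
    unfolding G_def by (rule resolvent_identity[OF s s z z rc])
  also have "\<dots> = (\<Sum>k<n. \<Sum>l<n. of_real (- t * (y - y')) * (G y' r k * of_bool (pos k l = p) * G y l c))"
    by (intro sum.cong refl) (auto simp: perturbed_def algebra_simps)
  also have "\<dots> = of_real (- t * (y - y')) * sandwich p (G y') (G y) r c"
    unfolding sum_pos_indicator[OF p, symmetric] by (simp only: sum_distrib_left)
  finally show ?thesis .
qed

text \<open>
  One constant \<open>\<kappa>\<close> bounds the second and the fourth moments. Unit variance is required off the diagonal
  only, so that Wigner arrays and the Gaussian orthogonal ensemble are both covered.
\<close>
locale wigner_entries = independent_reals "upper n" \<nu> for n \<nu> +
  fixes \<kappa> :: real
  assumes \<kappa>: "1 \<le> \<kappa>" and n_pos: "0 < n"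
    and fourth: "\<And>p. p \<in> upper n \<Longrightarrow> integrable (\<nu> p) (\<lambda>y. y ^ 4)"
    and fourth_le: "\<And>p. p \<in> upper n \<Longrightarrow> (\<integral>y. y ^ 4 \<partial>\<nu> p) \<le> \<kappa>"
    and mean: "\<And>p. p \<in> upper n \<Longrightarrow> (\<integral>y. y \<partial>\<nu> p) = 0"
    and second_le: "\<And>p. p \<in> upper n \<Longrightarrow> (\<integral>y. y\<^sup>2 \<partial>\<nu> p) \<le> \<kappa>"
    and second: "\<And>p. p \<in> upper n \<Longrightarrow> fst p \<noteq> snd p \<Longrightarrow> (\<integral>y. y\<^sup>2 \<partial>\<nu> p) = 1"
begin

abbreviation "P \<equiv> PiM (upper n) \<nu>"

lemma borel_measurable_nu: "f \<in> borel_measurable borel \<Longrightarrow> f \<in> borel_measurable (\<nu> p)"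
  by (simp add: measurable_cong_sets[OF sets_borel refl])

lemma integrable_powers:
  assumes p: "p \<in> upper n"
  shows "integrable (\<nu> p) (\<lambda>y. y)" "integrable (\<nu> p) (\<lambda>y. y\<^sup>2)" "integrable (\<nu> p) (\<lambda>y. \<bar>y\<bar>)"
    "integrable (\<nu> p) (\<lambda>y. \<bar>y\<bar> ^ 3)"
    "(\<integral>y. \<bar>y\<bar> \<partial>\<nu> p) \<le> 2 * \<kappa>" "(\<integral>y. \<bar>y\<bar> ^ 3 \<partial>\<nu> p) \<le> 2 * \<kappa>"
proof -
  interpret p: prob_space "\<nu> p" by simp
  have i: "integrable (\<nu> p) (\<lambda>y. 1 + y ^ 4)" using fourth[OF p] by simp
  have y2: "2 * y\<^sup>2 \<le> 1 + y ^ 4" for y :: real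
  proof -
    have "1 + y ^ 4 - 2 * y\<^sup>2 = (y\<^sup>2 - 1)\<^sup>2" by (simp add: power2_eq_square algebra_simps numeral_eq_Suc)
    then show ?thesis by (metis diff_ge_0_iff_ge zero_le_power2)
  qed
  have y1: "2 * \<bar>y\<bar> \<le> 1 + y\<^sup>2" for y :: real
    using zero_le_power2[of "\<bar>y\<bar> - 1"] by (simp add: power2_diff)
  have y3: "2 * \<bar>y\<bar> ^ 3 \<le> y\<^sup>2 + y ^ 4" for y :: real
  proof -
    have "x\<^sup>2 + x ^ 4 - 2 * x ^ 3 = (x * (x - 1))\<^sup>2" for x :: real
      by (simp add: power2_eq_square algebra_simps numeral_eq_Suc)
    then have "2 * x ^ 3 \<le> x\<^sup>2 + x ^ 4" for x :: real by (metis diff_ge_0_iff_ge zero_le_power2)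
    from this[of "\<bar>y\<bar>"] show ?thesis by simp
  qed
  have b1: "\<bar>y\<bar> \<le> 1 + y ^ 4" "\<bar>y\<bar> ^ 3 \<le> 1 + y ^ 4" "y\<^sup>2 \<le> 1 + y ^ 4" for y :: real
  proof -
    have "0 \<le> y ^ 4" by simp
    then show "\<bar>y\<bar> \<le> 1 + y ^ 4" "\<bar>y\<bar> ^ 3 \<le> 1 + y ^ 4" "y\<^sup>2 \<le> 1 + y ^ 4"
      using y1[of y] y2[of y] y3[of y] by linarith+
  qed
  show "integrable (\<nu> p) (\<lambda>y. y)"
    by (rule Bochner_Integration.integrable_bound[OF i])
      (use b1 in \<open>auto intro!: borel_measurable_nu AE_I2 order_trans[OF _ abs_ge_self]\<close>)
  show "integrable (\<nu> p) (\<lambda>y. y\<^sup>2)"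
    by (rule Bochner_Integration.integrable_bound[OF i])
      (use b1 in \<open>auto intro!: borel_measurable_nu AE_I2 order_trans[OF _ abs_ge_self]\<close>)
  show "integrable (\<nu> p) (\<lambda>y. \<bar>y\<bar>)"
    by (rule Bochner_Integration.integrable_bound[OF i])
      (use b1 in \<open>auto intro!: borel_measurable_nu AE_I2 order_trans[OF _ abs_ge_self]\<close>)
  show "integrable (\<nu> p) (\<lambda>y. \<bar>y\<bar> ^ 3)"
    by (rule Bochner_Integration.integrable_bound[OF i])
      (use b1 in \<open>auto intro!: borel_measurable_nu AE_I2 order_trans[OF _ abs_ge_self]\<close>)
  have "(\<integral>y. \<bar>y\<bar> \<partial>\<nu> p) \<le> (\<integral>y. 1 + y\<^sup>2 \<partial>\<nu> p)"
  proof (rule integral_mono)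
    show "\<bar>y\<bar> \<le> 1 + y\<^sup>2" for y :: real using y1[of y] abs_ge_zero[of y] by linarith
  qed (use \<open>integrable (\<nu> p) (\<lambda>y. y\<^sup>2)\<close> \<open>integrable (\<nu> p) (\<lambda>y. \<bar>y\<bar>)\<close> in auto)
  also have "\<dots> \<le> 2 * \<kappa>"
    using second_le[OF p] \<kappa> \<open>integrable (\<nu> p) (\<lambda>y. y\<^sup>2)\<close> by simp
  finally show "(\<integral>y. \<bar>y\<bar> \<partial>\<nu> p) \<le> 2 * \<kappa>" .
  have "(\<integral>y. \<bar>y\<bar> ^ 3 \<partial>\<nu> p) \<le> (\<integral>y. y\<^sup>2 + y ^ 4 \<partial>\<nu> p)"
  proof (rule integral_mono)
    show "\<bar>y\<bar> ^ 3 \<le> y\<^sup>2 + y ^ 4" for y :: real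
      using y3[of y] zero_le_power[of "\<bar>y\<bar>" 3] by linarith
  qed (use \<open>integrable (\<nu> p) (\<lambda>y. y\<^sup>2)\<close> \<open>integrable (\<nu> p) (\<lambda>y. \<bar>y\<bar> ^ 3)\<close> fourth[OF p] in auto)
  also have "\<dots> \<le> 2 * \<kappa>"
    using second_le[OF p] fourth_le[OF p] fourth[OF p] \<open>integrable (\<nu> p) (\<lambda>y. y\<^sup>2)\<close> by simp
  finally show "(\<integral>y. \<bar>y\<bar> ^ 3 \<partial>\<nu> p) \<le> 2 * \<kappa>" .
qed

end

section \<open>Variance of the Stieltjes transform\<close>

lemma norm_mprod_resolvent_le:
  assumes "real_symmetric n A" "real_symmetric n B" "0 < e" "e \<le> Im z" "e \<le> Im z'" "i < n" "j < n"
  shows "cmod (mprod n (resolvent A z) (resolvent B z') i j) \<le> (1 / e)\<^sup>2"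
proof -
  have "(\<Sum>r<n. (cmod (resolvent B z' r j))\<^sup>2) \<le> (1 / e)\<^sup>2"
    using resolvent_row_norm[OF assms(2,3,5,7)] by (simp add: resolvent_symmetric[of B z' _ j])
  then have "cmod (\<Sum>r<n. resolvent A z i r * resolvent B z' r j) \<le> (1 / e) * (1 / e)"
    using resolvent_row_norm[OF assms(1,3,4,6)] assms(3) by (intro norm_sum_mult_le) auto
  then show ?thesis by (simp add: mprod_def power2_eq_square)
qed

lemma mprod_resolvent_row_norm:
  assumes "real_symmetric n A" "real_symmetric n B" "0 < e" "e \<le> Im z" "e \<le> Im z'" "i < n"
  shows "(\<Sum>j<n. (cmod (mprod n (resolvent A z) (resolvent B z') i j))\<^sup>2) \<le> ((1 / e)\<^sup>2)\<^sup>2"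
proof -
  have "(\<Sum>j<n. (cmod (mprod n (resolvent A z) (resolvent B z') i j))\<^sup>2)
      = (\<Sum>j<n. (cmod (\<Sum>r<n. resolvent B z' j r * resolvent A z i r))\<^sup>2)"
    by (simp add: mprod_def resolvent_symmetric[of B z' _ _] mult.commute)
  also have "\<dots> \<le> (1 / e)\<^sup>2 * (\<Sum>r<n. (cmod (resolvent A z i r))\<^sup>2)"
    by (rule resolvent_operator_norm) (use assms in auto)
  also have "\<dots> \<le> (1 / e)\<^sup>2 * (1 / e)\<^sup>2"
    by (intro mult_left_mono resolvent_row_norm) (use assms in auto)
  finally show ?thesis by (simp add: power2_eq_square)
qed

lemma mprod_cong:
  assumes "\<And>r. r < n \<Longrightarrow> X i r = X' i r" "\<And>r. r < n \<Longrightarrow> Y r j = Y' r j"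
  shows "mprod n X Y i j = mprod n X' Y' i j"
  unfolding mprod_def using assms by (intro sum.cong) auto

lemma mprod_diff:
  "mprod n X Y i j - mprod n X' Y' i j = mprod n (\<lambda>i j. X i j - X' i j) Y i j + mprod n X' (\<lambda>i j. Y i j - Y' i j) i j"
  by (simp add: mprod_def sum.distrib[symmetric] sum_subtractf[symmetric] algebra_simps)

lemma sandwich_trace:
  "(\<Sum>r<n. sandwich (i, j) X Y r r) = (if i = j then mprod n Y X i i else mprod n Y X j i + mprod n Y X i j)"
  by (auto simp: sandwich_def mprod_def sum.distrib mult.commute)

lemma power2_sum_le: "(u + v)\<^sup>2 \<le> 2 * u\<^sup>2 + 2 * (v::real)\<^sup>2"
  using zero_le_power2[of "u - v"] by (simp add: power2_sum power2_diff)

text \<open>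
  The number \<open>g\<close> bounds the resolvent: \<open>1 / g\<close> is a lower bound for the imaginary part of
  \<open>z\<close>.
\<close>
locale deformed_wigner = wigner_entries +
  fixes a :: "real mat" and t :: real and z :: complex and g :: real
  assumes a: "real_symmetric n a" and g: "0 < g" "1 / g \<le> Im z"
begin

definition B :: "(nat \<times> nat \<Rightarrow> real) \<Rightarrow> real mat" where "B w = perturbed n a t w"
definition G :: "(nat \<times> nat \<Rightarrow> real) \<Rightarrow> nat \<Rightarrow> nat \<Rightarrow> complex" where "G w = resolvent (B w) z"
definition s :: "(nat \<times> nat \<Rightarrow> real) \<Rightarrow> complex" where "s w = stieltjes n (eig_desc (B w)) z"

lemma e_pos: "0 < 1 / g" and Im_z: "Im z \<noteq> 0" using g by (auto simp: field_simps)
  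
lemma sym: "real_symmetric n (B w)" unfolding B_def by (rule perturbed_symmetric[OF a])

lemma measurable_component: "p \<in> upper n \<Longrightarrow> (\<lambda>w. w p) \<in> borel_measurable P"
  using measurable_component_singleton[of p "upper n" \<nu>] by (simp add: measurable_cong_sets[OF refl sets_borel])

lemma measurable_entry: "i < n \<Longrightarrow> j < n \<Longrightarrow> (\<lambda>w. B w $$ (i, j)) \<in> borel_measurable P"
  unfolding B_def perturbed_def using measurable_component[of "pos i j"] by simp

lemma measurable_G: "i < n \<Longrightarrow> j < n \<Longrightarrow> (\<lambda>w. G w i j) \<in> borel_measurable P"
  unfolding G_def by (rule borel_measurable_resolvent[OF measurable_entry]) (auto simp: sym Im_z)

lemma measurable_GG: "i < n \<Longrightarrow> j < n \<Longrightarrow> (\<lambda>w. mprod n (G w) (G w) i j) \<in> borel_measurable P"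
  unfolding mprod_def by (intro borel_measurable_sum borel_measurable_times measurable_G) auto

lemma measurable_s [measurable]: "s \<in> borel_measurable P"
  unfolding s_def[abs_def] by (rule borel_measurable_stieltjes[OF measurable_entry]) (auto simp: sym Im_z)

lemma norm_s: "cmod (s w) \<le> g"
  unfolding s_def using norm_stieltjes_le[OF e_pos g(2)] by simp

lemma norm_G: "i < n \<Longrightarrow> j < n \<Longrightarrow> cmod (G w i j) \<le> g"
  unfolding G_def using resolvent_norm_le[OF sym e_pos g(2)] by simp

lemma norm_GG: "i < n \<Longrightarrow> j < n \<Longrightarrow> cmod (mprod n (G w) (G w') i j) \<le> g\<^sup>2"
  unfolding G_def using norm_mprod_resolvent_le[OF sym sym e_pos g(2) g(2)] by simp

lemma G_upd:
  assumes "p \<in> upper n" "r < n" "c < n"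
  shows "G (w(p := y)) r c - G (w(p := y')) r c
       = of_real (- t * (y - y')) * sandwich p (G (w(p := y'))) (G (w(p := y))) r c"
  unfolding G_def B_def by (rule resolvent_perturbed_upd[OF a Im_z assms])

lemma s_upd:
  assumes p: "p \<in> upper n"
  shows "s (w(p := y)) - s (w(p := y'))
       = of_real (- t * (y - y')) / of_nat n * (\<Sum>r<n. sandwich p (G (w(p := y'))) (G (w(p := y))) r r)"
proof -
  have "of_nat n * (s (w(p := y)) - s (w(p := y'))) = (\<Sum>r<n. G (w(p := y)) r r - G (w(p := y')) r r)"
    unfolding s_def right_diff_distrib resolvent_trace[OF sym, symmetric] G_def sum_subtractf ..
  also have "\<dots> = of_real (- t * (y - y')) * (\<Sum>r<n. sandwich p (G (w(p := y'))) (G (w(p := y))) r r)"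
    unfolding sum_distrib_left by (intro sum.cong refl G_upd[OF p]) auto
  finally show ?thesis using n_pos by (simp add: field_simps)
qed

text \<open>
  The fluctuation of the trace in one entry involves resolvents at two different values of this entry. The bound replaces
  both by the resolvent at the actual value, at the price of a term with a further factor \<open>t\<close>.
\<close>
lemma GG_upd_le:
  assumes p: "p \<in> upper n" and ij: "i < n" "j < n"
  shows "cmod (mprod n (G (w(p := y))) (G (w(p := 0))) i j)
       \<le> cmod (mprod n (G w) (G w) i j) + 2 * \<bar>t\<bar> * (\<bar>y\<bar> + 2 * \<bar>w p\<bar>) * g ^ 3"
proof -
  have w: "w = w(p := w p)" by simp
  have 1: "cmod (mprod n (\<lambda>i j. G (w(p := y)) i j - G w i j) (G (w(p := 0))) i j) \<le> \<bar>t\<bar> * \<bar>y - w p\<bar> * (2 * (g * g\<^sup>2))"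
  proof -
    have "mprod n (\<lambda>i j. G (w(p := y)) i j - G w i j) (G (w(p := 0))) i j
       = mprod n (\<lambda>r c. of_real (- t * (y - w p)) * sandwich p (G w) (G (w(p := y))) r c) (G (w(p := 0))) i j"
      using G_upd[OF p, of _ _ w y "w p"] ij by (intro mprod_cong) auto
    also have "\<dots> = of_real (- t * (y - w p)) * sandwich p (G w) (mprod n (G (w(p := y))) (G (w(p := 0)))) i j"
      unfolding sandwich_mprod ..
    also have "cmod \<dots> \<le> \<bar>- t * (y - w p)\<bar> * (2 * (g * g\<^sup>2))"
      unfolding norm_mult norm_of_real
      by (intro mult_left_mono norm_sandwich_le[OF p norm_G norm_GG ij]) auto
    finally show ?thesis by (simp add: abs_mult)
  qed
  have 2: "cmod (mprod n (G w) (\<lambda>i j. G (w(p := 0)) i j - G w i j) i j) \<le> \<bar>t\<bar> * \<bar>w p\<bar> * (2 * (g\<^sup>2 * g))"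
  proof -
    have "mprod n (G w) (\<lambda>i j. G (w(p := 0)) i j - G w i j) i j
       = mprod n (G w) (\<lambda>r c. of_real (- t * (0 - w p)) * sandwich p (G w) (G (w(p := 0))) r c) i j"
      using G_upd[OF p, of _ _ w 0 "w p"] ij by (intro mprod_cong) auto
    also have "\<dots> = of_real (- t * (0 - w p)) * sandwich p (mprod n (G w) (G w)) (G (w(p := 0))) i j"
      unfolding sandwich_mprod ..
    also have "cmod \<dots> \<le> \<bar>- t * (0 - w p)\<bar> * (2 * (g\<^sup>2 * g))"
      unfolding norm_mult norm_of_real
      by (intro mult_left_mono norm_sandwich_le[OF p norm_GG norm_G ij]) auto
    finally show ?thesis by (simp add: abs_mult)
  qed
  have "\<bar>t\<bar> * \<bar>y - w p\<bar> * (2 * (g * g\<^sup>2)) \<le> \<bar>t\<bar> * (\<bar>y\<bar> + \<bar>w p\<bar>) * (2 * (g * g\<^sup>2))"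
    using g by (intro mult_right_mono mult_left_mono) auto
  then have "cmod (mprod n (G (w(p := y))) (G (w(p := 0))) i j - mprod n (G w) (G w) i j)
     \<le> \<bar>t\<bar> * (\<bar>y\<bar> + \<bar>w p\<bar>) * (2 * (g * g\<^sup>2)) + \<bar>t\<bar> * \<bar>w p\<bar> * (2 * (g\<^sup>2 * g))"
    unfolding mprod_diff using 1 2 by (intro norm_triangle_le) linarith
  also have "\<dots> = 2 * \<bar>t\<bar> * (\<bar>y\<bar> + 2 * \<bar>w p\<bar>) * g ^ 3"
    by (simp add: power2_eq_square power3_eq_cube algebra_simps)
  finally show ?thesis using norm_triangle_sub[of "mprod n (G (w(p := y))) (G (w(p := 0))) i j" "mprod n (G w) (G w) i j"]
    by linarith
qed

lemma s_fluctuation: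
  fixes w :: "nat \<times> nat \<Rightarrow> real"
  assumes p: "p \<in> upper n"
  defines "q \<equiv> cmod (mprod n (G w) (G w) (fst p) (snd p))"
  shows "(cmod (s (w(p := y)) - s (w(p := 0))))\<^sup>2
      \<le> t\<^sup>2 / (real n)\<^sup>2 * (y\<^sup>2 * (8 * q\<^sup>2 + 64 * t\<^sup>2 * g ^ 6 * (y\<^sup>2 + 4 * (w p)\<^sup>2)))"
proof -
  obtain i j where ij: "p = (i, j)" "i < n" "j < n" using p by (auto simp: upper_def)
  define d where "d = 2 * \<bar>t\<bar> * (\<bar>y\<bar> + 2 * \<bar>w p\<bar>) * g ^ 3"
  have d0: "0 \<le> d" using g by (simp add: d_def)
  have qji: "cmod (mprod n (G w) (G w) j i) = q"
    by (simp add: q_def ij(1) mprod_def G_def resolvent_symmetric[of _ _ j] resolvent_symmetric[of _ _ _ i] mult.commute)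
  define K where "K = (\<Sum>r<n. sandwich p (G (w(p := 0))) (G (w(p := y))) r r)"
  have "cmod K \<le> 2 * (q + d)"
  proof (cases "i = j")
    case True
    have "cmod K \<le> q + d"
      using GG_upd_le[OF p ij(2,2), of w y] qji True unfolding K_def ij(1) sandwich_trace d_def by (simp add: ij(1))
    moreover have "0 \<le> q" by (simp add: q_def)
    ultimately show ?thesis using d0 by simp
  next
    case False
    have "cmod (mprod n (G (w(p := y))) (G (w(p := 0))) j i) \<le> q + d"
      "cmod (mprod n (G (w(p := y))) (G (w(p := 0))) i j) \<le> q + d"
      using GG_upd_le[OF p ij(2,3), of w y] GG_upd_le[OF p ij(3,2), of w y] qji
      unfolding d_def q_def by (simp_all add: ij(1))
    then show ?thesis
      using False norm_triangle_ineq[of "mprod n (G (w(p := y))) (G (w(p := 0))) j i" "mprod n (G (w(p := y))) (G (w(p := 0))) i j"]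
      unfolding K_def unfolding ij(1) sandwich_trace by simp
  qed
  then have "(cmod K)\<^sup>2 \<le> (2 * (q + d))\<^sup>2" by (intro power_mono) auto
  also have "\<dots> \<le> 4 * (2 * q\<^sup>2 + 2 * d\<^sup>2)"
    unfolding power_mult_distrib using power2_sum_le[of q d] by simp
  also have "d\<^sup>2 = 4 * t\<^sup>2 * g ^ 6 * (\<bar>y\<bar> + 2 * \<bar>w p\<bar>)\<^sup>2"
    by (simp add: d_def power_mult_distrib flip: power_mult)
  also have "4 * (2 * q\<^sup>2 + 2 * (4 * t\<^sup>2 * g ^ 6 * (\<bar>y\<bar> + 2 * \<bar>w p\<bar>)\<^sup>2))
      \<le> 4 * (2 * q\<^sup>2 + 2 * (4 * t\<^sup>2 * g ^ 6 * (2 * y\<^sup>2 + 8 * (w p)\<^sup>2)))"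
    using power2_sum_le[of "\<bar>y\<bar>" "2 * \<bar>w p\<bar>"] g
    by (intro mult_left_mono add_left_mono) (auto simp: power_mult_distrib)
  finally have K: "(cmod K)\<^sup>2 \<le> 8 * q\<^sup>2 + 64 * t\<^sup>2 * g ^ 6 * (y\<^sup>2 + 4 * (w p)\<^sup>2)"
    by (simp add: algebra_simps)
  have "cmod (s (w(p := y)) - s (w(p := 0))) = \<bar>t\<bar> * \<bar>y\<bar> / real n * cmod K"
    unfolding s_upd[OF p] K_def[symmetric] norm_mult norm_divide norm_of_real by (simp add: abs_mult)
  then have "(cmod (s (w(p := y)) - s (w(p := 0))))\<^sup>2 = t\<^sup>2 / (real n)\<^sup>2 * (y\<^sup>2 * (cmod K)\<^sup>2)"
    by (simp add: power_mult_distrib power_divide)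
  also have "\<dots> \<le> t\<^sup>2 / (real n)\<^sup>2 * (y\<^sup>2 * (8 * q\<^sup>2 + 64 * t\<^sup>2 * g ^ 6 * (y\<^sup>2 + 4 * (w p)\<^sup>2)))"
    by (intro mult_left_mono K) auto
  finally show ?thesis .
qed

definition m :: complex where "m = (\<integral>w. s w \<partial>P)"

lemma integrable_s: "integrable P s" using norm_s by (intro integrable_bounded) auto

text \<open>
  In the square of the fluctuation the replaced entry \<open>y\<close> and the entry \<open>w p\<close> are independent. This
  separates their moments, and no moment beyond the fourth occurs.
\<close>
lemma resampled_increment:
  assumes p: "p \<in> upper n"
  shows "(\<integral>w. (cmod (s w - s (w(p := 0))))\<^sup>2 \<partial>P)
       \<le> t\<^sup>2 / (real n)\<^sup>2 * (8 * \<kappa> * (\<integral>w. (cmod (mprod n (G w) (G w) (fst p) (snd p)))\<^sup>2 \<partial>P) + 320 * t\<^sup>2 * g ^ 6 * \<kappa>\<^sup>2)"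
proof -
  define q where "q w = cmod (mprod n (G w) (G w) (fst p) (snd p))" for w
  have pn: "fst p < n" "snd p < n" using p by (auto simp: upper_def)
  have qm [measurable]: "q \<in> borel_measurable P"
    unfolding q_def[abs_def] using measurable_GG[OF pn] by measurable
  have qb: "\<bar>(q w)\<^sup>2\<bar> \<le> (g\<^sup>2)\<^sup>2" for w 
    unfolding q_def abs_of_nonneg[OF zero_le_power2] by (intro power_mono norm_GG pn) auto
  have iq: "integrable P (\<lambda>w. (q w)\<^sup>2)" using qb by (intro integrable_bounded[of _ "(g\<^sup>2)\<^sup>2"]) auto
  have sm: "(\<lambda>w. s (w(p := 0))) \<in> borel_measurable P"
    by (rule measurable_compose[OF measurable_upd[OF p] measurable_s])
  have db: "cmod (s u - s v) \<le> 2 * g" for u v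
    using norm_triangle_ineq4[of "s u" "s v"] norm_s[of u] norm_s[of v] by linarith
  have fi: "integrable P (\<lambda>w. (cmod (s w - s (w(p := 0))))\<^sup>2)"
  proof (rule integrable_bounded)
    show "(\<lambda>w. (cmod (s w - s (w(p := 0))))\<^sup>2) \<in> borel_measurable P" using sm by measurable
    show "norm ((cmod (s w - s (w(p := 0))))\<^sup>2) \<le> (2 * g)\<^sup>2" for w
      unfolding real_norm_def abs_of_nonneg[OF zero_le_power2] by (intro power_mono db) auto
  qed
  define b where "b w y = t\<^sup>2 / (real n)\<^sup>2 * (8 * (q w)\<^sup>2 * y\<^sup>2 + 64 * t\<^sup>2 * g ^ 6 * y ^ 4 + 256 * t\<^sup>2 * g ^ 6 * (w p)\<^sup>2 * y\<^sup>2)" for w y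
  note ip = integrable_powers[OF p] fourth[OF p]
  have hm: "(\<lambda>y :: real. y\<^sup>2) \<in> borel_measurable borel" by simp
  have sq: "integrable P (\<lambda>w. (w p)\<^sup>2)" by (rule integrable_component(1)[OF p hm, THEN iffD2]) (rule ip)
  note sq_int = integrable_component(2)[OF p hm]
  have "(\<integral>w. (cmod (s w - s (w(p := 0))))\<^sup>2 \<partial>P) = (\<integral>w. (\<integral>y. (cmod (s (w(p := y)) - s (w(p := 0))))\<^sup>2 \<partial>\<nu> p) \<partial>P)"
    using integral_resample(1)[OF p fi] by simp
  also have "\<dots> \<le> (\<integral>w. t\<^sup>2 / (real n)\<^sup>2 * (8 * (q w)\<^sup>2 * \<kappa> + 64 * t\<^sup>2 * g ^ 6 * \<kappa> + 256 * t\<^sup>2 * g ^ 6 * (w p)\<^sup>2 * \<kappa>) \<partial>P)"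
  proof (rule integral_mono)
    show "integrable P (\<lambda>w. \<integral>y. (cmod (s (w(p := y)) - s (w(p := 0))))\<^sup>2 \<partial>\<nu> p)"
      using integral_resample(2)[OF p fi] by simp
    show "integrable P (\<lambda>w. t\<^sup>2 / (real n)\<^sup>2 * (8 * (q w)\<^sup>2 * \<kappa> + 64 * t\<^sup>2 * g ^ 6 * \<kappa> + 256 * t\<^sup>2 * g ^ 6 * (w p)\<^sup>2 * \<kappa>))"
      using iq sq by (intro integrable_mult_right Bochner_Integration.integrable_add integrable_mult_left) auto
    fix w assume w: "w \<in> space P"
    have "(\<integral>y. (cmod (s (w(p := y)) - s (w(p := 0))))\<^sup>2 \<partial>\<nu> p) \<le> (\<integral>y. b w y \<partial>\<nu> p)"
    proof (rule integral_mono)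
      show "integrable (\<nu> p) (\<lambda>y. (cmod (s (w(p := y)) - s (w(p := 0))))\<^sup>2)"
      proof (rule finite_measure.integrable_const_bound[where B = "(2 * g)\<^sup>2"])
        show "finite_measure (\<nu> p)" using prob prob_space.finite_measure by blast
        show "AE y in \<nu> p. norm ((cmod (s (w(p := y)) - s (w(p := 0))))\<^sup>2) \<le> (2 * g)\<^sup>2"
          unfolding real_norm_def abs_of_nonneg[OF zero_le_power2] by (intro AE_I2 power_mono db) auto
        show "(\<lambda>y. (cmod (s (w(p := y)) - s (w(p := 0))))\<^sup>2) \<in> borel_measurable (\<nu> p)"
          using measurable_compose[OF measurable_upd_const[OF p w] measurable_s] by simp
      qed
      show "integrable (\<nu> p) (b w)" unfolding b_def using ip
        by (intro integrable_mult_right Bochner_Integration.integrable_add integrable_mult_left) auto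
      show "(cmod (s (w(p := y)) - s (w(p := 0))))\<^sup>2 \<le> b w y" for y
      proof -
        have "y ^ 4 = y\<^sup>2 * y\<^sup>2" by (simp flip: power_add)
        then have "b w y = t\<^sup>2 / (real n)\<^sup>2 * (y\<^sup>2 * (8 * (q w)\<^sup>2 + 64 * t\<^sup>2 * g ^ 6 * (y\<^sup>2 + 4 * (w p)\<^sup>2)))"
          unfolding b_def by (simp only:) (simp add: algebra_simps)
        then show ?thesis using s_fluctuation[OF p, of w y] unfolding q_def by simp
      qed
    qed
    also have "\<dots> = t\<^sup>2 / (real n)\<^sup>2 * (8 * (q w)\<^sup>2 * (\<integral>y. y\<^sup>2 \<partial>\<nu> p) + 64 * t\<^sup>2 * g ^ 6 * (\<integral>y. y ^ 4 \<partial>\<nu> p)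
        + 256 * t\<^sup>2 * g ^ 6 * (w p)\<^sup>2 * (\<integral>y. y\<^sup>2 \<partial>\<nu> p))"
      unfolding b_def using ip by simp
    also have "\<dots> \<le> t\<^sup>2 / (real n)\<^sup>2 * (8 * (q w)\<^sup>2 * \<kappa> + 64 * t\<^sup>2 * g ^ 6 * \<kappa> + 256 * t\<^sup>2 * g ^ 6 * (w p)\<^sup>2 * \<kappa>)"
      using second_le[OF p] fourth_le[OF p] g by (intro mult_left_mono add_mono) auto
    finally show "(\<integral>y. (cmod (s (w(p := y)) - s (w(p := 0))))\<^sup>2 \<partial>\<nu> p)
       \<le> t\<^sup>2 / (real n)\<^sup>2 * (8 * (q w)\<^sup>2 * \<kappa> + 64 * t\<^sup>2 * g ^ 6 * \<kappa> + 256 * t\<^sup>2 * g ^ 6 * (w p)\<^sup>2 * \<kappa>)" .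
  qed
  also have "\<dots> = t\<^sup>2 / (real n)\<^sup>2 * (8 * (\<integral>w. (q w)\<^sup>2 \<partial>P) * \<kappa> + 64 * t\<^sup>2 * g ^ 6 * \<kappa>
      + 256 * t\<^sup>2 * g ^ 6 * (\<integral>y. y\<^sup>2 \<partial>\<nu> p) * \<kappa>)"
    using iq sq by (simp add: P.prob_space sq_int)
  also have "\<dots> \<le> t\<^sup>2 / (real n)\<^sup>2 * (8 * (\<integral>w. (q w)\<^sup>2 \<partial>P) * \<kappa> + 64 * t\<^sup>2 * g ^ 6 * \<kappa>\<^sup>2 + 256 * t\<^sup>2 * g ^ 6 * \<kappa> * \<kappa>)"
    using second_le[OF p] \<kappa> g self_le_power[of \<kappa> 2]
    by (intro mult_left_mono add_mono mult_right_mono) auto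
  also have "\<dots> = t\<^sup>2 / (real n)\<^sup>2 * (8 * \<kappa> * (\<integral>w. (q w)\<^sup>2 \<partial>P) + 320 * t\<^sup>2 * g ^ 6 * \<kappa>\<^sup>2)"
    by (simp add: power2_eq_square algebra_simps)
  finally show ?thesis unfolding q_def .
qed

text \<open>
  A row of the square of the resolvent has norm at most \<open>g\<^sup>2\<close>. Summation over all entries thus gains a
  factor \<open>n\<close> over the entrywise bound, which is what makes the variance of order \<open>1 / n\<^sup>2\<close>.
\<close>
lemma sum_GG_le: "(\<Sum>p\<in>upper n. (cmod (mprod n (G w) (G w) (fst p) (snd p)))\<^sup>2) \<le> n * g ^ 4"
proof -
  have "(\<Sum>p\<in>upper n. (cmod (mprod n (G w) (G w) (fst p) (snd p)))\<^sup>2)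
     \<le> (\<Sum>p\<in>{..<n} \<times> {..<n}. (cmod (mprod n (G w) (G w) (fst p) (snd p)))\<^sup>2)"
    by (intro sum_mono2 upper_subset) auto
  also have "\<dots> = (\<Sum>i<n. \<Sum>j<n. (cmod (mprod n (G w) (G w) i j))\<^sup>2)"
    by (simp add: sum.cartesian_product split_beta)
  also have "\<dots> \<le> (\<Sum>i<n. g ^ 4)"
    using mprod_resolvent_row_norm[OF sym sym e_pos g(2) g(2)]
    by (intro sum_mono) (simp add: G_def flip: power_mult)
  finally show ?thesis by simp
qed

text \<open>
  The Efron--Stein inequality for the real and the imaginary part. The order \<open>1 / n\<^sup>2\<close> is summable, so
  that almost sure convergence will follow from the Borel--Cantelli lemma.
\<close>
theorem variance_stieltjes_le:
  assumes T: "t\<^sup>2 * n = T"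
  shows "(\<integral>w. (cmod (s w - m))\<^sup>2 \<partial>P) \<le> T * (8 * \<kappa> * g ^ 4 + 320 * \<kappa>\<^sup>2 * T * g ^ 6) / (real n)\<^sup>2"
proof -
  have [measurable]: "(\<lambda>w. s (w(p := 0))) \<in> borel_measurable P" if "p \<in> upper n" for p
    by (rule measurable_compose[OF measurable_upd[OF that] measurable_s])
  have reim: "\<bar>Re (s w)\<bar> \<le> g" "\<bar>Im (s w)\<bar> \<le> g" for w
    using norm_s[of w] abs_Re_le_cmod[of "s w"] abs_Im_le_cmod[of "s w"] by linarith+
  have var: "(\<integral>w. (cmod (s w - m))\<^sup>2 \<partial>P)
     = ((\<integral>w. (Re (s w))\<^sup>2 \<partial>P) - (\<integral>w. Re (s w) \<partial>P)\<^sup>2) + ((\<integral>w. (Im (s w))\<^sup>2 \<partial>P) - (\<integral>w. Im (s w) \<partial>P)\<^sup>2)"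
  proof -
    have i: "integrable P (\<lambda>w. Re (s w))" "integrable P (\<lambda>w. Im (s w))"
      "integrable P (\<lambda>w. (Re (s w))\<^sup>2)" "integrable P (\<lambda>w. (Im (s w))\<^sup>2)"
      using reim power_mono[OF reim(1) abs_ge_zero, where n = 2] power_mono[OF reim(2) abs_ge_zero, where n = 2]
      by (simp_all add: integrable_bounded[of _ g] integrable_bounded[of _ "g\<^sup>2"] del: integrable_Re integrable_Im)
    have mm: "Re m = (\<integral>w. Re (s w) \<partial>P)" "Im m = (\<integral>w. Im (s w) \<partial>P)"
      unfolding m_def using integrable_s by simp_all
    have "(\<integral>w. (cmod (s w - m))\<^sup>2 \<partial>P)
        = (\<integral>w. ((Re (s w))\<^sup>2 - 2 * Re m * Re (s w) + (Re m)\<^sup>2) + ((Im (s w))\<^sup>2 - 2 * Im m * Im (s w) + (Im m)\<^sup>2) \<partial>P)"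
      by (intro Bochner_Integration.integral_cong refl) (simp add: cmod_power2 power2_diff algebra_simps)
    also have "\<dots> = ((\<integral>w. (Re (s w))\<^sup>2 \<partial>P) - 2 * Re m * (\<integral>w. Re (s w) \<partial>P) + (Re m)\<^sup>2)
        + ((\<integral>w. (Im (s w))\<^sup>2 \<partial>P) - 2 * Im m * (\<integral>w. Im (s w) \<partial>P) + (Im m)\<^sup>2)"
      using i by (simp add: P.prob_space)
    finally show ?thesis by (simp add: mm power2_eq_square)
  qed
  have re: "(\<integral>w. (Re (s w))\<^sup>2 \<partial>P) - (\<integral>w. Re (s w) \<partial>P)\<^sup>2 \<le> (\<Sum>p\<in>upper n. \<integral>w. (Re (s w) - Re (s (w(p := 0))))\<^sup>2 \<partial>P)"
    by (rule efron_stein[where b = g]) (use reim in auto)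
  have im: "(\<integral>w. (Im (s w))\<^sup>2 \<partial>P) - (\<integral>w. Im (s w) \<partial>P)\<^sup>2 \<le> (\<Sum>p\<in>upper n. \<integral>w. (Im (s w) - Im (s (w(p := 0))))\<^sup>2 \<partial>P)"
    by (rule efron_stein[where b = g]) (use reim in auto)
  have "(\<integral>w. (cmod (s w - m))\<^sup>2 \<partial>P)
     \<le> (\<Sum>p\<in>upper n. (\<integral>w. (Re (s w) - Re (s (w(p := 0))))\<^sup>2 \<partial>P) + (\<integral>w. (Im (s w) - Im (s (w(p := 0))))\<^sup>2 \<partial>P))"
    unfolding var sum.distrib using re im by linarith
  also have "\<dots> = (\<Sum>p\<in>upper n. \<integral>w. (cmod (s w - s (w(p := 0))))\<^sup>2 \<partial>P)"
  proof (intro sum.cong refl)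
    fix p assume p: "p \<in> upper n"
    have d: "\<bar>Re (s w) - Re (s (w(p := 0)))\<bar> \<le> 2 * g" "\<bar>Im (s w) - Im (s (w(p := 0)))\<bar> \<le> 2 * g" for w
      using reim[of w] reim[of "w(p := 0)"] by linarith+
    have "integrable P (\<lambda>w. (Re (s w) - Re (s (w(p := 0))))\<^sup>2)" "integrable P (\<lambda>w. (Im (s w) - Im (s (w(p := 0))))\<^sup>2)"
      using power_mono[OF d(1) abs_ge_zero, where n = 2] power_mono[OF d(2) abs_ge_zero, where n = 2] p
      by (auto intro!: integrable_bounded[of _ "(2 * g)\<^sup>2"])
    then show "(\<integral>w. (Re (s w) - Re (s (w(p := 0))))\<^sup>2 \<partial>P) + (\<integral>w. (Im (s w) - Im (s (w(p := 0))))\<^sup>2 \<partial>P)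
       = (\<integral>w. (cmod (s w - s (w(p := 0))))\<^sup>2 \<partial>P)"
      by (simp add: cmod_power2)
  qed
  also have "\<dots> \<le> (\<Sum>p\<in>upper n. t\<^sup>2 / (real n)\<^sup>2 *
      (8 * \<kappa> * (\<integral>w. (cmod (mprod n (G w) (G w) (fst p) (snd p)))\<^sup>2 \<partial>P) + 320 * t\<^sup>2 * g ^ 6 * \<kappa>\<^sup>2))"
    by (intro sum_mono resampled_increment)
  also have "\<dots> = t\<^sup>2 / (real n)\<^sup>2 * (8 * \<kappa> * (\<Sum>p\<in>upper n. \<integral>w. (cmod (mprod n (G w) (G w) (fst p) (snd p)))\<^sup>2 \<partial>P)
      + real (card (upper n)) * (320 * t\<^sup>2 * g ^ 6 * \<kappa>\<^sup>2))"
    by (simp only: sum_distrib_left[symmetric] sum.distrib sum_constant mult_ac)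
  also have "(\<Sum>p\<in>upper n. \<integral>w. (cmod (mprod n (G w) (G w) (fst p) (snd p)))\<^sup>2 \<partial>P) \<le> n * g ^ 4"
  proof -
    have i: "integrable P (\<lambda>w. (cmod (mprod n (G w) (G w) (fst p) (snd p)))\<^sup>2)" if "p \<in> upper n" for p
    proof (rule integrable_bounded[where b = "(g\<^sup>2)\<^sup>2"])
      have pn: "fst p < n" "snd p < n" using that by (auto simp: upper_def)
      show "(\<lambda>w. (cmod (mprod n (G w) (G w) (fst p) (snd p)))\<^sup>2) \<in> borel_measurable P"
        using measurable_GG[OF pn] by measurable
      show "norm ((cmod (mprod n (G w) (G w) (fst p) (snd p)))\<^sup>2) \<le> (g\<^sup>2)\<^sup>2" for w
        unfolding real_norm_def abs_of_nonneg[OF zero_le_power2] by (intro power_mono norm_GG pn) auto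
    qed
    have "(\<Sum>p\<in>upper n. \<integral>w. (cmod (mprod n (G w) (G w) (fst p) (snd p)))\<^sup>2 \<partial>P)
        = (\<integral>w. (\<Sum>p\<in>upper n. (cmod (mprod n (G w) (G w) (fst p) (snd p)))\<^sup>2) \<partial>P)"
      using i by simp
    also have "\<dots> \<le> (\<integral>w. n * g ^ 4 \<partial>P)"
      using i sum_GG_le by (intro integral_mono) auto
    finally show ?thesis by (simp add: P.prob_space)
  qed
  also have "real (card (upper n)) \<le> (real n)\<^sup>2"
    using card_upper_le[of n] by (metis of_nat_le_iff of_nat_power)
  also have "t\<^sup>2 / (real n)\<^sup>2 * (8 * \<kappa> * (n * g ^ 4) + (real n)\<^sup>2 * (320 * t\<^sup>2 * g ^ 6 * \<kappa>\<^sup>2))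
     = T * (8 * \<kappa> * g ^ 4 + 320 * \<kappa>\<^sup>2 * T * g ^ 6) / (real n)\<^sup>2"
    using n_pos by (simp add: T[symmetric] field_simps power2_eq_square)
  finally show ?thesis using \<kappa> g by (simp add: mult_left_mono add_mono divide_right_mono mult_right_mono)
qed

end

section \<open>The self-consistent equation\<close>

text \<open>
  Comparison with the unperturbed matrix \<open>a\<close> at a second spectral parameter \<open>z'\<close>; below,
  \<open>z'\<close> is chosen as \<open>z + T m\<close>, for which the leading terms cancel.
\<close>
locale deformed_wigner_reference = deformed_wigner +
  fixes z' :: complex
  assumes z': "1 / g \<le> Im z'"
begin

definition R :: "nat \<Rightarrow> nat \<Rightarrow> complex" where "R = resolvent a z'"
definition X :: "(nat \<times> nat \<Rightarrow> real) \<Rightarrow> nat \<Rightarrow> nat \<Rightarrow> complex" where "X w = mprod n (G w) R"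

lemma norm_X: "i < n \<Longrightarrow> j < n \<Longrightarrow> cmod (X w i j) \<le> g\<^sup>2"
  unfolding X_def G_def R_def using norm_mprod_resolvent_le[OF sym a e_pos g(2) z'] by simp

lemma measurable_X: "i < n \<Longrightarrow> j < n \<Longrightarrow> (\<lambda>w. X w i j) \<in> borel_measurable P"
  unfolding X_def mprod_def by (intro borel_measurable_sum borel_measurable_times measurable_G borel_measurable_const) auto

lemma X_upd:
  assumes "p \<in> upper n" "r < n" "c < n"
  shows "X (w(p := y)) r c - X (w(p := y')) r c
       = of_real (- t * (y - y')) * sandwich p (G (w(p := y'))) (X (w(p := y))) r c"
proof -
  have "X (w(p := y)) r c - X (w(p := y')) r c = mprod n (\<lambda>i j. G (w(p := y)) i j - G (w(p := y')) i j) R r c"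
    unfolding X_def by (simp add: mprod_def sum_subtractf[symmetric] left_diff_distrib)
  also have "\<dots> = mprod n (\<lambda>r c. of_real (- t * (y - y')) * sandwich p (G (w(p := y'))) (G (w(p := y))) r c) R r c"
    using G_upd[OF assms(1)] assms by (intro mprod_cong) auto
  finally show ?thesis unfolding sandwich_mprod X_def .
qed

text \<open>
  The contribution of the noise entry to the trace of \<open>G - R\<close> in the resolvent identity.
\<close>
definition F :: "nat \<Rightarrow> nat \<Rightarrow> (nat \<times> nat \<Rightarrow> real) \<Rightarrow> complex" where
  "F k l w = of_real (t * w (pos k l)) * X w l k"

text \<open>
  Minus the mean of \<open>F\<close> to leading order: expanding \<open>X\<close> in the entry \<open>w (pos k l)\<close>,
  the linear term of \<open>F\<close> is centred, and the quadratic one has mean \<open>- H\<close>, since the entry has unit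
  variance.
\<close>
definition H :: "nat \<Rightarrow> nat \<Rightarrow> (nat \<times> nat \<Rightarrow> real) \<Rightarrow> complex" where
  "H k l w = of_real (t\<^sup>2) * sandwich (pos k l) (G w) (X w) l k"

lemma measurable_sandwich:
  assumes p: "p \<in> upper n" and ij: "i < n" "j < n"
  shows "(\<lambda>w. sandwich p (G w) (X w) i j) \<in> borel_measurable P"
proof -
  have "fst p < n" "snd p < n" using p by (auto simp: upper_def)
  then have m: "(\<lambda>w. G w i u) \<in> borel_measurable P" "(\<lambda>w. X w u j) \<in> borel_measurable P"
    if "u \<in> {fst p, snd p}" for u
    using that ij measurable_G measurable_X by auto
  show ?thesis unfolding sandwich_def split_beta
    by (cases "fst p = snd p") (simp_all add: m borel_measurable_add borel_measurable_times)
qed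

lemma integrable_F:
  assumes kl: "k < n" "l < n" shows "integrable P (F k l)"
proof -
  note p = pos_upper[OF kl]
  have "(\<lambda>y :: real. \<bar>y\<bar>) \<in> borel_measurable borel" by simp
  then have "integrable P (\<lambda>w. \<bar>w (pos k l)\<bar>)"
    by (rule integrable_component(1)[OF p, THEN iffD2]) (rule integrable_powers[OF p])
  then have "integrable P (\<lambda>w. \<bar>t\<bar> * \<bar>w (pos k l)\<bar> * g\<^sup>2)" by simp
  then show ?thesis
  proof (rule Bochner_Integration.integrable_bound)
    show "F k l \<in> borel_measurable P" unfolding F_def[abs_def]
      using measurable_component[OF p] measurable_X[OF kl(2,1)] by measurable
    show "AE w in P. norm (F k l w) \<le> norm (\<bar>t\<bar> * \<bar>w (pos k l)\<bar> * g\<^sup>2)"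
      by (intro AE_I2) (simp add: F_def norm_mult abs_mult mult_left_mono norm_X kl)
  qed
qed

lemma norm_H: "k < n \<Longrightarrow> l < n \<Longrightarrow> norm (H k l w) \<le> t\<^sup>2 * (2 * (g * g\<^sup>2))"
  unfolding H_def norm_mult norm_of_real abs_of_nonneg[OF zero_le_power2]
  by (intro mult_left_mono norm_sandwich_le[OF pos_upper] norm_G norm_X) auto

lemma integrable_H: "k < n \<Longrightarrow> l < n \<Longrightarrow> integrable P (H k l)"
  using norm_H[of k l] unfolding H_def[abs_def]
  by (intro integrable_bounded[of _ "t\<^sup>2 * (2 * (g * g\<^sup>2))"] borel_measurable_times borel_measurable_const measurable_sandwich) auto

lemma integrable_upd:
  fixes f :: "(nat \<times> nat \<Rightarrow> real) \<Rightarrow> complex"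
  assumes p: "p \<in> upper n" and w: "w \<in> space P" and f: "f \<in> borel_measurable P"
    and b: "\<And>y. norm (f (w(p := y))) \<le> c * \<bar>y\<bar> + d"
  shows "integrable (\<nu> p) (\<lambda>y. f (w(p := y)))"
proof -
  interpret p: prob_space "\<nu> p" by simp
  have "integrable (\<nu> p) (\<lambda>y. c * \<bar>y\<bar> + d)" using integrable_powers(3)[OF p] by simp
  then show ?thesis
    by (rule Bochner_Integration.integrable_bound)
      (use measurable_compose[OF measurable_upd_const[OF p w] f] b in \<open>auto intro!: AE_I2 order_trans[OF b abs_ge_self]\<close>)
qed

lemma norm_X_upd_le:
  assumes p: "p \<in> upper n" and rc: "r < n" "c < n"
  shows "cmod (X (w(p := y)) r c - X (w(p := 0)) r c) \<le> \<bar>t\<bar> * \<bar>y\<bar> * (2 * (g * g\<^sup>2))"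
proof -
  have "cmod (X (w(p := y)) r c - X (w(p := 0)) r c) \<le> \<bar>- t * (y - 0)\<bar> * (2 * (g * g\<^sup>2))"
    unfolding X_upd[OF assms] norm_mult norm_of_real
    by (intro mult_left_mono norm_sandwich_le[OF p norm_G norm_X rc]) auto
  then show ?thesis by (simp add: abs_mult)
qed

lemma norm_G_upd_le:
  assumes p: "p \<in> upper n" and rc: "r < n" "c < n"
  shows "cmod (G (w(p := y)) r c - G (w(p := 0)) r c) \<le> \<bar>t\<bar> * \<bar>y\<bar> * (2 * (g * g))"
proof -
  have "cmod (G (w(p := y)) r c - G (w(p := 0)) r c) \<le> \<bar>- t * (y - 0)\<bar> * (2 * (g * g))"
    unfolding G_upd[OF assms] norm_mult norm_of_real
    by (intro mult_left_mono norm_sandwich_le[OF p norm_G norm_G rc]) auto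
  then show ?thesis by (simp add: abs_mult)
qed

text \<open>
  The function \<open>F + H\<close> of one entry \<open>y\<close> agrees up to third order in \<open>t\<close> with \<open>h
  y\<close>, a combination of \<open>y\<close> and of \<open>1 - y\<^sup>2\<close> with coefficients that do not depend on
  \<open>y\<close>. Mean zero and unit variance make the integral of \<open>h\<close> vanish. There are
  \<open>n\<^sup>2\<close> entries and \<open>t\<^sup>3\<close> is of order \<open>n powr (- 3 / 2)\<close>, so after
  division by \<open>n\<close> these errors vanish.
\<close>
lemma norm_expectation_offdiagonal:
  assumes kl: "k < n" "l < n" "k \<noteq> l"
  shows "norm (\<integral>w. F k l w + H k l w \<partial>P) \<le> 24 * \<kappa> * \<bar>t\<bar> ^ 3 * g ^ 4"
proof (rule norm_integral_le_resample[OF pos_upper[OF kl(1,2)]])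
  define p where "p = pos k l"
  have p: "p \<in> upper n" unfolding p_def by (rule pos_upper[OF kl(1,2)])
  note lk = kl(2,1)
  show "integrable P (\<lambda>w. F k l w + H k l w)"
    by (intro Bochner_Integration.integrable_add integrable_F integrable_H kl)
  fix w assume w: "w \<in> space P"
  interpret p: prob_space "\<nu> p" by simp
  define Gy where "Gy y = G (w(p := y))" for y
  define Xy where "Xy y = X (w(p := y))" for y
  define b0 where "b0 = sandwich p (Gy 0) (Xy 0) l k"
  define f where "f y = of_real (t * y) * Xy y l k + of_real (t\<^sup>2) * sandwich p (Gy y) (Xy y) l k" for y
  \<comment> \<open>the expansion of \<open>f\<close> to second order in \<open>t\<close>\<close>
  define h where "h y = of_real (t * y) * Xy 0 l k + of_real (t\<^sup>2 * (1 - y\<^sup>2)) * b0" for y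
  note ip = integrable_powers[OF p]
  have f_eq: "F k l (w(p := y)) + H k l (w(p := y)) = f y" for y
    by (simp add: F_def H_def f_def Gy_def Xy_def p_def)
  have fi: "integrable (\<nu> p) f"
  proof -
    have "norm (F k l (w(p := y)) + H k l (w(p := y))) \<le> (\<bar>t\<bar> * g\<^sup>2) * \<bar>y\<bar> + t\<^sup>2 * (2 * (g * g\<^sup>2))" for y
    proof (intro norm_triangle_le add_mono norm_H kl)
      show "norm (F k l (w(p := y))) \<le> (\<bar>t\<bar> * g\<^sup>2) * \<bar>y\<bar>"
        unfolding F_def norm_mult norm_of_real p_def fun_upd_same abs_mult
        using mult_left_mono[OF norm_X[OF lk], of "\<bar>t\<bar> * \<bar>y\<bar>"] by (simp add: mult_ac)
    qed
    then show ?thesis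
      using integrable_upd[OF p w, of "\<lambda>w. F k l w + H k l w"] integrable_F[OF kl(1,2)] integrable_H[OF kl(1,2)]
      unfolding f_eq by auto
  qed
  have hi: "integrable (\<nu> p) h"
    unfolding h_def using ip
    by (intro Bochner_Integration.integrable_add integrable_mult_left integrable_of_real) auto
  have h0: "(\<integral>y. h y \<partial>\<nu> p) = 0"
  proof -
    have neq: "fst p \<noteq> snd p" using kl(3) by (auto simp: p_def pos_def)
    have "(\<integral>y. h y \<partial>\<nu> p) = of_real (\<integral>y. t * y \<partial>\<nu> p) * Xy 0 l k + of_real (\<integral>y. t\<^sup>2 * (1 - y\<^sup>2) \<partial>\<nu> p) * b0"
    proof -
      have i: "integrable (\<nu> p) (\<lambda>y. complex_of_real (t * y) * Xy 0 l k)"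
        "integrable (\<nu> p) (\<lambda>y. complex_of_real (t\<^sup>2 * (1 - y\<^sup>2)) * b0)"
        using ip by (intro integrable_mult_left integrable_of_real; simp)+
      show ?thesis unfolding h_def Bochner_Integration.integral_add[OF i]
        by (simp only: integral_mult_left_zero integral_complex_of_real)
    qed
    also have "(\<integral>y. t * y \<partial>\<nu> p) = 0" using mean[OF p] by simp
    also have "(\<integral>y. t\<^sup>2 * (1 - y\<^sup>2) \<partial>\<nu> p) = 0" using second[OF p neq] ip by simp
    finally show ?thesis by simp
  qed
  have le: "norm (f y - h y) \<le> \<bar>t\<bar> ^ 3 * g ^ 4 * (8 * \<bar>y\<bar> + 4 * \<bar>y\<bar> ^ 3)" for y
  proof -
    define S1 where "S1 = sandwich p (Gy 0) (Xy y) l k - b0"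
    define S2 where "S2 = sandwich p (Gy y) (Xy y) l k - b0"
    have Xu: "Xy y l k = Xy 0 l k - of_real (t * y) * (S1 + b0)"
      using X_upd[OF p lk, of w y 0] unfolding Xy_def Gy_def S1_def by (simp add: algebra_simps)
    have fh: "f y - h y = of_real (t\<^sup>2) * S2 - of_real (t\<^sup>2 * y\<^sup>2) * S1"
      unfolding f_def h_def Xu S2_def by (simp add: algebra_simps power2_eq_square)
    have 1: "cmod S1 \<le> 2 * (g * (\<bar>t\<bar> * \<bar>y\<bar> * (2 * (g * g\<^sup>2))))"
    proof -
      have "S1 = sandwich p (Gy 0) (\<lambda>i j. Xy y i j - Xy 0 i j) l k"
        unfolding S1_def b0_def sandwich_diff by (simp add: sandwich_def split_beta)
      then show ?thesis unfolding Gy_def Xy_def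
        by (simp only:) (intro norm_sandwich_le[OF p norm_G norm_X_upd_le[OF p] lk])
    qed
    have 2: "cmod S2 \<le> 2 * ((\<bar>t\<bar> * \<bar>y\<bar> * (2 * (g * g))) * g\<^sup>2) + 2 * (g * (\<bar>t\<bar> * \<bar>y\<bar> * (2 * (g * g\<^sup>2))))"
      unfolding S2_def b0_def sandwich_diff unfolding Gy_def Xy_def
      by (intro norm_triangle_le add_mono norm_sandwich_le[OF p _ _ lk] norm_G norm_X norm_X_upd_le[OF p] norm_G_upd_le[OF p])
    have "norm (f y - h y) \<le> t\<^sup>2 * cmod S2 + t\<^sup>2 * y\<^sup>2 * cmod S1"
      unfolding fh using norm_triangle_ineq4[of "of_real (t\<^sup>2) * S2" "of_real (t\<^sup>2 * y\<^sup>2) * S1"]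
      by (simp add: norm_mult norm_power)
    also have "\<dots> \<le> t\<^sup>2 * (2 * ((\<bar>t\<bar> * \<bar>y\<bar> * (2 * (g * g))) * g\<^sup>2) + 2 * (g * (\<bar>t\<bar> * \<bar>y\<bar> * (2 * (g * g\<^sup>2)))))
        + t\<^sup>2 * y\<^sup>2 * (2 * (g * (\<bar>t\<bar> * \<bar>y\<bar> * (2 * (g * g\<^sup>2)))))"
      by (intro add_mono mult_left_mono 1 2) auto
    also have "\<dots> = \<bar>t\<bar>\<^sup>2 * \<bar>t\<bar> * (g\<^sup>2 * g\<^sup>2) * (8 * \<bar>y\<bar> + 4 * (\<bar>y\<bar>\<^sup>2 * \<bar>y\<bar>))"
      by (simp add: algebra_simps power2_eq_square)
    also have "\<dots> = \<bar>t\<bar> ^ 3 * g ^ 4 * (8 * \<bar>y\<bar> + 4 * \<bar>y\<bar> ^ 3)"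
      by (simp add: power2_eq_square power3_eq_cube numeral_eq_Suc mult_ac)
    finally show ?thesis .
  qed
  have "norm (\<integral>y. f y \<partial>\<nu> p) \<le> (\<integral>y. \<bar>t\<bar> ^ 3 * g ^ 4 * (8 * \<bar>y\<bar> + 4 * \<bar>y\<bar> ^ 3) \<partial>\<nu> p)"
    by (rule norm_integral_le_of_centered[OF fi hi _ h0 le]) (use ip in auto)
  also have "\<dots> = \<bar>t\<bar> ^ 3 * g ^ 4 * (8 * (\<integral>y. \<bar>y\<bar> \<partial>\<nu> p) + 4 * (\<integral>y. \<bar>y\<bar> ^ 3 \<partial>\<nu> p))"
    using ip by simp
  also have "\<dots> \<le> \<bar>t\<bar> ^ 3 * g ^ 4 * (8 * (2 * \<kappa>) + 4 * (2 * \<kappa>))"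
    using ip g by (intro mult_left_mono add_mono) auto
  finally show "norm (\<integral>y. F k l (w(pos k l := y)) + H k l (w(pos k l := y)) \<partial>\<nu> (pos k l)) \<le> 24 * \<kappa> * \<bar>t\<bar> ^ 3 * g ^ 4"
    unfolding p_def[symmetric] f_eq by (simp add: mult_ac)
qed

text \<open>There are only \<open>n\<close> diagonal entries, and a second order bound is sufficient.\<close>
lemma norm_expectation_diagonal:
  assumes k: "k < n"
  shows "norm (\<integral>w. F k k w \<partial>P) \<le> 2 * \<kappa> * t\<^sup>2 * g ^ 3"
proof (rule norm_integral_le_resample[OF pos_upper[OF k k] integrable_F[OF k k]])
  define p where "p = pos k k"
  have p: "p \<in> upper n" unfolding p_def by (rule pos_upper[OF k k])
  fix w assume w: "w \<in> space P"
  interpret p: prob_space "\<nu> p" by simp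
  define f where "f y = of_real (t * y) * X (w(p := y)) k k" for y
  define h where "h y = of_real (t * y) * X (w(p := 0)) k k" for y
  note ip = integrable_powers[OF p]
  have f_eq: "F k k (w(p := y)) = f y" for y
    by (simp add: F_def f_def p_def)
  have fi: "integrable (\<nu> p) f"
  proof -
    have "norm (F k k (w(p := y))) \<le> (\<bar>t\<bar> * g\<^sup>2) * \<bar>y\<bar> + 0" for y
      unfolding F_def norm_mult norm_of_real p_def fun_upd_same abs_mult
      using mult_left_mono[OF norm_X[OF k k], of "\<bar>t\<bar> * \<bar>y\<bar>"] by (simp add: mult_ac)
    then show ?thesis using integrable_upd[OF p w, of "F k k" "\<bar>t\<bar> * g\<^sup>2" 0] integrable_F[OF k k] unfolding f_eq by auto
  qed
  have hi: "integrable (\<nu> p) h"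
    unfolding h_def using ip by (intro integrable_mult_left integrable_of_real) auto
  have h0: "(\<integral>y. h y \<partial>\<nu> p) = 0"
  proof -
    have "(\<integral>y. h y \<partial>\<nu> p) = of_real (\<integral>y. t * y \<partial>\<nu> p) * X (w(p := 0)) k k"
      unfolding h_def using ip by simp
    then show ?thesis using mean[OF p] by simp
  qed
  have le: "norm (f y - h y) \<le> 2 * t\<^sup>2 * g ^ 3 * y\<^sup>2" for y
  proof -
    have "f y - h y = of_real (t * y) * (X (w(p := y)) k k - X (w(p := 0)) k k)"
      by (simp add: f_def h_def algebra_simps)
    then have "norm (f y - h y) = \<bar>t * y\<bar> * cmod (X (w(p := y)) k k - X (w(p := 0)) k k)"
      by (simp only: norm_mult norm_of_real)
    also have "\<dots> \<le> \<bar>t * y\<bar> * (\<bar>t\<bar> * \<bar>y\<bar> * (2 * (g * g\<^sup>2)))"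
      by (intro mult_left_mono norm_X_upd_le[OF p k k]) auto
    also have "\<dots> = 2 * \<bar>t\<bar>\<^sup>2 * g ^ 3 * \<bar>y\<bar>\<^sup>2"
      by (simp add: abs_mult power2_eq_square power3_eq_cube mult_ac)
    finally show ?thesis by simp
  qed
  have "norm (\<integral>y. f y \<partial>\<nu> p) \<le> (\<integral>y. 2 * t\<^sup>2 * g ^ 3 * y\<^sup>2 \<partial>\<nu> p)"
    by (rule norm_integral_le_of_centered[OF fi hi _ h0 le]) (use ip in auto)
  also have "\<dots> = 2 * t\<^sup>2 * g ^ 3 * (\<integral>y. y\<^sup>2 \<partial>\<nu> p)" using ip by simp
  also have "\<dots> \<le> 2 * t\<^sup>2 * g ^ 3 * \<kappa>" using second_le[OF p] g by (intro mult_left_mono) auto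
  finally show "norm (\<integral>y. F k k (w(pos k k := y)) \<partial>\<nu> (pos k k)) \<le> 2 * \<kappa> * t\<^sup>2 * g ^ 3"
    unfolding p_def[symmetric] f_eq by (simp add: mult_ac)
qed

definition x :: "(nat \<times> nat \<Rightarrow> real) \<Rightarrow> complex" where "x w = (\<Sum>k<n. X w k k)"

lemma norm_x: "cmod (x w) \<le> n * g\<^sup>2"
  unfolding x_def using sum_norm_le[of "{..<n}" "\<lambda>k. X w k k" "\<lambda>_. g\<^sup>2"] norm_X by simp

lemma measurable_x [measurable]: "x \<in> borel_measurable P"
  unfolding x_def[abs_def] by (intro borel_measurable_sum measurable_X) auto

text \<open>
  The trace of the resolvent identity for \<open>G\<close> and the resolvent \<open>R\<close> of the unperturbed matrix.
\<close>
lemma trace_identity: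
  "of_nat n * (s w - stieltjes n (eig_desc a) z') = - (\<Sum>k<n. \<Sum>l<n. F k l w) - (z' - z) * x w"
proof -
  have z'0: "Im z' \<noteq> 0" using z' e_pos by linarith
  have d: "G w i i - R i i = (\<Sum>k<n. \<Sum>l<n. (- of_real (t * w (pos k l)) + (z - z') * of_bool (k = l)) * (G w l i * R i k))"
    if "i < n" for i
    unfolding G_def R_def using resolvent_identity[OF a sym z'0 Im_z that that, of w]
    by (simp add: B_def perturbed_def mult_ac)
  have "of_nat n * (s w - stieltjes n (eig_desc a) z') = (\<Sum>i<n. G w i i - R i i)"
    unfolding s_def right_diff_distrib resolvent_trace[OF sym, symmetric] resolvent_trace[OF a, symmetric]
      G_def R_def sum_subtractf ..
  also have "\<dots> = (\<Sum>i<n. \<Sum>k<n. \<Sum>l<n. (- of_real (t * w (pos k l)) + (z - z') * of_bool (k = l)) * (G w l i * R i k))"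
    by (intro sum.cong refl d) simp
  also have "\<dots> = (\<Sum>k<n. \<Sum>l<n. \<Sum>i<n. (- of_real (t * w (pos k l)) + (z - z') * of_bool (k = l)) * (G w l i * R i k))"
    by (rule sum_triple_swap[symmetric])
  also have "\<dots> = (\<Sum>k<n. \<Sum>l<n. (- of_real (t * w (pos k l)) + (z - z') * of_bool (k = l)) * X w l k)"
    by (simp only: sum_distrib_left[symmetric] X_def mprod_def)
  also have "\<dots> = (\<Sum>k<n. \<Sum>l<n. (z - z') * (of_bool (k = l) * X w l k) - F k l w)"
    by (intro sum.cong refl) (simp add: F_def algebra_simps)
  also have "\<dots> = (z - z') * (\<Sum>k<n. \<Sum>l<n. of_bool (k = l) * X w l k) - (\<Sum>k<n. \<Sum>l<n. F k l w)"
    by (simp only: sum_subtractf sum_distrib_left)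
  also have "(\<Sum>k<n. \<Sum>l<n. of_bool (k = l) * X w l k) = x w"
    unfolding x_def by (intro sum.cong refl sum_of_bool_mult) simp
  finally show ?thesis by (simp add: algebra_simps)
qed

text \<open>
  The part of the sum of the \<open>H k l\<close> that does not factor into two traces. It has only \<open>O(n)\<close> size
  and is negligible.
\<close>
definition rho :: "(nat \<times> nat \<Rightarrow> real) \<Rightarrow> complex" where
  "rho w = (\<Sum>k<n. \<Sum>l<n. G w l k * X w l k) - 2 * (\<Sum>k<n. G w k k * X w k k)"

lemma norm_rho: "cmod (rho w) \<le> 3 * n * g ^ 3"
proof -
  have rows: "(\<Sum>k<n. (cmod (G w l k))\<^sup>2) \<le> g\<^sup>2" "(\<Sum>k<n. (cmod (X w l k))\<^sup>2) \<le> (g\<^sup>2)\<^sup>2" if "l < n" for l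
    using resolvent_row_norm[OF sym e_pos g(2) that] mprod_resolvent_row_norm[OF sym a e_pos g(2) z' that]
    unfolding G_def X_def R_def by simp_all
  have "cmod (\<Sum>k<n. \<Sum>l<n. G w l k * X w l k) = cmod (\<Sum>l<n. \<Sum>k<n. G w l k * X w l k)"
    by (subst sum.swap) (rule refl)
  also have "\<dots> \<le> (\<Sum>l<n. g * g\<^sup>2)"
    using rows g by (intro sum_norm_le norm_sum_mult_le) auto
  finally have 1: "cmod (\<Sum>k<n. \<Sum>l<n. G w l k * X w l k) \<le> n * g ^ 3" by (simp add: power2_eq_square power3_eq_cube)
  have "cmod (G w k k * X w k k) \<le> g * g\<^sup>2" if "k < n" for k
    unfolding norm_mult using norm_G norm_X that g by (intro mult_mono) auto
  then have "cmod (\<Sum>k<n. G w k k * X w k k) \<le> (\<Sum>k<n. g * g\<^sup>2)"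
    by (intro sum_norm_le) auto
  then have 2: "cmod (\<Sum>k<n. G w k k * X w k k) \<le> n * g ^ 3" by (simp add: power2_eq_square power3_eq_cube)
  show ?thesis unfolding rho_def
    using norm_triangle_ineq4[of "\<Sum>k<n. \<Sum>l<n. G w l k * X w l k" "2 * (\<Sum>k<n. G w k k * X w k k)"] 1 2
    by (simp add: norm_mult)
qed

lemma measurable_rho [measurable]: "rho \<in> borel_measurable P"
  unfolding rho_def[abs_def]
  by (intro borel_measurable_diff borel_measurable_sum borel_measurable_times measurable_G measurable_X borel_measurable_const) auto

text \<open>
  The main term is a product of two traces, and this product is the source of the nonlinearity in the self-consistent
  equation.
\<close>
lemma sum_H:
  "(\<Sum>k<n. \<Sum>l<n. if k = l then 0 else H k l w) = of_real (t\<^sup>2) * (of_nat n * s w * x w + rho w)"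
proof -
  have sw: "sandwich (pos k l) (G w) (X w) l k = G w l k * X w l k + G w l l * X w k k" if "k \<noteq> l" for k l
    using that by (auto simp: sandwich_def pos_def min_def max_def)
  have "(\<Sum>k<n. \<Sum>l<n. if k = l then 0 else H k l w)
      = (\<Sum>k<n. \<Sum>l<n. of_real (t\<^sup>2) * (G w l l * X w k k + (G w l k * X w l k - of_bool (k = l) * (2 * (G w l l * X w k k)))))"
    by (intro sum.cong refl) (auto simp: H_def sw)
  also have "\<dots> = of_real (t\<^sup>2) * ((\<Sum>k<n. \<Sum>l<n. G w l l * X w k k) +
      ((\<Sum>k<n. \<Sum>l<n. G w l k * X w l k) - (\<Sum>k<n. \<Sum>l<n. of_bool (k = l) * (2 * (G w l l * X w k k)))))"
    by (simp only: sum_distrib_left[symmetric] sum.distrib sum_subtractf)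
  also have "(\<Sum>k<n. \<Sum>l<n. G w l l * X w k k) = of_nat n * s w * x w"
    unfolding s_def resolvent_trace[OF sym, symmetric] x_def G_def
    by (simp only: sum_product) (rule sum.swap)
  also have "(\<Sum>k<n. \<Sum>l<n. of_bool (k = l) * (2 * (G w l l * X w k k))) = (\<Sum>k<n. 2 * (G w k k * X w k k))"
    by (intro sum.cong refl sum_of_bool_mult) simp
  finally show ?thesis by (simp add: rho_def sum_distrib_left)
qed

text \<open>
  With \<open>z' = z + T m\<close> the term \<open>(z' - z) x\<close> of the trace identity cancels the main term of the sum
  of the \<open>H k l\<close>, up to the fluctuation of \<open>s\<close> about its mean \<open>m\<close>.
\<close>
theorem bias_le:
  assumes T: "t\<^sup>2 * n = T" and z'_eq: "z' = z + of_real T * m"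
  shows "cmod (m - stieltjes n (eig_desc a) z')
      \<le> 24 * \<kappa> * n * \<bar>t\<bar> ^ 3 * g ^ 4 + (2 * \<kappa> + 3) * t\<^sup>2 * g ^ 3 + T * g\<^sup>2 * (\<integral>w. cmod (s w - m) \<partial>P)"
proof -
  define S where "S = stieltjes n (eig_desc a) z'"
  define D where "D k l w = F k l w + (if k = l then 0 else H k l w)" for k l w
  have T0: "0 \<le> T" using T by auto
  have D_int: "integrable P (D k l)" if "k < n" "l < n" for k l
    unfolding D_def[abs_def] using that by (cases "k = l") (auto intro: integrable_F integrable_H Bochner_Integration.integrable_add)
  have D_le: "norm (\<integral>w. D k l w \<partial>P) \<le> 24 * \<kappa> * \<bar>t\<bar> ^ 3 * g ^ 4 + of_bool (k = l) * (2 * \<kappa> * t\<^sup>2 * g ^ 3)" if "k < n" "l < n" for k l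
    using norm_expectation_offdiagonal[OF that] norm_expectation_diagonal[OF that(1)] \<kappa> g unfolding D_def
    by (cases "k = l") (auto intro: order_trans)
  \<comment> \<open>subtracting the \<open>H k l\<close> replaces the noise terms by their expansion; what is left are \<open>D\<close>, a fluctuation and \<open>rho\<close>\<close>
  have pt: "of_nat n * (s w - S) = - (\<Sum>k<n. \<Sum>l<n. D k l w) + of_real T * ((s w - m) * x w) + of_real (t\<^sup>2) * rho w" for w
  proof -
    have Tc: "of_real (t\<^sup>2) * of_nat n = complex_of_real T"
      unfolding T[symmetric] by simp
    have "(\<Sum>k<n. \<Sum>l<n. D k l w) = (\<Sum>k<n. \<Sum>l<n. F k l w) + of_real (t\<^sup>2) * (of_nat n * s w * x w + rho w)"
      unfolding D_def sum.distrib sum_H ..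
    also have "of_real (t\<^sup>2) * (of_nat n * s w * x w + rho w) = of_real T * (s w * x w) + of_real (t\<^sup>2) * rho w"
      unfolding Tc[symmetric] by (simp only: distrib_left mult.assoc)
    finally have F_eq: "(\<Sum>k<n. \<Sum>l<n. F k l w) = (\<Sum>k<n. \<Sum>l<n. D k l w) - (of_real T * (s w * x w) + of_real (t\<^sup>2) * rho w)"
      by (rule eq_diff_eq[THEN iffD2, OF HOL.sym])
    have zz: "z' - z = of_real T * m" using z'_eq by simp
    show ?thesis
      unfolding S_def trace_identity zz F_eq by (simp only: left_diff_distrib right_diff_distrib mult.assoc) simp
  qed
  have sx_le: "cmod ((s w - m) * x w) \<le> n * g\<^sup>2 * cmod (s w - m)" for w
    unfolding norm_mult using norm_x[of w] by (simp add: mult.commute mult_right_mono)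
  have sm_int: "integrable P (\<lambda>w. s w - m)" using integrable_s by simp
  have sx_int: "integrable P (\<lambda>w. (s w - m) * x w)"
    by (rule Bochner_Integration.integrable_bound[OF integrable_mult_right[OF integrable_norm[OF sm_int], of "n * g\<^sup>2"]])
      (use sx_le in \<open>auto intro!: AE_I2 order_trans[OF _ abs_ge_self]\<close>)
  have rho_int: "integrable P rho" using norm_rho by (intro integrable_bounded) auto
  have "of_nat n * (m - S) = (\<integral>w. of_nat n * (s w - S) \<partial>P)"
    unfolding m_def using integrable_s by (simp add: P.prob_space)
  also have "\<dots> = - (\<Sum>k<n. \<Sum>l<n. \<integral>w. D k l w \<partial>P) + of_real T * (\<integral>w. (s w - m) * x w \<partial>P) + of_real (t\<^sup>2) * (\<integral>w. rho w \<partial>P)"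
  proof -
    have Di: "integrable P (\<lambda>w. \<Sum>k<n. \<Sum>l<n. D k l w)" by (intro Bochner_Integration.integrable_sum D_int) auto
    have "(\<integral>w. (\<Sum>k<n. \<Sum>l<n. D k l w) \<partial>P) = (\<Sum>k<n. \<integral>w. (\<Sum>l<n. D k l w) \<partial>P)"
      by (intro Bochner_Integration.integral_sum Bochner_Integration.integrable_sum D_int) auto
    also have "\<dots> = (\<Sum>k<n. \<Sum>l<n. \<integral>w. D k l w \<partial>P)"
      by (intro sum.cong refl Bochner_Integration.integral_sum D_int) auto
    finally show ?thesis
      unfolding pt using Di sx_int rho_int by (simp del: of_real_power)
  qed
  finally have "real n * cmod (m - S) = cmod (- (\<Sum>k<n. \<Sum>l<n. \<integral>w. D k l w \<partial>P) + of_real T * (\<integral>w. (s w - m) * x w \<partial>P) + of_real (t\<^sup>2) * (\<integral>w. rho w \<partial>P))"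
    by (metis norm_mult norm_of_nat)
  also have "\<dots> \<le> cmod (\<Sum>k<n. \<Sum>l<n. \<integral>w. D k l w \<partial>P) + T * cmod (\<integral>w. (s w - m) * x w \<partial>P) + t\<^sup>2 * cmod (\<integral>w. rho w \<partial>P)"
    using T0 by (intro norm_triangle_le add_mono) (auto simp: norm_mult norm_power)
  also have "cmod (\<Sum>k<n. \<Sum>l<n. \<integral>w. D k l w \<partial>P) \<le> (\<Sum>k<n. \<Sum>l<n. 24 * \<kappa> * \<bar>t\<bar> ^ 3 * g ^ 4 + of_bool (k = l) * (2 * \<kappa> * t\<^sup>2 * g ^ 3))"
    by (intro sum_norm_le D_le) auto
  also have "\<dots> = n * (n * (24 * \<kappa> * \<bar>t\<bar> ^ 3 * g ^ 4) + 2 * \<kappa> * t\<^sup>2 * g ^ 3)"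
    by (simp add: sum.distrib sum_of_bool_mult)
  also have "cmod (\<integral>w. (s w - m) * x w \<partial>P) \<le> n * g\<^sup>2 * (\<integral>w. cmod (s w - m) \<partial>P)"
  proof -
    have "cmod (\<integral>w. (s w - m) * x w \<partial>P) \<le> (\<integral>w. cmod ((s w - m) * x w) \<partial>P)" by (rule integral_norm_bound)
    also have "\<dots> \<le> (\<integral>w. n * g\<^sup>2 * cmod (s w - m) \<partial>P)"
      by (intro integral_mono sx_le integrable_norm sx_int integrable_mult_right sm_int)
    finally show ?thesis by simp
  qed
  also have "cmod (\<integral>w. rho w \<partial>P) \<le> 3 * n * g ^ 3"
  proof -
    have "cmod (\<integral>w. rho w \<partial>P) \<le> (\<integral>w. cmod (rho w) \<partial>P)" by (rule integral_norm_bound)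
    also have "\<dots> \<le> (\<integral>w. 3 * n * g ^ 3 \<partial>P)"
      by (intro integral_mono norm_rho integrable_norm rho_int) auto
    finally show ?thesis by (simp add: P.prob_space)
  qed
  finally have "real n * cmod (m - S) \<le> real n * (n * (24 * \<kappa> * \<bar>t\<bar> ^ 3 * g ^ 4) + 2 * \<kappa> * t\<^sup>2 * g ^ 3)
      + T * (n * g\<^sup>2 * (\<integral>w. cmod (s w - m) \<partial>P)) + t\<^sup>2 * (3 * n * g ^ 3)"
    using T0 by (simp add: mult_left_mono)
  also have "\<dots> = real n * (24 * \<kappa> * n * \<bar>t\<bar> ^ 3 * g ^ 4 + (2 * \<kappa> + 3) * t\<^sup>2 * g ^ 3 + T * g\<^sup>2 * (\<integral>w. cmod (s w - m) \<partial>P))"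
    by (simp add: algebra_simps)
  finally show ?thesis unfolding S_def using n_pos by simp
qed

end

context deformed_wigner
begin

lemma Im_m_nonneg: "0 \<le> Im m"
proof -
  have "0 < Im z" using g(2) e_pos by linarith
  then have "0 \<le> Im (s w)" for w unfolding s_def by (rule Im_stieltjes_nonneg)
  then show ?thesis unfolding m_def using integrable_s by (simp flip: integral_Im)
qed

text \<open>
  The residual is at most a multiple of the fluctuation of \<open>s\<close> plus a deterministic bias of order \<open>1 /
  sqrt n\<close>. If it exceeds \<open>\<delta>\<close>, either the fluctuation is large, which is Chebyshev's inequality, or
  the bias is above \<open>\<delta> / 2\<close>. The latter forces \<open>n\<close> to be small; the term of order \<open>(1
  / \<delta>) ^ 4\<close> then makes the bound trivial.
\<close>
theorem self_consistency_probability: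
  fixes \<delta> :: real
  assumes T: "t\<^sup>2 * n = T" and \<delta>: "0 < \<delta>"
  defines "V \<equiv> T * (8 * \<kappa> * g ^ 4 + 320 * \<kappa>\<^sup>2 * T * g ^ 6)"
  defines "D \<equiv> 24 * \<kappa> * T * sqrt T * g ^ 4 + (2 * \<kappa> + 3) * T * g ^ 3 + T * g\<^sup>2 * sqrt V"
  shows "measure P {w \<in> space P. \<delta> < cmod (s w - stieltjes n (eig_desc a) (z + of_real T * s w))}
      \<le> (V * (2 * (1 + T * g\<^sup>2) / \<delta>)\<^sup>2 + (2 * D / \<delta>) ^ 4) / (real n)\<^sup>2"
proof -
  define z' where "z' = z + of_real T * m"
  have T0: "0 \<le> T" using T by auto
  have n1: "1 \<le> real n" using n_pos by simp
  have V0: "0 \<le> V" using T0 \<kappa> g by (simp add: V_def)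
  have z': "1 / g \<le> Im z'" using g(2) T0 Im_m_nonneg by (simp add: z'_def add_increasing2)
  interpret ref: deformed_wigner_reference n \<nu> \<kappa> a t z g z'
    by unfold_locales (rule z')
  have sm_int: "integrable P (\<lambda>w. cmod (s w - m))" "integrable P (\<lambda>w. (cmod (s w - m))\<^sup>2)"
  proof -
    have b: "cmod (s w - m) \<le> g + cmod m" for w
      using norm_triangle_ineq4[of "s w" m] norm_s[of w] by linarith
    show "integrable P (\<lambda>w. cmod (s w - m))" using b by (intro integrable_bounded) auto
    show "integrable P (\<lambda>w. (cmod (s w - m))\<^sup>2)"
    proof (rule integrable_bounded)
      show "norm ((cmod (s w - m))\<^sup>2) \<le> (g + cmod m)\<^sup>2" for w
        unfolding real_norm_def abs_of_nonneg[OF zero_le_power2] by (intro power_mono b) auto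
    qed measurable
  qed
  have var: "(\<integral>w. (cmod (s w - m))\<^sup>2 \<partial>P) \<le> V / (real n)\<^sup>2"
    using variance_stieltjes_le[OF T] unfolding V_def .
  have mean_dev: "(\<integral>w. cmod (s w - m) \<partial>P) \<le> sqrt V / sqrt n"
  proof -
    have "(\<integral>w. cmod (s w - m) \<partial>P)\<^sup>2 \<le> (\<integral>w. (cmod (s w - m))\<^sup>2 \<partial>P)"
      using P.variance_positive[of "\<lambda>w. cmod (s w - m)"] P.variance_eq[OF sm_int] by linarith
    also have "\<dots> \<le> V / (real n)\<^sup>2" by (rule var)
    also have "\<dots> \<le> V / real n"
      using n1 V0 by (intro divide_left_mono) (auto simp: power2_eq_square)
    finally have "(\<integral>w. cmod (s w - m) \<partial>P) \<le> sqrt (V / real n)" by (rule real_le_rsqrt)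
    then show ?thesis by (simp add: real_sqrt_divide)
  qed
  have bias: "cmod (m - stieltjes n (eig_desc a) z') \<le> D / sqrt n"
  proof -
    have sn: "1 \<le> sqrt (real n)" "sqrt (real n) * sqrt (real n) = real n" using n1 by simp_all
    have t2: "t\<^sup>2 = T / n" using T n_pos by (simp add: field_simps)
    have ta: "\<bar>t\<bar> = sqrt T / sqrt n"
      using t2 by (metis real_sqrt_abs real_sqrt_divide)
    have t3: "real n * \<bar>t\<bar> ^ 3 = T * sqrt T / sqrt n"
    proof -
      have "real n * \<bar>t\<bar> ^ 3 = (t\<^sup>2 * n) * \<bar>t\<bar>" by (simp add: power3_eq_cube power2_eq_square)
      then show ?thesis unfolding T ta by simp
    qed
    have "sqrt n \<le> n" using mult_right_mono[OF sn(1), of "sqrt n"] sn n1 by simp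
    then have "T / n \<le> T / sqrt n"
      using T0 n1 by (intro divide_left_mono) auto
    then have t2': "t\<^sup>2 \<le> T / sqrt n" unfolding t2 .
    have "cmod (m - stieltjes n (eig_desc a) z')
      \<le> 24 * \<kappa> * n * \<bar>t\<bar> ^ 3 * g ^ 4 + (2 * \<kappa> + 3) * t\<^sup>2 * g ^ 3 + T * g\<^sup>2 * (\<integral>w. cmod (s w - m) \<partial>P)"
      by (rule ref.bias_le[OF T z'_def])
    also have "\<dots> \<le> 24 * \<kappa> * (T * sqrt T / sqrt n) * g ^ 4 + (2 * \<kappa> + 3) * (T / sqrt n) * g ^ 3 + T * g\<^sup>2 * (sqrt V / sqrt n)"
      using \<kappa> g T0 by (intro add_mono mult_left_mono mult_right_mono t2' mean_dev) (auto simp: mult.assoc t3)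
    also have "\<dots> = D / sqrt n" by (simp add: D_def add_divide_distrib)
    finally show ?thesis .
  qed
  have le: "cmod (s w - stieltjes n (eig_desc a) (z + of_real T * s w)) \<le> (1 + T * g\<^sup>2) * cmod (s w - m) + D / sqrt n" for w
  proof -
    have "0 < Im z" using g(2) e_pos by linarith
    then have "0 \<le> Im (s w)" unfolding s_def by (rule Im_stieltjes_nonneg)
    then have i: "1 / g \<le> Im (z + of_real T * s w)" using g(2) T0 by (simp add: add_increasing2)
    have "cmod (stieltjes n (eig_desc a) z' - stieltjes n (eig_desc a) (z + of_real T * s w))
        \<le> cmod (z' - (z + of_real T * s w)) / (1 / g)\<^sup>2"
      using stieltjes_lipschitz[OF e_pos z' i, of n "eig_desc a" "eig_desc a"] by simp
    also have "z' - (z + of_real T * s w) = of_real T * (m - s w)" by (simp add: z'_def algebra_simps)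
    finally have "cmod (stieltjes n (eig_desc a) z' - stieltjes n (eig_desc a) (z + of_real T * s w)) \<le> T * g\<^sup>2 * cmod (s w - m)"
      using T0 by (simp add: norm_mult power_divide norm_minus_commute mult_ac)
    moreover have "cmod (s w - stieltjes n (eig_desc a) (z + of_real T * s w))
       \<le> cmod (s w - m) + cmod (m - stieltjes n (eig_desc a) z')
         + cmod (stieltjes n (eig_desc a) z' - stieltjes n (eig_desc a) (z + of_real T * s w))"
    proof -
      have "cmod (s w - stieltjes n (eig_desc a) (z + of_real T * s w))
          = cmod (((s w - m) + (m - stieltjes n (eig_desc a) z'))
              + (stieltjes n (eig_desc a) z' - stieltjes n (eig_desc a) (z + of_real T * s w)))"
        by simp
      also have "\<dots> \<le> cmod (s w - m) + cmod (m - stieltjes n (eig_desc a) z')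
         + cmod (stieltjes n (eig_desc a) z' - stieltjes n (eig_desc a) (z + of_real T * s w))"
        by (intro norm_triangle_le add_mono order_refl)
      finally show ?thesis .
    qed
    ultimately show ?thesis using bias by (simp add: distrib_right)
  qed
  show ?thesis
  proof (cases "D / sqrt n \<le> \<delta> / 2")
    case True
    define c where "c = \<delta> / (2 * (1 + T * g\<^sup>2))"
    have Tg: "0 < 1 + T * g\<^sup>2" using T0 by (simp add: add_pos_nonneg)
    have c: "0 < c" using \<delta> Tg by (simp add: c_def)
    have "{w \<in> space P. \<delta> < cmod (s w - stieltjes n (eig_desc a) (z + of_real T * s w))}
        \<subseteq> {w \<in> space P. c\<^sup>2 \<le> (cmod (s w - m))\<^sup>2}"
    proof safe
      fix w assume "\<delta> < cmod (s w - stieltjes n (eig_desc a) (z + of_real T * s w))"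
      then have "\<delta> / 2 \<le> (1 + T * g\<^sup>2) * cmod (s w - m)" using le[of w] True by linarith
      then have "c \<le> cmod (s w - m)" using Tg by (simp add: c_def field_simps)
      then show "c\<^sup>2 \<le> (cmod (s w - m))\<^sup>2" using c by (intro power_mono) auto
    qed
    then have "measure P {w \<in> space P. \<delta> < cmod (s w - stieltjes n (eig_desc a) (z + of_real T * s w))}
        \<le> measure P {w \<in> space P. c\<^sup>2 \<le> (cmod (s w - m))\<^sup>2}"
      by (intro P.finite_measure_mono) auto
    also have "\<dots> \<le> (\<integral>w. (cmod (s w - m))\<^sup>2 \<partial>P) / c\<^sup>2"
      using c by (intro integral_Markov_inequality_measure[OF sm_int(2) sets.top]) auto
    also have "\<dots> \<le> (V / (real n)\<^sup>2) / c\<^sup>2" by (intro divide_right_mono var) auto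
    also have "\<dots> = V * (2 * (1 + T * g\<^sup>2) / \<delta>)\<^sup>2 / (real n)\<^sup>2"
      by (simp add: c_def power_divide mult_ac)
    also have "\<dots> \<le> (V * (2 * (1 + T * g\<^sup>2) / \<delta>)\<^sup>2 + (2 * D / \<delta>) ^ 4) / (real n)\<^sup>2"
      by (intro divide_right_mono) auto
    finally show ?thesis .
  next
    case False
    have "sqrt n > 0" using n1 by simp
    then have "sqrt n \<le> 2 * D / \<delta>" using False \<delta> by (simp add: field_simps)
    then have "sqrt n ^ 4 \<le> (2 * D / \<delta>) ^ 4" by (intro power_mono) auto
    also have "sqrt n ^ 4 = (real n)\<^sup>2"
    proof -
      have "sqrt n ^ 4 = ((sqrt n)\<^sup>2)\<^sup>2" unfolding power_mult[symmetric] by simp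
      then show ?thesis by simp
    qed
    finally have "1 \<le> (2 * D / \<delta>) ^ 4 / (real n)\<^sup>2" using n1 by simp
    also have "\<dots> \<le> (V * (2 * (1 + T * g\<^sup>2) / \<delta>)\<^sup>2 + (2 * D / \<delta>) ^ 4) / (real n)\<^sup>2"
      using V0 by (intro divide_right_mono) auto
    finally show ?thesis using P.prob_le_1 order_trans by blast
  qed
qed

end

section \<open>Frobenius norm of the noise and its pairing with a fixed matrix\<close>

text \<open>Independent centred variables are orthogonal.\<close>
lemma (in independent_reals) second_moment_sum:
  fixes f :: "'i \<Rightarrow> real \<Rightarrow> real"
  assumes m: "\<And>i. i \<in> I \<Longrightarrow> f i \<in> borel_measurable borel"
    and sq: "\<And>i. i \<in> I \<Longrightarrow> integrable (\<nu> i) (\<lambda>y. (f i y)\<^sup>2)"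
    and mean: "\<And>i. i \<in> I \<Longrightarrow> (\<integral>y. f i y \<partial>\<nu> i) = 0"
  shows "integrable (PiM I \<nu>) (\<lambda>w. (\<Sum>i\<in>I. f i (w i))\<^sup>2)"
    and "(\<integral>w. (\<Sum>i\<in>I. f i (w i))\<^sup>2 \<partial>PiM I \<nu>) = (\<Sum>i\<in>I. \<integral>y. (f i y)\<^sup>2 \<partial>\<nu> i)"
proof -
  have sqP: "integrable (PiM I \<nu>) (\<lambda>w. (f i (w i))\<^sup>2)" "(\<integral>w. (f i (w i))\<^sup>2 \<partial>PiM I \<nu>) = (\<integral>y. (f i y)\<^sup>2 \<partial>\<nu> i)" if "i \<in> I" for i
  proof -
    have h: "(\<lambda>y. (f i y)\<^sup>2) \<in> borel_measurable borel" using m[OF that] by measurable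
    show "integrable (PiM I \<nu>) (\<lambda>w. (f i (w i))\<^sup>2)" by (rule integrable_component(1)[OF that h, THEN iffD2]) (rule sq[OF that])
    show "(\<integral>w. (f i (w i))\<^sup>2 \<partial>PiM I \<nu>) = (\<integral>y. (f i y)\<^sup>2 \<partial>\<nu> i)" by (rule integrable_component(2)[OF that h])
  qed
  have mP: "(\<lambda>w. f i (w i)) \<in> borel_measurable (PiM I \<nu>)" if "i \<in> I" for i
  proof -
    have "(\<lambda>w. w i) \<in> borel_measurable (PiM I \<nu>)"
      using measurable_component_singleton[of i I \<nu>] that by (simp add: measurable_cong_sets[OF refl sets_borel])
    then show ?thesis by (rule measurable_compose[OF _ m[OF that]])
  qed
  have prod: "integrable (PiM I \<nu>) (\<lambda>w. f i (w i) * f j (w j))" if "i \<in> I" "j \<in> I" for i j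
  proof (rule Bochner_Integration.integrable_bound[OF Bochner_Integration.integrable_add[OF sqP(1)[OF that(1)] sqP(1)[OF that(2)]]])
    show "(\<lambda>w. f i (w i) * f j (w j)) \<in> borel_measurable (PiM I \<nu>)"
      by (intro borel_measurable_times mP that)
    have "\<bar>a * b\<bar> \<le> a\<^sup>2 + b\<^sup>2" for a b :: real
    proof -
      have "2 * (\<bar>a\<bar> * \<bar>b\<bar>) \<le> a\<^sup>2 + b\<^sup>2"
        using zero_le_power2[of "\<bar>a\<bar> - \<bar>b\<bar>"] by (simp add: power2_diff)
      moreover have "0 \<le> \<bar>a\<bar> * \<bar>b\<bar>" by simp
      ultimately show ?thesis unfolding abs_mult by linarith
    qed
    then show "AE w in PiM I \<nu>. norm (f i (w i) * f j (w j)) \<le> norm ((f i (w i))\<^sup>2 + (f j (w j))\<^sup>2)"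
      by (intro AE_I2) simp
  qed
  have sum_eq: "(\<Sum>i\<in>I. f i (w i))\<^sup>2 = (\<Sum>i\<in>I. \<Sum>j\<in>I. f i (w i) * f j (w j))" for w
    by (simp only: power2_eq_square sum_product)
  show "integrable (PiM I \<nu>) (\<lambda>w. (\<Sum>i\<in>I. f i (w i))\<^sup>2)"
    unfolding sum_eq by (intro Bochner_Integration.integrable_sum prod)
  have orth: "(\<integral>w. f i (w i) * f j (w j) \<partial>PiM I \<nu>) = (if i = j then \<integral>y. (f i y)\<^sup>2 \<partial>\<nu> i else 0)" if "i \<in> I" "j \<in> I" for i j
  proof (cases "i = j")
    case True
    then show ?thesis using sqP(2)[OF that(1)] by (simp add: power2_eq_square)
  next
    case False
    have "(\<integral>w. f i (w i) * f j (w j) \<partial>PiM I \<nu>) = (\<integral>w. (\<integral>y. f i y * f j (w j) \<partial>\<nu> i) \<partial>PiM I \<nu>)"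
      using integral_resample(1)[OF that(1) prod[OF that]] False by simp
    then show ?thesis using False mean[OF that(1)] by simp
  qed
  have "(\<integral>w. (\<Sum>i\<in>I. f i (w i))\<^sup>2 \<partial>PiM I \<nu>) = (\<Sum>i\<in>I. \<integral>w. (\<Sum>j\<in>I. f i (w i) * f j (w j)) \<partial>PiM I \<nu>)"
    unfolding sum_eq by (intro Bochner_Integration.integral_sum Bochner_Integration.integrable_sum prod)
  also have "\<dots> = (\<Sum>i\<in>I. \<Sum>j\<in>I. \<integral>w. f i (w i) * f j (w j) \<partial>PiM I \<nu>)"
    by (intro sum.cong refl Bochner_Integration.integral_sum prod)
  also have "\<dots> = (\<Sum>i\<in>I. \<Sum>j\<in>I. if i = j then \<integral>y. (f i y)\<^sup>2 \<partial>\<nu> i else 0)"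
    by (intro sum.cong refl orth)
  also have "\<dots> = (\<Sum>i\<in>I. \<integral>y. (f i y)\<^sup>2 \<partial>\<nu> i)"
    by (intro sum.cong refl) (simp add: sum.delta')
  finally show "(\<integral>w. (\<Sum>i\<in>I. f i (w i))\<^sup>2 \<partial>PiM I \<nu>) = (\<Sum>i\<in>I. \<integral>y. (f i y)\<^sup>2 \<partial>\<nu> i)" .
qed

lemma (in independent_reals) chebyshev_sum:
  fixes f :: "'i \<Rightarrow> real \<Rightarrow> real"
  assumes "\<And>i. i \<in> I \<Longrightarrow> f i \<in> borel_measurable borel"
    and "\<And>i. i \<in> I \<Longrightarrow> integrable (\<nu> i) (\<lambda>y. (f i y)\<^sup>2)"
    and "\<And>i. i \<in> I \<Longrightarrow> (\<integral>y. f i y \<partial>\<nu> i) = 0"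
    and b: "(\<Sum>i\<in>I. \<integral>y. (f i y)\<^sup>2 \<partial>\<nu> i) \<le> b" and c: "0 < c"
  shows "measure (PiM I \<nu>) {w \<in> space (PiM I \<nu>). c \<le> \<bar>\<Sum>i\<in>I. f i (w i)\<bar>} \<le> b / c\<^sup>2"
proof -
  have sm: "integrable (PiM I \<nu>) (\<lambda>w. (\<Sum>i\<in>I. f i (w i))\<^sup>2)"
    "(\<integral>w. (\<Sum>i\<in>I. f i (w i))\<^sup>2 \<partial>PiM I \<nu>) = (\<Sum>i\<in>I. \<integral>y. (f i y)\<^sup>2 \<partial>\<nu> i)"
    using assms(1-3) by (intro second_moment_sum; blast)+
  have "c \<le> \<bar>x\<bar> \<longleftrightarrow> c\<^sup>2 \<le> x\<^sup>2" for x :: real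
    using c by (metis abs_le_square_iff abs_of_pos)
  then have "measure (PiM I \<nu>) {w \<in> space (PiM I \<nu>). c \<le> \<bar>\<Sum>i\<in>I. f i (w i)\<bar>}
      = measure (PiM I \<nu>) {w \<in> space (PiM I \<nu>). c\<^sup>2 \<le> (\<Sum>i\<in>I. f i (w i))\<^sup>2}" by simp
  also have "\<dots> \<le> (\<integral>w. (\<Sum>i\<in>I. f i (w i))\<^sup>2 \<partial>PiM I \<nu>) / c\<^sup>2"
    using c by (intro integral_Markov_inequality_measure[OF sm(1) sets.top]) auto
  also have "\<dots> \<le> b / c\<^sup>2" unfolding sm(2) using b by (intro divide_right_mono) auto
  finally show ?thesis .
qed

text \<open>The number of positions of the full matrix that share an independent entry.\<close>
definition mult_pos :: "nat \<times> nat \<Rightarrow> real" where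
  "mult_pos p = (if fst p = snd p then 1 else 2)"

lemma sum_over_entries:
  "(\<Sum>i<n. \<Sum>j<n. f (pos i j)) = (\<Sum>p\<in>upper n. mult_pos p * (f p :: real))"
proof -
  let ?S = "{..<n} \<times> {..<n}"
  have fib: "(\<Sum>x\<in>{x \<in> ?S. pos (fst x) (snd x) = p}. f (pos (fst x) (snd x))) = mult_pos p * f p" if "p \<in> upper n" for p
  proof -
    obtain i j where ij: "p = (i, j)" "i \<le> j" "j < n" using \<open>p \<in> upper n\<close> by (auto simp: upper_def)
    have "{x \<in> ?S. pos (fst x) (snd x) = p} = {(i, j), (j, i)}"
      using ij by (auto simp: pos_def min_def max_def split: if_splits)
    then show ?thesis using ij by (cases "i = j") (auto simp: mult_pos_def pos_def)
  qed
  have "(\<Sum>i<n. \<Sum>j<n. f (pos i j)) = (\<Sum>x\<in>?S. f (pos (fst x) (snd x)))"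
    by (simp add: sum.cartesian_product split_beta)
  also have "\<dots> = (\<Sum>p\<in>upper n. \<Sum>x\<in>{x \<in> ?S. pos (fst x) (snd x) = p}. f (pos (fst x) (snd x)))"
    by (rule sum.group[symmetric]) auto
  also have "\<dots> = (\<Sum>p\<in>upper n. mult_pos p * f p)" by (intro sum.cong refl fib)
  finally show ?thesis .
qed

context wigner_entries
begin

text \<open>
  The centred squares of the entries are independent and have variance at most the fourth moment. The bias comes from the
  diagonal alone, where the variance may differ from one, and is of order \<open>1 / n\<close>; the second summand on the
  right covers the small \<open>n\<close> for which it exceeds \<open>\<delta> / 2\<close>.
\<close>
lemma prob_frobenius:
  assumes \<delta>: "0 < \<delta>"
  shows "measure P {w \<in> space P. \<delta> < \<bar>(\<Sum>i<n. \<Sum>j<n. (w (pos i j))\<^sup>2) / (real n)\<^sup>2 - 1\<bar>}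
     \<le> (4 * \<kappa> * (2 / \<delta>)\<^sup>2 + (2 * (\<kappa> + 1) / \<delta>)\<^sup>2) / (real n)\<^sup>2"
proof -
  define v where "v p = (\<integral>y. y\<^sup>2 \<partial>\<nu> p)" for p
  define f where "f p y = mult_pos p * (y\<^sup>2 - v p) / (real n)\<^sup>2" for p y
  have v0: "0 \<le> v p" for p unfolding v_def by simp
  have mean0: "(\<integral>y. f p y \<partial>\<nu> p) = 0" if "p \<in> upper n" for p
    unfolding f_def using integrable_powers(2)[OF that] by (simp add: v_def)
  have fsq: "integrable (\<nu> p) (\<lambda>y. (f p y)\<^sup>2)" "(\<integral>y. (f p y)\<^sup>2 \<partial>\<nu> p) \<le> 4 * \<kappa> / (real n) ^ 4" if p: "p \<in> upper n" for p
  proof -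
    have eq: "(f p y)\<^sup>2 = (mult_pos p)\<^sup>2 / (real n) ^ 4 * (y ^ 4 - 2 * v p * y\<^sup>2 + (v p)\<^sup>2)" for y
    proof -
      have "(f p y)\<^sup>2 = (mult_pos p)\<^sup>2 / ((real n)\<^sup>2)\<^sup>2 * (y\<^sup>2 - v p)\<^sup>2"
        by (simp add: f_def power_divide power_mult_distrib)
      also have "(y\<^sup>2 - v p)\<^sup>2 = y ^ 4 - 2 * v p * y\<^sup>2 + (v p)\<^sup>2"
        by (simp add: power2_diff mult_ac flip: power_mult)
      finally show ?thesis by (simp flip: power_mult)
    qed
    show "integrable (\<nu> p) (\<lambda>y. (f p y)\<^sup>2)"
      unfolding eq using integrable_powers(2)[OF p] fourth[OF p] by simp
    have "(\<integral>y. (f p y)\<^sup>2 \<partial>\<nu> p) = (mult_pos p)\<^sup>2 / (real n) ^ 4 * ((\<integral>y. y ^ 4 \<partial>\<nu> p) - 2 * v p * v p + (v p)\<^sup>2)"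
      unfolding eq v_def using integrable_powers(2)[OF p] fourth[OF p] by simp
    also have "\<dots> \<le> 4 / (real n) ^ 4 * \<kappa>"
    proof (intro mult_mono)
      show "(\<integral>y. y ^ 4 \<partial>\<nu> p) - 2 * v p * v p + (v p)\<^sup>2 \<le> \<kappa>"
        unfolding power2_eq_square using fourth_le[OF p] zero_le_square[of "v p"] by linarith
      show "0 \<le> (\<integral>y. y ^ 4 \<partial>\<nu> p) - 2 * v p * v p + (v p)\<^sup>2"
      proof -
        have "0 \<le> (\<integral>y. (y\<^sup>2 - v p)\<^sup>2 \<partial>\<nu> p)" by simp
        also have "\<dots> = (\<integral>y. y ^ 4 - 2 * v p * y\<^sup>2 + (v p)\<^sup>2 \<partial>\<nu> p)"
          by (intro Bochner_Integration.integral_cong refl) (simp add: power2_diff mult_ac flip: power_mult)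
        also have "\<dots> = (\<integral>y. y ^ 4 \<partial>\<nu> p) - 2 * v p * v p + (v p)\<^sup>2"
          unfolding v_def using integrable_powers(2)[OF p] fourth[OF p] by simp
        finally show ?thesis .
      qed
    qed (auto simp: mult_pos_def divide_right_mono)
    finally show "(\<integral>y. (f p y)\<^sup>2 \<partial>\<nu> p) \<le> 4 * \<kappa> / (real n) ^ 4" by simp
  qed
  have dev: "(\<Sum>i<n. \<Sum>j<n. (w (pos i j))\<^sup>2) / (real n)\<^sup>2 - 1
      = (\<Sum>p\<in>upper n. f p (w p)) + (\<Sum>i<n. v (i, i) - 1) / (real n)\<^sup>2" for w :: "nat \<times> nat \<Rightarrow> real"
  proof -
    have "(\<Sum>p\<in>upper n. mult_pos p * v p) = (\<Sum>i<n. \<Sum>j<n. v (pos i j))"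
      by (rule sum_over_entries[symmetric])
    also have "\<dots> = (\<Sum>i<n. \<Sum>j<n. 1 + of_bool (i = j) * (v (j, j) - 1))"
    proof (intro sum.cong refl)
      fix i j assume "i \<in> {..<n}" "j \<in> {..<n}"
      then show "v (pos i j) = 1 + of_bool (i = j) * (v (j, j) - 1)"
        using second[of "pos i j"] pos_upper[of i n j] by (auto simp: v_def pos_def)
    qed
    also have "\<dots> = (real n)\<^sup>2 + (\<Sum>i<n. v (i, i) - 1)"
      by (simp add: sum.distrib sum_of_bool_mult power2_eq_square)
    finally have vs: "(\<Sum>p\<in>upper n. mult_pos p * v p) = (real n)\<^sup>2 + (\<Sum>i<n. v (i, i) - 1)" .
    have "(\<Sum>p\<in>upper n. f p (w p)) = ((\<Sum>p\<in>upper n. mult_pos p * (w p)\<^sup>2) - (\<Sum>p\<in>upper n. mult_pos p * v p)) / (real n)\<^sup>2"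
      by (simp add: f_def sum_divide_distrib[symmetric] right_diff_distrib sum_subtractf)
    also have "(\<Sum>p\<in>upper n. mult_pos p * (w p)\<^sup>2) = (\<Sum>i<n. \<Sum>j<n. (w (pos i j))\<^sup>2)"
      by (rule sum_over_entries[symmetric])
    finally show ?thesis unfolding vs using n_pos by (simp add: field_simps)
  qed
  have bias: "\<bar>(\<Sum>i<n. v (i, i) - 1) / (real n)\<^sup>2\<bar> \<le> (\<kappa> + 1) / n"
  proof -
    have "\<bar>\<Sum>i<n. v (i, i) - 1\<bar> \<le> (\<Sum>i<n. \<bar>v (i, i) - 1\<bar>)" by (rule sum_abs)
    also have "\<dots> \<le> (\<Sum>i<n. \<kappa> + 1)"
    proof (intro sum_mono)
      fix i assume "i \<in> {..<n}"
      then have "(i, i) \<in> upper n" by (simp add: upper_def)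
      from second_le[OF this] v0[of "(i, i)"] show "\<bar>v (i, i) - 1\<bar> \<le> \<kappa> + 1" unfolding v_def by linarith
    qed
    finally have "\<bar>\<Sum>i<n. v (i, i) - 1\<bar> \<le> real n * (\<kappa> + 1)" by simp
    then show ?thesis using n_pos by (simp add: abs_divide field_simps power2_eq_square)
  qed
  show ?thesis
  proof (cases "(\<kappa> + 1) / n \<le> \<delta> / 2")
    case True
    have "measure P {w \<in> space P. \<delta> < \<bar>(\<Sum>i<n. \<Sum>j<n. (w (pos i j))\<^sup>2) / (real n)\<^sup>2 - 1\<bar>}
        \<le> measure P {w \<in> space P. \<delta> / 2 \<le> \<bar>\<Sum>p\<in>upper n. f p (w p)\<bar>}"
    proof (intro P.finite_measure_mono)
      have "(\<lambda>w. f p (w p)) \<in> borel_measurable P" if "p \<in> upper n" for p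
      proof -
        have "(\<lambda>w. w p) \<in> borel_measurable P"
          using measurable_component_singleton[of p "upper n" \<nu>] that by (simp add: measurable_cong_sets[OF refl sets_borel])
        then show ?thesis unfolding f_def by measurable
      qed
      then show "{w \<in> space P. \<delta> / 2 \<le> \<bar>\<Sum>p\<in>upper n. f p (w p)\<bar>} \<in> sets P" by measurable
      show "{w \<in> space P. \<delta> < \<bar>(\<Sum>i<n. \<Sum>j<n. (w (pos i j))\<^sup>2) / (real n)\<^sup>2 - 1\<bar>}
         \<subseteq> {w \<in> space P. \<delta> / 2 \<le> \<bar>\<Sum>p\<in>upper n. f p (w p)\<bar>}"
      proof safe
        fix w :: "nat \<times> nat \<Rightarrow> real"
        assume "\<delta> < \<bar>(\<Sum>i<n. \<Sum>j<n. (w (pos i j))\<^sup>2) / (real n)\<^sup>2 - 1\<bar>"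
        then show "\<delta> / 2 \<le> \<bar>\<Sum>p\<in>upper n. f p (w p)\<bar>"
          using bias True abs_triangle_ineq[of "\<Sum>p\<in>upper n. f p (w p)" "(\<Sum>i<n. v (i, i) - 1) / (real n)\<^sup>2"]
          unfolding dev by linarith
      qed
    qed
    also have "\<dots> \<le> (4 * \<kappa> / (real n)\<^sup>2) / (\<delta> / 2)\<^sup>2"
    proof (rule chebyshev_sum)
      have "(\<Sum>p\<in>upper n. \<integral>y. (f p y)\<^sup>2 \<partial>\<nu> p) \<le> (\<Sum>p\<in>upper n. 4 * \<kappa> / (real n) ^ 4)"
        by (intro sum_mono fsq)
      also have "\<dots> = real (card (upper n)) * (4 * \<kappa> / (real n) ^ 4)" by simp
      also have "\<dots> \<le> (real n)\<^sup>2 * (4 * \<kappa> / (real n) ^ 4)"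
        using card_upper_le[of n] \<kappa> by (intro mult_right_mono) (auto simp flip: of_nat_power)
      also have "\<dots> = 4 * \<kappa> / (real n)\<^sup>2" using n_pos by (simp add: field_simps flip: power_add)
      finally show "(\<Sum>p\<in>upper n. \<integral>y. (f p y)\<^sup>2 \<partial>\<nu> p) \<le> 4 * \<kappa> / (real n)\<^sup>2" .
    qed (use \<delta> mean0 fsq in \<open>auto simp: f_def[abs_def]\<close>)
    also have "\<dots> = 4 * \<kappa> * (2 / \<delta>)\<^sup>2 / (real n)\<^sup>2" by (simp add: power_divide)
    also have "\<dots> \<le> (4 * \<kappa> * (2 / \<delta>)\<^sup>2 + (2 * (\<kappa> + 1) / \<delta>)\<^sup>2) / (real n)\<^sup>2" by (intro divide_right_mono) auto
    finally show ?thesis .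
  next
    case False
    then have "real n \<le> 2 * (\<kappa> + 1) / \<delta>" using n_pos \<delta> by (simp add: field_simps)
    then have "(real n)\<^sup>2 \<le> (2 * (\<kappa> + 1) / \<delta>)\<^sup>2" by (intro power_mono) auto
    then have "1 \<le> (2 * (\<kappa> + 1) / \<delta>)\<^sup>2 / (real n)\<^sup>2" using n_pos by simp
    also have "\<dots> \<le> (4 * \<kappa> * (2 / \<delta>)\<^sup>2 + (2 * (\<kappa> + 1) / \<delta>)\<^sup>2) / (real n)\<^sup>2"
      using \<kappa> by (intro divide_right_mono) auto
    finally show ?thesis using P.prob_le_1 order_trans by blast
  qed
qed

text \<open>The bound \<open>K * n\<close> on the coefficients is what bounded eigenvalues give.\<close>
lemma prob_linear:
  fixes a :: "nat \<times> nat \<Rightarrow> real" and K :: real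
  assumes \<delta>: "0 < \<delta>" and a: "(\<Sum>i<n. \<Sum>j<n. (a (pos i j))\<^sup>2) \<le> K * n"
  shows "measure P {w \<in> space P. \<delta> < \<bar>(\<Sum>i<n. \<Sum>j<n. a (pos i j) * w (pos i j)) / (n * sqrt n)\<bar>}
     \<le> (2 * \<kappa> * K / \<delta>\<^sup>2) / (real n)\<^sup>2"
proof -
  define f where "f p y = mult_pos p * a p / (n * sqrt n) * y" for p y
  have nn: "(real n * sqrt n)\<^sup>2 = real n ^ 3" by (simp add: power_mult_distrib power3_eq_cube power2_eq_square)
  have eq: "(\<Sum>i<n. \<Sum>j<n. a (pos i j) * w (pos i j)) / (n * sqrt n) = (\<Sum>p\<in>upper n. f p (w p))" for w :: "nat \<times> nat \<Rightarrow> real"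
    using sum_over_entries[of "\<lambda>p. a p * w p" n] by (simp add: f_def sum_divide_distrib mult.assoc)
  have "measure P {w \<in> space P. \<delta> < \<bar>(\<Sum>i<n. \<Sum>j<n. a (pos i j) * w (pos i j)) / (n * sqrt n)\<bar>}
      \<le> measure P {w \<in> space P. \<delta> \<le> \<bar>\<Sum>p\<in>upper n. f p (w p)\<bar>}"
  proof (intro P.finite_measure_mono)
    have "(\<lambda>w. f p (w p)) \<in> borel_measurable P" if "p \<in> upper n" for p
    proof -
      have "(\<lambda>w. w p) \<in> borel_measurable P"
        using measurable_component_singleton[of p "upper n" \<nu>] that by (simp add: measurable_cong_sets[OF refl sets_borel])
      then show ?thesis unfolding f_def by measurable
    qed
    then show "{w \<in> space P. \<delta> \<le> \<bar>\<Sum>p\<in>upper n. f p (w p)\<bar>} \<in> sets P" by measurable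
  qed (auto simp: eq)
  also have "\<dots> \<le> (2 * \<kappa> * K / (real n)\<^sup>2) / \<delta>\<^sup>2"
  proof (rule chebyshev_sum)
    show "f p \<in> borel_measurable borel" for p unfolding f_def[abs_def] by simp
    show "integrable (\<nu> p) (\<lambda>y. (f p y)\<^sup>2)" if "p \<in> upper n" for p
      unfolding f_def power_mult_distrib using integrable_powers(2)[OF that] by simp
    show "(\<integral>y. f p y \<partial>\<nu> p) = 0" if "p \<in> upper n" for p
      unfolding f_def using mean[OF that] by simp
    have "(\<Sum>p\<in>upper n. \<integral>y. (f p y)\<^sup>2 \<partial>\<nu> p) \<le> (\<Sum>p\<in>upper n. 2 * \<kappa> / real n ^ 3 * (mult_pos p * (a p)\<^sup>2))"
    proof (intro sum_mono)
      fix p assume p: "p \<in> upper n"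
      have "(\<integral>y. (f p y)\<^sup>2 \<partial>\<nu> p) = (mult_pos p * a p)\<^sup>2 / real n ^ 3 * (\<integral>y. y\<^sup>2 \<partial>\<nu> p)"
      proof -
        have "(f p y)\<^sup>2 = (mult_pos p * a p)\<^sup>2 / real n ^ 3 * y\<^sup>2" for y
          unfolding f_def power_mult_distrib[of "_ / _" y] power_divide nn ..
        then show ?thesis by simp
      qed
      also have "\<dots> \<le> (mult_pos p * a p)\<^sup>2 / real n ^ 3 * \<kappa>"
        by (intro mult_left_mono second_le[OF p]) auto
      also have "\<dots> \<le> 2 * \<kappa> / real n ^ 3 * (mult_pos p * (a p)\<^sup>2)"
      proof -
        have "(mult_pos p * a p)\<^sup>2 \<le> 2 * (mult_pos p * (a p)\<^sup>2)"
          by (simp add: mult_pos_def power_mult_distrib)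
        then have "(mult_pos p * a p)\<^sup>2 * (\<kappa> / real n ^ 3) \<le> 2 * (mult_pos p * (a p)\<^sup>2) * (\<kappa> / real n ^ 3)"
          using \<kappa> by (intro mult_right_mono) auto
        then show ?thesis by (simp add: mult_ac)
      qed
      finally show "(\<integral>y. (f p y)\<^sup>2 \<partial>\<nu> p) \<le> 2 * \<kappa> / real n ^ 3 * (mult_pos p * (a p)\<^sup>2)" .
    qed
    also have "\<dots> = 2 * \<kappa> / real n ^ 3 * (\<Sum>i<n. \<Sum>j<n. (a (pos i j))\<^sup>2)"
      using sum_over_entries[of "\<lambda>p. (a p)\<^sup>2" n] by (simp add: sum_distrib_left)
    also have "\<dots> \<le> 2 * \<kappa> / real n ^ 3 * (K * n)" using a \<kappa> by (intro mult_left_mono) auto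
    also have "\<dots> = 2 * \<kappa> * K / (real n)\<^sup>2" using n_pos by (simp add: power3_eq_cube power2_eq_square)
    finally show "(\<Sum>p\<in>upper n. \<integral>y. (f p y)\<^sup>2 \<partial>\<nu> p) \<le> 2 * \<kappa> * K / (real n)\<^sup>2" .
  qed (rule \<delta>)
  finally show ?thesis by (simp add: mult_ac)
qed

lemma prob_diagonal:
  assumes \<delta>: "0 < \<delta>"
  shows "measure P {w \<in> space P. \<delta> < (\<Sum>i<n. (w (i, i))\<^sup>2) / (real n)\<^sup>2} \<le> (\<kappa> / \<delta>\<^sup>2) / (real n)\<^sup>2"
proof -
  have diag: "(i, i) \<in> upper n" if "i < n" for i using that by (simp add: upper_def)
  have h: "(\<lambda>y :: real. y ^ 4) \<in> borel_measurable borel" by simp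
  have i4: "integrable P (\<lambda>w. (w (i, i)) ^ 4)" "(\<integral>w. (w (i, i)) ^ 4 \<partial>P) \<le> \<kappa>" if "i < n" for i
    using integrable_component[OF diag[OF that] h] fourth[OF diag[OF that]] fourth_le[OF diag[OF that]] by simp_all
  have i4s: "integrable P (\<lambda>w. (\<Sum>i<n. (w (i, i)) ^ 4) / real n ^ 3)"
    using i4(1) by (intro integrable_divide Bochner_Integration.integrable_sum) auto
  have le: "((\<Sum>i<n. (w (i, i))\<^sup>2) / (real n)\<^sup>2)\<^sup>2 \<le> (\<Sum>i<n. (w (i, i)) ^ 4) / real n ^ 3" for w :: "nat \<times> nat \<Rightarrow> real"
  proof -
    have "(\<Sum>i<n. 1 * (w (i, i))\<^sup>2)\<^sup>2 \<le> (\<Sum>i<n. 1\<^sup>2) * (\<Sum>i<n. ((w (i, i))\<^sup>2)\<^sup>2)"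
      by (rule Cauchy_Schwarz_ineq_sum)
    then have "(\<Sum>i<n. (w (i, i))\<^sup>2)\<^sup>2 \<le> n * (\<Sum>i<n. (w (i, i)) ^ 4)" by (simp flip: power_mult)
    then have "(\<Sum>i<n. (w (i, i))\<^sup>2)\<^sup>2 / (real n) ^ 4 \<le> n * (\<Sum>i<n. (w (i, i)) ^ 4) / (real n) ^ 4"
      by (rule divide_right_mono) simp
    then show ?thesis using n_pos by (simp add: power_divide numeral_eq_Suc flip: power_mult)
  qed
  have "measure P {w \<in> space P. \<delta> < (\<Sum>i<n. (w (i, i))\<^sup>2) / (real n)\<^sup>2}
      \<le> measure P {w \<in> space P. \<delta>\<^sup>2 \<le> (\<Sum>i<n. (w (i, i)) ^ 4) / real n ^ 3}"
  proof (intro P.finite_measure_mono)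
    show "{w \<in> space P. \<delta>\<^sup>2 \<le> (\<Sum>i<n. (w (i, i)) ^ 4) / real n ^ 3} \<in> sets P"
      using i4s by measurable
    show "{w \<in> space P. \<delta> < (\<Sum>i<n. (w (i, i))\<^sup>2) / (real n)\<^sup>2}
       \<subseteq> {w \<in> space P. \<delta>\<^sup>2 \<le> (\<Sum>i<n. (w (i, i)) ^ 4) / real n ^ 3}"
    proof safe
      fix w :: "nat \<times> nat \<Rightarrow> real" assume "\<delta> < (\<Sum>i<n. (w (i, i))\<^sup>2) / (real n)\<^sup>2"
      then have "\<delta>\<^sup>2 \<le> ((\<Sum>i<n. (w (i, i))\<^sup>2) / (real n)\<^sup>2)\<^sup>2" using \<delta> by (intro power_mono) auto
      then show "\<delta>\<^sup>2 \<le> (\<Sum>i<n. (w (i, i)) ^ 4) / real n ^ 3" using le[of w] by linarith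
    qed
  qed
  also have "\<dots> \<le> (\<integral>w. (\<Sum>i<n. (w (i, i)) ^ 4) / real n ^ 3 \<partial>P) / \<delta>\<^sup>2"
    using \<delta> by (intro integral_Markov_inequality_measure[OF i4s sets.top]) (auto intro!: sum_nonneg AE_I2 divide_nonneg_nonneg)
  also have "(\<integral>w. (\<Sum>i<n. (w (i, i)) ^ 4) / real n ^ 3 \<partial>P) = (\<Sum>i<n. \<integral>w. (w (i, i)) ^ 4 \<partial>P) / real n ^ 3"
    using i4(1) by simp
  also have "\<dots> \<le> (\<Sum>i<n. \<kappa>) / real n ^ 3"
    using i4(2) by (intro divide_right_mono sum_mono) auto
  also have "\<dots> = \<kappa> / (real n)\<^sup>2" using n_pos by (simp add: power3_eq_cube power2_eq_square)
  finally show ?thesis using \<delta> by (simp add: divide_right_mono mult_ac)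
qed

end

section \<open>Almost sure limits\<close>

context prob_space
begin

text \<open>
  The probabilities are summable, so that the Borel--Cantelli lemma applies. The bound is only meaningful for \<open>n \<ge>
  1\<close>, since division by zero gives zero.
\<close>
lemma AE_eventually_of_inverse_square:
  assumes E: "\<And>n. n \<ge> 1 \<Longrightarrow> E n \<in> events" and p: "\<And>n :: nat. n \<ge> 1 \<Longrightarrow> prob (E n) \<le> c / (real n)\<^sup>2"
  shows "AE w in M. \<forall>\<^sub>F n in sequentially. w \<notin> E n"
proof -
  define F where "F n = (if n = 0 then {} else E n)" for n :: nat
  have "summable (\<lambda>n. c * (1 / (real n)\<^sup>2))"
    using inverse_power_summable[of 2, where 'a = real] by (intro summable_mult) (simp add: inverse_eq_divide)
  then have "summable (\<lambda>n. prob (F n))"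
    by (rule summable_comparison_test'[where N = 1]) (use p in \<open>auto simp: F_def\<close>)
  then have "AE w in M. \<forall>\<^sub>F n in sequentially. w \<in> space M - F n"
    by (intro borel_cantelli_AE1) (auto simp: F_def E emeasure_eq_measure)
  then show ?thesis
  proof eventually_elim
    case (elim w)
    then have "\<forall>\<^sub>F n in sequentially. w \<in> space M - F n \<and> n \<ge> 1"
      using eventually_ge_at_top[of "1 :: nat"] by eventually_elim auto
    then show ?case by eventually_elim (auto simp: F_def)
  qed
qed

lemma AE_tendsto_zero_of_inverse_square:
  assumes b: "\<And>\<delta>. 0 < \<delta> \<Longrightarrow> \<exists>c. \<forall>n\<ge>1. {w \<in> space M. \<delta> < q n w} \<in> events \<and>
      prob {w \<in> space M. \<delta> < q n w} \<le> c / (real n)\<^sup>2"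
    and q: "\<And>n w. 0 \<le> (q n w :: real)"
  shows "AE w in M. (\<lambda>n. q n w) \<longlonglongrightarrow> 0"
proof -
  have "AE w in M. \<forall>\<^sub>F n in sequentially. w \<notin> {w \<in> space M. 1 / real (Suc k) < q n w}" for k
  proof -
    obtain c where "\<forall>n\<ge>1. {w \<in> space M. 1 / real (Suc k) < q n w} \<in> events \<and>
      prob {w \<in> space M. 1 / real (Suc k) < q n w} \<le> c / (real n)\<^sup>2"
      using b[of "1 / real (Suc k)"] by auto
    then show ?thesis by (intro AE_eventually_of_inverse_square[of _ c]) auto
  qed
  then have "AE w in M. \<forall>k. \<forall>\<^sub>F n in sequentially. w \<notin> {w \<in> space M. 1 / real (Suc k) < q n w}"
    by (simp only: AE_all_countable) blast
  then show ?thesis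
  proof (rule AE_mp, intro AE_I2 impI)
    fix w assume w: "w \<in> space M" and ev: "\<forall>k. \<forall>\<^sub>F n in sequentially. w \<notin> {w \<in> space M. 1 / real (Suc k) < q n w}"
    show "(\<lambda>n. q n w) \<longlonglongrightarrow> 0"
    proof (rule order_tendstoI)
      fix a :: real assume "a < 0"
      then show "\<forall>\<^sub>F n in sequentially. a < q n w"
        using q by (intro always_eventually) (auto intro: less_le_trans)
    next
      fix a :: real assume "0 < a"
      then obtain k where k: "inverse (real (Suc k)) < a" using reals_Archimedean by blast
      from ev have "\<forall>\<^sub>F n in sequentially. w \<notin> {w \<in> space M. 1 / real (Suc k) < q n w}" by blast
      then show "\<forall>\<^sub>F n in sequentially. q n w < a"
        by eventually_elim (use w k in \<open>auto simp: inverse_eq_divide\<close>)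
    qed
  qed
qed

lemma indep_var_const:
  assumes Y: "random_variable N' Y" and c: "c \<in> space N"
  shows "indep_var N (\<lambda>_. c) N' Y"
  unfolding indep_var_distribution_eq
proof (intro conjI)
  show "random_variable N (\<lambda>_. c)" using c by simp
  show "random_variable N' Y" by (rule Y)
  interpret D: prob_space "distr M N (\<lambda>_. c)" by (rule prob_space_distr) (use c in simp)
  interpret D': prob_space "distr M N' Y" by (rule prob_space_distr[OF Y])
  show "distr M N (\<lambda>_. c) \<Otimes>\<^sub>M distr M N' Y = distr M (N \<Otimes>\<^sub>M N') (\<lambda>x. (c, Y x))"
  proof (rule pair_measure_eqI)
    show "sigma_finite_measure (distr M N (\<lambda>_. c))" "sigma_finite_measure (distr M N' Y)" by unfold_locales
    show "sets (distr M N (\<lambda>_. c) \<Otimes>\<^sub>M distr M N' Y) = sets (distr M (N \<Otimes>\<^sub>M N') (\<lambda>x. (c, Y x)))"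
      by (simp cong: sets_pair_measure_cong)
    fix A B assume AB: "A \<in> sets (distr M N (\<lambda>_. c))" "B \<in> sets (distr M N' Y)"
    have "(\<lambda>x. (c, Y x)) -` (A \<times> B) \<inter> space M = (if c \<in> A then Y -` B \<inter> space M else {})" by auto
    then show "emeasure (distr M N (\<lambda>_. c)) A * emeasure (distr M N' Y) B
        = emeasure (distr M (N \<Otimes>\<^sub>M N') (\<lambda>x. (c, Y x))) (A \<times> B)"
      using AB Y c by (auto simp: emeasure_distr emeasure_space_1 vimage_def)
  qed
qed

text \<open>
  If a bound holds for every fixed first component, then it holds for a random one which is independent of the second. This
  is how results for deterministic matrices apply to a random matrix independent of the noise.
\<close>
lemma prob_le_of_sections:
  assumes ind: "indep_var N X N' Y" and E: "E \<in> sets (N \<Otimes>\<^sub>M N')" and c: "0 \<le> c"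
    and le: "\<And>x. x \<in> space N \<Longrightarrow> measure (distr M N' Y) {y \<in> space N'. (x, y) \<in> E} \<le> c"
  shows "prob {w \<in> space M. (X w, Y w) \<in> E} \<le> c"
proof -
  have X: "random_variable N X" and Y: "random_variable N' Y" using ind by (auto dest: indep_var_rv1 indep_var_rv2)
  interpret D: prob_space "distr M N X" by (rule prob_space_distr[OF X])
  interpret D': prob_space "distr M N' Y" by (rule prob_space_distr[OF Y])
  have XY: "(\<lambda>w. (X w, Y w)) \<in> measurable M (N \<Otimes>\<^sub>M N')" using X Y by simp
  have E': "E \<in> sets (distr M N X \<Otimes>\<^sub>M distr M N' Y)" using E by (simp cong: sets_pair_measure_cong)
  have "emeasure M {w \<in> space M. (X w, Y w) \<in> E} = emeasure (distr M (N \<Otimes>\<^sub>M N') (\<lambda>w. (X w, Y w))) E"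
    using emeasure_distr[OF XY E] by (simp add: vimage_def Int_def conj_commute)
  also have "\<dots> = emeasure (distr M N X \<Otimes>\<^sub>M distr M N' Y) E"
    using ind unfolding indep_var_distribution_eq by simp
  also have "\<dots> = (\<integral>\<^sup>+ x. emeasure (distr M N' Y) (Pair x -` E) \<partial>distr M N X)"
    by (rule D'.emeasure_pair_measure_alt[OF E'])
  also have "\<dots> \<le> (\<integral>\<^sup>+ x. ennreal c \<partial>distr M N X)"
  proof (rule nn_integral_mono)
    fix x assume "x \<in> space (distr M N X)"
    then have x: "x \<in> space N" by simp
    have "Pair x -` E = {y \<in> space N'. (x, y) \<in> E}"
      using sets.sets_into_space[OF E] by (auto simp: space_pair_measure)
    then show "emeasure (distr M N' Y) (Pair x -` E) \<le> ennreal c"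
      using le[OF x] by (simp add: D'.emeasure_eq_measure ennreal_leI)
  qed
  also have "\<dots> = ennreal c" using D.emeasure_space_1 by (simp add: X)
  finally show ?thesis using c by (simp add: emeasure_eq_measure)
qed

end

abbreviation upper_space :: "nat \<Rightarrow> (nat \<times> nat \<Rightarrow> real) measure" where
  "upper_space n \<equiv> PiM (upper n) (\<lambda>_. borel)"

definition symm :: "nat \<Rightarrow> (nat \<times> nat \<Rightarrow> real) \<Rightarrow> real mat" where
  "symm n a = mat n n (\<lambda>(i, j). a (pos i j))"

lemma symm_symmetric: "real_symmetric n (symm n a)"
  unfolding real_symmetric_def symm_def by (auto intro!: eq_matI simp: pos_commute)

lemma measurable_upper_component: "p \<in> upper n \<Longrightarrow> (\<lambda>a. a p) \<in> borel_measurable (upper_space n)"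
  by (rule measurable_component_singleton)

text \<open>
  The error in the self-consistent equation for the spectra of \<open>A\<close> and of its perturbation \<open>B\<close>.
\<close>
definition residual :: "nat \<Rightarrow> real \<Rightarrow> complex \<Rightarrow> real mat \<Rightarrow> real mat \<Rightarrow> real" where
  "residual n T z A B = cmod (stieltjes n (eig_desc B) z
      - stieltjes n (eig_desc A) (z + of_real T * stieltjes n (eig_desc B) z))"

lemma residual_nonneg: "0 \<le> residual n T z A B" by (simp add: residual_def)

lemma Im_shifted_ge:
  assumes "0 \<le> T" "0 < Im z" shows "Im z \<le> Im (z + of_real T * stieltjes n x z)"
  using Im_stieltjes_nonneg[OF assms(2), of n x] assms(1) by simp

lemma residual_lipschitz:
  assumes T: "0 \<le> T" and c: "0 < c" "c \<le> Im z" "c \<le> Im z'"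
  shows "residual n T z A B \<le> residual n T z' A B + (2 / c\<^sup>2 + T / c ^ 4) * cmod (z - z')"
proof -
  let ?S = "stieltjes n (eig_desc B)" and ?s = "stieltjes n (eig_desc A)"
  have 1: "cmod (?S z - ?S z') \<le> cmod (z - z') / c\<^sup>2"
    using stieltjes_lipschitz[OF c(1) c(2) c(3), of n "eig_desc B" "eig_desc B"] by simp
  have "cmod (?s (z + of_real T * ?S z) - ?s (z' + of_real T * ?S z'))
      \<le> cmod ((z + of_real T * ?S z) - (z' + of_real T * ?S z')) / c\<^sup>2"
    using stieltjes_lipschitz[OF c(1), of "z + of_real T * ?S z" "z' + of_real T * ?S z'" n "eig_desc A" "eig_desc A"]
      Im_shifted_ge[OF T, of z n "eig_desc B"] Im_shifted_ge[OF T, of z' n "eig_desc B"] c by simp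
  also have "\<dots> \<le> (cmod (z - z') + T * (cmod (z - z') / c\<^sup>2)) / c\<^sup>2"
  proof (intro divide_right_mono)
    have "(z + of_real T * ?S z) - (z' + of_real T * ?S z') = (z - z') + of_real T * (?S z - ?S z')"
      by (simp add: algebra_simps)
    also have "cmod \<dots> \<le> cmod (z - z') + T * cmod (?S z - ?S z')"
      using T by (intro norm_triangle_le add_mono) (auto simp: norm_mult)
    also have "\<dots> \<le> cmod (z - z') + T * (cmod (z - z') / c\<^sup>2)" using 1 T by (intro add_left_mono mult_left_mono)
    finally show "cmod ((z + of_real T * ?S z) - (z' + of_real T * ?S z')) \<le> cmod (z - z') + T * (cmod (z - z') / c\<^sup>2)" .
  qed simp
  finally have 2: "cmod (?s (z + of_real T * ?S z) - ?s (z' + of_real T * ?S z'))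
     \<le> (cmod (z - z') + T * (cmod (z - z') / c\<^sup>2)) / c\<^sup>2" .
  have eq: "?S z - ?s (z + of_real T * ?S z) = (?S z' - ?s (z' + of_real T * ?S z')) + ((?S z - ?S z')
      - (?s (z + of_real T * ?S z) - ?s (z' + of_real T * ?S z')))" by simp
  have "residual n T z A B = cmod ((?S z' - ?s (z' + of_real T * ?S z')) + ((?S z - ?S z')
      - (?s (z + of_real T * ?S z) - ?s (z' + of_real T * ?S z'))))"
    unfolding residual_def by (rule arg_cong[OF eq])
  also have "\<dots> \<le> residual n T z' A B + (cmod (?S z - ?S z')
      + cmod (?s (z + of_real T * ?S z) - ?s (z' + of_real T * ?S z')))"
    unfolding residual_def by (intro order_trans[OF norm_triangle_ineq] add_left_mono norm_triangle_ineq4)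
  also have "\<dots> \<le> residual n T z' A B + (cmod (z - z') / c\<^sup>2 + (cmod (z - z') + T * (cmod (z - z') / c\<^sup>2)) / c\<^sup>2)"
    using 1 2 by (intro add_left_mono add_mono)
  also have "\<dots> = residual n T z' A B + (2 / c\<^sup>2 + T / c ^ 4) * cmod (z - z')"
  proof -
    have "c ^ 4 = c\<^sup>2 * c\<^sup>2" by (simp flip: power_add)
    then show ?thesis by (simp add: add_divide_distrib distrib_right)
  qed
  finally show ?thesis .
qed

text \<open>
  The residual is Lipschitz in \<open>z\<close> uniformly in \<open>n\<close>, away from the real axis. It suffices to know
  convergence on a countable dense set, and so the exceptional null set does not depend on \<open>z\<close>.
\<close>
lemma residual_tendsto_all:
  assumes T: "0 \<le> T" and D: "\<And>X :: complex set. open X \<Longrightarrow> X \<noteq> {} \<Longrightarrow> \<exists>d\<in>D. d \<in> X"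
    and lim: "\<And>d. d \<in> D \<Longrightarrow> 0 < Im d \<Longrightarrow> (\<lambda>n. residual n T d (A n) (B n)) \<longlonglongrightarrow> 0" and z: "0 < Im z"
  shows "(\<lambda>n. residual n T z (A n) (B n)) \<longlonglongrightarrow> 0"
proof (rule order_tendstoI)
  fix a :: real assume "a < 0"
  then show "\<forall>\<^sub>F n in sequentially. a < residual n T z (A n) (B n)"
    using residual_nonneg by (intro always_eventually) (auto intro: less_le_trans)
next
  fix a :: real assume a: "0 < a"
  define c where "c = Im z / 2"
  define L where "L = 2 / c\<^sup>2 + T / c ^ 4"
  define r where "r = min c (a / (2 * (L + 1)))"
  have c: "0 < c" using z by (simp add: c_def)
  have L: "0 \<le> L" using c T by (simp add: L_def)
  have r: "0 < r" using c a L by (simp add: r_def)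
  obtain d where d: "d \<in> D" "d \<in> ball z r" using D[of "ball z r"] r by auto
  have dz: "cmod (z - d) < r" using d(2) by (simp add: dist_norm)
  have "\<bar>Im z - Im d\<bar> \<le> cmod (z - d)" using abs_Im_le_cmod[of "z - d"] by simp
  moreover have "cmod (z - d) < c" using dz by (simp add: r_def)
  ultimately have cd: "c \<le> Im d" unfolding c_def by linarith
  have "L * cmod (z - d) \<le> L * (a / (2 * (L + 1)))"
    using dz L by (intro mult_left_mono) (auto simp: r_def)
  also have "\<dots> \<le> a / 2" using L a by (simp add: field_simps)
  finally have La: "L * cmod (z - d) \<le> a / 2" .
  have "(\<lambda>n. residual n T d (A n) (B n)) \<longlonglongrightarrow> 0" using d(1) cd c by (intro lim) auto
  then have "\<forall>\<^sub>F n in sequentially. residual n T d (A n) (B n) < a / 2"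
    by (rule order_tendstoD) (use a in simp)
  then show "\<forall>\<^sub>F n in sequentially. residual n T z (A n) (B n) < a"
  proof eventually_elim
    case (elim n)
    then show ?case using residual_lipschitz[OF T c _ cd, of z n "A n" "B n"] La z
      unfolding L_def[symmetric] by (simp add: c_def)
  qed
qed

text \<open>
  The random vector \<open>W\<close> has the distribution of independent entries as above. The measures \<open>\<nu>\<close>
  may depend on \<open>n\<close>, but the moment bound \<open>\<kappa>\<close> does not.
\<close>
definition wigner_law :: "nat \<Rightarrow> real \<Rightarrow> 'w measure \<Rightarrow> ('w \<Rightarrow> nat \<times> nat \<Rightarrow> real) \<Rightarrow> bool" where
  "wigner_law n \<kappa> M W \<longleftrightarrow> W \<in> measurable M (upper_space n) \<and>
     (\<exists>\<nu>. wigner_entries n \<nu> \<kappa> \<and> distr M (upper_space n) W = PiM (upper n) \<nu>)"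

lemma measurable_residual:
  assumes z: "0 < Im z" and T: "0 \<le> T"
  shows "(\<lambda>x. residual n T z (symm n (fst x)) (perturbed n (symm n (fst x)) t (snd x)))
    \<in> borel_measurable (upper_space n \<Otimes>\<^sub>M upper_space n)"
proof -
  let ?N = "upper_space n \<Otimes>\<^sub>M upper_space n"
  have c: "(\<lambda>x. fst x (pos i j)) \<in> borel_measurable ?N" "(\<lambda>x. snd x (pos i j)) \<in> borel_measurable ?N"
    if "i < n" "j < n" for i j
    using measurable_compose[OF measurable_fst measurable_upper_component[OF pos_upper[OF that]]]
      measurable_compose[OF measurable_snd measurable_upper_component[OF pos_upper[OF that]]] by auto
  have A: "(\<lambda>x. symm n (fst x) $$ (i, j)) \<in> borel_measurable ?N" if "i < n" "j < n" for i j
    using c[OF that] that by (simp add: symm_def)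
  have B: "(\<lambda>x. perturbed n (symm n (fst x)) t (snd x) $$ (i, j)) \<in> borel_measurable ?N" if "i < n" "j < n" for i j
    using c[OF that] that by (simp add: symm_def perturbed_def)
  have S: "(\<lambda>x. stieltjes n (eig_desc (perturbed n (symm n (fst x)) t (snd x))) z) \<in> borel_measurable ?N"
    by (rule borel_measurable_stieltjes[OF B]) (use z in \<open>auto intro: perturbed_symmetric symm_symmetric\<close>)
  have zS: "(\<lambda>x. z + of_real T * stieltjes n (eig_desc (perturbed n (symm n (fst x)) t (snd x))) z) \<in> borel_measurable ?N"
    by (intro borel_measurable_add borel_measurable_const borel_measurable_times S)
  have s: "(\<lambda>x. stieltjes n (eig_desc (symm n (fst x))) (z + of_real T * stieltjes n (eig_desc (perturbed n (symm n (fst x)) t (snd x))) z)) \<in> borel_measurable ?N"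
  proof (rule borel_measurable_stieltjes[OF A zS])
    show "Im (z + of_real T * stieltjes n (eig_desc (perturbed n (symm n (fst x)) t (snd x))) z) \<noteq> 0" for x
      using Im_shifted_ge[OF T z, of n "eig_desc (perturbed n (symm n (fst x)) t (snd x))"] z by linarith
  qed (auto intro: symm_symmetric)
  show ?thesis unfolding residual_def using S s by measurable
qed

context prob_space
begin

theorem AE_residual_tendsto_zero:
  assumes T: "\<sigma>\<^sup>2 = T" and ind: "\<And>n. n \<ge> 1 \<Longrightarrow> indep_var (upper_space n) (X n) (upper_space n) (W n)"
    and W: "\<And>n. n \<ge> 1 \<Longrightarrow> wigner_law n \<kappa> M (W n)"
  shows "AE w in M. \<forall>z. 0 < Im z \<longrightarrow>
    (\<lambda>n. residual n T z (symm n (X n w)) (perturbed n (symm n (X n w)) (\<sigma> / sqrt n) (W n w))) \<longlonglongrightarrow> 0"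
proof -
  have T0: "0 \<le> T" using T by auto
  have one: "AE w in M. (\<lambda>n. residual n T z (symm n (X n w)) (perturbed n (symm n (X n w)) (\<sigma> / sqrt n) (W n w))) \<longlonglongrightarrow> 0"
    if z: "0 < Im z" for z
  proof (rule AE_tendsto_zero_of_inverse_square)
    fix \<delta> :: real assume \<delta>: "0 < \<delta>"
    define g where "g = 1 / Im z"
    define V where "V = T * (8 * \<kappa> * g ^ 4 + 320 * \<kappa>\<^sup>2 * T * g ^ 6)"
    define D where "D = 24 * \<kappa> * T * sqrt T * g ^ 4 + (2 * \<kappa> + 3) * T * g ^ 3 + T * g\<^sup>2 * sqrt V"
    define c where "c = V * (2 * (1 + T * g\<^sup>2) / \<delta>)\<^sup>2 + (2 * D / \<delta>) ^ 4"
    show "\<exists>c. \<forall>n\<ge>1. {w \<in> space M. \<delta> < residual n T z (symm n (X n w)) (perturbed n (symm n (X n w)) (\<sigma> / sqrt n) (W n w))} \<in> events \<and>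
      prob {w \<in> space M. \<delta> < residual n T z (symm n (X n w)) (perturbed n (symm n (X n w)) (\<sigma> / sqrt n) (W n w))} \<le> c / (real n)\<^sup>2"
    proof (intro exI[of _ c] allI impI)
      fix n :: nat assume n: "n \<ge> 1"
      let ?N = "upper_space n"
      define E where "E = {x \<in> space (?N \<Otimes>\<^sub>M ?N). \<delta> < residual n T z (symm n (fst x)) (perturbed n (symm n (fst x)) (\<sigma> / sqrt n) (snd x))}"
      have E: "E \<in> sets (?N \<Otimes>\<^sub>M ?N)"
        unfolding E_def using measurable_residual[OF z T0, of n "\<sigma> / sqrt n"] by measurable
      have XW: "random_variable ?N (X n)" "random_variable ?N (W n)"
        using ind[OF n] by (auto dest: indep_var_rv1 indep_var_rv2)
      have eq: "{w \<in> space M. \<delta> < residual n T z (symm n (X n w)) (perturbed n (symm n (X n w)) (\<sigma> / sqrt n) (W n w))}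
         = {w \<in> space M. (X n w, W n w) \<in> E}"
        using measurable_space[OF XW(1)] measurable_space[OF XW(2)] by (auto simp: E_def space_pair_measure)
      note sections = prob_le_of_sections[OF ind[OF n] E]
      obtain \<nu> where \<nu>: "wigner_entries n \<nu> \<kappa>" "distr M ?N (W n) = PiM (upper n) \<nu>"
        using W[OF n] by (auto simp: wigner_law_def)
      interpret wigner_entries n \<nu> \<kappa> by (rule \<nu>(1))
      have sp: "space (PiM (upper n) \<nu>) = space ?N" by (simp add: space_PiM)
      have "measure (PiM (upper n) \<nu>) {y \<in> space ?N. (x, y) \<in> E} \<le> c / (real n)\<^sup>2" if x: "x \<in> space ?N" for x
      proof -
        interpret deformed_wigner n \<nu> \<kappa> "symm n x" "\<sigma> / sqrt n" z g
          by unfold_locales (use z in \<open>auto simp: symm_symmetric g_def\<close>)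
        have t: "(\<sigma> / sqrt n)\<^sup>2 * n = T" using n T by (simp add: power_divide)
        have "{y \<in> space ?N. (x, y) \<in> E} = {w \<in> space P. \<delta> < cmod (s w - stieltjes n (eig_desc (symm n x)) (z + of_real T * s w))}"
          using x by (auto simp: E_def sp space_pair_measure residual_def s_def B_def)
        then show ?thesis
          using self_consistency_probability[OF t \<delta>] unfolding c_def D_def V_def by simp
      qed
      moreover have "0 \<le> c / (real n)\<^sup>2"
        using T0 \<kappa> z unfolding c_def V_def g_def by (intro divide_nonneg_nonneg add_nonneg_nonneg mult_nonneg_nonneg) auto
      ultimately have "measure M {w \<in> space M. (X n w, W n w) \<in> E} \<le> c / (real n)\<^sup>2"
        by (intro sections) (auto simp: \<nu>(2))
      moreover have "{w \<in> space M. (X n w, W n w) \<in> E} \<in> sets M"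
        using measurable_sets[OF measurable_Pair[OF XW] E] by (simp add: vimage_def Int_def conj_commute)
      ultimately show "{w \<in> space M. \<delta> < residual n T z (symm n (X n w)) (perturbed n (symm n (X n w)) (\<sigma> / sqrt n) (W n w))} \<in> sets M \<and>
        measure M {w \<in> space M. \<delta> < residual n T z (symm n (X n w)) (perturbed n (symm n (X n w)) (\<sigma> / sqrt n) (W n w))} \<le> c / (real n)\<^sup>2"
        unfolding eq by simp
    qed
  qed (rule residual_nonneg)
  obtain D :: "complex set" where D: "countable D" "\<And>X. open X \<Longrightarrow> X \<noteq> {} \<Longrightarrow> \<exists>d\<in>D. d \<in> X"
    by (rule countable_dense_setE) auto
  have "AE w in M. \<forall>d\<in>{d \<in> D. 0 < Im d}. (\<lambda>n. residual n T d (symm n (X n w)) (perturbed n (symm n (X n w)) (\<sigma> / sqrt n) (W n w))) \<longlonglongrightarrow> 0"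
    using D(1) one by (subst AE_ball_countable) auto
  then show ?thesis
  proof eventually_elim
    case (elim w)
    show ?case
    proof (intro allI impI)
      fix z assume z: "0 < Im z"
      show "(\<lambda>n. residual n T z (symm n (X n w)) (perturbed n (symm n (X n w)) (\<sigma> / sqrt n) (W n w))) \<longlonglongrightarrow> 0"
      proof (rule residual_tendsto_all[OF T0 _ _ z, where D = D])
        show "\<exists>d\<in>D. d \<in> X" if "open X" "X \<noteq> {}" for X using D(2)[OF that] .
        show "(\<lambda>n. residual n T d (symm n (X n w)) (perturbed n (symm n (X n w)) (\<sigma> / sqrt n) (W n w))) \<longlonglongrightarrow> 0"
          if "d \<in> D" "0 < Im d" for d
          using elim that by blast
      qed
    qed
  qed
qed

lemma wigner_law_prob:
  assumes W: "wigner_law n \<kappa> M W" and E: "{y \<in> space (upper_space n). Q y} \<in> sets (upper_space n)"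
    and le: "\<And>\<nu>. wigner_entries n \<nu> \<kappa> \<Longrightarrow> measure (PiM (upper n) \<nu>) {y \<in> space (PiM (upper n) \<nu>). Q y} \<le> c"
  shows "{w \<in> space M. Q (W w)} \<in> events" "prob {w \<in> space M. Q (W w)} \<le> c"
proof -
  have Wm: "random_variable (upper_space n) W" using W by (simp add: wigner_law_def)
  obtain \<nu> where \<nu>: "wigner_entries n \<nu> \<kappa>" "distr M (upper_space n) W = PiM (upper n) \<nu>"
    using W by (auto simp: wigner_law_def)
  interpret wigner_entries n \<nu> \<kappa> by (rule \<nu>(1))
  have sp: "space (PiM (upper n) \<nu>) = space (upper_space n)" by (simp add: space_PiM)
  have eq: "W -` {y \<in> space (upper_space n). Q y} \<inter> space M = {w \<in> space M. Q (W w)}"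
    using measurable_space[OF Wm] by auto
  show "{w \<in> space M. Q (W w)} \<in> sets M" using measurable_sets[OF Wm E] unfolding eq .
  have "measure M {w \<in> space M. Q (W w)} = measure (distr M (upper_space n) W) {y \<in> space (upper_space n). Q y}"
    using measure_distr[OF Wm E] unfolding eq by simp
  then show "measure M {w \<in> space M. Q (W w)} \<le> c" using le[OF \<nu>(1)] unfolding \<nu>(2) sp by simp
qed

lemma measurable_entry_sums:
  shows "(\<lambda>w. \<Sum>i<n. \<Sum>j<n. (w (pos i j))\<^sup>2) \<in> borel_measurable (upper_space n)"
    "(\<lambda>w. \<Sum>i<n. (w (i, i))\<^sup>2) \<in> borel_measurable (upper_space n)"
proof -
  show "(\<lambda>w. \<Sum>i<n. \<Sum>j<n. (w (pos i j))\<^sup>2) \<in> borel_measurable (upper_space n)"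
    by (intro borel_measurable_sum borel_measurable_power measurable_upper_component) auto
  show "(\<lambda>w. \<Sum>i<n. (w (i, i))\<^sup>2) \<in> borel_measurable (upper_space n)"
    by (intro borel_measurable_sum borel_measurable_power measurable_upper_component) (simp add: upper_def)
qed

theorem AE_frobenius:
  assumes W: "\<And>n. n \<ge> 1 \<Longrightarrow> wigner_law n \<kappa> M (W n)"
  shows "AE w in M. (\<lambda>n. \<bar>(\<Sum>i<n. \<Sum>j<n. (W n w (pos i j))\<^sup>2) / (real n)\<^sup>2 - 1\<bar>) \<longlonglongrightarrow> 0"
proof (rule AE_tendsto_zero_of_inverse_square)
  fix \<delta> :: real assume \<delta>: "0 < \<delta>"
  define c where "c = 4 * \<kappa> * (2 / \<delta>)\<^sup>2 + (2 * (\<kappa> + 1) / \<delta>)\<^sup>2"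
  have "{w \<in> space M. \<delta> < \<bar>(\<Sum>i<n. \<Sum>j<n. (W n w (pos i j))\<^sup>2) / (real n)\<^sup>2 - 1\<bar>} \<in> events \<and>
     prob {w \<in> space M. \<delta> < \<bar>(\<Sum>i<n. \<Sum>j<n. (W n w (pos i j))\<^sup>2) / (real n)\<^sup>2 - 1\<bar>} \<le> c / (real n)\<^sup>2"
    if n: "n \<ge> 1" for n
  proof -
    have m: "{y \<in> space (upper_space n). \<delta> < \<bar>(\<Sum>i<n. \<Sum>j<n. (y (pos i j))\<^sup>2) / (real n)\<^sup>2 - 1\<bar>} \<in> sets (upper_space n)"
      using measurable_entry_sums(1)[of n] by measurable
    show ?thesis
      using wigner_law_prob[OF W[OF n] m, of "c / (real n)\<^sup>2"] wigner_entries.prob_frobenius[OF _ \<delta>] unfolding c_def by blast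
  qed
  then show "\<exists>c. \<forall>n\<ge>1. {w \<in> space M. \<delta> < \<bar>(\<Sum>i<n. \<Sum>j<n. (W n w (pos i j))\<^sup>2) / (real n)\<^sup>2 - 1\<bar>} \<in> events \<and>
     prob {w \<in> space M. \<delta> < \<bar>(\<Sum>i<n. \<Sum>j<n. (W n w (pos i j))\<^sup>2) / (real n)\<^sup>2 - 1\<bar>} \<le> c / (real n)\<^sup>2" by blast
qed simp

theorem AE_diagonal:
  assumes W: "\<And>n. n \<ge> 1 \<Longrightarrow> wigner_law n \<kappa> M (W n)"
  shows "AE w in M. (\<lambda>n. (\<Sum>i<n. (W n w (i, i))\<^sup>2) / (real n)\<^sup>2) \<longlonglongrightarrow> 0"
proof (rule AE_tendsto_zero_of_inverse_square)
  fix \<delta> :: real assume \<delta>: "0 < \<delta>"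
  have "{w \<in> space M. \<delta> < (\<Sum>i<n. (W n w (i, i))\<^sup>2) / (real n)\<^sup>2} \<in> events \<and>
     prob {w \<in> space M. \<delta> < (\<Sum>i<n. (W n w (i, i))\<^sup>2) / (real n)\<^sup>2} \<le> (\<kappa> / \<delta>\<^sup>2) / (real n)\<^sup>2"
    if n: "n \<ge> 1" for n
  proof -
    have m: "{y \<in> space (upper_space n). \<delta> < (\<Sum>i<n. (y (i, i))\<^sup>2) / (real n)\<^sup>2} \<in> sets (upper_space n)"
      using measurable_entry_sums(2)[of n] by measurable
    show ?thesis
      using wigner_law_prob[OF W[OF n] m, of "(\<kappa> / \<delta>\<^sup>2) / (real n)\<^sup>2"] wigner_entries.prob_diagonal[OF _ \<delta>] by blast
  qed
  then show "\<exists>c. \<forall>n\<ge>1. {w \<in> space M. \<delta> < (\<Sum>i<n. (W n w (i, i))\<^sup>2) / (real n)\<^sup>2} \<in> events \<and>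
     prob {w \<in> space M. \<delta> < (\<Sum>i<n. (W n w (i, i))\<^sup>2) / (real n)\<^sup>2} \<le> c / (real n)\<^sup>2" by blast
qed (simp add: sum_nonneg)

text \<open>
  The indicator restricts to the event on which the coefficients are bounded as required; for the matrices of interest this
  event occurs for all large \<open>n\<close>.
\<close>
theorem AE_linear:
  fixes X W :: "nat \<Rightarrow> 'a \<Rightarrow> nat \<times> nat \<Rightarrow> real" and K :: real
  assumes ind: "\<And>n. n \<ge> 1 \<Longrightarrow> indep_var (upper_space n) (X n) (upper_space n) (W n)"
    and W: "\<And>n. n \<ge> 1 \<Longrightarrow> wigner_law n \<kappa> M (W n)" and K: "0 \<le> K"
  shows "AE w in M. (\<lambda>n. of_bool ((\<Sum>i<n. \<Sum>j<n. (X n w (pos i j))\<^sup>2) \<le> K * n) *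
     \<bar>(\<Sum>i<n. \<Sum>j<n. X n w (pos i j) * W n w (pos i j)) / (n * sqrt n)\<bar>) \<longlonglongrightarrow> 0"
proof (rule AE_tendsto_zero_of_inverse_square)
  fix \<delta> :: real assume \<delta>: "0 < \<delta>"
  define q where "q n x y = of_bool ((\<Sum>i<n. \<Sum>j<n. (x (pos i j))\<^sup>2) \<le> K * n) *
     \<bar>(\<Sum>i<n. \<Sum>j<n. x (pos i j) * y (pos i j)) / (n * sqrt n)\<bar>" for n and x y :: "nat \<times> nat \<Rightarrow> real"
  define c where "c = 2 * \<bar>\<kappa>\<bar> * K / \<delta>\<^sup>2"
  have "{w \<in> space M. \<delta> < q n (X n w) (W n w)} \<in> events \<and> prob {w \<in> space M. \<delta> < q n (X n w) (W n w)} \<le> c / (real n)\<^sup>2"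
    if n: "n \<ge> 1" for n
  proof -
    let ?N = "upper_space n"
    define E where "E = {x \<in> space (?N \<Otimes>\<^sub>M ?N). \<delta> < q n (fst x) (snd x)}"
    have m: "(\<lambda>x. fst x (pos i j)) \<in> borel_measurable (?N \<Otimes>\<^sub>M ?N)" "(\<lambda>x. snd x (pos i j)) \<in> borel_measurable (?N \<Otimes>\<^sub>M ?N)"
      if "i < n" "j < n" for i j
      using measurable_compose[OF measurable_fst measurable_upper_component[OF pos_upper[OF that]]]
        measurable_compose[OF measurable_snd measurable_upper_component[OF pos_upper[OF that]]] by auto
    have "(\<lambda>x. \<Sum>i<n. \<Sum>j<n. (fst x (pos i j))\<^sup>2) \<in> borel_measurable (?N \<Otimes>\<^sub>M ?N)"
      "(\<lambda>x. \<Sum>i<n. \<Sum>j<n. fst x (pos i j) * snd x (pos i j)) \<in> borel_measurable (?N \<Otimes>\<^sub>M ?N)"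
      by (intro borel_measurable_sum borel_measurable_power borel_measurable_times m; simp)+
    then have E: "E \<in> sets (?N \<Otimes>\<^sub>M ?N)" unfolding E_def q_def by measurable
    have XW: "random_variable ?N (X n)" "random_variable ?N (W n)"
      using ind[OF n] by (auto dest: indep_var_rv1 indep_var_rv2)
    have eq: "{w \<in> space M. \<delta> < q n (X n w) (W n w)} = {w \<in> space M. (X n w, W n w) \<in> E}"
      using measurable_space[OF XW(1)] measurable_space[OF XW(2)] by (auto simp: E_def space_pair_measure)
    note sections = prob_le_of_sections[OF ind[OF n] E]
    obtain \<nu> where \<nu>: "wigner_entries n \<nu> \<kappa>" "distr M ?N (W n) = PiM (upper n) \<nu>"
      using W[OF n] by (auto simp: wigner_law_def)
    interpret wigner_entries n \<nu> \<kappa> by (rule \<nu>(1))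
    have sp: "space (PiM (upper n) \<nu>) = space ?N" by (simp add: space_PiM)
    have c0: "0 \<le> c / (real n)\<^sup>2" using K by (simp add: c_def)
    have "measure (PiM (upper n) \<nu>) {y \<in> space ?N. (x, y) \<in> E} \<le> c / (real n)\<^sup>2" if x: "x \<in> space ?N" for x
    proof (cases "(\<Sum>i<n. \<Sum>j<n. (x (pos i j))\<^sup>2) \<le> K * n")
      case True
      have "{y \<in> space ?N. (x, y) \<in> E} = {w \<in> space P. \<delta> < \<bar>(\<Sum>i<n. \<Sum>j<n. x (pos i j) * w (pos i j)) / (n * sqrt n)\<bar>}"
        using x True by (auto simp: E_def sp space_pair_measure q_def)
      then show ?thesis using prob_linear[OF \<delta> True] \<kappa> unfolding c_def by simp
    next
      case False
      then have emp: "{y \<in> space ?N. (x, y) \<in> E} = {}" using \<delta> by (auto simp: E_def q_def)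
      show ?thesis unfolding emp using c0 by simp
    qed
    then have "measure M {w \<in> space M. (X n w, W n w) \<in> E} \<le> c / (real n)\<^sup>2"
      by (intro sections c0) (auto simp: \<nu>(2))
    moreover have "{w \<in> space M. (X n w, W n w) \<in> E} \<in> sets M"
      using measurable_sets[OF measurable_Pair[OF XW] E] by (simp add: vimage_def Int_def conj_commute)
    ultimately show ?thesis unfolding eq by simp
  qed
  then show "\<exists>c. \<forall>n\<ge>1. {w \<in> space M. \<delta> < of_bool ((\<Sum>i<n. \<Sum>j<n. (X n w (pos i j))\<^sup>2) \<le> K * n) *
     \<bar>(\<Sum>i<n. \<Sum>j<n. X n w (pos i j) * W n w (pos i j)) / (n * sqrt n)\<bar>} \<in> events \<and>
     prob {w \<in> space M. \<delta> < of_bool ((\<Sum>i<n. \<Sum>j<n. (X n w (pos i j))\<^sup>2) \<le> K * n) *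
     \<bar>(\<Sum>i<n. \<Sum>j<n. X n w (pos i j) * W n w (pos i j)) / (n * sqrt n)\<bar>} \<le> c / (real n)\<^sup>2"
    unfolding q_def by blast
qed simp

end

section \<open>Test functions generated by Stieltjes transforms\<close>

definition avg :: "nat \<Rightarrow> (nat \<Rightarrow> real) \<Rightarrow> real" where
  "avg n f = (\<Sum>i<n. f i) / real n"

lemma avg_add: "avg n (\<lambda>i. f i + g i) = avg n f + avg n g"
  by (simp add: avg_def sum.distrib add_divide_distrib)

lemma avg_diff: "avg n (\<lambda>i. f i - g i) = avg n f - avg n g"
  by (simp add: avg_def sum_subtractf diff_divide_distrib)

lemma avg_cmult: "avg n (\<lambda>i. c * f i) = c * avg n f"
  by (simp add: avg_def sum_distrib_left[symmetric])

lemma avg_mono: "(\<And>i. i < n \<Longrightarrow> f i \<le> g i) \<Longrightarrow> avg n f \<le> avg n g"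
  unfolding avg_def by (intro divide_right_mono sum_mono) auto

lemma avg_cong: "(\<And>i. i < n \<Longrightarrow> f i = g i) \<Longrightarrow> avg n f = avg n g"
  unfolding avg_def by (intro arg_cong2[where f = "(/)"] sum.cong) auto

lemma avg_nonneg: "(\<And>i. i < n \<Longrightarrow> 0 \<le> f i) \<Longrightarrow> 0 \<le> avg n f"
  unfolding avg_def by (intro divide_nonneg_nonneg sum_nonneg) auto

lemma abs_avg_le: "\<bar>avg n f\<bar> \<le> avg n (\<lambda>i. \<bar>f i\<bar>)"
  unfolding avg_def abs_divide by (simp add: divide_right_mono sum_abs)

lemma avg_const_le: "0 \<le> c \<Longrightarrow> avg n (\<lambda>_. c) \<le> c"
  by (cases "n = 0") (simp_all add: avg_def)

text \<open>
  Null sequences in the form in which estimates arrive, with weak inequalities and eventual validity.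
\<close>
lemma tendsto_zero_by_eps:
  fixes f :: "nat \<Rightarrow> real"
  assumes "\<And>e. 0 < e \<Longrightarrow> \<forall>\<^sub>F n in sequentially. \<bar>f n\<bar> \<le> e"
  shows "f \<longlonglongrightarrow> 0"
proof (rule tendstoI)
  fix e :: real assume "0 < e"
  then have "\<forall>\<^sub>F n in sequentially. \<bar>f n\<bar> \<le> e / 2" using assms[of "e / 2"] by simp
  then show "\<forall>\<^sub>F n in sequentially. dist (f n) 0 < e"
    by eventually_elim (use \<open>0 < e\<close> in simp)
qed

lemma eventually_abs_le:
  fixes f :: "nat \<Rightarrow> real"
  assumes "f \<longlonglongrightarrow> 0" "0 < e" shows "\<forall>\<^sub>F n in sequentially. \<bar>f n\<bar> \<le> e"
proof -
  have "\<forall>\<^sub>F n in sequentially. dist (f n) 0 < e" using assms by (rule tendstoD)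
  then show ?thesis by eventually_elim simp
qed

text \<open>
  A sequence of pairs of samples with bounded second moments; row \<open>n\<close> has the entries with index below
  \<open>n\<close>. Test functions are called good if the averages over the two samples have the same asymptotic behaviour;
  there need not be any limit.
\<close>
locale two_samples =
  fixes x y :: "nat \<Rightarrow> nat \<Rightarrow> real" and M :: real
  assumes M0: "0 \<le> M"
    and x2: "\<forall>\<^sub>F n in sequentially. avg n (\<lambda>i. (x n i)\<^sup>2) \<le> M"
    and y2: "\<forall>\<^sub>F n in sequentially. avg n (\<lambda>i. (y n i)\<^sup>2) \<le> M"
begin

definition gap :: "(real \<Rightarrow> real) \<Rightarrow> nat \<Rightarrow> real" where
  "gap h n = avg n (\<lambda>i. h (x n i)) - avg n (\<lambda>i. h (y n i))"

definition good :: "(real \<Rightarrow> real) \<Rightarrow> bool" where "good h \<longleftrightarrow> gap h \<longlonglongrightarrow> 0"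

lemma good_add: "good h \<Longrightarrow> good k \<Longrightarrow> good (\<lambda>x. h x + k x)"
  unfolding good_def gap_def avg_add by (drule (1) tendsto_add) (simp add: algebra_simps)

lemma good_cmult: "good h \<Longrightarrow> good (\<lambda>x. c * h x)"
  unfolding good_def gap_def avg_cmult by (drule tendsto_mult_left[of _ _ _ c]) (simp add: algebra_simps)

lemma good_diff: "good h \<Longrightarrow> good k \<Longrightarrow> good (\<lambda>x. h x - k x)"
  using good_add[of h "\<lambda>x. (- 1) * k x"] good_cmult[of k "- 1"] by simp

lemma good_const: "good (\<lambda>_. c)"
  unfolding good_def gap_def by simp

lemma good_sum: "(\<And>j. j \<in> J \<Longrightarrow> good (h j)) \<Longrightarrow> good (\<lambda>x. \<Sum>j\<in>J. h j x)"
  by (induction J rule: infinite_finite_induct) (auto intro: good_add good_const)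

text \<open>
  Approximation up to \<open>e * (1 + u\<^sup>2)\<close> suffices, because the second moments are bounded. The quadratic
  growth is what allows bounded functions to be approximated by functions which have another limit at infinity.
\<close>
lemma good_approx:
  assumes "\<And>e. 0 < e \<Longrightarrow> \<exists>k. good k \<and> (\<forall>u. \<bar>h u - k u\<bar> \<le> e * (1 + u\<^sup>2))"
  shows "good h"
  unfolding good_def
proof (rule tendsto_zero_by_eps)
  fix e :: real assume e: "0 < e"
  define d where "d = e / (3 * (1 + M))"
  have d: "0 < d" using e M0 by (simp add: d_def)
  obtain k where k: "good k" "\<And>u. \<bar>h u - k u\<bar> \<le> d * (1 + u\<^sup>2)" using assms[OF d] by blast
  have "1 + M \<noteq> 0" using M0 by linarith
  then have dM: "d * (1 + M) = e / 3" by (simp add: d_def field_simps)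
  have near: "\<bar>avg n (\<lambda>i. h (v i)) - avg n (\<lambda>i. k (v i))\<bar> \<le> e / 3" if "avg n (\<lambda>i. (v i)\<^sup>2) \<le> M" for n v
  proof -
    have "\<bar>avg n (\<lambda>i. h (v i)) - avg n (\<lambda>i. k (v i))\<bar> \<le> avg n (\<lambda>i. \<bar>h (v i) - k (v i)\<bar>)"
      unfolding avg_diff[symmetric] by (rule abs_avg_le)
    also have "\<dots> \<le> avg n (\<lambda>i. d * (1 + (v i)\<^sup>2))" by (intro avg_mono k)
    also have "\<dots> = d * (avg n (\<lambda>i. 1) + avg n (\<lambda>i. (v i)\<^sup>2))" by (simp only: avg_cmult avg_add)
    also have "\<dots> \<le> d * (1 + M)" using d that avg_const_le[of 1 n] by (intro mult_left_mono add_mono) auto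
    finally show ?thesis using dM by simp
  qed
  have "\<forall>\<^sub>F n in sequentially. \<bar>gap k n\<bar> \<le> e / 3"
    using k(1) e unfolding good_def by (intro eventually_abs_le) auto
  with x2 y2 show "\<forall>\<^sub>F n in sequentially. \<bar>gap h n\<bar> \<le> e"
  proof eventually_elim
    case (elim n)
    show ?case using near[OF elim(1)] near[OF elim(2)] elim(3) unfolding gap_def by linarith
  qed
qed

end

text \<open>
  Closeness is required on the imaginary axis only, and only above \<open>c\<close>. This is all that the self-consistent
  equation can provide.
\<close>
locale close_stieltjes = two_samples +
  fixes c :: real
  assumes c: "0 < c"
    and close: "\<And>e. c \<le> e \<Longrightarrow> (\<lambda>n. stieltjes n (x n) (\<i> * of_real e) - stieltjes n (y n) (\<i> * of_real e)) \<longlonglongrightarrow> 0"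
begin

definition u :: "real \<Rightarrow> real" where "u v = 1 / (v\<^sup>2 + c\<^sup>2)"

lemma u_pos: "0 < u v" and u_le: "u v \<le> 1 / c\<^sup>2"
proof -
  have "0 < v\<^sup>2 + c\<^sup>2" using c by (simp add: add_nonneg_pos)
  then show "0 < u v" by (simp add: u_def)
  show "u v \<le> 1 / c\<^sup>2" unfolding u_def using c by (intro divide_left_mono mult_pos_pos add_nonneg_pos) auto
qed

lemma inverse_imaginary:
  assumes e: "0 < e"
  shows "1 / (complex_of_real v - \<i> * of_real e) = of_real (v / (v\<^sup>2 + e\<^sup>2)) + \<i> * of_real (e / (v\<^sup>2 + e\<^sup>2))"
proof -
  have p: "v\<^sup>2 + e\<^sup>2 \<noteq> 0" using e by (simp add: add_nonneg_eq_0_iff)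
  show ?thesis by (simp add: complex_eq_iff Re_divide Im_divide power2_eq_square)
qed

text \<open>Real and imaginary parts of the Stieltjes transform.\<close>
lemma good_resolvent:
  assumes e: "c \<le> e"
  shows "good (\<lambda>v. v / (v\<^sup>2 + e\<^sup>2))" "good (\<lambda>v. 1 / (v\<^sup>2 + e\<^sup>2))"
proof -
  have e0: "0 < e" using c e by simp
  have st: "stieltjes n w (\<i> * of_real e) = of_real (avg n (\<lambda>i. w i / ((w i)\<^sup>2 + e\<^sup>2))) + \<i> * of_real (avg n (\<lambda>i. e / ((w i)\<^sup>2 + e\<^sup>2)))" for n w
    unfolding stieltjes_def inverse_imaginary[OF e0] avg_def sum.distrib sum_distrib_left[symmetric] of_real_sum[symmetric]
    by (simp add: add_divide_distrib)
  have re: "Re (stieltjes n (x n) (\<i> * of_real e) - stieltjes n (y n) (\<i> * of_real e)) = gap (\<lambda>v. v / (v\<^sup>2 + e\<^sup>2)) n"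
    and im: "Im (stieltjes n (x n) (\<i> * of_real e) - stieltjes n (y n) (\<i> * of_real e)) = gap (\<lambda>v. e / (v\<^sup>2 + e\<^sup>2)) n" for n
    unfolding st gap_def by simp_all
  show "good (\<lambda>v. v / (v\<^sup>2 + e\<^sup>2))"
    unfolding good_def using tendsto_Re[OF close[OF e]] unfolding re by simp
  have "good (\<lambda>v. e / (v\<^sup>2 + e\<^sup>2))"
    unfolding good_def using tendsto_Im[OF close[OF e]] unfolding im by simp
  from good_cmult[OF this, of "1 / e"] show "good (\<lambda>v. 1 / (v\<^sup>2 + e\<^sup>2))" using e0 by simp
qed

text \<open>
  Higher powers of the resolvent are difference quotients of lower ones, as in the resolvent identity: \<open>s\<close> times
  \<open>r u\<^sup>k\<^sup>+\<^sup>1 (u / (1 + s u))\<close> is the difference of \<open>r u\<^sup>k\<^sup>+\<^sup>1\<close>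
  and \<open>r u\<^sup>k (u / (1 + s u))\<close>. The limit \<open>s \<longlonglongrightarrow> 0\<close> is taken by uniform
  approximation, so that good functions need only a half-line of the imaginary axis.
\<close>
lemma good_powers_aux:
  assumes r: "\<And>s. 0 \<le> s \<Longrightarrow> good (\<lambda>v. r v * (u v / (1 + s * u v)))"
    and R: "\<And>v. \<bar>r v * u v\<bar> \<le> R"
  shows "good (\<lambda>v. r v * u v ^ Suc k) \<and> (\<forall>s>0. good (\<lambda>v. r v * u v ^ k * (u v / (1 + s * u v))))"
proof (induction k)
  case 0
  then show ?case using r[of 0] r by auto
next
  case (Suc k)
  have R0: "0 \<le> R" using R[of 0] by (rule order_trans[OF abs_ge_zero])
  have step: "good (\<lambda>v. r v * u v ^ Suc k * (u v / (1 + s * u v)))" if s: "0 < s" for s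
  proof -
    have "r v * u v ^ Suc k * (u v / (1 + s * u v)) = 1 / s * (r v * u v ^ Suc k - r v * u v ^ k * (u v / (1 + s * u v)))" for v
    proof -
      have "0 < 1 + s * u v" using s u_pos[of v] by (intro add_pos_pos mult_pos_pos) auto
      then show ?thesis using s by (simp add: field_simps)
    qed
    moreover have "good (\<lambda>v. 1 / s * (r v * u v ^ Suc k - r v * u v ^ k * (u v / (1 + s * u v))))"
      using Suc s by (intro good_cmult good_diff) auto
    ultimately show ?thesis by simp
  qed
  have "good (\<lambda>v. r v * u v ^ Suc (Suc k))"
  proof (rule good_approx)
    fix e :: real assume e: "0 < e"
    define b where "b = R * (1 / c\<^sup>2) ^ Suc (Suc k)"
    define s where "s = e / (b + 1)"
    have b0: "0 \<le> b" using R0 by (simp add: b_def)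
    have s: "0 < s" using e b0 by (simp add: s_def)
    have "\<bar>r v * u v ^ Suc (Suc k) - r v * u v ^ Suc k * (u v / (1 + s * u v))\<bar> \<le> e * (1 + v\<^sup>2)" for v
    proof -
      have p: "1 \<le> 1 + s * u v" using s u_pos[of v] by simp
      then have p0: "0 < 1 + s * u v" by linarith
      have "r v * u v ^ Suc (Suc k) - r v * u v ^ Suc k * (u v / (1 + s * u v))
          = s * ((r v * u v) * u v ^ Suc (Suc k)) / (1 + s * u v)"
        using p by (simp add: field_simps)
      then have "\<bar>r v * u v ^ Suc (Suc k) - r v * u v ^ Suc k * (u v / (1 + s * u v))\<bar>
          = s * (\<bar>r v * u v\<bar> * u v ^ Suc (Suc k)) / (1 + s * u v)"
        using s p u_pos[of v] by (simp add: abs_mult abs_divide)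
      also have "\<dots> \<le> s * (\<bar>r v * u v\<bar> * u v ^ Suc (Suc k)) / 1"
        using s p p0 u_pos[of v] by (intro divide_left_mono mult_nonneg_nonneg) auto
      also have "\<dots> \<le> s * (R * (1 / c\<^sup>2) ^ Suc (Suc k)) / 1"
        using s R0 u_pos[of v] u_le[of v] by (intro divide_right_mono mult_left_mono mult_mono R power_mono) auto
      also have "\<dots> \<le> e" using e b0 unfolding b_def[symmetric] s_def by (simp add: field_simps)
      also have "\<dots> \<le> e * (1 + v\<^sup>2)" using e by simp
      finally show ?thesis .
    qed
    then show "\<exists>k'. good k' \<and> (\<forall>v. \<bar>r v * u v ^ Suc (Suc k) - k' v\<bar> \<le> e * (1 + v\<^sup>2))"
      using step[OF s] by blast
  qed
  then show ?case using step by blast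
qed

text \<open>
  The function \<open>u / (1 + s u)\<close> is \<open>u\<close> with \<open>c\<^sup>2\<close> replaced by \<open>c\<^sup>2 +
  s\<close>.
\<close>
lemma good_shifted:
  assumes s: "0 \<le> s"
  shows "good (\<lambda>v. 1 * (u v / (1 + s * u v)))" "good (\<lambda>v. v * (u v / (1 + s * u v)))"
proof -
  define e where "e = sqrt (c\<^sup>2 + s)"
  have e2: "e\<^sup>2 = c\<^sup>2 + s" using s by (simp add: e_def)
  have ce: "c \<le> e" unfolding e_def using s c by (intro real_le_rsqrt) simp
  have "u v / (1 + s * u v) = 1 / (v\<^sup>2 + e\<^sup>2)" for v
  proof -
    have "0 < v\<^sup>2 + c\<^sup>2" using c by (simp add: add_nonneg_pos)
    moreover from this have "0 < v\<^sup>2 + (c\<^sup>2 + s)" using s by simp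
    ultimately show ?thesis unfolding u_def e2 using c by (simp add: divide_simps)
  qed
  then show "good (\<lambda>v. 1 * (u v / (1 + s * u v)))" "good (\<lambda>v. v * (u v / (1 + s * u v)))"
    using good_resolvent[OF ce] by simp_all
qed

lemma good_powers: "good (\<lambda>v. u v ^ Suc k)" "good (\<lambda>v. v * u v ^ Suc k)"
proof -
  show "good (\<lambda>v. u v ^ Suc k)"
    using good_powers_aux[of "\<lambda>_. 1" "1 / c\<^sup>2" k] good_shifted(1) u_pos u_le by (simp add: less_imp_le)
  have "\<bar>v * u v\<bar> \<le> 1 + 1 / c\<^sup>2" for v
  proof (cases "\<bar>v\<bar> \<le> 1")
    case True
    then have "\<bar>v * u v\<bar> \<le> 1 * (1 / c\<^sup>2)"
      unfolding abs_mult using u_pos[of v] u_le[of v] by (intro mult_mono) auto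
    then show ?thesis by simp
  next
    case False
    have "\<bar>v\<bar> \<le> v\<^sup>2 + c\<^sup>2"
    proof -
      have "\<bar>v\<bar> * 1 \<le> \<bar>v\<bar> * \<bar>v\<bar>" using False by (intro mult_left_mono) auto
      then show ?thesis using zero_le_square[of c] abs_mult_self_eq[of v] unfolding power2_eq_square by linarith
    qed
    then have "\<bar>v * u v\<bar> \<le> 1" using c by (simp add: u_def abs_mult divide_le_eq add_nonneg_pos)
    then show ?thesis using c by (simp add: add_increasing2)
  qed
  then show "good (\<lambda>v. v * u v ^ Suc k)"
    using good_powers_aux[of "\<lambda>v. v" "1 + 1 / c\<^sup>2" k] good_shifted(2) by simp
qed

text \<open>
  An even function with a limit at infinity is a continuous function of \<open>u\<close>, and the range of \<open>u\<close>
  is bounded, so that the Weierstrass theorem applies. The function is frozen beyond \<open>K\<close> to avoid the endpoint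
  \<open>u = 0\<close>.
\<close>
lemma even_approx:
  assumes h: "continuous_on UNIV h" and even: "\<And>v. h (- v) = h v"
    and K: "0 < K" "\<And>v. K \<le> v \<Longrightarrow> \<bar>h v - l\<bar> \<le> e" and e: "0 < e"
  shows "\<exists>a N. \<forall>v. \<bar>h v - (\<Sum>i\<le>N. a i * u v ^ i)\<bar> \<le> 3 * e"
proof -
  define u0 where "u0 = u K"
  have u0: "0 < u0" unfolding u0_def by (rule u_pos)
  \<comment> \<open>\<open>h\<close> as a function of \<open>u\<close>, constant below the value of \<open>u\<close> at \<open>K\<close>\<close>
  define H where "H t = h (sqrt (1 / max t u0 - c\<^sup>2))" for t
  have "continuous_on {0..1 / c\<^sup>2} H"
    unfolding H_def using u0
    by (intro continuous_on_compose2[OF h] continuous_intros) auto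
  then obtain g where g: "real_polynomial_function g" "\<And>t. t \<in> {0..1 / c\<^sup>2} \<Longrightarrow> \<bar>H t - g t\<bar> < e"
    using Stone_Weierstrass_real_polynomial_function[of "{0..1 / c\<^sup>2}" H e] e by auto
  obtain a N where aN: "g = (\<lambda>t. \<Sum>i\<le>N. a i * t ^ i)"
    using g(1) unfolding real_polynomial_function_iff_sum by blast
  have "\<bar>h v - g (u v)\<bar> \<le> 3 * e" for v
  proof -
    have "\<bar>h v - H (u v)\<bar> \<le> 2 * e"
    proof (cases "\<bar>v\<bar> \<le> K")
      case True
      then have "v\<^sup>2 \<le> K\<^sup>2" using abs_le_square_iff[of v K] K by simp
      then have "u0 \<le> u v" unfolding u0_def u_def using c by (intro divide_left_mono mult_pos_pos add_nonneg_pos) auto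
      then have "H (u v) = h (sqrt (1 / u v - c\<^sup>2))" by (simp add: H_def)
      also have "1 / u v - c\<^sup>2 = v\<^sup>2" by (simp add: u_def)
      finally have "H (u v) = h \<bar>v\<bar>" by simp
      also have "\<dots> = h v" using even[of v] by (simp add: abs_if)
      finally show ?thesis using e by simp
    next
      case False
      then have "K\<^sup>2 \<le> v\<^sup>2" using abs_le_square_iff[of K v] K by simp
      then have "u v \<le> u0" unfolding u0_def u_def using c by (intro divide_left_mono mult_pos_pos add_nonneg_pos) auto
      then have "H (u v) = h (sqrt (1 / u0 - c\<^sup>2))" by (simp add: H_def max_absorb2)
      also have "1 / u0 - c\<^sup>2 = K\<^sup>2" by (simp add: u0_def u_def)
      finally have "H (u v) = h K" using K by simp
      moreover have "h v = h \<bar>v\<bar>" using even[of v] by (simp add: abs_if)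
      ultimately show ?thesis using K(2)[of K] K(2)[of "\<bar>v\<bar>"] False by simp
    qed
    moreover have "\<bar>H (u v) - g (u v)\<bar> < e" using u_pos[of v] u_le[of v] by (intro g) auto
    ultimately show ?thesis by linarith
  qed
  then show ?thesis unfolding aN by blast
qed

lemma good_polynomial:
  "good (\<lambda>v. \<Sum>i\<le>N. a i * u v ^ i)" "good (\<lambda>v. v * ((\<Sum>i\<le>N. a i * u v ^ i) - a 0))"
proof -
  have "good (\<lambda>v. a i * u v ^ i)" for i
  proof (cases i)
    case 0
    then show ?thesis using good_const[of "a 0"] by simp
  next
    case (Suc k)
    show ?thesis unfolding Suc by (rule good_cmult[OF good_powers(1)])
  qed
  then show "good (\<lambda>v. \<Sum>i\<le>N. a i * u v ^ i)" by (intro good_sum)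
  have "(\<Sum>i\<le>N. a i * t ^ i) - a 0 = (\<Sum>i\<in>{1..N}. a i * t ^ i)" for t :: real
    by (simp add: atMost_atLeast0 sum.atLeast_Suc_atMost)
  then have eq: "v * ((\<Sum>i\<le>N. a i * u v ^ i) - a 0) = (\<Sum>i\<in>{1..N}. a i * (v * u v ^ i))" for v
    by (simp add: sum_distrib_left mult_ac)
  have "good (\<lambda>v. a i * (v * u v ^ i))" if "i \<in> {1..N}" for i
    using that good_cmult[OF good_powers(2)[of "i - 1"], of "a i"] by simp
  then show "good (\<lambda>v. v * ((\<Sum>i\<le>N. a i * u v ^ i) - a 0))" unfolding eq by (intro good_sum)
qed

text \<open>
  Continuous replacement for the indicator of a half-line; it takes its values \<open>0\<close> and \<open>1\<close> outside
  the interval from \<open>a\<close> to \<open>b\<close>.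
\<close>
definition ramp :: "real \<Rightarrow> real \<Rightarrow> real \<Rightarrow> real" where
  "ramp a b v = max 0 (min 1 ((v - a) / (b - a)))"

text \<open>
  The even part of a ramp is a limit of polynomials in \<open>u\<close>. The odd part does not tend to a common limit at both
  ends; it is approximated by \<open>v\<close> times an even function, where the error may grow linearly in \<open>v\<close>.
\<close>
lemma good_ramp:
  assumes ab: "a < b" shows "good (ramp a b)"
proof -
  define f where "f = ramp a b"
  define L where "L = 1 / (b - a)"
  have L: "0 < L" using ab by (simp add: L_def)
  have fc: "continuous_on UNIV f" unfolding f_def ramp_def[abs_def] by (intro continuous_intros) (use ab in auto)
  have f01: "0 \<le> f v" "f v \<le> 1" for v by (auto simp: f_def ramp_def)
  have fLip: "\<bar>f v - f w\<bar> \<le> L * \<bar>v - w\<bar>" for v w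
  proof -
    have "\<bar>f v - f w\<bar> \<le> \<bar>(v - a) / (b - a) - (w - a) / (b - a)\<bar>"
      unfolding f_def ramp_def by (auto simp: max_def min_def)
    also have "(v - a) / (b - a) - (w - a) / (b - a) = L * (v - w)"
      by (simp add: L_def diff_divide_distrib)
    finally show ?thesis using L by (simp add: abs_mult)
  qed
  define K where "K = max \<bar>a\<bar> \<bar>b\<bar> + 1"
  have K: "0 < K" by (simp add: K_def)
  have fK: "f v = 1" "f (- v) = 0" if "K \<le> v" for v
  proof -
    have v: "b \<le> v" "- v \<le> a" using that by (auto simp: K_def)
    then have "1 \<le> (v - a) / (b - a)" "(- v - a) / (b - a) \<le> 0"
      using ab by (auto simp: le_divide_eq divide_le_eq)
    then show "f v = 1" "f (- v) = 0" by (auto simp: f_def ramp_def)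
  qed
  define ev where "ev v = (f v + f (- v)) / 2" for v
  define od where "od v = (f v - f (- v)) / 2" for v
  have cneg: "continuous_on UNIV (\<lambda>v. f (- v))"
    by (rule continuous_on_compose2[OF fc]) (auto intro: continuous_intros)
  have "good ev"
  proof (rule good_approx)
    fix e :: real assume e: "0 < e"
    have "\<exists>p N. \<forall>v. \<bar>ev v - (\<Sum>i\<le>N. p i * u v ^ i)\<bar> \<le> 3 * (e / 3)"
    proof (rule even_approx[where l = "1 / 2"])
      show "continuous_on UNIV ev" unfolding ev_def by (intro continuous_intros fc cneg) simp
      show "ev (- v) = ev v" for v by (simp add: ev_def)
      show "\<bar>ev v - 1 / 2\<bar> \<le> e / 3" if "K \<le> v" for v using fK[OF that] e by (simp add: ev_def)
    qed (use e K in auto)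
    then obtain p N where pN: "\<And>v. \<bar>ev v - (\<Sum>i\<le>N. p i * u v ^ i)\<bar> \<le> e" by auto
    have "e \<le> e * (1 + v\<^sup>2)" for v :: real using e by simp
    then show "\<exists>k. good k \<and> (\<forall>v. \<bar>ev v - k v\<bar> \<le> e * (1 + v\<^sup>2))"
      using good_polynomial(1)[where a = p and N = N] pN
      by (intro exI[of _ "\<lambda>v. \<Sum>i\<le>N. p i * u v ^ i"] conjI allI order_trans[OF pN]) auto
  qed
  moreover have "good od"
  proof (rule good_approx)
    fix e :: real assume e: "0 < e"
    define d where "d = e / L"
    have d: "0 < d" using e L by (simp add: d_def)
    have pos: "0 < v\<^sup>2 + d\<^sup>2" for v :: real using d by (simp add: add_nonneg_pos)
    \<comment> \<open>\<open>v * h v\<close> is close to the odd part, and \<open>h\<close> is even and vanishes at infinity\<close>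
    define h where "h v = od v * v / (v\<^sup>2 + d\<^sup>2)" for v
    have odb: "\<bar>od v\<bar> \<le> 1" for v using f01[of v] f01[of "- v"] by (simp add: od_def abs_le_iff)
    have odL: "\<bar>od v\<bar> \<le> L * \<bar>v\<bar>" for v
      using fLip[of v "- v"] by (simp add: od_def)
    define K' where "K' = 12 / e + 1"
    have K': "0 < K'" using e by (simp add: K'_def add_pos_pos)
    have "\<exists>p N. \<forall>v. \<bar>h v - (\<Sum>i\<le>N. p i * u v ^ i)\<bar> \<le> 3 * (e / 12)"
    proof (rule even_approx[where l = 0])
      show "continuous_on UNIV h" unfolding h_def od_def
        by (intro continuous_intros fc cneg) (use pos in \<open>auto simp: less_imp_neq[symmetric]\<close>)
      show "h (- v) = h v" for v by (simp add: h_def od_def field_simps)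
      show "\<bar>h v - 0\<bar> \<le> e / 12" if v: "K' \<le> v" for v
      proof -
        have v0: "0 < v" using v K' by simp
        have "\<bar>h v\<bar> = \<bar>od v\<bar> * v / (v\<^sup>2 + d\<^sup>2)" using v0 pos[of v] by (simp add: h_def abs_mult abs_divide)
        also have "\<dots> \<le> 1 * v / v\<^sup>2" using v0 odb[of v] by (intro frac_le mult_right_mono) auto
        also have "\<dots> = 1 / v" using v0 by (simp add: power2_eq_square)
        also have "\<dots> \<le> 1 / (12 / e)" using v e v0 by (intro divide_left_mono) (auto simp: K'_def)
        finally show ?thesis by simp
      qed
    qed (use e K' in auto)
    then obtain p N where pN: "\<And>v. \<bar>h v - (\<Sum>i\<le>N. p i * u v ^ i)\<bar> \<le> e / 4" by auto
    \<comment> \<open>\<open>h\<close> vanishes at infinity, so the constant term is small\<close>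
    have p0: "\<bar>p 0\<bar> \<le> e / 4"
    proof (rule tendsto_le[of "at_top :: real filter"])
      have ut: "(u \<longlongrightarrow> 0) at_top"
        unfolding u_def[abs_def] by real_asymp
      have "((\<lambda>v. \<Sum>i\<le>N. p i * u v ^ i) \<longlongrightarrow> (\<Sum>i\<le>N. p i * 0 ^ i)) at_top"
        by (intro tendsto_intros ut)
      moreover have "(\<Sum>i\<le>N. p i * 0 ^ i) = p 0" by (simp add: sum.atMost_shift)
      moreover have "(h \<longlongrightarrow> 0) at_top"
      proof (rule Lim_null_comparison)
        have "((\<lambda>v. v / (v\<^sup>2 + d\<^sup>2)) \<longlongrightarrow> 0) at_top" by real_asymp
        then show "((\<lambda>v. \<bar>v\<bar> / (v\<^sup>2 + d\<^sup>2)) \<longlongrightarrow> 0) at_top"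
          by (rule Lim_transform_eventually) (use eventually_ge_at_top[of "0 :: real"] in \<open>eventually_elim, auto\<close>)
        show "\<forall>\<^sub>F v in at_top. norm (h v) \<le> \<bar>v\<bar> / (v\<^sup>2 + d\<^sup>2)"
          using odb pos by (intro always_eventually allI) (simp add: h_def abs_mult divide_right_mono mult_left_le_one_le less_imp_le)
      qed
      ultimately have "((\<lambda>v. h v - (\<Sum>i\<le>N. p i * u v ^ i)) \<longlongrightarrow> 0 - p 0) at_top" by (intro tendsto_diff) auto
      then show "((\<lambda>v. \<bar>h v - (\<Sum>i\<le>N. p i * u v ^ i)\<bar>) \<longlongrightarrow> \<bar>p 0\<bar>) at_top"
        using tendsto_rabs by force
      show "((\<lambda>_. e / 4) \<longlongrightarrow> e / 4) (at_top :: real filter)" by simp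
      show "\<forall>\<^sub>F v in at_top. \<bar>h v - (\<Sum>i\<le>N. p i * u v ^ i)\<bar> \<le> e / 4"
        by (intro always_eventually allI pN)
    qed simp
    have "\<bar>od v - v * ((\<Sum>i\<le>N. p i * u v ^ i) - p 0)\<bar> \<le> e * (1 + v\<^sup>2)" for v
    proof -
      have "od v = od v * ((v\<^sup>2 + d\<^sup>2) / (v\<^sup>2 + d\<^sup>2))" using pos[of v] d by simp
      moreover have "v * h v = od v * (v\<^sup>2 / (v\<^sup>2 + d\<^sup>2))" by (simp add: h_def power2_eq_square)
      ultimately have "od v - v * h v = od v * (d\<^sup>2 / (v\<^sup>2 + d\<^sup>2))"
        by (metis right_diff_distrib diff_divide_distrib add_diff_cancel_left')
      then have "\<bar>od v - v * h v\<bar> = \<bar>od v\<bar> * (d\<^sup>2 / (v\<^sup>2 + d\<^sup>2))"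
        using pos[of v] by (simp add: abs_mult abs_divide)
      also have "\<dots> \<le> L * \<bar>v\<bar> * (d\<^sup>2 / (v\<^sup>2 + d\<^sup>2))"
        using pos[of v] by (intro mult_right_mono odL) auto
      also have "\<dots> = L * d * (\<bar>v\<bar> * d / (v\<^sup>2 + d\<^sup>2))" by (simp add: power2_eq_square)
      also have "\<dots> \<le> L * d * (1 / 2)"
      proof (intro mult_left_mono)
        have "2 * (\<bar>v\<bar> * d) \<le> v\<^sup>2 + d\<^sup>2" using zero_le_power2[of "\<bar>v\<bar> - d"] by (simp add: power2_diff)
        then show "\<bar>v\<bar> * d / (v\<^sup>2 + d\<^sup>2) \<le> 1 / 2" using pos[of v] by (simp add: divide_le_eq)
      qed (use L d in auto)
      also have "\<dots> = e / 2" using L by (simp add: d_def)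
      finally have 1: "\<bar>od v - v * h v\<bar> \<le> e / 2" .
      have "\<bar>v * h v - v * ((\<Sum>i\<le>N. p i * u v ^ i) - p 0)\<bar> = \<bar>v\<bar> * \<bar>(h v - (\<Sum>i\<le>N. p i * u v ^ i)) + p 0\<bar>"
        unfolding abs_mult[symmetric] by (simp add: algebra_simps)
      also have "\<dots> \<le> \<bar>v\<bar> * (e / 4 + e / 4)"
        by (intro mult_left_mono order_trans[OF abs_triangle_ineq] add_mono pN p0) auto
      finally have 2: "\<bar>v * h v - v * ((\<Sum>i\<le>N. p i * u v ^ i) - p 0)\<bar> \<le> (e / 2) * \<bar>v\<bar>" by (simp add: mult.commute)
      have "\<bar>v\<bar> \<le> 1 + v\<^sup>2" using zero_le_power2[of "\<bar>v\<bar> - 1"] abs_ge_zero[of v] by (simp add: power2_diff)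
      then have "(e / 2) * \<bar>v\<bar> \<le> (e / 2) * (1 + v\<^sup>2)" using e by (intro mult_left_mono) auto
      moreover have "e / 2 \<le> (e / 2) * (1 + v\<^sup>2)" using e by simp
      moreover have "(e / 2) * (1 + v\<^sup>2) + (e / 2) * (1 + v\<^sup>2) = e * (1 + v\<^sup>2)" by (simp add: field_simps)
      moreover have "\<bar>od v - v * ((\<Sum>i\<le>N. p i * u v ^ i) - p 0)\<bar>
          \<le> \<bar>od v - v * h v\<bar> + \<bar>v * h v - v * ((\<Sum>i\<le>N. p i * u v ^ i) - p 0)\<bar>"
        using abs_triangle_ineq[of "od v - v * h v" "v * h v - v * ((\<Sum>i\<le>N. p i * u v ^ i) - p 0)"] by simp
      ultimately show ?thesis using 1 2 by linarith
    qed
    then show "\<exists>k. good k \<and> (\<forall>v. \<bar>od v - k v\<bar> \<le> e * (1 + v\<^sup>2))"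
      using good_polynomial(2)[where a = p and N = N] by blast
  qed
  ultimately have "good (\<lambda>v. ev v + od v)" by (rule good_add)
  moreover have "ev v + od v = f v" for v by (simp add: ev_def od_def field_simps)
  ultimately show ?thesis by (simp add: f_def)
qed

end

section \<open>Distance between sorted samples\<close>

definition clip :: "real \<Rightarrow> real \<Rightarrow> real" where
  "clip K v = max (- K) (min K v)"

lemma clip_bounds: "0 \<le> K \<Longrightarrow> \<bar>clip K v\<bar> \<le> K"
  by (auto simp: clip_def)

lemma clip_tail:
  assumes "0 \<le> K" shows "(v - clip K v)\<^sup>2 \<le> v\<^sup>2 - (clip K v)\<^sup>2" "(clip K v)\<^sup>2 \<le> v\<^sup>2"
proof -
  have "0 \<le> 2 * clip K v * (v - clip K v)"
  proof -
    consider "v \<le> - K" | "K \<le> v" | "clip K v = v"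
      by (cases "v \<le> - K"; cases "K \<le> v") (auto simp: clip_def)
    then show ?thesis
    proof cases
      case 1
      then have "clip K v = - K" using assms by (simp add: clip_def)
      then show ?thesis using 1 assms by (simp add: mult_nonneg_nonpos)
    next
      case 2
      then have "clip K v = K" using assms by (simp add: clip_def)
      then show ?thesis using 2 assms by simp
    qed simp
  qed
  then show 1: "(v - clip K v)\<^sup>2 \<le> v\<^sup>2 - (clip K v)\<^sup>2"
    by (simp add: power2_diff power2_eq_square algebra_simps)
  show "(clip K v)\<^sup>2 \<le> v\<^sup>2" using order_trans[OF zero_le_power2 1] by simp
qed

lemma power2_sum3_le: "(a + b + c)\<^sup>2 \<le> 3 * a\<^sup>2 + 3 * b\<^sup>2 + 3 * (c::real)\<^sup>2"
proof -
  have "3 * a\<^sup>2 + 3 * b\<^sup>2 + 3 * c\<^sup>2 - (a + b + c)\<^sup>2 = (a - b)\<^sup>2 + (a - c)\<^sup>2 + (b - c)\<^sup>2"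
    by (simp add: power2_eq_square algebra_simps)
  then show ?thesis by (metis add_nonneg_nonneg diff_ge_0_iff_ge zero_le_power2)
qed

context close_stieltjes
begin

text \<open>
  For decreasing samples the indices at which \<open>y\<close> is below \<open>a\<close> and \<open>x\<close> above
  \<open>b\<close> are all explained by a difference of ramp averages: fixing one such index \<open>k\<close>, for \<open>i
  \<le> k\<close> the ramp of \<open>x\<close> is \<open>1\<close>, and for \<open>i \<ge> k\<close> the ramp of
  \<open>y\<close> is \<open>0\<close>, so that the difference is nonnegative at every index.
\<close>
lemma crossings_le:
  assumes ab: "a < b" and sx: "\<And>i j. i \<le> j \<Longrightarrow> j < n \<Longrightarrow> x n j \<le> x n i" and sy: "\<And>i j. i \<le> j \<Longrightarrow> j < n \<Longrightarrow> y n j \<le> y n i"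
  shows "real (card {i. i < n \<and> y n i \<le> a \<and> b \<le> x n i}) \<le> real n * \<bar>gap (ramp a b) n\<bar>"
    and "real (card {i. i < n \<and> x n i \<le> a \<and> b \<le> y n i}) \<le> real n * \<bar>gap (ramp a b) n\<bar>"
proof -
  have r1: "ramp a b v = 1" if "b \<le> v" for v
  proof -
    have "1 \<le> (v - a) / (b - a)" using that ab by (simp add: le_divide_eq)
    then show ?thesis by (simp add: ramp_def)
  qed
  have r0: "ramp a b v = 0" if "v \<le> a" for v
  proof -
    have "(v - a) / (b - a) \<le> 0" using that ab by (simp add: divide_le_eq)
    then show ?thesis by (simp add: ramp_def)
  qed
  have rb: "0 \<le> ramp a b v" "ramp a b v \<le> 1" for v by (auto simp: ramp_def)
  have gen: "real (card {i. i < n \<and> q i \<le> a \<and> b \<le> p i}) \<le> real n * \<bar>avg n (\<lambda>i. ramp a b (p i)) - avg n (\<lambda>i. ramp a b (q i))\<bar>"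
    if p: "\<And>i j. i \<le> j \<Longrightarrow> j < n \<Longrightarrow> p j \<le> p i" and q: "\<And>i j. i \<le> j \<Longrightarrow> j < n \<Longrightarrow> q j \<le> q i" for p q :: "nat \<Rightarrow> real"
  proof (cases "{i. i < n \<and> q i \<le> a \<and> b \<le> p i} = {}")
    case True
    then show ?thesis by (simp only: card.empty) simp
  next
    case False
    then obtain k where k: "k < n" "q k \<le> a" "b \<le> p k" by auto
    have pt: "of_bool (q i \<le> a \<and> b \<le> p i) \<le> ramp a b (p i) - ramp a b (q i)" if "i < n" for i
    proof (cases "i \<le> k")
      case True
      then have "b \<le> p i" using p[OF True k(1)] k(3) by simp
      then show ?thesis using r1[of "p i"] r0[of "q i"] rb[of "q i"] by auto
    next
      case False
      then have "q i \<le> a" using q[of k i] that k(2) by simp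
      then show ?thesis using r1[of "p i"] r0[of "q i"] rb[of "p i"] by auto
    qed
    have "real (card {i. i < n \<and> q i \<le> a \<and> b \<le> p i}) = (\<Sum>i<n. of_bool (q i \<le> a \<and> b \<le> p i))"
      by (simp add: of_bool_def sum.If_cases Int_def)
    also have "\<dots> \<le> (\<Sum>i<n. ramp a b (p i) - ramp a b (q i))" by (intro sum_mono pt) simp
    also have "\<dots> = real n * (avg n (\<lambda>i. ramp a b (p i)) - avg n (\<lambda>i. ramp a b (q i)))"
      using k by (simp add: avg_def sum_subtractf field_simps)
    also have "\<dots> \<le> real n * \<bar>avg n (\<lambda>i. ramp a b (p i)) - avg n (\<lambda>i. ramp a b (q i))\<bar>"
      by (intro mult_left_mono) auto
    finally show ?thesis .
  qed
  show "real (card {i. i < n \<and> y n i \<le> a \<and> b \<le> x n i}) \<le> real n * \<bar>gap (ramp a b) n\<bar>"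
    unfolding gap_def by (rule gen) (use sx sy in auto)
  show "real (card {i. i < n \<and> x n i \<le> a \<and> b \<le> y n i}) \<le> real n * \<bar>gap (ramp a b) n\<bar>"
    unfolding gap_def by (subst abs_minus_commute, rule gen) (use sx sy in auto)
qed

text \<open>
  On a mesh of width \<open>d\<close>, an index at which the clipped values differ by more than \<open>2 * d\<close> is a
  crossing of one of finitely many mesh intervals, and crossings are rare by \<open>crossings_le\<close>.
\<close>
lemma clipped_distance_tendsto_zero:
  assumes sx: "\<And>n i j. i \<le> j \<Longrightarrow> j < n \<Longrightarrow> x n j \<le> x n i" and sy: "\<And>n i j. i \<le> j \<Longrightarrow> j < n \<Longrightarrow> y n j \<le> y n i"
    and K: "0 < K"
  shows "(\<lambda>n. avg n (\<lambda>i. (clip K (x n i) - clip K (y n i))\<^sup>2)) \<longlonglongrightarrow> 0"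
proof (rule tendsto_zero_by_eps)
  fix e :: real assume e: "0 < e"
  define d where "d = sqrt (e / 2) / 2"
  have d: "0 < d" using e by (simp add: d_def)
  have d2: "(2 * d)\<^sup>2 = e / 2" using e by (simp add: d_def)
  obtain m :: nat where m: "2 * K / d < real m" using reals_Archimedean2 by blast
  then have m: "2 * K < real m * d" using d by (simp add: field_simps)
  define t where "t j = - K + real j * d" for j
  have tt: "t j < t (Suc j)" for j using d by (simp add: t_def algebra_simps)
  \<comment> \<open>two clipped values further apart than two mesh widths have a mesh interval between them\<close>
  have sep: "\<exists>j<m. clip K w \<le> t j \<and> t (Suc j) \<le> clip K v" if "2 * d < clip K v - clip K w" for v w
  proof -
    define j where "j = nat \<lceil>(clip K w + K) / d\<rceil>"
    have w0: "0 \<le> (clip K w + K) / d" using clip_bounds[of K w] K d by (simp add: abs_le_iff)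
    have j1: "(clip K w + K) / d \<le> real j" unfolding j_def by (rule real_nat_ceiling_ge)
    have j2: "real j < (clip K w + K) / d + 1" unfolding j_def using w0 by linarith
    have 1: "clip K w \<le> t j" using j1 d by (simp add: t_def field_simps)
    have "real j * d < ((clip K w + K) / d + 1) * d" by (rule mult_strict_right_mono[OF j2 d])
    also have "\<dots> = clip K w + K + d" unfolding distrib_right using d by simp
    finally have "t (Suc j) < clip K w + 2 * d" by (simp add: t_def distrib_right)
    then have 2: "t (Suc j) \<le> clip K v" using that by simp
    have "t (Suc j) \<le> K" using 2 clip_bounds[of K v] K by (simp add: abs_le_iff)
    then have "real (Suc j) * d < real m * d" using m unfolding t_def by linarith
    then have "j < m" using d by (simp only: mult_less_cancel_right) auto
    then show ?thesis using 1 2 by blast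
  qed
  have unclip: "w \<le> a" if "clip K w \<le> a" "a < b" "b \<le> clip K v" for a b v w
    using that clip_bounds[of K v] K by (auto simp: clip_def max_def min_def split: if_splits)
  have unclip': "b \<le> v" if "clip K w \<le> a" "a < b" "b \<le> clip K v" for a b v w
    using that clip_bounds[of K w] K by (auto simp: clip_def max_def min_def split: if_splits)
  have bound: "avg n (\<lambda>i. (clip K (x n i) - clip K (y n i))\<^sup>2)
      \<le> e / 2 + (2 * K)\<^sup>2 * (2 * (\<Sum>j<m. \<bar>gap (ramp (t j) (t (Suc j))) n\<bar>))" for n
  proof (cases "n = 0")
    case True
    then show ?thesis using e by (simp add: avg_def gap_def)
  next
    case False
    let ?P = "\<lambda>j. {i. i < n \<and> y n i \<le> t j \<and> t (Suc j) \<le> x n i}" and ?Q = "\<lambda>j. {i. i < n \<and> x n i \<le> t j \<and> t (Suc j) \<le> y n i}"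
    define Bad where "Bad = (\<Union>j<m. ?P j \<union> ?Q j)"
    have pt: "(clip K (x n i) - clip K (y n i))\<^sup>2 \<le> e / 2 + (2 * K)\<^sup>2 * of_bool (i \<in> Bad)" if i: "i < n" for i
    proof (cases "\<bar>clip K (x n i) - clip K (y n i)\<bar> \<le> 2 * d")
      case True
      then have "(clip K (x n i) - clip K (y n i))\<^sup>2 \<le> (2 * d)\<^sup>2"
        using abs_le_square_iff[of "clip K (x n i) - clip K (y n i)" "2 * d"] d by simp
      then show ?thesis unfolding d2 by (rule order_trans) simp
    next
      case False
      then have "2 * d < clip K (x n i) - clip K (y n i) \<or> 2 * d < clip K (y n i) - clip K (x n i)" by linarith
      then have "i \<in> Bad"
      proof
        assume "2 * d < clip K (x n i) - clip K (y n i)"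
        then obtain j where j: "j < m" "clip K (y n i) \<le> t j" "t (Suc j) \<le> clip K (x n i)" using sep by blast
        then have "i \<in> ?P j" using unclip[OF j(2) tt j(3)] unclip'[OF j(2) tt j(3)] i by simp
        then show ?thesis using j(1) unfolding Bad_def by (intro UN_I[of j]) auto
      next
        assume "2 * d < clip K (y n i) - clip K (x n i)"
        then obtain j where j: "j < m" "clip K (x n i) \<le> t j" "t (Suc j) \<le> clip K (y n i)" using sep by blast
        then have "i \<in> ?Q j" using unclip[OF j(2) tt j(3)] unclip'[OF j(2) tt j(3)] i by simp
        then show ?thesis using j(1) unfolding Bad_def by (intro UN_I[of j]) auto
      qed
      moreover have "(clip K (x n i) - clip K (y n i))\<^sup>2 \<le> (2 * K)\<^sup>2"
      proof -
        have "\<bar>clip K (x n i) - clip K (y n i)\<bar> \<le> \<bar>2 * K\<bar>"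
          using clip_bounds[of K "x n i"] clip_bounds[of K "y n i"] K by (simp add: abs_le_iff)
        then show ?thesis unfolding abs_le_square_iff .
      qed
      ultimately show ?thesis using e by simp
    qed
    have card: "real (card Bad) \<le> real n * (2 * (\<Sum>j<m. \<bar>gap (ramp (t j) (t (Suc j))) n\<bar>))"
    proof -
      have "card Bad \<le> (\<Sum>j<m. card (?P j \<union> ?Q j))" unfolding Bad_def by (rule card_UN_le) simp
      also have "\<dots> \<le> (\<Sum>j<m. card (?P j) + card (?Q j))" by (intro sum_mono card_Un_le)
      finally have cB: "card Bad \<le> (\<Sum>j<m. card (?P j) + card (?Q j))" .
      have "real (card Bad) \<le> (\<Sum>j<m. real (card (?P j)) + real (card (?Q j)))"
        using of_nat_mono[OF cB, where 'a = real] by (simp only: of_nat_sum of_nat_add)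
      also have "\<dots> \<le> (\<Sum>j<m. real n * \<bar>gap (ramp (t j) (t (Suc j))) n\<bar> + real n * \<bar>gap (ramp (t j) (t (Suc j))) n\<bar>)"
        by (intro sum_mono add_mono crossings_le[OF tt sx sy])
      also have "\<dots> = real n * (2 * (\<Sum>j<m. \<bar>gap (ramp (t j) (t (Suc j))) n\<bar>))"
        by (simp add: sum_distrib_left mult.left_commute)
      finally show ?thesis .
    qed
    have "avg n (\<lambda>i. (clip K (x n i) - clip K (y n i))\<^sup>2) \<le> avg n (\<lambda>i. e / 2 + (2 * K)\<^sup>2 * of_bool (i \<in> Bad))"
      by (intro avg_mono pt)
    also have "\<dots> = avg n (\<lambda>i. e / 2) + (2 * K)\<^sup>2 * avg n (\<lambda>i. of_bool (i \<in> Bad))"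
      by (simp only: avg_add avg_cmult)
    also have "avg n (\<lambda>i. of_bool (i \<in> Bad)) = real (card Bad) / n"
    proof -
      have "Bad \<subseteq> {..<n}" unfolding Bad_def by auto
      then have "(\<Sum>i<n. of_bool (i \<in> Bad)) = real (card Bad)"
        by (simp add: of_bool_def sum.If_cases Int_absorb1)
      then show ?thesis by (simp add: avg_def)
    qed
    also have "avg n (\<lambda>i. e / 2) + (2 * K)\<^sup>2 * (real (card Bad) / n)
       \<le> e / 2 + (2 * K)\<^sup>2 * (2 * (\<Sum>j<m. \<bar>gap (ramp (t j) (t (Suc j))) n\<bar>))"
      using card False e by (intro add_mono avg_const_le mult_left_mono) (simp_all add: field_simps)
    finally show ?thesis .
  qed
  have "(\<lambda>n. (2 * K)\<^sup>2 * (2 * (\<Sum>j<m. \<bar>gap (ramp (t j) (t (Suc j))) n\<bar>))) \<longlonglongrightarrow> (2 * K)\<^sup>2 * (2 * (\<Sum>j<m. \<bar>0\<bar>))"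
    using good_ramp[OF tt] unfolding good_def by (intro tendsto_mult tendsto_const tendsto_sum tendsto_rabs)
  then have "(\<lambda>n. (2 * K)\<^sup>2 * (2 * (\<Sum>j<m. \<bar>gap (ramp (t j) (t (Suc j))) n\<bar>))) \<longlonglongrightarrow> 0" by simp
  then have "\<forall>\<^sub>F n in sequentially. \<bar>(2 * K)\<^sup>2 * (2 * (\<Sum>j<m. \<bar>gap (ramp (t j) (t (Suc j))) n\<bar>))\<bar> \<le> e / 2"
    by (rule eventually_abs_le) (use e in simp)
  then show "\<forall>\<^sub>F n in sequentially. \<bar>avg n (\<lambda>i. (clip K (x n i) - clip K (y n i))\<^sup>2)\<bar> \<le> e"
  proof eventually_elim
    case (elim n)
    have "0 \<le> avg n (\<lambda>i. (clip K (x n i) - clip K (y n i))\<^sup>2)" by (intro avg_nonneg) simp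
    then show ?case using bound[of n] elim by linarith
  qed
qed

end

text \<open>
  The excess of the second moment over that of the clipped sample. Smallness for large \<open>K\<close>, uniformly in
  \<open>n\<close>, is uniform integrability of the squares.
\<close>
definition tail :: "real \<Rightarrow> nat \<Rightarrow> (nat \<Rightarrow> real) \<Rightarrow> real" where
  "tail K n y = avg n (\<lambda>i. (y i)\<^sup>2 - (clip K (y i))\<^sup>2)"

text \<open>
  The clipped samples approach each other. The second sample has a small tail by assumption, and then so has the first one:
  the full second moments agree asymptotically, and so do the clipped ones.
\<close>
theorem sorted_distance_tendsto_zero:
  fixes x y :: "nat \<Rightarrow> nat \<Rightarrow> real"
  assumes sx: "\<And>n i j. i \<le> j \<Longrightarrow> j < n \<Longrightarrow> x n j \<le> x n i" and sy: "\<And>n i j. i \<le> j \<Longrightarrow> j < n \<Longrightarrow> y n j \<le> y n i"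
    and c: "0 < c"
    and close: "\<And>e. c \<le> e \<Longrightarrow> (\<lambda>n. stieltjes n (x n) (\<i> * of_real e) - stieltjes n (y n) (\<i> * of_real e)) \<longlonglongrightarrow> 0"
    and sec: "(\<lambda>n. avg n (\<lambda>i. (x n i)\<^sup>2) - avg n (\<lambda>i. (y n i)\<^sup>2)) \<longlonglongrightarrow> 0"
    and ui: "\<And>e. 0 < e \<Longrightarrow> \<exists>K>0. \<forall>\<^sub>F n in sequentially. tail K n (y n) \<le> e"
  shows "(\<lambda>n. avg n (\<lambda>i. (x n i - y n i)\<^sup>2)) \<longlonglongrightarrow> 0"
proof -
  have ev1: "\<forall>\<^sub>F n in sequentially. \<bar>avg n (\<lambda>i. (x n i)\<^sup>2) - avg n (\<lambda>i. (y n i)\<^sup>2)\<bar> \<le> e" if "0 < e" for e :: real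
    using eventually_abs_le[OF sec that] .
  obtain K1 where K1: "0 < K1" "\<forall>\<^sub>F n in sequentially. tail K1 n (y n) \<le> 1" using ui[of 1] by auto
  define M where "M = K1\<^sup>2 + 2"
  have y2: "\<forall>\<^sub>F n in sequentially. avg n (\<lambda>i. (y n i)\<^sup>2) \<le> K1\<^sup>2 + 1"
    using K1(2)
  proof eventually_elim
    case (elim n)
    have "(clip K1 (y n i))\<^sup>2 \<le> K1\<^sup>2" for i
      using clip_bounds[of K1 "y n i"] K1 abs_le_square_iff[of "clip K1 (y n i)" K1] by simp
    then have "avg n (\<lambda>i. (clip K1 (y n i))\<^sup>2) \<le> avg n (\<lambda>i. K1\<^sup>2)" by (intro avg_mono)
    also have "\<dots> \<le> K1\<^sup>2" by (rule avg_const_le) simp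
    finally show ?case using elim unfolding tail_def avg_diff by linarith
  qed
  interpret close_stieltjes x y M c
  proof
    show "0 \<le> M" by (simp add: M_def)
    show "\<forall>\<^sub>F n in sequentially. avg n (\<lambda>i. (x n i)\<^sup>2) \<le> M"
      using y2 ev1[of 1, simplified] unfolding M_def by eventually_elim linarith
    show "\<forall>\<^sub>F n in sequentially. avg n (\<lambda>i. (y n i)\<^sup>2) \<le> M"
      using y2 unfolding M_def by eventually_elim linarith
  qed (use c close in auto)
  show ?thesis
  proof (rule tendsto_zero_by_eps)
    fix e0 :: real assume e0: "0 < e0"
    define e where "e = e0 / 18"
    have e: "0 < e" using e0 by (simp add: e_def)
    obtain K where K: "0 < K" and tailK: "\<forall>\<^sub>F n in sequentially. tail K n (y n) \<le> e" using ui[OF e] by blast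
    define D where "D n = avg n (\<lambda>i. (clip K (x n i) - clip K (y n i))\<^sup>2)" for n
    have D: "D \<longlonglongrightarrow> 0" unfolding D_def by (rule clipped_distance_tendsto_zero[OF sx sy K])
    have D0: "0 \<le> D n" for n unfolding D_def by (intro avg_nonneg) simp
    have sqdiff: "avg n (\<lambda>i. (clip K (y n i))\<^sup>2) - avg n (\<lambda>i. (clip K (x n i))\<^sup>2) \<le> e + K\<^sup>2 / e * D n" for n
    proof -
      have "(clip K (y n i))\<^sup>2 - (clip K (x n i))\<^sup>2 \<le> e + K\<^sup>2 / e * (clip K (x n i) - clip K (y n i))\<^sup>2" for i
      proof -
        define d where "d = \<bar>clip K (x n i) - clip K (y n i)\<bar>"
        have "(clip K (y n i))\<^sup>2 - (clip K (x n i))\<^sup>2 = (clip K (y n i) + clip K (x n i)) * (clip K (y n i) - clip K (x n i))"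
          by (simp add: power2_eq_square algebra_simps)
        also have "\<dots> \<le> \<bar>clip K (y n i) + clip K (x n i)\<bar> * \<bar>clip K (y n i) - clip K (x n i)\<bar>"
          unfolding abs_mult[symmetric] by (rule abs_ge_self)
        also have "\<dots> \<le> (2 * K) * d"
          unfolding d_def using clip_bounds[of K "y n i"] clip_bounds[of K "x n i"] K
          by (intro mult_mono) (auto simp: abs_le_iff)
        also have "\<dots> \<le> e + K\<^sup>2 / e * d\<^sup>2"
        proof -
          have "0 \<le> (e - K * d)\<^sup>2 / e" using e by simp
          also have "\<dots> = e + K\<^sup>2 / e * d\<^sup>2 - (2 * K) * d" using e by (simp add: power2_eq_square field_simps)
          finally show ?thesis by simp
        qed
        finally show ?thesis by (simp add: d_def)
      qed
      then have "avg n (\<lambda>i. (clip K (y n i))\<^sup>2 - (clip K (x n i))\<^sup>2) \<le> avg n (\<lambda>i. e + K\<^sup>2 / e * (clip K (x n i) - clip K (y n i))\<^sup>2)"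
        by (intro avg_mono)
      also have "\<dots> = avg n (\<lambda>i. e) + K\<^sup>2 / e * D n" unfolding D_def by (simp only: avg_add avg_cmult)
      also have "\<dots> \<le> e + K\<^sup>2 / e * D n" using avg_const_le[of e n] e by simp
      finally show ?thesis unfolding avg_diff .
    qed
    have tri: "avg n (\<lambda>i. (x n i - y n i)\<^sup>2) \<le> 3 * D n + 3 * tail K n (x n) + 3 * tail K n (y n)" for n
    proof -
      have "(x n i - y n i)\<^sup>2 \<le> 3 * (clip K (x n i) - clip K (y n i))\<^sup>2 + 3 * ((x n i)\<^sup>2 - (clip K (x n i))\<^sup>2)
          + 3 * ((y n i)\<^sup>2 - (clip K (y n i))\<^sup>2)" for i
      proof -
        have "(x n i - y n i)\<^sup>2 = ((clip K (x n i) - clip K (y n i)) + (x n i - clip K (x n i)) + (- (y n i - clip K (y n i))))\<^sup>2"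
          by simp
        also have "\<dots> \<le> 3 * (clip K (x n i) - clip K (y n i))\<^sup>2 + 3 * (x n i - clip K (x n i))\<^sup>2 + 3 * (- (y n i - clip K (y n i)))\<^sup>2"
          by (rule power2_sum3_le)
        also have "\<dots> \<le> 3 * (clip K (x n i) - clip K (y n i))\<^sup>2 + 3 * ((x n i)\<^sup>2 - (clip K (x n i))\<^sup>2) + 3 * ((y n i)\<^sup>2 - (clip K (y n i))\<^sup>2)"
          unfolding power2_minus using K by (intro add_mono mult_left_mono clip_tail order_refl) auto
        finally show ?thesis .
      qed
      then have "avg n (\<lambda>i. (x n i - y n i)\<^sup>2) \<le> avg n (\<lambda>i. 3 * (clip K (x n i) - clip K (y n i))\<^sup>2
          + 3 * ((x n i)\<^sup>2 - (clip K (x n i))\<^sup>2) + 3 * ((y n i)\<^sup>2 - (clip K (y n i))\<^sup>2))"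
        by (intro avg_mono)
      then show ?thesis unfolding tail_def D_def by (simp only: avg_add avg_cmult)
    qed
    define r where "r = min e (e\<^sup>2 / K\<^sup>2)"
    have r: "0 < r" using e K by (simp add: r_def)
    have "\<forall>\<^sub>F n in sequentially. \<bar>D n\<bar> \<le> r" by (rule eventually_abs_le[OF D r])
    with tailK ev1[OF e] show "\<forall>\<^sub>F n in sequentially. \<bar>avg n (\<lambda>i. (x n i - y n i)\<^sup>2)\<bar> \<le> e0"
    proof eventually_elim
      case (elim n)
      have D1: "D n \<le> e" and "D n \<le> e\<^sup>2 / K\<^sup>2" using elim(3) by (auto simp: r_def)
      then have "K\<^sup>2 / e * D n \<le> K\<^sup>2 / e * (e\<^sup>2 / K\<^sup>2)" using e by (intro mult_left_mono) auto
      also have "\<dots> = e" using e K by (simp add: power2_eq_square)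
      finally have D2: "K\<^sup>2 / e * D n \<le> e" .
      have "tail K n (x n) \<le> 4 * e - 0"
        using sqdiff[of n] D2 elim(1,2) unfolding tail_def avg_diff by linarith
      then have "avg n (\<lambda>i. (x n i - y n i)\<^sup>2) \<le> 3 * e + 3 * (4 * e) + 3 * e"
        using tri[of n] D1 elim(1) by linarith
      moreover have "0 \<le> avg n (\<lambda>i. (x n i - y n i)\<^sup>2)" by (intro avg_nonneg) simp
      ultimately show ?case unfolding e_def using e0 by linarith
    qed
  qed
qed

lemma tail_le_truncated_moment:
  assumes e: "0 < e"
  shows "tail e n y \<le> 2 * avg n (\<lambda>i. (y i) ^ 4 / ((y i)\<^sup>2 + e\<^sup>2))"
proof -
  have "(v)\<^sup>2 - (clip e v)\<^sup>2 \<le> 2 * (v ^ 4 / (v\<^sup>2 + e\<^sup>2))" for v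
  proof (cases "\<bar>v\<bar> \<le> e")
    case True
    then have "clip e v = v" using e by (auto simp: clip_def abs_le_iff)
    then show ?thesis by simp
  next
    case False
    then have ev: "e\<^sup>2 \<le> v\<^sup>2" using abs_le_square_iff[of e v] e by simp
    have "v \<noteq> 0" using False e by auto
    then have v0: "0 < v\<^sup>2" by simp
    have v4: "v ^ 4 = v\<^sup>2 * v\<^sup>2" by (simp flip: power_add)
    have "v\<^sup>2 * (v\<^sup>2 + e\<^sup>2) \<le> v\<^sup>2 * (2 * v\<^sup>2)" using ev by (intro mult_left_mono) auto
    moreover have "0 < v\<^sup>2 + e\<^sup>2" using v0 by (intro add_pos_nonneg) auto
    ultimately have "v\<^sup>2 \<le> v\<^sup>2 * (2 * v\<^sup>2) / (v\<^sup>2 + e\<^sup>2)" by (simp only: pos_le_divide_eq)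
    also have "\<dots> = 2 * (v ^ 4 / (v\<^sup>2 + e\<^sup>2))" unfolding v4 by simp
    finally have "v\<^sup>2 \<le> 2 * (v ^ 4 / (v\<^sup>2 + e\<^sup>2))" .
    then show ?thesis using zero_le_power2[of "clip e v"] by linarith
  qed
  then have "tail e n y \<le> avg n (\<lambda>i. 2 * ((y i) ^ 4 / ((y i)\<^sup>2 + e\<^sup>2)))"
    unfolding tail_def by (intro avg_mono)
  then show ?thesis by (simp only: avg_cmult)
qed

text \<open>
  Each application of this identity gains one power of the sample values over the Stieltjes transform; the real part on the
  imaginary axis is a truncated second moment.
\<close>
lemma one_plus_stieltjes:
  assumes n: "0 < n" and z: "Im z \<noteq> 0"
  shows "1 + z * stieltjes n x z = (\<Sum>i<n. of_real (x i) / (of_real (x i) - z)) / of_nat n"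
proof -
  have nz: "of_real v - z \<noteq> 0" for v :: real using z by (auto simp: complex_eq_iff)
  have "(\<Sum>i<n. of_real (x i) / (of_real (x i) - z)) = (\<Sum>i<n. 1 + z * (1 / (of_real (x i) - z)))"
    by (intro sum.cong refl) (use nz in \<open>simp add: field_simps\<close>)
  also have "\<dots> = of_nat n + z * (\<Sum>i<n. 1 / (of_real (x i) - z))"
    by (simp only: sum.distrib sum_distrib_left) simp
  finally show ?thesis using n by (simp add: stieltjes_def add_divide_distrib)
qed

lemma Re_ratio_imaginary:
  assumes "0 < e" shows "Re (of_real v / (of_real v - \<i> * of_real e)) = v\<^sup>2 / (v\<^sup>2 + e\<^sup>2)"
  using assms by (simp add: Re_divide power2_eq_square)

text \<open>
  The truncated fourth moment is the difference of the second moment and of \<open>e\<^sup>2 Re (1 + z S)\<close>. By the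
  self-consistent equation \<open>S\<close> may be replaced by the transform of the bounded spectrum \<open>lam\<close> at
  \<open>w = z + T S\<close>, and the shift contributes \<open>T\<close> since \<open>S\<close> is close to \<open>- 1 /
  z\<close>. What remains is the known deviation of the second moments, an error of order \<open>1 / e\<close>, and the
  residual \<open>r\<close> of the equation.
\<close>
lemma truncated_moment_bound:
  fixes y lam :: "nat \<Rightarrow> real"
  assumes n: "0 < n" and e: "1 \<le> e" and T: "0 \<le> T" and K: "0 \<le> K" and lam: "\<And>i. i < n \<Longrightarrow> \<bar>lam i\<bar> \<le> K"
    and M: "avg n (\<lambda>i. (y i)\<^sup>2) \<le> M"
  defines "z \<equiv> \<i> * of_real e"
  defines "S \<equiv> stieltjes n y z"
  defines "r \<equiv> S - stieltjes n lam (z + of_real T * S)"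
  shows "avg n (\<lambda>i. (y i) ^ 4 / ((y i)\<^sup>2 + e\<^sup>2))
    \<le> \<bar>avg n (\<lambda>i. (y i)\<^sup>2) - avg n (\<lambda>i. (lam i)\<^sup>2) - T\<bar> + (K ^ 4 + K * T + 2 * T * (1 + M)) / e + e\<^sup>2 * (e + T) * cmod r"
proof -
  have e0: "0 < e" and z_im: "Im z = e" and z0: "z \<noteq> 0" and zn: "cmod z = e" using e by (auto simp: z_def norm_mult)
  have z_im0: "Im z \<noteq> 0" using z_im e0 by simp
  define w where "w = z + of_real T * S"
  define \<phi> where "\<phi> = stieltjes n lam w"
  have n1: "real n \<noteq> 0" using n by simp
  have S_im: "0 \<le> Im S" unfolding S_def using z_im e0 by (intro Im_stieltjes_nonneg) simp
  have S_le: "cmod S \<le> 1 / e" unfolding S_def by (rule norm_stieltjes_le) (use z_im e0 in auto)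
  have w_im: "e \<le> Im w" using S_im T by (simp add: w_def z_im)
  have wz: "cmod (w - z) \<le> T / e" using S_le T mult_left_mono[OF S_le T] by (simp add: w_def norm_mult)
  have TE: "T / e \<le> T" using T e by (simp add: divide_le_eq mult_le_cancel_left1)
  have wn: "cmod w \<le> e + T" using norm_triangle_ineq[of z "w - z"] wz TE zn by simp
  have M0: "0 \<le> M" using M avg_nonneg[of n "\<lambda>i. (y i)\<^sup>2"] by simp
  \<comment> \<open>the truncated second moment of the sample\<close>
  have reS: "Re (1 + z * S) = avg n (\<lambda>i. (y i)\<^sup>2 / ((y i)\<^sup>2 + e\<^sup>2))"
  proof -
    have "Re (1 + z * S) = (\<Sum>i<n. Re (of_real (y i) / (of_real (y i) - z))) / n"
      unfolding S_def one_plus_stieltjes[OF n z_im0]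
      by (simp only: Re_divide_of_nat Re_sum)
    then show ?thesis unfolding z_def Re_ratio_imaginary[OF e0] avg_def .
  qed
  have moment: "avg n (\<lambda>i. (y i) ^ 4 / ((y i)\<^sup>2 + e\<^sup>2)) = avg n (\<lambda>i. (y i)\<^sup>2) - e\<^sup>2 * Re (1 + z * S)"
  proof -
    have "v ^ 4 / (v\<^sup>2 + e\<^sup>2) = v\<^sup>2 - e\<^sup>2 * (v\<^sup>2 / (v\<^sup>2 + e\<^sup>2))" for v :: real
    proof -
      have "v\<^sup>2 + e\<^sup>2 \<noteq> 0" using e0 by (simp add: add_nonneg_eq_0_iff)
      moreover have "v ^ 4 = v\<^sup>2 * v\<^sup>2" by (simp flip: power_add)
      ultimately show ?thesis by (simp add: field_simps)
    qed
    then show ?thesis unfolding reS by (simp only: avg_diff avg_cmult)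
  qed
  \<comment> \<open>the same quantity for the unperturbed spectrum\<close>
  have re_phi: "\<bar>Re (1 + w * \<phi>) - avg n (\<lambda>i. (lam i)\<^sup>2 / ((lam i)\<^sup>2 + e\<^sup>2))\<bar> \<le> K * T / e ^ 3"
  proof -
    have wi: "Im w \<noteq> 0" using w_im e0 by simp
    have avg_re: "avg n (\<lambda>i. (lam i)\<^sup>2 / ((lam i)\<^sup>2 + e\<^sup>2)) = (\<Sum>i<n. Re (of_real (lam i) / (of_real (lam i) - z))) / n"
      unfolding z_def Re_ratio_imaginary[OF e0] avg_def ..
    have "Re (1 + w * \<phi>) = (\<Sum>i<n. Re (of_real (lam i) / (of_real (lam i) - w))) / n"
      unfolding \<phi>_def one_plus_stieltjes[OF n wi] by (simp only: Re_divide_of_nat Re_sum)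
    then have "Re (1 + w * \<phi>) - avg n (\<lambda>i. (lam i)\<^sup>2 / ((lam i)\<^sup>2 + e\<^sup>2))
        = avg n (\<lambda>i. Re (of_real (lam i) / (of_real (lam i) - w)) - Re (of_real (lam i) / (of_real (lam i) - z)))"
      unfolding avg_re by (simp add: avg_def sum_subtractf diff_divide_distrib)
    also have "\<bar>\<dots>\<bar> \<le> avg n (\<lambda>i. \<bar>Re (of_real (lam i) / (of_real (lam i) - w)) - Re (of_real (lam i) / (of_real (lam i) - z))\<bar>)"
      by (rule abs_avg_le)
    also have "\<dots> \<le> avg n (\<lambda>i. K * T / e ^ 3)"
    proof (rule avg_mono)
      fix i assume i: "i < n"
      have "\<bar>Re (of_real (lam i) / (of_real (lam i) - w)) - Re (of_real (lam i) / (of_real (lam i) - z))\<bar>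
          \<le> cmod (of_real (lam i) / (of_real (lam i) - w) - of_real (lam i) / (of_real (lam i) - z))"
        using abs_Re_le_cmod[of "of_real (lam i) / (of_real (lam i) - w) - of_real (lam i) / (of_real (lam i) - z)"] by simp
      also have "of_real (lam i) / (of_real (lam i) - w) - of_real (lam i) / (of_real (lam i) - z)
          = of_real (lam i) * (1 / (of_real (lam i) - w) - 1 / (of_real (lam i) - z))" by (simp add: right_diff_distrib)
      also have "cmod \<dots> = \<bar>lam i\<bar> * cmod (1 / (of_real (lam i) - w) - 1 / (of_real (lam i) - z))"
        by (simp only: norm_mult norm_of_real)
      also have "\<dots> \<le> K * ((T / e) / e\<^sup>2)"
      proof (intro mult_mono lam i)
        have "cmod (1 / (of_real (lam i) - w) - 1 / (of_real (lam i) - z)) \<le> (\<bar>lam i - lam i\<bar> + cmod (w - z)) / e\<^sup>2"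
          by (rule norm_inverse_real_diff_lipschitz[OF e0 w_im]) (simp add: z_im)
        also have "\<dots> \<le> (T / e) / e\<^sup>2" using wz by (intro divide_right_mono) auto
        finally show "cmod (1 / (of_real (lam i) - w) - 1 / (of_real (lam i) - z)) \<le> (T / e) / e\<^sup>2" .
      qed (use K in auto)
      also have "\<dots> = K * T / e ^ 3" by (simp add: power3_eq_cube power2_eq_square)
      finally show "\<bar>Re (of_real (lam i) / (of_real (lam i) - w)) - Re (of_real (lam i) / (of_real (lam i) - z))\<bar> \<le> K * T / e ^ 3" .
    qed
    also have "\<dots> \<le> K * T / e ^ 3" by (rule avg_const_le) (use K T e0 in simp)
    finally show ?thesis .
  qed
  have lam_moment: "avg n (\<lambda>i. (lam i)\<^sup>2) - e\<^sup>2 * avg n (\<lambda>i. (lam i)\<^sup>2 / ((lam i)\<^sup>2 + e\<^sup>2)) \<le> K ^ 4 / e\<^sup>2"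
  proof -
    have "(lam i)\<^sup>2 - e\<^sup>2 * ((lam i)\<^sup>2 / ((lam i)\<^sup>2 + e\<^sup>2)) \<le> K ^ 4 / e\<^sup>2" if "i < n" for i
    proof -
      have "(lam i)\<^sup>2 + e\<^sup>2 \<noteq> 0" using e0 by (simp add: add_nonneg_eq_0_iff)
      moreover have "(lam i) ^ 4 = (lam i)\<^sup>2 * (lam i)\<^sup>2" by (simp flip: power_add)
      ultimately have "(lam i)\<^sup>2 - e\<^sup>2 * ((lam i)\<^sup>2 / ((lam i)\<^sup>2 + e\<^sup>2)) = (lam i) ^ 4 / ((lam i)\<^sup>2 + e\<^sup>2)"
        by (simp add: field_simps)
      also have "\<dots> = \<bar>lam i\<bar> ^ 4 / ((lam i)\<^sup>2 + e\<^sup>2)" by simp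
      also have "\<dots> \<le> K ^ 4 / e\<^sup>2" using lam[OF that] e0 by (intro frac_le power_mono) auto
      finally show ?thesis .
    qed
    then have "avg n (\<lambda>i. (lam i)\<^sup>2 - e\<^sup>2 * ((lam i)\<^sup>2 / ((lam i)\<^sup>2 + e\<^sup>2))) \<le> avg n (\<lambda>i. K ^ 4 / e\<^sup>2)" by (intro avg_mono)
    also have "\<dots> \<le> K ^ 4 / e\<^sup>2" by (rule avg_const_le) simp
    finally show ?thesis by (simp only: avg_diff avg_cmult)
  qed
  \<comment> \<open>\<open>S\<close> is close to \<open>- 1 / z\<close>\<close>
  have Sz: "cmod (S + 1 / z) \<le> (1 + M) / e\<^sup>2"
  proof -
    have nz: "of_real v - z \<noteq> 0" for v :: real using z_im e0 by (auto simp: complex_eq_iff)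
    have "S + 1 / z = (1 + z * S) / z" using z0 by (simp add: field_simps)
    also have "\<dots> = (\<Sum>i<n. of_real (y i) / (of_real (y i) - z)) / of_nat n / z"
      unfolding S_def using one_plus_stieltjes[OF n, of z y] z_im e0 by simp
    finally have "cmod (S + 1 / z) = cmod (\<Sum>i<n. of_real (y i) / (of_real (y i) - z)) / n / e"
      by (simp add: norm_divide norm_mult zn)
    also have "\<dots> \<le> (\<Sum>i<n. \<bar>y i\<bar> * (1 / e)) / n / e"
    proof (intro divide_right_mono sum_norm_le)
      fix i
      have "cmod (of_real (y i) / (of_real (y i) - z)) = \<bar>y i\<bar> * cmod (1 / (of_real (y i) - z))"
        by (simp add: norm_divide)
      also have "\<dots> \<le> \<bar>y i\<bar> * (1 / e)"
        by (intro mult_left_mono norm_inverse_real_diff_le e0) (auto simp: z_im)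
      finally show "cmod (of_real (y i) / (of_real (y i) - z)) \<le> \<bar>y i\<bar> * (1 / e)" .
    qed (use e0 in auto)
    also have "\<dots> = avg n (\<lambda>i. \<bar>y i\<bar>) / e\<^sup>2"
      by (simp add: avg_def sum_divide_distrib[symmetric] power2_eq_square)
    also have "\<dots> \<le> (1 + M) / e\<^sup>2"
    proof (intro divide_right_mono)
      have "\<bar>v\<bar> \<le> 1 + v\<^sup>2" for v :: real
        using zero_le_power2[of "\<bar>v\<bar> - 1"] abs_ge_zero[of v] by (simp add: power2_diff)
      then have "avg n (\<lambda>i. \<bar>y i\<bar>) \<le> avg n (\<lambda>i. 1 + (y i)\<^sup>2)" by (intro avg_mono)
      also have "\<dots> \<le> 1 + M" unfolding avg_add using M avg_const_le[of 1 n] by simp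
      finally show "avg n (\<lambda>i. \<bar>y i\<bar>) \<le> 1 + M" .
    qed simp
    finally show ?thesis .
  qed
  have S2: "T * (1 + e\<^sup>2 * Re (S\<^sup>2)) \<le> 2 * T * (1 + M) / e"
  proof -
    have zz: "(1 / z)\<^sup>2 = - of_real (1 / e\<^sup>2)" using e0 by (simp add: z_def power_mult_distrib power_divide)
    have "1 + e\<^sup>2 * Re (S\<^sup>2) = e\<^sup>2 * Re (S\<^sup>2 - (1 / z)\<^sup>2)" unfolding zz using e0 by (simp add: distrib_left)
    also have "\<dots> \<le> e\<^sup>2 * cmod (S\<^sup>2 - (1 / z)\<^sup>2)" by (intro mult_left_mono complex_Re_le_cmod) auto
    also have "S\<^sup>2 - (1 / z)\<^sup>2 = (S - 1 / z) * (S + 1 / z)" by (simp add: power2_eq_square algebra_simps)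
    also have "cmod \<dots> \<le> (2 / e) * ((1 + M) / e\<^sup>2)"
      unfolding norm_mult
    proof (intro mult_mono Sz)
      show "cmod (S - 1 / z) \<le> 2 / e"
        using norm_triangle_ineq4[of S "1 / z"] S_le by (simp add: norm_divide zn)
    qed (use e0 in auto)
    finally have "1 + e\<^sup>2 * Re (S\<^sup>2) \<le> e\<^sup>2 * ((2 / e) * ((1 + M) / e\<^sup>2))" by (simp add: mult_left_mono)
    also have "\<dots> = 2 * (1 + M) / e" using e0 by simp
    finally have "T * (1 + e\<^sup>2 * Re (S\<^sup>2)) \<le> T * (2 * (1 + M) / e)" using T by (rule mult_left_mono)
    then show ?thesis by (simp add: mult_ac)
  qed
  have S_split: "1 + z * S = (1 + w * \<phi>) + w * r - of_real T * S\<^sup>2"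
  proof -
    have ph: "\<phi> = S - r" by (simp add: r_def \<phi>_def w_def)
    have 1: "w * \<phi> = w * S - w * r" unfolding ph by (rule right_diff_distrib)
    have 2: "w * S = z * S + of_real T * S\<^sup>2" unfolding w_def power2_eq_square distrib_right mult.assoc ..
    show ?thesis unfolding 1 2 by simp
  qed
  have wr: "\<bar>Re (w * r)\<bar> \<le> (e + T) * cmod r"
    using abs_Re_le_cmod[of "w * r"] mult_right_mono[OF wn norm_ge_zero[of r]] by (simp add: norm_mult)
  have "avg n (\<lambda>i. (y i) ^ 4 / ((y i)\<^sup>2 + e\<^sup>2))
      = (avg n (\<lambda>i. (y i)\<^sup>2) - avg n (\<lambda>i. (lam i)\<^sup>2) - T) + (avg n (\<lambda>i. (lam i)\<^sup>2) - e\<^sup>2 * Re (1 + w * \<phi>))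
        + (- (e\<^sup>2 * Re (w * r))) + T * (1 + e\<^sup>2 * Re (S\<^sup>2))"
    unfolding moment S_split by (simp add: algebra_simps)
  also have "\<dots> \<le> \<bar>avg n (\<lambda>i. (y i)\<^sup>2) - avg n (\<lambda>i. (lam i)\<^sup>2) - T\<bar> + (K ^ 4 / e\<^sup>2 + e\<^sup>2 * (K * T / e ^ 3))
        + e\<^sup>2 * ((e + T) * cmod r) + 2 * T * (1 + M) / e"
  proof (intro add_mono S2 abs_ge_self)
    have "e\<^sup>2 * (avg n (\<lambda>i. (lam i)\<^sup>2 / ((lam i)\<^sup>2 + e\<^sup>2)) - Re (1 + w * \<phi>)) \<le> e\<^sup>2 * (K * T / e ^ 3)"
      using re_phi by (intro mult_left_mono) auto
    then show "avg n (\<lambda>i. (lam i)\<^sup>2) - e\<^sup>2 * Re (1 + w * \<phi>) \<le> K ^ 4 / e\<^sup>2 + e\<^sup>2 * (K * T / e ^ 3)"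
      using lam_moment unfolding right_diff_distrib by linarith
    have "- (e\<^sup>2 * Re (w * r)) = e\<^sup>2 * (- Re (w * r))" by (rule minus_mult_right)
    also have "\<dots> \<le> e\<^sup>2 * \<bar>Re (w * r)\<bar>" by (intro mult_left_mono abs_ge_minus_self) auto
    also have "\<dots> \<le> e\<^sup>2 * ((e + T) * cmod r)" by (intro mult_left_mono wr) auto
    finally show "- (e\<^sup>2 * Re (w * r)) \<le> e\<^sup>2 * ((e + T) * cmod r)" .
  qed
  also have "\<dots> \<le> \<bar>avg n (\<lambda>i. (y i)\<^sup>2) - avg n (\<lambda>i. (lam i)\<^sup>2) - T\<bar> + (K ^ 4 / e + K * T / e)
        + e\<^sup>2 * ((e + T) * cmod r) + 2 * T * (1 + M) / e"
  proof -
    have "e \<le> e\<^sup>2" using e by (simp add: power2_eq_square)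
    then have "K ^ 4 / e\<^sup>2 \<le> K ^ 4 / e" using e0 by (intro divide_left_mono) auto
    moreover have "e\<^sup>2 * (K * T / e ^ 3) = K * T / e" using e0 by (simp add: power3_eq_cube power2_eq_square)
    ultimately show ?thesis by simp
  qed
  also have "\<dots> = \<bar>avg n (\<lambda>i. (y i)\<^sup>2) - avg n (\<lambda>i. (lam i)\<^sup>2) - T\<bar> + (K ^ 4 + K * T + 2 * T * (1 + M)) / e + e\<^sup>2 * (e + T) * cmod r"
    by (simp add: add_divide_distrib mult.assoc)
  finally show ?thesis .
qed

text \<open>
  If the second moment exceeds that of \<open>lam\<close> by exactly the amount \<open>T\<close> that the equation predicts,
  no mass can have escaped to infinity. The parameter \<open>e\<close> is chosen before \<open>n\<close>, so that the
  residual at \<open>e\<close> tends to zero.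
\<close>
theorem uniformly_integrable_perturbed:
  fixes y lam :: "nat \<Rightarrow> nat \<Rightarrow> real"
  assumes T: "0 \<le> T" and K: "0 \<le> K" and lam: "\<forall>\<^sub>F n in sequentially. \<forall>i<n. \<bar>lam n i\<bar> \<le> K"
    and sec: "(\<lambda>n. avg n (\<lambda>i. (y n i)\<^sup>2) - avg n (\<lambda>i. (lam n i)\<^sup>2) - T) \<longlonglongrightarrow> 0"
    and res: "\<And>e. c \<le> e \<Longrightarrow> (\<lambda>n. stieltjes n (y n) (\<i> * of_real e)
        - stieltjes n (lam n) (\<i> * of_real e + of_real T * stieltjes n (y n) (\<i> * of_real e))) \<longlonglongrightarrow> 0"
    and eps: "0 < \<epsilon>"
  shows "\<exists>K>0. \<forall>\<^sub>F n in sequentially. tail K n (y n) \<le> \<epsilon>"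
proof -
  define M where "M = K\<^sup>2 + T + 1"
  define C where "C = K ^ 4 + K * T + 2 * T * (1 + M)"
  have C0: "0 \<le> C" using K T by (simp add: C_def M_def)
  define e where "e = max (max 1 c) (6 * C / \<epsilon> + 1)"
  have e: "1 \<le> e" "c \<le> e" "6 * C / \<epsilon> \<le> e" by (auto simp: e_def)
  have Ce: "C / e \<le> \<epsilon> / 6"
  proof -
    have "6 * C \<le> e * \<epsilon>" using e(3) eps by (simp add: divide_le_eq)
    then show ?thesis using e(1) by (simp add: divide_le_eq mult.commute)
  qed
  define r where "r n = stieltjes n (y n) (\<i> * of_real e)
        - stieltjes n (lam n) (\<i> * of_real e + of_real T * stieltjes n (y n) (\<i> * of_real e))" for n
  have "(\<lambda>n. e\<^sup>2 * (e + T) * cmod (r n)) \<longlonglongrightarrow> e\<^sup>2 * (e + T) * 0"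
    using tendsto_norm_zero[OF res[OF e(2)]] unfolding r_def by (intro tendsto_mult_left)
  then have rl: "\<forall>\<^sub>F n in sequentially. \<bar>e\<^sup>2 * (e + T) * cmod (r n)\<bar> \<le> \<epsilon> / 6"
    using eps by (intro eventually_abs_le) auto
  have d1: "\<forall>\<^sub>F n in sequentially. \<bar>avg n (\<lambda>i. (y n i)\<^sup>2) - avg n (\<lambda>i. (lam n i)\<^sup>2) - T\<bar> \<le> min 1 (\<epsilon> / 6)"
    by (rule eventually_abs_le[OF sec]) (use eps in simp)
  have "\<forall>\<^sub>F n in sequentially. tail e n (y n) \<le> \<epsilon>"
    using lam rl d1 eventually_gt_at_top[of 0]
  proof eventually_elim
    case (elim n)
    have "(lam n i)\<^sup>2 \<le> K\<^sup>2" if "i < n" for i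
      using elim(1) that abs_le_square_iff[of "lam n i" K] K by simp
    then have "avg n (\<lambda>i. (lam n i)\<^sup>2) \<le> avg n (\<lambda>i. K\<^sup>2)" by (intro avg_mono)
    also have "\<dots> \<le> K\<^sup>2" by (rule avg_const_le) simp
    finally have M: "avg n (\<lambda>i. (y n i)\<^sup>2) \<le> M" using elim(3) unfolding M_def by linarith
    have "tail e n (y n) \<le> 2 * avg n (\<lambda>i. (y n i) ^ 4 / ((y n i)\<^sup>2 + e\<^sup>2))"
      by (rule tail_le_truncated_moment) (use e(1) in simp)
    also have "\<dots> \<le> 2 * (\<bar>avg n (\<lambda>i. (y n i)\<^sup>2) - avg n (\<lambda>i. (lam n i)\<^sup>2) - T\<bar> + C / e + e\<^sup>2 * (e + T) * cmod (r n))"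
      unfolding C_def r_def using elim(1)
      by (intro mult_left_mono truncated_moment_bound[OF elim(4) e(1) T K _ M]) auto
    also have "\<dots> \<le> 2 * (\<epsilon> / 6 + \<epsilon> / 6 + \<epsilon> / 6)" using elim(2,3) Ce by (intro mult_left_mono add_mono) auto
    finally show ?case by simp
  qed
  then show ?thesis using e(1) by (intro exI[of _ e]) auto
qed

section \<open>Uniformity over diagonal matrices\<close>

lemma stieltjes_diag: "stieltjes n (eig_desc (mat_diag n t)) z = stieltjes n t z"
proof -
  have "map (eig_desc (mat_diag n t)) [0..<n] = rev (sort (map t [0..<n]))"
  proof (rule eig_desc_of_orthonormal)
    show "mat_diag n t \<in> carrier_mat n n" by simp
    show "orthonormal n (\<lambda>k i. of_bool (k = i))"
      unfolding orthonormal_def by (auto simp: sum_of_bool_mult)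
    show "mat_diag n t $$ (i, j) = (\<Sum>k<n. t k * of_bool (k = i) * of_bool (k = j))" if "i < n" "j < n" for i j
      using that by (simp add: mat_diag_def sum_of_bool_mult)
  qed
  then have m: "mset (map (eig_desc (mat_diag n t)) [0..<n]) = mset (map t [0..<n])"
    by (simp only: mset_rev mset_sort)
  have sl: "(\<Sum>k<n. 1 / (of_real (f k) - z)) = sum_mset (image_mset (\<lambda>v. 1 / (of_real v - z)) (mset (map f [0..<n])))" for f
    by (simp add: sum_unfold_sum_mset lessThan_atLeast0 image_mset.compositionality comp_def)
  show ?thesis unfolding stieltjes_def sl m ..
qed

text \<open>
  In the resolvent identity for two diagonal matrices with the same noise only the diagonal of a product of two resolvents
  appears, and this is bounded. The Hoffman--Wielandt inequality would give a bound by the \<open>l\<^sup>2\<close>-distance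
  instead, in which decreasing vectors of bounded second moment are not totally bounded.
\<close>
lemma stieltjes_perturbed_diag_le:
  assumes e: "0 < e" "e \<le> Im z"
  shows "cmod (stieltjes n (eig_desc (perturbed n (mat_diag n t) s w)) z
      - stieltjes n (eig_desc (perturbed n (mat_diag n t') s w)) z) \<le> avg n (\<lambda>i. \<bar>t i - t' i\<bar>) / e\<^sup>2"
proof (cases "n = 0")
  case True
  then show ?thesis by (simp add: stieltjes_def avg_def)
next
  case False
  let ?B = "perturbed n (mat_diag n t) s w" and ?B' = "perturbed n (mat_diag n t') s w"
  have sym: "real_symmetric n ?B" "real_symmetric n ?B'" by (intro perturbed_symmetric real_symmetric_diag)+
  have z: "Im z \<noteq> 0" using e by simp
  have d: "resolvent ?B' z i i - resolvent ?B z i i = (\<Sum>k<n. of_real (t k - t' k) * (resolvent ?B' z k i * resolvent ?B z i k))" if i: "i < n" for i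
  proof -
    have "resolvent ?B' z i i - resolvent ?B z i i
        = (\<Sum>k<n. \<Sum>l<n. of_bool (k = l) * (of_real (t k - t' k) * (resolvent ?B' z l i * resolvent ?B z i k)))"
      unfolding resolvent_identity[OF sym z z i i]
      by (intro sum.cong refl) (auto simp: perturbed_def mat_diag_def)
    also have "\<dots> = (\<Sum>k<n. of_real (t k - t' k) * (resolvent ?B' z k i * resolvent ?B z i k))"
      by (intro sum.cong refl) (simp only: sum_of_bool_mult lessThan_iff)
    finally show ?thesis .
  qed
  have "of_nat n * (stieltjes n (eig_desc ?B') z - stieltjes n (eig_desc ?B) z) = (\<Sum>i<n. resolvent ?B' z i i - resolvent ?B z i i)"
    unfolding right_diff_distrib resolvent_trace[OF sym(1), symmetric] resolvent_trace[OF sym(2), symmetric] sum_subtractf ..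
  also have "\<dots> = (\<Sum>i<n. \<Sum>k<n. of_real (t k - t' k) * (resolvent ?B' z k i * resolvent ?B z i k))"
    by (intro sum.cong refl d) simp
  also have "\<dots> = (\<Sum>k<n. of_real (t k - t' k) * mprod n (resolvent ?B' z) (resolvent ?B z) k k)"
    unfolding mprod_def sum_distrib_left by (rule sum.swap)
  finally have "real n * cmod (stieltjes n (eig_desc ?B') z - stieltjes n (eig_desc ?B) z)
      = cmod (\<Sum>k<n. of_real (t k - t' k) * mprod n (resolvent ?B' z) (resolvent ?B z) k k)"
    by (metis norm_mult norm_of_nat)
  also have "\<dots> \<le> (\<Sum>k<n. \<bar>t k - t' k\<bar> * (1 / e)\<^sup>2)"
  proof (rule sum_norm_le)
    fix k assume "k \<in> {..<n}"
    then have "cmod (mprod n (resolvent ?B' z) (resolvent ?B z) k k) \<le> (1 / e)\<^sup>2"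
      by (intro norm_mprod_resolvent_le[OF sym(2,1) e(1,2,2)]) auto
    then show "cmod (of_real (t k - t' k) * mprod n (resolvent ?B' z) (resolvent ?B z) k k) \<le> \<bar>t k - t' k\<bar> * (1 / e)\<^sup>2"
      unfolding norm_mult norm_of_real by (intro mult_left_mono) auto
  qed
  also have "\<dots> = real n * (avg n (\<lambda>i. \<bar>t i - t' i\<bar>) / e\<^sup>2)"
    using False by (simp add: avg_def sum_divide_distrib[symmetric] power_divide)
  finally show ?thesis using False by (simp only: mult_le_cancel_left_pos of_nat_0_less_iff norm_minus_commute neq0_conv)
qed

lemma residual_diag_lipschitz:
  assumes T: "0 \<le> T" and e: "0 < e" "e \<le> Im z"
  shows "residual n T z (mat_diag n t) (perturbed n (mat_diag n t) s w)
    \<le> residual n T z (mat_diag n t') (perturbed n (mat_diag n t') s w) + (2 / e\<^sup>2 + T / e ^ 4) * avg n (\<lambda>i. \<bar>t i - t' i\<bar>)"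
proof -
  define \<Delta> where "\<Delta> = avg n (\<lambda>i. \<bar>t i - t' i\<bar>)"
  define S where "S t = stieltjes n (eig_desc (perturbed n (mat_diag n t) s w)) z" for t
  define \<phi> where "\<phi> t = stieltjes n t (z + of_real T * S t)" for t
  have res: "residual n T z (mat_diag n t) (perturbed n (mat_diag n t) s w) = cmod (S t - \<phi> t)" for t
    unfolding residual_def stieltjes_diag S_def \<phi>_def ..
  have 1: "cmod (S t - S t') \<le> \<Delta> / e\<^sup>2"
    unfolding S_def \<Delta>_def by (rule stieltjes_perturbed_diag_le[OF e])
  have im: "e \<le> Im (z + of_real T * S t)" for t
    using Im_shifted_ge[OF T, of z n "eig_desc (perturbed n (mat_diag n t) s w)"] e by (simp add: S_def)
  have "cmod (\<phi> t - \<phi> t') \<le> (\<Delta> + cmod ((z + of_real T * S t) - (z + of_real T * S t'))) / e\<^sup>2"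
    unfolding \<phi>_def \<Delta>_def avg_def by (rule stieltjes_lipschitz[OF e(1) im im])
  also have "(z + of_real T * S t) - (z + of_real T * S t') = of_real T * (S t - S t')" by (simp add: algebra_simps)
  also have "cmod (of_real T * (S t - S t')) \<le> T * (\<Delta> / e\<^sup>2)"
    using mult_left_mono[OF 1 T] T by (simp add: norm_mult)
  finally have 2: "cmod (\<phi> t - \<phi> t') \<le> (\<Delta> + T * (\<Delta> / e\<^sup>2)) / e\<^sup>2" by (simp add: divide_right_mono)
  have "cmod (S t - \<phi> t) = cmod ((S t' - \<phi> t') + ((S t - S t') - (\<phi> t - \<phi> t')))" by simp
  also have "\<dots> \<le> cmod (S t' - \<phi> t') + (cmod (S t - S t') + cmod (\<phi> t - \<phi> t'))"
    by (intro order_trans[OF norm_triangle_ineq] add_left_mono norm_triangle_ineq4)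
  also have "\<dots> \<le> cmod (S t' - \<phi> t') + (\<Delta> / e\<^sup>2 + (\<Delta> + T * (\<Delta> / e\<^sup>2)) / e\<^sup>2)" using 1 2 by (intro add_left_mono add_mono)
  also have "\<dots> = cmod (S t' - \<phi> t') + (2 / e\<^sup>2 + T / e ^ 4) * \<Delta>"
  proof -
    have "e ^ 4 = e\<^sup>2 * e\<^sup>2" by (simp flip: power_add)
    then show ?thesis by (simp add: add_divide_distrib distrib_right)
  qed
  finally show ?thesis unfolding res \<Delta>_def .
qed

text \<open>
  A step function with \<open>length rs\<close> blocks of nearly equal size. The values are rational so that there are only
  countably many of them, and one list serves all \<open>n\<close>.
\<close>
definition profile :: "rat list \<Rightarrow> nat \<Rightarrow> nat \<Rightarrow> real" where
  "profile rs n i = of_rat (rs ! (i * length rs div n))"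

lemma card_block_le:
  fixes n L b :: nat
  shows "card {i. i < n \<and> i * L div n = b} * L \<le> n + L"
proof (cases "{i. i < n \<and> i * L div n = b} = {}")
  case True
  then show ?thesis by (simp only: card.empty mult_0)
next
  case False
  let ?A = "{i. i < n \<and> i * L div n = b}"
  have fin: "finite ?A" by simp
  define lo where "lo = Min ?A"
  define hi where "hi = Max ?A"
  have lo: "lo \<in> ?A" and hi: "hi \<in> ?A" using Min_in[OF fin False] Max_in[OF fin False] unfolding lo_def hi_def by blast+
  have sub: "?A \<subseteq> {lo..hi}" unfolding lo_def hi_def using fin by auto
  have le: "lo \<le> hi" using sub lo by auto
  have n0: "0 < n" using lo by auto
  have lo': "lo * L div n = b" and hi': "hi * L div n = b" using lo hi by auto
  have "b * n \<le> lo * L" unfolding lo'[symmetric] by (rule div_times_less_eq_dividend)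
  moreover have "hi * L < (b + 1) * n" unfolding hi'[symmetric] using dividend_less_times_div[OF n0, of "hi * L"] by (simp add: mult.commute)
  ultimately have "hi * L \<le> lo * L + n" by simp
  moreover have "card ?A \<le> hi - lo + 1" using card_mono[OF _ sub] le by simp
  ultimately have "card ?A * L \<le> (hi - lo + 1) * L" "(hi - lo) * L \<le> n"
    using mult_le_mono1[of "card ?A" "hi - lo + 1" L] by (auto simp: diff_mult_distrib)
  then show ?thesis by simp
qed

text \<open>
  The value in block \<open>b\<close> is taken at the first index \<open>f b\<close> of this block. Within a block a
  decreasing vector varies by at most the drop to the next block, and these drops telescope to \<open>2 * K\<close>; each of
  them is counted once for every index of its block.
\<close>
lemma decreasing_near_step:
  fixes t :: "nat \<Rightarrow> real"
  assumes t: "\<And>i j. i \<le> j \<Longrightarrow> j < n \<Longrightarrow> t j \<le> t i" and b: "\<And>i. i < n \<Longrightarrow> \<bar>t i\<bar> \<le> K" and K: "0 \<le> K"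
    and L: "0 < L" and n: "0 < n"
  shows "\<exists>\<tau>. (\<forall>b<L. \<bar>\<tau> b\<bar> \<le> K) \<and> avg n (\<lambda>i. \<bar>t i - \<tau> (i * L div n)\<bar>) \<le> 2 * K * (1 / L + 1 / n)"
proof -
  define f where "f b = (LEAST i. b * n \<le> i * L)" for b
  have f: "b * n \<le> f b * L" for b
    unfolding f_def by (rule LeastI[of "\<lambda>i. b * n \<le> i * L" "b * n"]) (use L in simp)
  have f_le: "f b \<le> i" if "b * n \<le> i * L" for b i unfolding f_def using that by (rule Least_le)
  define \<tau> where "\<tau> b = (if f b < n then t (f b) else - K)" for b
  have \<tau>K: "\<bar>\<tau> b\<bar> \<le> K" for b using assms by (auto simp: \<tau>_def)
  have f_mono: "f b \<le> f (Suc b)" for b using f[of "Suc b"] by (intro f_le) simp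
  have \<tau>_mono: "\<tau> (Suc b) \<le> \<tau> b" for b
  proof (cases "f (Suc b) < n")
    case True
    then show ?thesis using f_mono[of b] t[of "f b" "f (Suc b)"] by (simp add: \<tau>_def)
  next
    case False
    then have "\<tau> (Suc b) = - K" by (simp add: \<tau>_def)
    then show ?thesis using \<tau>K[of b] by (simp add: abs_le_iff)
  qed
  have pt: "\<bar>t i - \<tau> (i * L div n)\<bar> \<le> \<tau> (i * L div n) - \<tau> (Suc (i * L div n))" if i: "i < n" for i
  proof -
    define b where "b = i * L div n"
    have "b * n \<le> i * L" unfolding b_def by (rule div_times_less_eq_dividend)
    then have "f b \<le> i" by (rule f_le)
    then have 1: "t i \<le> \<tau> b" using t[of "f b" i] i by (simp add: \<tau>_def)
    have "i * L < Suc b * n" unfolding b_def using dividend_less_times_div[OF n, of "i * L"] by (simp add: mult.commute)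
    then have "i * L < f (Suc b) * L" using f[of "Suc b"] by linarith
    then have "i < f (Suc b)" by simp
    then have 2: "\<tau> (Suc b) \<le> t i" using t[of i "f (Suc b)"] b[OF i] by (auto simp: \<tau>_def abs_le_iff)
    show ?thesis unfolding b_def[symmetric] using 1 2 by simp
  qed
  have blk: "(\<lambda>i. i * L div n) ` {..<n} \<subseteq> {..<L}"
    using n L by (auto simp: less_mult_imp_div_less mult.commute)
  have "(\<Sum>i<n. \<bar>t i - \<tau> (i * L div n)\<bar>) \<le> (\<Sum>i<n. \<tau> (i * L div n) - \<tau> (Suc (i * L div n)))"
    by (intro sum_mono pt) simp
  also have "\<dots> = (\<Sum>b<L. \<Sum>i\<in>{i \<in> {..<n}. i * L div n = b}. \<tau> (i * L div n) - \<tau> (Suc (i * L div n)))"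
    by (rule sum.group[symmetric]) (use blk in auto)
  also have "\<dots> = (\<Sum>b<L. real (card {i. i < n \<and> i * L div n = b}) * (\<tau> b - \<tau> (Suc b)))"
    by (intro sum.cong refl) simp
  also have "\<dots> \<le> (\<Sum>b<L. (real n / L + 1) * (\<tau> b - \<tau> (Suc b)))"
  proof (intro sum_mono mult_right_mono)
    fix b
    have "real (card {i. i < n \<and> i * L div n = b} * L) \<le> real (n + L)"
      using card_block_le[of n L b] by (simp only: of_nat_le_iff)
    then show "real (card {i. i < n \<and> i * L div n = b}) \<le> real n / L + 1"
      using L by (simp add: field_simps)
    show "0 \<le> \<tau> b - \<tau> (Suc b)" using \<tau>_mono[of b] by simp
  qed
  also have "\<dots> = (real n / L + 1) * (\<tau> 0 - \<tau> L)"
    by (simp only: sum_distrib_left[symmetric] sum_lessThan_telescope')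
  also have "\<dots> \<le> (real n / L + 1) * (2 * K)"
    using \<tau>K[of 0] \<tau>K[of L] by (intro mult_left_mono) (auto simp: abs_le_iff)
  finally have "avg n (\<lambda>i. \<bar>t i - \<tau> (i * L div n)\<bar>) \<le> (real n / L + 1) * (2 * K) / n"
    unfolding avg_def by (rule divide_right_mono) simp
  also have "\<dots> = 2 * K * (1 / L + 1 / n)" using n L by (simp add: field_simps)
  finally show ?thesis using \<tau>K by blast
qed

lemma clip_dist: "0 < K \<Longrightarrow> \<bar>v - clip K v\<bar> \<le> v\<^sup>2 / K"
proof -
  assume K: "0 < K"
  show ?thesis
  proof (cases "\<bar>v\<bar> \<le> K")
    case True
    then have "clip K v = v" using K by (auto simp: clip_def abs_le_iff)
    then show ?thesis using K by simp
  next
    case False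
    then have "\<bar>v - clip K v\<bar> \<le> \<bar>v\<bar>" using K by (auto simp: clip_def max_def min_def abs_if)
    also have "\<bar>v\<bar> * K \<le> \<bar>v\<bar> * \<bar>v\<bar>" using False by (intro mult_left_mono) auto
    then have "\<bar>v\<bar> \<le> v\<^sup>2 / K" using K by (simp add: le_divide_eq power2_eq_square)
    finally show ?thesis .
  qed
qed

text \<open>
  Clipping at a level \<open>K\<close> costs little in the \<open>l\<^sup>1\<close>-distance because of the second moment.
  Then the vector is replaced by a step function with \<open>L\<close> blocks, and its values are rounded to multiples of
  \<open>1 / D\<close>. None of \<open>K\<close>, \<open>L\<close>, \<open>D\<close> depends on \<open>n\<close>.
\<close>
lemma finite_profile_net:
  assumes \<epsilon>: "0 < \<epsilon>" and M: "0 \<le> M"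
  shows "\<exists>F N. finite F \<and> (\<forall>n\<ge>N. \<forall>t. (\<forall>i j. i \<le> j \<longrightarrow> j < n \<longrightarrow> t j \<le> t i) \<longrightarrow> avg n (\<lambda>i. (t i)\<^sup>2) \<le> M
           \<longrightarrow> (\<exists>rs\<in>F. avg n (\<lambda>i. \<bar>t i - profile rs n i\<bar>) \<le> \<epsilon>))"
proof -
  define K where "K = 4 * M / \<epsilon> + 1"
  have K: "0 < K" using \<epsilon> M by (simp add: K_def add_nonneg_pos)
  have MK: "M / K \<le> \<epsilon> / 4"
  proof -
    have "M = \<epsilon> / 4 * (4 * M / \<epsilon>)" using \<epsilon> by simp
    also have "\<dots> \<le> \<epsilon> / 4 * K" using \<epsilon> by (intro mult_left_mono) (auto simp: K_def)
    finally show ?thesis using K by (simp add: divide_le_eq)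
  qed
  obtain L :: nat where L: "8 * K / \<epsilon> < real L" using reals_Archimedean2 by blast
  have "0 < 8 * K / \<epsilon>" using K \<epsilon> by simp
  then have L0: "0 < L" using L by (cases L) auto
  have small: "2 * K * (1 / real m) \<le> \<epsilon> / 4" if "L \<le> m" for m
  proof -
    have "8 * K / \<epsilon> \<le> real m" using L that by simp
    then have "8 * K \<le> real m * \<epsilon>" using \<epsilon> by (simp add: divide_le_eq)
    then show ?thesis using L0 that by (simp add: divide_le_eq mult.commute)
  qed
  obtain D :: nat where D: "4 / \<epsilon> < real D" using reals_Archimedean2 by blast
  have "0 < 4 / \<epsilon>" using \<epsilon> by simp
  then have D0: "0 < D" using D by (cases D) auto
  have D1: "1 / real D \<le> \<epsilon> / 4"
  proof -
    have "4 \<le> real D * \<epsilon>" using D \<epsilon> by (simp add: divide_less_eq less_imp_le)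
    then show ?thesis using D0 by (simp add: divide_le_eq mult.commute)
  qed
  define J where "J = \<lceil>K * D\<rceil> + 1"
  define F where "F = {rs :: rat list. set rs \<subseteq> (\<lambda>j. of_int j / of_nat D) ` {- J..J} \<and> length rs = L}"
  have "finite F" unfolding F_def by (rule finite_lists_length_eq) simp
  moreover have "\<exists>rs\<in>F. avg n (\<lambda>i. \<bar>t i - profile rs n i\<bar>) \<le> \<epsilon>"
    if n: "L \<le> n" and t: "\<forall>i j. i \<le> j \<longrightarrow> j < n \<longrightarrow> t j \<le> t i" and tM: "avg n (\<lambda>i. (t i)\<^sup>2) \<le> M" for n t
  proof -
    have n0: "0 < n" using n L0 by simp
    define t' where "t' i = clip K (t i)" for i
    have "\<exists>\<tau>. (\<forall>b<L. \<bar>\<tau> b\<bar> \<le> K) \<and> avg n (\<lambda>i. \<bar>t' i - \<tau> (i * L div n)\<bar>) \<le> 2 * K * (1 / L + 1 / n)"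
    proof (rule decreasing_near_step)
      show "t' j \<le> t' i" if "i \<le> j" "j < n" for i j
        proof -
          have "t j \<le> t i" using t that by blast
          then show ?thesis by (auto simp: t'_def clip_def max_def min_def)
        qed
      show "\<bar>t' i\<bar> \<le> K" for i unfolding t'_def by (rule clip_bounds) (use K in simp)
    qed (use K L0 n0 in auto)
    then obtain \<tau> where \<tau>: "\<And>b. b < L \<Longrightarrow> \<bar>\<tau> b\<bar> \<le> K"
      and d2: "avg n (\<lambda>i. \<bar>t' i - \<tau> (i * L div n)\<bar>) \<le> 2 * K * (1 / L + 1 / n)" by blast
    define rs :: "rat list" where "rs = map (\<lambda>b. of_int \<lfloor>\<tau> b * D\<rfloor> / of_nat D) [0..<L]"
    have "\<lfloor>\<tau> b * D\<rfloor> \<in> {- J..J}" if b: "b < L" for b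
    proof -
      have "\<bar>\<tau> b * D\<bar> \<le> K * D" using \<tau>[OF b] by (simp add: abs_mult mult_right_mono)
      then have "- (K * D) \<le> \<tau> b * D" "\<tau> b * D \<le> K * D" by (simp_all add: abs_le_iff)
      then show ?thesis unfolding J_def by simp linarith
    qed
    then have "rs \<in> F" by (auto simp: F_def rs_def)
    have prof: "profile rs n i = of_int \<lfloor>\<tau> (i * L div n) * D\<rfloor> / D" if i: "i < n" for i
    proof -
      have "i * L div n < L" using i n0 L0 by (simp add: less_mult_imp_div_less mult.commute)
      then show ?thesis by (simp add: profile_def rs_def of_rat_divide)
    qed
    have d3: "\<bar>\<tau> (i * L div n) - profile rs n i\<bar> \<le> 1 / D" if "i < n" for i
    proof -
      define v where "v = \<tau> (i * L div n) * D"
      have "\<tau> (i * L div n) - profile rs n i = (v - of_int \<lfloor>v\<rfloor>) / D"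
        unfolding prof[OF that] v_def using D0 by (simp add: diff_divide_distrib)
      moreover have "0 \<le> v - of_int \<lfloor>v\<rfloor>" "v - of_int \<lfloor>v\<rfloor> \<le> 1" by linarith+
      ultimately show ?thesis using D0 by (simp add: abs_divide divide_right_mono)
    qed
    have "avg n (\<lambda>i. \<bar>t i - profile rs n i\<bar>)
        \<le> avg n (\<lambda>i. 1 / K * (t i)\<^sup>2 + \<bar>t' i - \<tau> (i * L div n)\<bar> + 1 / D)"
    proof (rule avg_mono)
      fix i assume "i < n"
      have "\<bar>t i - t' i\<bar> \<le> 1 / K * (t i)\<^sup>2" unfolding t'_def using clip_dist[OF K, of "t i"] by simp
      then show "\<bar>t i - profile rs n i\<bar> \<le> 1 / K * (t i)\<^sup>2 + \<bar>t' i - \<tau> (i * L div n)\<bar> + 1 / D"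
        using d3[OF \<open>i < n\<close>] by linarith
    qed
    also have "\<dots> = 1 / K * avg n (\<lambda>i. (t i)\<^sup>2) + avg n (\<lambda>i. \<bar>t' i - \<tau> (i * L div n)\<bar>) + avg n (\<lambda>i. 1 / D)"
      by (simp only: avg_add avg_cmult)
    also have "\<dots> \<le> \<epsilon> / 4 + (\<epsilon> / 4 + \<epsilon> / 4) + \<epsilon> / 4"
    proof (intro add_mono)
      show "1 / K * avg n (\<lambda>i. (t i)\<^sup>2) \<le> \<epsilon> / 4"
        by (rule order_trans[OF mult_left_mono[OF tM]]) (use K MK in auto)
      show "avg n (\<lambda>i. \<bar>t' i - \<tau> (i * L div n)\<bar>) \<le> \<epsilon> / 4 + \<epsilon> / 4"
        using d2 small[of L] small[OF n] by (simp add: distrib_left)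
      show "avg n (\<lambda>i. 1 / D) \<le> \<epsilon> / 4" using avg_const_le[of "1 / D" n] D1 by simp
    qed
    also have "\<dots> = \<epsilon>" by simp
    finally show ?thesis using \<open>rs \<in> F\<close> by blast
  qed
  ultimately show ?thesis by blast
qed

text \<open>
  The vectors \<open>t n\<close> may depend on the noise \<open>w\<close>. For given accuracy they are, for large
  \<open>n\<close>, close to one of finitely many profiles, for each of which the residual tends to zero.
\<close>
theorem residual_tendsto_uniformly:
  fixes t :: "nat \<Rightarrow> nat \<Rightarrow> real" and s :: "nat \<Rightarrow> real"
  assumes T: "0 \<le> T" and z: "0 < Im z"
    and prof: "\<And>rs. (\<lambda>n. residual n T z (mat_diag n (profile rs n)) (perturbed n (mat_diag n (profile rs n)) (s n) (w n))) \<longlonglongrightarrow> 0"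
    and t: "\<And>n i j. i \<le> j \<Longrightarrow> j < n \<Longrightarrow> t n j \<le> t n i"
    and M: "\<forall>\<^sub>F n in sequentially. avg n (\<lambda>i. (t n i)\<^sup>2) \<le> M"
  shows "(\<lambda>n. residual n T z (mat_diag n (t n)) (perturbed n (mat_diag n (t n)) (s n) (w n))) \<longlonglongrightarrow> 0"
proof (rule tendsto_zero_by_eps)
  fix \<epsilon> :: real assume \<epsilon>: "0 < \<epsilon>"
  define C where "C = 2 / (Im z)\<^sup>2 + T / (Im z) ^ 4"
  have C: "0 \<le> C" using T z by (simp add: C_def)
  define d where "d = \<epsilon> / (2 * (C + 1))"
  have d: "0 < d" using \<epsilon> C by (simp add: d_def)
  have "C * d \<le> (C + 1) * d" using d by (intro mult_right_mono) auto
  also have "\<dots> = \<epsilon> / 2"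
  proof -
    have "q * (\<epsilon> / (2 * q)) = \<epsilon> / 2" if "q \<noteq> 0" for q using that by simp
    from this[of "C + 1"] show ?thesis using C by (simp only: d_def)
  qed
  finally have Cd: "C * d \<le> \<epsilon> / 2" .
  obtain F N where F: "finite F" and net: "\<And>n t. N \<le> n \<Longrightarrow> (\<forall>i j. i \<le> j \<longrightarrow> j < n \<longrightarrow> t j \<le> t i) \<Longrightarrow>
      avg n (\<lambda>i. (t i)\<^sup>2) \<le> max M 0 \<Longrightarrow> \<exists>rs\<in>F. avg n (\<lambda>i. \<bar>t i - profile rs n i\<bar>) \<le> d"
    using finite_profile_net[OF d max.cobounded2[of 0 M]] by blast
  have "\<forall>\<^sub>F n in sequentially. \<forall>rs\<in>F. \<bar>residual n T z (mat_diag n (profile rs n)) (perturbed n (mat_diag n (profile rs n)) (s n) (w n))\<bar> \<le> \<epsilon> / 2"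
    using F prof \<epsilon> by (intro eventually_ball_finite ballI eventually_abs_le) auto
  with M eventually_ge_at_top[of N]
  show "\<forall>\<^sub>F n in sequentially. \<bar>residual n T z (mat_diag n (t n)) (perturbed n (mat_diag n (t n)) (s n) (w n))\<bar> \<le> \<epsilon>"
  proof eventually_elim
    case (elim n)
    have "\<exists>rs\<in>F. avg n (\<lambda>i. \<bar>t n i - profile rs n i\<bar>) \<le> d" using elim t by (intro net) auto
    then obtain rs where rs: "rs \<in> F" "avg n (\<lambda>i. \<bar>t n i - profile rs n i\<bar>) \<le> d" by blast
    have "residual n T z (mat_diag n (t n)) (perturbed n (mat_diag n (t n)) (s n) (w n))
        \<le> residual n T z (mat_diag n (profile rs n)) (perturbed n (mat_diag n (profile rs n)) (s n) (w n))
          + C * avg n (\<lambda>i. \<bar>t n i - profile rs n i\<bar>)"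
      unfolding C_def by (rule residual_diag_lipschitz[OF T z order_refl])
    also have "\<dots> \<le> \<epsilon> / 2 + C * d"
      using elim(3) rs C by (intro add_mono mult_left_mono) (auto simp: abs_le_iff)
    also have "\<dots> \<le> \<epsilon>" using Cd by simp
    finally show ?case using residual_nonneg by simp
  qed
qed

section \<open>Wigner arrays and the Gaussian orthogonal ensemble\<close>

definition upper_entries :: "nat \<Rightarrow> real mat \<Rightarrow> nat \<times> nat \<Rightarrow> real" where
  "upper_entries n B = restrict (\<lambda>ij. B $$ ij) (upper n)"

context prob_space
begin

text \<open>
  Independence of a finite family means that its joint distribution is a product. Outside the index set, where nothing is
  known about \<open>Y\<close>, the measures are set to a point mass.
\<close>
lemma wigner_law_of_indep:
  assumes n: "1 \<le> n" and indep: "indep_vars (\<lambda>_. borel) Y (upper n)" and \<kappa>: "1 \<le> \<kappa>"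
    and fourth: "\<And>p. p \<in> upper n \<Longrightarrow> integrable M (\<lambda>w. Y p w ^ 4)"
      "\<And>p. p \<in> upper n \<Longrightarrow> expectation (\<lambda>w. Y p w ^ 4) \<le> \<kappa>"
    and mean: "\<And>p. p \<in> upper n \<Longrightarrow> expectation (Y p) = 0"
    and second: "\<And>p. p \<in> upper n \<Longrightarrow> expectation (\<lambda>w. (Y p w)\<^sup>2) \<le> \<kappa>"
      "\<And>p. p \<in> upper n \<Longrightarrow> fst p \<noteq> snd p \<Longrightarrow> expectation (\<lambda>w. (Y p w)\<^sup>2) = 1"
  shows "wigner_law n \<kappa> M (\<lambda>w. restrict (\<lambda>p. Y p w) (upper n))"
proof -
  have rv: "random_variable borel (Y p)" if "p \<in> upper n" for p
    using indep that by (auto simp: indep_vars_def)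
  have ne: "upper n \<noteq> {}" using n by (auto simp: upper_def intro!: exI[of _ 0])
  define \<nu> where "\<nu> p = distr M borel (if p \<in> upper n then Y p else (\<lambda>_. 0))" for p
  have \<nu>: "\<nu> p = distr M borel (Y p)" if "p \<in> upper n" for p using that by (simp add: \<nu>_def)
  have "distr M (upper_space n) (\<lambda>w. restrict (\<lambda>p. Y p w) (upper n)) = PiM (upper n) (\<lambda>p. distr M borel (Y p))"
    using indep_vars_iff_distr_eq_PiM'[OF ne, where X = Y and M' = "\<lambda>_. borel"] rv indep by blast
  also have "\<dots> = PiM (upper n) \<nu>" by (rule PiM_cong) (simp_all add: \<nu>)
  finally have d: "distr M (upper_space n) (\<lambda>w. restrict (\<lambda>p. Y p w) (upper n)) = PiM (upper n) \<nu>" .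
  have "wigner_entries n \<nu> \<kappa>"
  proof (intro wigner_entries.intro independent_reals.intro wigner_entries_axioms.intro)
    show "finite (upper n)" "1 \<le> \<kappa>" "0 < n" using \<kappa> n by auto
    show "prob_space (\<nu> p)" for p unfolding \<nu>_def by (rule prob_space_distr) (use rv in auto)
    show "sets (\<nu> p) = sets borel" for p by (simp add: \<nu>_def)
    fix p assume p: "p \<in> upper n"
    show "integrable (\<nu> p) (\<lambda>y. y ^ 4)" unfolding \<nu>[OF p] using rv[OF p] fourth(1)[OF p] by (subst integrable_distr_eq) auto
    show "(\<integral>y. y ^ 4 \<partial>\<nu> p) \<le> \<kappa>" unfolding \<nu>[OF p] using rv[OF p] fourth(2)[OF p] by (subst integral_distr) auto
    show "(\<integral>y. y \<partial>\<nu> p) = 0" unfolding \<nu>[OF p] using rv[OF p] mean[OF p] by (subst integral_distr) auto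
    show "(\<integral>y. y\<^sup>2 \<partial>\<nu> p) \<le> \<kappa>" unfolding \<nu>[OF p] using rv[OF p] second(1)[OF p] by (subst integral_distr) auto
    show "(\<integral>y. y\<^sup>2 \<partial>\<nu> p) = 1" if "fst p \<noteq> snd p"
      unfolding \<nu>[OF p] using rv[OF p] second(2)[OF p that] by (subst integral_distr) auto
  qed
  moreover have "(\<lambda>w. restrict (\<lambda>p. Y p w) (upper n)) \<in> measurable M (upper_space n)"
    by (rule measurable_restrict) (rule rv)
  ultimately show ?thesis using d by (auto simp: wigner_law_def)
qed

lemma wigner_law_array:
  assumes Z: "wigner_array Z" and n: "1 \<le> n"
  shows "wigner_law n (max 1 (expectation (\<lambda>w. Z w 0 0 ^ 4))) M (\<lambda>w. upper_entries n (top_left n (Z w)))"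
proof -
  note Z' = Z[unfolded wigner_array_def]
  have iv: "indep_vars (\<lambda>_. borel) (\<lambda>(i, j) w. Z w i j) {(i, j). i \<le> j}" using Z' by blast
  have sub: "upper n \<subseteq> {(i, j). i \<le> j}" by (auto simp: upper_def)
  have rv: "random_variable borel (\<lambda>w. Z w i j)" if "i \<le> j" for i j
    using iv that by (auto simp: indep_vars_def)
  have same: "distr M borel (\<lambda>w. Z w i j) = distr M borel (\<lambda>w. Z w 0 0)" if "i \<le> j" for i j using Z' that by blast
  have E: "expectation (\<lambda>w. f (Z w i j)) = expectation (\<lambda>w. f (Z w 0 0))" if "i \<le> j" "f \<in> borel_measurable borel"
    for f :: "real \<Rightarrow> real" and i j
    using integral_distr[OF rv[OF that(1)] that(2)] integral_distr[OF rv[OF order_refl] that(2)] unfolding same[OF that(1)] by simp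
  have I: "integrable M (\<lambda>w. Z w i j ^ 4)" if "i \<le> j" for i j
  proof -
    have m: "(\<lambda>y :: real. y ^ 4) \<in> borel_measurable borel" by simp
    have "integrable M (\<lambda>w. Z w 0 0 ^ 4)" using Z' by blast
    then have "integrable (distr M borel (\<lambda>w. Z w i j)) (\<lambda>y. y ^ 4)"
      unfolding same[OF that] by (rule integrable_distr_eq[OF rv[OF order_refl] m, THEN iffD2])
    then show ?thesis by (rule integrable_distr_eq[OF rv[OF that] m, THEN iffD1])
  qed
  have m0: "expectation (\<lambda>w. Z w 0 0) = 0" using Z' by blast
  have "variance (\<lambda>w. Z w 0 0) = 1" using Z' by blast
  then have v0: "expectation (\<lambda>w. (Z w 0 0)\<^sup>2) = 1" unfolding m0 by simp
  have eq: "upper_entries n (top_left n (Z w)) = restrict (\<lambda>p. (\<lambda>(i, j) w. Z w i j) p w) (upper n)" for w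
    by (auto simp: upper_entries_def top_left_def upper_def fun_eq_iff restrict_def)
  show ?thesis unfolding eq
  proof (rule wigner_law_of_indep[OF n indep_vars_subset[OF iv sub]])
    fix p assume "p \<in> upper n"
    then obtain i j where p: "p = (i, j)" "i \<le> j" by (auto simp: upper_def)
    show "integrable M (\<lambda>w. (\<lambda>(i, j) w. Z w i j) p w ^ 4)" using I[OF p(2)] by (simp add: p(1))
    show "expectation (\<lambda>w. (\<lambda>(i, j) w. Z w i j) p w ^ 4) \<le> max 1 (expectation (\<lambda>w. Z w 0 0 ^ 4))"
      using E[OF p(2), of "\<lambda>y. y ^ 4"] by (simp add: p(1))
    show "expectation ((\<lambda>(i, j) w. Z w i j) p) = 0" using E[OF p(2), of "\<lambda>y. y"] m0 by (simp add: p(1))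
    have "expectation (\<lambda>w. ((\<lambda>(i, j) w. Z w i j) p w)\<^sup>2) = 1" using E[OF p(2), of "\<lambda>y. y\<^sup>2"] v0 by (simp add: p(1))
    then show "expectation (\<lambda>w. ((\<lambda>(i, j) w. Z w i j) p w)\<^sup>2) \<le> max 1 (expectation (\<lambda>w. Z w 0 0 ^ 4))"
      "expectation (\<lambda>w. ((\<lambda>(i, j) w. Z w i j) p w)\<^sup>2) = 1" by simp_all
  qed simp
qed

text \<open>
  The constant \<open>12\<close> is the fourth moment \<open>3 * 2\<^sup>2\<close> of the diagonal entries.
\<close>
lemma wigner_law_GOE:
  assumes X: "GOE n X" and n: "1 \<le> n"
  shows "wigner_law n 12 M (\<lambda>w. upper_entries n (X w))"
  unfolding upper_entries_def
proof (rule wigner_law_of_indep[OF n])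
  note X' = X[unfolded GOE_def]
  have e: "(\<lambda>(i, j) w. X w $$ (i, j)) = (\<lambda>ij w. X w $$ ij)" by (simp add: fun_eq_iff)
  show "indep_vars (\<lambda>_. borel) (\<lambda>ij w. X w $$ ij) (upper n)" using X' unfolding upper_def e by blast
  fix p assume "p \<in> upper n"
  then obtain i j where p: "p = (i, j)" "i \<le> j" "j < n" by (auto simp: upper_def)
  define s :: real where "s = (if i = j then sqrt 2 else 1)"
  have s: "0 < s" "s\<^sup>2 = (if i = j then 2 else 1)" by (auto simp: s_def)
  have d: "distributed M lborel (\<lambda>w. X w $$ p) (normal_density 0 s)" using X' p unfolding s_def by blast
  have m4: "has_bochner_integral lborel (\<lambda>x. normal_density 0 s x * x ^ 4) (3 * (s\<^sup>2)\<^sup>2)"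
    using normal_moment_even[OF s(1), of 0 2] by (simp add: fact_numeral power_divide)
  have m2: "has_bochner_integral lborel (\<lambda>x. normal_density 0 s x * x\<^sup>2) (s\<^sup>2)"
    using normal_moment_even[OF s(1), of 0 1] by (simp add: fact_numeral power_divide)
  note I = distributed_integral[OF d] and J = distributed_integrable[OF d]
  show "integrable M (\<lambda>w. (X w $$ p) ^ 4)"
    using J[of "\<lambda>x. x ^ 4"] m4 by (simp add: has_bochner_integral_iff)
  show "expectation (\<lambda>w. (X w $$ p) ^ 4) \<le> 12"
    using I[of "\<lambda>x. x ^ 4"] m4 s(2) by (auto simp: has_bochner_integral_iff)
  show "expectation (\<lambda>w. X w $$ p) = 0"
    using I[of "\<lambda>x. x"] integral_normal_moment_nz_1[OF s(1), of 0] by simp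
  have "expectation (\<lambda>w. (X w $$ p)\<^sup>2) = s\<^sup>2"
    using I[of "\<lambda>x. x\<^sup>2"] m2 by (simp add: has_bochner_integral_iff)
  then show "expectation (\<lambda>w. (X w $$ p)\<^sup>2) \<le> 12" "fst p \<noteq> snd p \<Longrightarrow> expectation (\<lambda>w. (X w $$ p)\<^sup>2) = 1"
    using s(2) p(1) by auto
qed simp

end

lemma upper_entries_of_entries: "upper_entries n B = restrict (entries n B) (upper n)"
  using upper_subset[of n] by (auto simp: upper_entries_def entries_def fun_eq_iff restrict_def)

lemma symmetric_entry_pos:
  assumes "real_symmetric n B" "i < n" "j < n"
  shows "B $$ pos i j = B $$ (i, j)"
proof -
  have "B $$ (i, j) = B $$ (j, i)"
    using assms unfolding real_symmetric_def by (metis carrier_matD index_transpose_mat(1))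
  then show ?thesis by (cases "i \<le> j") (simp_all add: pos_def min_def max_def)
qed

lemma symm_upper_entries:
  assumes B: "real_symmetric n B" shows "symm n (upper_entries n B) = B"
proof (rule eq_matI)
  show "dim_row (symm n (upper_entries n B)) = dim_row B" "dim_col (symm n (upper_entries n B)) = dim_col B"
    using B by (auto simp: real_symmetric_def symm_def)
  fix i j assume "i < dim_row B" "j < dim_col B"
  then have ij: "i < n" "j < n" using B by (auto simp: real_symmetric_def)
  then show "symm n (upper_entries n B) $$ (i, j) = B $$ (i, j)"
    using symmetric_entry_pos[OF B ij] by (simp add: symm_def upper_entries_def)
qed

lemma (in prob_space) indep_upper_entries:
  assumes "indep_var (entry_space n) (\<lambda>w. entries n (X w)) (entry_space n) (\<lambda>w. entries n (Y w))"
  shows "indep_var (upper_space n) (\<lambda>w. upper_entries n (X w)) (upper_space n) (\<lambda>w. upper_entries n (Y w))"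
proof -
  have m: "(\<lambda>f. restrict f (upper n)) \<in> measurable (entry_space n) (upper_space n)"
    unfolding entry_space_def by (rule measurable_restrict_subset[OF upper_subset])
  show ?thesis
    using indep_var_compose[OF assms m m] by (simp add: comp_def upper_entries_of_entries)
qed

lemma real_symmetric_top_left:
  assumes "\<And>i j. z i j = z j i" shows "real_symmetric n (top_left n z)"
  unfolding real_symmetric_def top_left_def
  by (intro conjI eq_matI) (simp_all, rule assms)

lemma perturbed_symmetric_noise:
  assumes c: "B \<in> carrier_mat n n" and G: "real_symmetric n G"
  shows "B + s \<cdot>\<^sub>m G = perturbed n B s (upper_entries n G)"
proof (rule eq_matI)
  have c': "G \<in> carrier_mat n n" using G by (simp add: real_symmetric_def)
  show "dim_row (B + s \<cdot>\<^sub>m G) = dim_row (perturbed n B s (upper_entries n G))"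
    "dim_col (B + s \<cdot>\<^sub>m G) = dim_col (perturbed n B s (upper_entries n G))"
    using c c' by (auto simp: perturbed_def)
  fix i j assume "i < dim_row (perturbed n B s (upper_entries n G))" "j < dim_col (perturbed n B s (upper_entries n G))"
  then have ij: "i < n" "j < n" by (auto simp: perturbed_def)
  show "(B + s \<cdot>\<^sub>m G) $$ (i, j) = perturbed n B s (upper_entries n G) $$ (i, j)"
    using ij c c' symmetric_entry_pos[OF G ij] by (simp add: perturbed_def upper_entries_def)
qed

section \<open>Limits along a single path\<close>

lemma avg_cauchy: "\<bar>avg n (\<lambda>i. f i * g i)\<bar> \<le> sqrt (avg n (\<lambda>i. (f i)\<^sup>2)) * sqrt (avg n (\<lambda>i. (g i)\<^sup>2))"
proof -
  have "\<bar>avg n (\<lambda>i. f i * g i)\<bar> \<le> (\<Sum>i<n. \<bar>f i\<bar> * \<bar>g i\<bar>) / n"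
    unfolding avg_def abs_divide abs_of_nat
    by (intro divide_right_mono order_trans[OF sum_abs]) (simp_all add: abs_mult)
  also have "\<dots> \<le> (L2_set f {..<n} * L2_set g {..<n}) / n"
    by (intro divide_right_mono L2_set_mult_ineq) simp
  also have "\<dots> = sqrt (avg n (\<lambda>i. (f i)\<^sup>2)) * sqrt (avg n (\<lambda>i. (g i)\<^sup>2))"
    by (simp add: L2_set_def avg_def real_sqrt_divide)
  finally show ?thesis .
qed

lemma sum_diag_entries:
  "(\<Sum>i<n. \<Sum>j<n. mat_diag n t $$ (i, j) * f i j) = (\<Sum>i<n. t i * f i i :: real)"
proof (intro sum.cong refl)
  fix i assume i: "i \<in> {..<n}"
  then have "(\<Sum>j<n. mat_diag n t $$ (i, j) * f i j) = (\<Sum>j<n. of_bool (i = j) * (t i * f i j))"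
    by (intro sum.cong refl) (auto simp: mat_diag_def)
  also have "\<dots> = t i * f i i" using i by (simp only: sum_of_bool_mult lessThan_iff)
  finally show "(\<Sum>j<n. mat_diag n t $$ (i, j) * f i j) = t i * f i i" .
qed

lemma sum_diag_squares: "(\<Sum>i<n. \<Sum>j<n. (mat_diag n t $$ (i, j))\<^sup>2) = (\<Sum>i<n. (t i)\<^sup>2 :: real)"
proof -
  have "(\<Sum>i<n. t i * mat_diag n t $$ (i, i)) = (\<Sum>i<n. (t i)\<^sup>2)"
    by (intro sum.cong refl) (simp add: mat_diag_def power2_eq_square)
  then show ?thesis using sum_diag_entries[of n t "\<lambda>i j. mat_diag n t $$ (i, j)"] by (simp only: power2_eq_square)
qed

text \<open>This splits the second moment into the three quantities whose almost sure limits are known.\<close>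
lemma second_moment_perturbed:
  assumes B: "real_symmetric n B" and n: "1 \<le> n"
  shows "avg n (\<lambda>i. (eig_desc (perturbed n B (\<sigma> / sqrt n) w) i)\<^sup>2)
    = avg n (\<lambda>i. (eig_desc B i)\<^sup>2) + 2 * \<sigma> * ((\<Sum>i<n. \<Sum>j<n. B $$ (i, j) * w (pos i j)) / (n * sqrt n))
      + \<sigma>\<^sup>2 * ((\<Sum>i<n. \<Sum>j<n. (w (pos i j))\<^sup>2) / (real n)\<^sup>2)"
proof -
  define s where "s = \<sigma> / sqrt n"
  have n0: "real n \<noteq> 0" using n by simp
  have "(\<Sum>i<n. (eig_desc (perturbed n B s w) i)\<^sup>2) = (\<Sum>i<n. \<Sum>j<n. (perturbed n B s w $$ (i, j))\<^sup>2)"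
    by (rule sum_eig_desc_squares[OF perturbed_symmetric[OF B]])
  also have "\<dots> = (\<Sum>i<n. \<Sum>j<n. (B $$ (i, j))\<^sup>2 + 2 * s * (B $$ (i, j) * w (pos i j)) + s\<^sup>2 * (w (pos i j))\<^sup>2)"
    by (intro sum.cong refl) (simp add: perturbed_def power2_sum power_mult_distrib mult_ac)
  also have "\<dots> = (\<Sum>i<n. (eig_desc B i)\<^sup>2) + 2 * s * (\<Sum>i<n. \<Sum>j<n. B $$ (i, j) * w (pos i j)) + s\<^sup>2 * (\<Sum>i<n. \<Sum>j<n. (w (pos i j))\<^sup>2)"
    by (simp only: sum.distrib sum_distrib_left sum_eig_desc_squares[OF B])
  finally have eq: "(\<Sum>i<n. (eig_desc (perturbed n B s w) i)\<^sup>2) = \<dots>" .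
  have s2: "s\<^sup>2 = \<sigma>\<^sup>2 / n" by (simp add: s_def power_divide)
  show ?thesis unfolding s_def[symmetric] avg_def eq s2
    by (simp add: s_def add_divide_distrib power2_eq_square mult_ac)
qed

text \<open>
  A vector whose perturbed spectrum has bounded second moment has itself bounded second moment; this is how minimizers are
  controlled before anything else is known about them.
\<close>
lemma diag_second_moment_le:
  assumes n: "1 \<le> n"
  shows "avg n (\<lambda>i. (t i)\<^sup>2) \<le> 2 * avg n (\<lambda>i. (eig_desc (perturbed n (mat_diag n t) (\<sigma> / sqrt n) w) i)\<^sup>2)
    + 2 * \<sigma>\<^sup>2 * ((\<Sum>i<n. \<Sum>j<n. (w (pos i j))\<^sup>2) / (real n)\<^sup>2)"
proof -
  define s where "s = \<sigma> / sqrt n"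
  let ?P = "perturbed n (mat_diag n t) s w"
  have "(\<Sum>i<n. (t i)\<^sup>2) = (\<Sum>i<n. \<Sum>j<n. (mat_diag n t $$ (i, j))\<^sup>2)" by (rule sum_diag_squares[symmetric])
  also have "\<dots> \<le> (\<Sum>i<n. \<Sum>j<n. 2 * (?P $$ (i, j))\<^sup>2 + 2 * s\<^sup>2 * (w (pos i j))\<^sup>2)"
  proof (intro sum_mono)
    fix i j assume ij: "i \<in> {..<n}" "j \<in> {..<n}"
    have "x\<^sup>2 \<le> 2 * (x + y)\<^sup>2 + 2 * y\<^sup>2" for x y :: real
      using zero_le_power2[of "x + 2 * y"] by (simp add: power2_eq_square algebra_simps)
    from this[of "mat_diag n t $$ (i, j)" "s * w (pos i j)"]
    show "(mat_diag n t $$ (i, j))\<^sup>2 \<le> 2 * (?P $$ (i, j))\<^sup>2 + 2 * s\<^sup>2 * (w (pos i j))\<^sup>2"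
      using ij by (simp add: perturbed_def power_mult_distrib)
  qed
  also have "\<dots> = 2 * (\<Sum>i<n. (eig_desc ?P i)\<^sup>2) + 2 * s\<^sup>2 * (\<Sum>i<n. \<Sum>j<n. (w (pos i j))\<^sup>2)"
    by (simp only: sum.distrib sum_distrib_left sum_eig_desc_squares[OF perturbed_symmetric[OF real_symmetric_diag]])
  finally have le: "(\<Sum>i<n. (t i)\<^sup>2) \<le> \<dots>" .
  have s2: "s\<^sup>2 = \<sigma>\<^sup>2 / n" by (simp add: s_def power_divide)
  show ?thesis
    using divide_right_mono[OF le, of "real n"] unfolding s_def[symmetric] avg_def s2
    by (simp add: add_divide_distrib power2_eq_square mult_ac)
qed

text \<open>
  For \<open>Im z \<ge> 2 * \<sigma>\<close> the map \<open>s \<mapsto> stieltjes n x (z + \<sigma>\<^sup>2 s)\<close> is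
  Lipschitz with constant \<open>\<sigma>\<^sup>2 / (2 * \<sigma>)\<^sup>2 = 1 / 4\<close> on the upper half-plane, so that
  approximate fixed points are close to each other.
\<close>
lemma fixed_point_stable:
  assumes \<sigma>: "0 < \<sigma>" and z: "2 * \<sigma> \<le> Im z" and s: "0 \<le> Im s" "0 \<le> Im s'"
  shows "cmod (s - s') \<le> 2 * (cmod (s - stieltjes n x (z + of_real (\<sigma>\<^sup>2) * s)) + cmod (s' - stieltjes n x (z + of_real (\<sigma>\<^sup>2) * s')))"
proof -
  define f where "f s = stieltjes n x (z + of_real (\<sigma>\<^sup>2) * s)" for s
  have im: "2 * \<sigma> \<le> Im (z + of_real (\<sigma>\<^sup>2) * s)" if "0 \<le> Im s" for s
  proof -
    have "0 \<le> \<sigma>\<^sup>2 * Im s" using that by simp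
    moreover have "Im (z + of_real (\<sigma>\<^sup>2) * s) = Im z + \<sigma>\<^sup>2 * Im s" by simp
    ultimately show ?thesis using z by linarith
  qed
  have "cmod (f s - f s') \<le> ((\<Sum>k<n. \<bar>x k - x k\<bar>) / n + cmod ((z + of_real (\<sigma>\<^sup>2) * s) - (z + of_real (\<sigma>\<^sup>2) * s'))) / (2 * \<sigma>)\<^sup>2"
    unfolding f_def using \<sigma> by (intro stieltjes_lipschitz im s) simp
  also have "(z + of_real (\<sigma>\<^sup>2) * s) - (z + of_real (\<sigma>\<^sup>2) * s') = of_real (\<sigma>\<^sup>2) * (s - s')" by (simp add: algebra_simps)
  also have "((\<Sum>k<n. \<bar>x k - x k\<bar>) / n + cmod (of_real (\<sigma>\<^sup>2) * (s - s'))) / (2 * \<sigma>)\<^sup>2 = cmod (s - s') / 4"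
    using \<sigma> by (simp add: norm_mult norm_power power_mult_distrib)
  finally have f: "4 * cmod (f s - f s') \<le> cmod (s - s')" by simp
  have "cmod (s - s') = cmod ((s - f s) - (s' - f s') + (f s - f s'))" by simp
  also have "\<dots> \<le> cmod (s - f s) + cmod (s' - f s') + cmod (f s - f s')"
    by (intro order_trans[OF norm_triangle_ineq] add_right_mono norm_triangle_ineq4)
  finally have le: "cmod (s - s') \<le> cmod (s - f s) + cmod (s' - f s') + cmod (f s - f s')" .
  have "a \<le> 2 * b + 2 * c" if "a \<le> b + c + d" "4 * d \<le> a" "0 \<le> b" "0 \<le> c" for a b c d :: real
    using that by linarith
  from this[OF le _ norm_ge_zero norm_ge_zero] f
  have "cmod (s - s') \<le> 2 * (cmod (s - f s) + cmod (s' - f s'))" by simp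
  then show ?thesis unfolding f_def .
qed

lemma esd_stieltjes:
  assumes n: "1 \<le> n" and B: "real_symmetric n B"
  shows "real_distribution (esd B)" "(\<integral>x. 1 / (of_real x - z) \<partial>esd B) = stieltjes n (eig_desc B) z"
proof -
  have d: "dim_row B = n" using B by (auto simp: real_symmetric_def)
  have "0 \<in> {..<n}" using n by simp
  then have ne: "{..<n} \<noteq> {}" by blast
  interpret U: prob_space "uniform_count_measure {..<n}" by (rule prob_space_uniform_count_measure) (use ne in auto)
  have m: "eig_desc B \<in> measurable (uniform_count_measure {..<n}) borel"
    by (simp add: measurable_def uniform_count_measure_def)
  show "real_distribution (esd B)" unfolding esd_def d by (rule U.real_distribution_distr[OF m])
  have "(\<integral>x. 1 / (of_real x - z) \<partial>esd B) = (\<integral>k. 1 / (of_real (eig_desc B k) - z) \<partial>uniform_count_measure {..<n})"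
    unfolding esd_def d by (rule integral_distr[OF m]) measurable
  also have "\<dots> = stieltjes n (eig_desc B) z"
    unfolding uniform_count_measure_def using n
    by (subst lebesgue_integral_point_measure_finite)
       (simp_all add: stieltjes_def scaleR_conv_of_real sum_distrib_left[symmetric] divide_inverse mult.commute)
  finally show "(\<integral>x. 1 / (of_real x - z) \<partial>esd B) = stieltjes n (eig_desc B) z" .
qed

text \<open>
  The sequence is shifted by one because nothing is known about \<open>B 0\<close>, whose empirical measure need not be a
  probability measure.
\<close>
lemma stieltjes_weak_limit:
  assumes sym: "\<And>n. 1 \<le> n \<Longrightarrow> real_symmetric n (B n)" and H: "real_distribution H"
    and weak: "weak_conv_m (\<lambda>n. esd (B n)) H" and z: "0 < Im z"
  shows "(\<lambda>n. stieltjes n (eig_desc (B n)) z) \<longlonglongrightarrow> (\<integral>x. 1 / (of_real x - z) \<partial>H)"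
proof -
  have w: "weak_conv_m (\<lambda>n. esd (B (Suc n))) H"
    using weak unfolding weak_conv_m_def weak_conv_def by (auto intro: LIMSEQ_Suc)
  have nz: "of_real x - z \<noteq> 0" for x using z by (auto simp: complex_eq_iff)
  interpret H: real_distribution H by (rule H)
  have "(\<lambda>n. \<integral>x. 1 / (of_real x - z) \<partial>esd (B (Suc n))) \<longlonglongrightarrow> (\<integral>x. 1 / (of_real x - z) \<partial>H)"
  proof (rule weak_conv_imp_integral_bdd_continuous_conv[OF _ H w, of _ "1 / Im z"])
    show "real_distribution (esd (B (Suc n)))" for n by (rule esd_stieltjes[OF _ sym]) simp_all
    show "isCont (\<lambda>x. 1 / (of_real x - z)) x" for x by (intro continuous_intros nz)
    show "cmod (1 / (of_real x - z)) \<le> 1 / Im z" for x by (rule norm_inverse_real_diff_le[OF z order_refl])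
  qed
  then have "(\<lambda>n. stieltjes (Suc n) (eig_desc (B (Suc n))) z) \<longlonglongrightarrow> (\<integral>x. 1 / (of_real x - z) \<partial>H)"
    by (simp add: esd_stieltjes(2)[OF _ sym])
  then show ?thesis by (rule LIMSEQ_imp_Suc)
qed

text \<open>
  The properties of a single outcome that hold almost surely: \<open>w\<close> is the noise in the data, \<open>v\<close> the
  Gaussian noise used for fitting. Within this locale the argument is deterministic.
\<close>
locale noise_path =
  fixes \<sigma> K :: real and B :: "nat \<Rightarrow> real mat" and H :: "real measure" and w v :: "nat \<Rightarrow> nat \<times> nat \<Rightarrow> real"
  assumes \<sigma>: "0 < \<sigma>"
    and sym: "\<And>n. 1 \<le> n \<Longrightarrow> real_symmetric n (B n)"
    and K: "0 < K" "\<forall>\<^sub>F n in sequentially. \<forall>k<n. \<bar>eig_desc (B n) k\<bar> \<le> K"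
    and H: "real_distribution H" and weak: "weak_conv_m (\<lambda>n. esd (B n)) H"
    and residual_data: "\<And>z. 0 < Im z \<Longrightarrow>
      (\<lambda>n. residual n (\<sigma>\<^sup>2) z (B n) (perturbed n (B n) (\<sigma> / sqrt n) (w n))) \<longlonglongrightarrow> 0"
    and residual_profile: "\<And>rs z. 0 < Im z \<Longrightarrow>
      (\<lambda>n. residual n (\<sigma>\<^sup>2) z (mat_diag n (profile rs n)) (perturbed n (mat_diag n (profile rs n)) (\<sigma> / sqrt n) (v n))) \<longlonglongrightarrow> 0"
    and frob: "(\<lambda>n. (\<Sum>i<n. \<Sum>j<n. (w n (pos i j))\<^sup>2) / (real n)\<^sup>2) \<longlonglongrightarrow> 1"
      "(\<lambda>n. (\<Sum>i<n. \<Sum>j<n. (v n (pos i j))\<^sup>2) / (real n)\<^sup>2) \<longlonglongrightarrow> 1"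
    and cross: "(\<lambda>n. (\<Sum>i<n. \<Sum>j<n. B n $$ (i, j) * w n (pos i j)) / (n * sqrt n)) \<longlonglongrightarrow> 0"
    and diag: "(\<lambda>n. (\<Sum>i<n. (v n (i, i))\<^sup>2) / (real n)\<^sup>2) \<longlonglongrightarrow> 0"
begin

abbreviation "lam n \<equiv> eig_desc (B n)"
abbreviation "mu n \<equiv> eig_desc (perturbed n (B n) (\<sigma> / sqrt n) (w n))"
abbreviation "hat n t \<equiv> eig_desc (perturbed n (mat_diag n t) (\<sigma> / sqrt n) (v n))"

lemma decreasing:
  "i \<le> j \<Longrightarrow> j < n \<Longrightarrow> lam n j \<le> lam n i" "i \<le> j \<Longrightarrow> j < n \<Longrightarrow> mu n j \<le> mu n i"
  "i \<le> j \<Longrightarrow> j < n \<Longrightarrow> hat n t j \<le> hat n t i"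
  using spectral_theorem(2)[OF sym, of n i j] spectral_theorem(2)[OF perturbed_symmetric[OF sym], of n i j]
    spectral_theorem(2)[OF perturbed_symmetric[OF real_symmetric_diag], of i j n] by auto

lemma lam_second_moment: "\<forall>\<^sub>F n in sequentially. avg n (\<lambda>i. (lam n i)\<^sup>2) \<le> K\<^sup>2"
  using K(2)
proof eventually_elim
  case (elim n)
  have "avg n (\<lambda>i. (lam n i)\<^sup>2) \<le> avg n (\<lambda>i. K\<^sup>2)"
    using elim K(1) by (intro avg_mono) (simp add: abs_le_square_iff[symmetric])
  also have "\<dots> \<le> K\<^sup>2" by (rule avg_const_le) simp
  finally show ?case .
qed

lemma mu_second_moment: "(\<lambda>n. avg n (\<lambda>i. (mu n i)\<^sup>2) - avg n (\<lambda>i. (lam n i)\<^sup>2) - \<sigma>\<^sup>2) \<longlonglongrightarrow> 0"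
proof -
  have "(\<lambda>n. 2 * \<sigma> * ((\<Sum>i<n. \<Sum>j<n. B n $$ (i, j) * w n (pos i j)) / (n * sqrt n))
      + \<sigma>\<^sup>2 * ((\<Sum>i<n. \<Sum>j<n. (w n (pos i j))\<^sup>2) / (real n)\<^sup>2) - \<sigma>\<^sup>2) \<longlonglongrightarrow> 2 * \<sigma> * 0 + \<sigma>\<^sup>2 * 1 - \<sigma>\<^sup>2"
    by (intro tendsto_diff tendsto_add tendsto_mult tendsto_const cross frob)
  moreover have "\<forall>\<^sub>F n in sequentially. 2 * \<sigma> * ((\<Sum>i<n. \<Sum>j<n. B n $$ (i, j) * w n (pos i j)) / (n * sqrt n))
      + \<sigma>\<^sup>2 * ((\<Sum>i<n. \<Sum>j<n. (w n (pos i j))\<^sup>2) / (real n)\<^sup>2) - \<sigma>\<^sup>2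
      = avg n (\<lambda>i. (mu n i)\<^sup>2) - avg n (\<lambda>i. (lam n i)\<^sup>2) - \<sigma>\<^sup>2"
    using eventually_ge_at_top[of "1 :: nat"]
    by eventually_elim (simp add: second_moment_perturbed[OF sym])
  ultimately show ?thesis using Lim_transform_eventually by fastforce
qed

text \<open>
  For a diagonal matrix the cross term involves only the diagonal of the noise, whose contribution is negligible. The
  Cauchy--Schwarz inequality makes this uniform in \<open>t\<close>, so that \<open>t\<close> may depend on the noise.
\<close>
lemma hat_second_moment:
  assumes M: "\<forall>\<^sub>F n in sequentially. avg n (\<lambda>i. (t n i)\<^sup>2) \<le> M"
  shows "(\<lambda>n. avg n (\<lambda>i. (hat n (t n) i)\<^sup>2) - avg n (\<lambda>i. (eig_desc (mat_diag n (t n)) i)\<^sup>2) - \<sigma>\<^sup>2) \<longlonglongrightarrow> 0"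
proof -
  define c where "c n = (\<Sum>i<n. \<Sum>j<n. mat_diag n (t n) $$ (i, j) * v n (pos i j)) / (n * sqrt n)" for n
  have "\<forall>\<^sub>F n in sequentially. \<bar>c n\<bar> \<le> sqrt (max M 0) * sqrt ((\<Sum>i<n. (v n (i, i))\<^sup>2) / (real n)\<^sup>2)"
    using M eventually_ge_at_top[of "1 :: nat"]
  proof eventually_elim
    case (elim n)
    have n: "real n \<noteq> 0" using elim by simp
    have "c n = avg n (\<lambda>i. t n i * v n (i, i)) / sqrt n"
      unfolding c_def sum_diag_entries avg_def by (simp add: pos_def)
    also have "\<bar>\<dots>\<bar> \<le> sqrt (avg n (\<lambda>i. (t n i)\<^sup>2)) * sqrt (avg n (\<lambda>i. (v n (i, i))\<^sup>2)) / sqrt n"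
      unfolding abs_divide abs_of_nonneg[OF real_sqrt_ge_zero[OF of_nat_0_le_iff]]
      by (intro divide_right_mono avg_cauchy) simp
    also have "\<dots> = sqrt (avg n (\<lambda>i. (t n i)\<^sup>2)) * sqrt ((\<Sum>i<n. (v n (i, i))\<^sup>2) / (real n)\<^sup>2)"
      by (simp add: avg_def real_sqrt_divide)
    also have "\<dots> \<le> sqrt (max M 0) * sqrt ((\<Sum>i<n. (v n (i, i))\<^sup>2) / (real n)\<^sup>2)"
      using elim by (intro mult_right_mono real_sqrt_le_mono) (auto simp: sum_nonneg)
    finally show ?case .
  qed
  moreover have "(\<lambda>n. sqrt (max M 0) * sqrt ((\<Sum>i<n. (v n (i, i))\<^sup>2) / (real n)\<^sup>2)) \<longlonglongrightarrow> sqrt (max M 0) * sqrt 0"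
    by (intro tendsto_mult tendsto_const tendsto_real_sqrt diag)
  ultimately have "c \<longlonglongrightarrow> 0"
    using Lim_null_comparison[of c] by auto
  then have "(\<lambda>n. 2 * \<sigma> * c n + \<sigma>\<^sup>2 * ((\<Sum>i<n. \<Sum>j<n. (v n (pos i j))\<^sup>2) / (real n)\<^sup>2) - \<sigma>\<^sup>2) \<longlonglongrightarrow> 2 * \<sigma> * 0 + \<sigma>\<^sup>2 * 1 - \<sigma>\<^sup>2"
    by (intro tendsto_diff tendsto_add tendsto_mult tendsto_const frob)
  moreover have "\<forall>\<^sub>F n in sequentially. 2 * \<sigma> * c n + \<sigma>\<^sup>2 * ((\<Sum>i<n. \<Sum>j<n. (v n (pos i j))\<^sup>2) / (real n)\<^sup>2) - \<sigma>\<^sup>2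
      = avg n (\<lambda>i. (hat n (t n) i)\<^sup>2) - avg n (\<lambda>i. (eig_desc (mat_diag n (t n)) i)\<^sup>2) - \<sigma>\<^sup>2"
    using eventually_ge_at_top[of "1 :: nat"] unfolding c_def
    by eventually_elim (simp add: second_moment_perturbed[OF real_symmetric_diag])
  ultimately show ?thesis using Lim_transform_eventually by fastforce
qed

lemma hat_second_moment':
  assumes M: "\<forall>\<^sub>F n in sequentially. avg n (\<lambda>i. (t n i)\<^sup>2) \<le> M"
  shows "(\<lambda>n. avg n (\<lambda>i. (hat n (t n) i)\<^sup>2) - avg n (\<lambda>i. (t n i)\<^sup>2) - \<sigma>\<^sup>2) \<longlonglongrightarrow> 0"
  using hat_second_moment[OF M]
  by (simp only: avg_def sum_eig_desc_squares[OF real_symmetric_diag] sum_diag_squares)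

lemma residual_hat:
  assumes t: "\<And>n i j. i \<le> j \<Longrightarrow> j < n \<Longrightarrow> t n j \<le> t n i"
    and M: "\<forall>\<^sub>F n in sequentially. avg n (\<lambda>i. (t n i)\<^sup>2) \<le> M" and z: "0 < Im z"
  shows "(\<lambda>n. cmod (stieltjes n (hat n (t n)) z - stieltjes n (t n) (z + of_real (\<sigma>\<^sup>2) * stieltjes n (hat n (t n)) z))) \<longlonglongrightarrow> 0"
  using residual_tendsto_uniformly[OF _ z residual_profile[OF z] t M] unfolding residual_def stieltjes_diag by simp

text \<open>
  Above \<open>2 * \<sigma>\<close> both transforms are approximate fixed points of the same contraction.
\<close>
theorem fit_true_spectrum: "(\<lambda>n. avg n (\<lambda>i. (hat n (lam n) i - mu n i)\<^sup>2)) \<longlonglongrightarrow> 0"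
proof (rule sorted_distance_tendsto_zero[where c = "2 * \<sigma>"])
  show "i \<le> j \<Longrightarrow> j < n \<Longrightarrow> hat n (lam n) j \<le> hat n (lam n) i" "i \<le> j \<Longrightarrow> j < n \<Longrightarrow> mu n j \<le> mu n i" for n i j
    by (rule decreasing; assumption)+
  show "0 < 2 * \<sigma>" using \<sigma> by simp
  have "(\<lambda>n. (avg n (\<lambda>i. (hat n (lam n) i)\<^sup>2) - avg n (\<lambda>i. (lam n i)\<^sup>2) - \<sigma>\<^sup>2) - (avg n (\<lambda>i. (mu n i)\<^sup>2) - avg n (\<lambda>i. (lam n i)\<^sup>2) - \<sigma>\<^sup>2)) \<longlonglongrightarrow> 0 - 0"
    by (intro tendsto_diff hat_second_moment'[OF lam_second_moment] mu_second_moment)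
  then show "(\<lambda>n. avg n (\<lambda>i. (hat n (lam n) i)\<^sup>2) - avg n (\<lambda>i. (mu n i)\<^sup>2)) \<longlonglongrightarrow> 0" by simp
  have rmu: "(\<lambda>n. cmod (stieltjes n (mu n) z - stieltjes n (lam n) (z + of_real (\<sigma>\<^sup>2) * stieltjes n (mu n) z))) \<longlonglongrightarrow> 0" if "0 < Im z" for z
    using residual_data[OF that] unfolding residual_def .
  show "\<exists>C>0. \<forall>\<^sub>F n in sequentially. tail C n (mu n) \<le> \<epsilon>" if "0 < \<epsilon>" for \<epsilon>
  proof (rule uniformly_integrable_perturbed[where T = "\<sigma>\<^sup>2" and K = K and c = \<sigma>, OF _ _ K(2) mu_second_moment _ that])
    fix e assume "\<sigma> \<le> e"
    then show "(\<lambda>n. stieltjes n (mu n) (\<i> * of_real e) - stieltjes n (lam n) (\<i> * of_real e + of_real (\<sigma>\<^sup>2) * stieltjes n (mu n) (\<i> * of_real e))) \<longlonglongrightarrow> 0"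
      using \<sigma> by (intro tendsto_norm_zero_cancel[OF rmu]) simp
  qed (use K(1) in simp_all)
  fix e assume e: "2 * \<sigma> \<le> e"
  define z where "z = \<i> * complex_of_real e"
  have z: "2 * \<sigma> \<le> Im z" "0 < Im z" using e \<sigma> by (simp_all add: z_def)
  let ?h = "\<lambda>n. stieltjes n (hat n (lam n)) z" and ?m = "\<lambda>n. stieltjes n (mu n) z"
  have lim: "(\<lambda>n. 2 * (cmod (?h n - stieltjes n (lam n) (z + of_real (\<sigma>\<^sup>2) * ?h n)) + cmod (?m n - stieltjes n (lam n) (z + of_real (\<sigma>\<^sup>2) * ?m n)))) \<longlonglongrightarrow> 2 * (0 + 0)"
    by (intro tendsto_mult tendsto_add tendsto_const rmu residual_hat[OF _ lam_second_moment] z decreasing)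
  show "(\<lambda>n. stieltjes n (hat n (lam n)) (\<i> * of_real e) - stieltjes n (mu n) (\<i> * of_real e)) \<longlonglongrightarrow> 0"
    unfolding z_def[symmetric]
  proof (rule Lim_null_comparison[OF always_eventually, OF allI])
    show "cmod (?h n - ?m n) \<le> 2 * (cmod (?h n - stieltjes n (lam n) (z + of_real (\<sigma>\<^sup>2) * ?h n)) + cmod (?m n - stieltjes n (lam n) (z + of_real (\<sigma>\<^sup>2) * ?m n)))" for n
      by (rule fixed_point_stable[OF \<sigma> z(1) Im_stieltjes_nonneg[OF z(2)] Im_stieltjes_nonneg[OF z(2)]])
  qed (use lim in simp)
qed

lemma hat_close:
  assumes fit: "(\<lambda>n. avg n (\<lambda>i. (hat n (t n) i - mu n i)\<^sup>2)) \<longlonglongrightarrow> 0"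
  shows "\<exists>M. \<forall>\<^sub>F n in sequentially. avg n (\<lambda>i. (t n i)\<^sup>2) \<le> M"
    and "(\<lambda>n. avg n (\<lambda>i. (hat n (t n) i)\<^sup>2) - avg n (\<lambda>i. (mu n i)\<^sup>2)) \<longlonglongrightarrow> 0"
    and "0 < Im z \<Longrightarrow> (\<lambda>n. stieltjes n (hat n (t n)) z - stieltjes n (mu n) z) \<longlonglongrightarrow> 0"
proof -
  define d where "d n i = hat n (t n) i - mu n i" for n i
  define D where "D n = avg n (\<lambda>i. (d n i)\<^sup>2)" for n
  have one: "0 < (1 :: real)" by simp
  have D: "D \<longlonglongrightarrow> 0" using fit unfolding D_def d_def .
  have mu: "\<forall>\<^sub>F n in sequentially. avg n (\<lambda>i. (mu n i)\<^sup>2) \<le> K\<^sup>2 + \<sigma>\<^sup>2 + 1"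
    using lam_second_moment eventually_abs_le[OF mu_second_moment one]
    by eventually_elim (simp add: abs_le_iff)
  have sq: "avg n (\<lambda>i. (hat n (t n) i)\<^sup>2) = D n + 2 * avg n (\<lambda>i. d n i * mu n i) + avg n (\<lambda>i. (mu n i)\<^sup>2)" for n
  proof -
    have "avg n (\<lambda>i. (hat n (t n) i)\<^sup>2) = avg n (\<lambda>i. (d n i)\<^sup>2 + 2 * (d n i * mu n i) + (mu n i)\<^sup>2)"
      by (rule avg_cong) (simp add: d_def power2_eq_square algebra_simps)
    then show ?thesis by (simp only: avg_add avg_cmult D_def)
  qed
  have cross: "(\<lambda>n. avg n (\<lambda>i. d n i * mu n i)) \<longlonglongrightarrow> 0"
  proof (rule Lim_null_comparison)
    show "\<forall>\<^sub>F n in sequentially. norm (avg n (\<lambda>i. d n i * mu n i)) \<le> sqrt (D n) * sqrt (K\<^sup>2 + \<sigma>\<^sup>2 + 1)"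
      using mu
    proof eventually_elim
      case (elim n)
      have "norm (avg n (\<lambda>i. d n i * mu n i)) \<le> sqrt (D n) * sqrt (avg n (\<lambda>i. (mu n i)\<^sup>2))"
        unfolding D_def real_norm_def by (rule avg_cauchy)
      also have "\<dots> \<le> sqrt (D n) * sqrt (K\<^sup>2 + \<sigma>\<^sup>2 + 1)"
        using elim by (intro mult_left_mono real_sqrt_le_mono) (auto simp: D_def avg_nonneg)
      finally show ?case .
    qed
    have "(\<lambda>n. sqrt (D n) * sqrt (K\<^sup>2 + \<sigma>\<^sup>2 + 1)) \<longlonglongrightarrow> sqrt 0 * sqrt (K\<^sup>2 + \<sigma>\<^sup>2 + 1)"
      by (intro tendsto_mult tendsto_const tendsto_real_sqrt D)
    then show "(\<lambda>n. sqrt (D n) * sqrt (K\<^sup>2 + \<sigma>\<^sup>2 + 1)) \<longlonglongrightarrow> 0" by simp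
  qed
  have "(\<lambda>n. D n + 2 * avg n (\<lambda>i. d n i * mu n i)) \<longlonglongrightarrow> 0 + 2 * 0"
    by (intro tendsto_add tendsto_mult tendsto_const D cross)
  then show sec: "(\<lambda>n. avg n (\<lambda>i. (hat n (t n) i)\<^sup>2) - avg n (\<lambda>i. (mu n i)\<^sup>2)) \<longlonglongrightarrow> 0"
    unfolding sq by simp
  have "\<forall>\<^sub>F n in sequentially. avg n (\<lambda>i. (t n i)\<^sup>2) \<le> 2 * (K\<^sup>2 + \<sigma>\<^sup>2 + 2) + 2 * \<sigma>\<^sup>2 * 2"
  proof -
    have "\<forall>\<^sub>F n in sequentially. (\<Sum>i<n. \<Sum>j<n. (v n (pos i j))\<^sup>2) / (real n)\<^sup>2 < 2"
      by (rule order_tendstoD[OF frob(2)]) simp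
    then show ?thesis using mu eventually_abs_le[OF sec one] eventually_ge_at_top[of "1 :: nat"]
    proof eventually_elim
      case (elim n)
      have "avg n (\<lambda>i. (hat n (t n) i)\<^sup>2) \<le> K\<^sup>2 + \<sigma>\<^sup>2 + 2" using elim(2,3) by (simp add: abs_le_iff)
      then show ?case using elim(1)
        by (intro order_trans[OF diag_second_moment_le[OF elim(4), of "t n" \<sigma> "v n"]] add_mono mult_left_mono) auto
    qed
  qed
  then show "\<exists>M. \<forall>\<^sub>F n in sequentially. avg n (\<lambda>i. (t n i)\<^sup>2) \<le> M" by blast
  assume z: "0 < Im z"
  show "(\<lambda>n. stieltjes n (hat n (t n)) z - stieltjes n (mu n) z) \<longlonglongrightarrow> 0"
  proof (rule Lim_null_comparison[OF always_eventually, OF allI])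
    fix n
    have "cmod (stieltjes n (hat n (t n)) z - stieltjes n (mu n) z) \<le> (avg n (\<lambda>i. \<bar>d n i\<bar>) + cmod (z - z)) / (Im z)\<^sup>2"
      unfolding avg_def d_def by (rule stieltjes_lipschitz[OF z order_refl order_refl])
    also have "\<dots> = avg n (\<lambda>i. \<bar>d n i\<bar> * 1) / (Im z)\<^sup>2" by simp
    also have "\<dots> \<le> sqrt (D n) / (Im z)\<^sup>2"
    proof (rule divide_right_mono)
      have "avg n (\<lambda>i. \<bar>d n i\<bar> * 1) \<le> sqrt (avg n (\<lambda>i. \<bar>d n i\<bar>\<^sup>2)) * sqrt (avg n (\<lambda>i. 1\<^sup>2))"
        by (rule order_trans[OF abs_ge_self avg_cauchy])
      also have "\<dots> \<le> sqrt (avg n (\<lambda>i. \<bar>d n i\<bar>\<^sup>2)) * 1"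
        by (intro mult_left_mono) (auto simp: avg_nonneg avg_const_le)
      finally show "avg n (\<lambda>i. \<bar>d n i\<bar> * 1) \<le> sqrt (D n)" by (simp add: D_def)
    qed simp
    finally show "cmod (stieltjes n (hat n (t n)) z - stieltjes n (mu n) z) \<le> sqrt (D n) / (Im z)\<^sup>2" .
  next
    have "(\<lambda>n. sqrt (D n) / (Im z)\<^sup>2) \<longlonglongrightarrow> sqrt 0 / (Im z)\<^sup>2"
      using z by (intro tendsto_divide tendsto_const tendsto_real_sqrt D) simp
    then show "(\<lambda>n. sqrt (D n) / (Im z)\<^sup>2) \<longlonglongrightarrow> 0" by simp
  qed
qed

text \<open>
  On the imaginary axis above \<open>3 * \<sigma>\<close>, let \<open>e\<close> be the limit of the transform of the true
  spectrum at \<open>x\<close> and put \<open>z = x - \<sigma>\<^sup>2 e\<close>. Then \<open>Im z \<ge> 2 *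
  \<sigma>\<close>, and \<open>e\<close> is an approximate fixed point at \<open>z\<close>, so that the transforms of the
  perturbed data and, the fit being good, of the perturbed vector at \<open>z\<close> tend to \<open>e\<close>. The equation
  for the vector reads backwards: its transform at \<open>z + \<sigma>\<^sup>2 e = x\<close> tends to \<open>e\<close> as
  well.
\<close>
theorem good_fit_is_close:
  assumes t: "\<And>n i j. i \<le> j \<Longrightarrow> j < n \<Longrightarrow> t n j \<le> t n i"
    and fit: "(\<lambda>n. avg n (\<lambda>i. (hat n (t n) i - mu n i)\<^sup>2)) \<longlonglongrightarrow> 0"
  shows "(\<lambda>n. avg n (\<lambda>i. (t n i - lam n i)\<^sup>2)) \<longlonglongrightarrow> 0"
proof (rule sorted_distance_tendsto_zero[where c = "3 * \<sigma>"])
  obtain M where M: "\<forall>\<^sub>F n in sequentially. avg n (\<lambda>i. (t n i)\<^sup>2) \<le> M" using hat_close(1)[OF fit] by blast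
  show "i \<le> j \<Longrightarrow> j < n \<Longrightarrow> t n j \<le> t n i" "i \<le> j \<Longrightarrow> j < n \<Longrightarrow> lam n j \<le> lam n i" for n i j
    by (rule t decreasing; assumption)+
  show "0 < 3 * \<sigma>" using \<sigma> by simp
  have "(\<lambda>n. ((avg n (\<lambda>i. (hat n (t n) i)\<^sup>2) - avg n (\<lambda>i. (mu n i)\<^sup>2)) - (avg n (\<lambda>i. (hat n (t n) i)\<^sup>2) - avg n (\<lambda>i. (t n i)\<^sup>2) - \<sigma>\<^sup>2))
      + (avg n (\<lambda>i. (mu n i)\<^sup>2) - avg n (\<lambda>i. (lam n i)\<^sup>2) - \<sigma>\<^sup>2)) \<longlonglongrightarrow> (0 - 0) + 0"
    by (intro tendsto_add tendsto_diff hat_close(2)[OF fit] hat_second_moment'[OF M] mu_second_moment)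
  then show "(\<lambda>n. avg n (\<lambda>i. (t n i)\<^sup>2) - avg n (\<lambda>i. (lam n i)\<^sup>2)) \<longlonglongrightarrow> 0" by simp
  show "\<exists>C>0. \<forall>\<^sub>F n in sequentially. tail C n (lam n) \<le> \<epsilon>" if "0 < \<epsilon>" for \<epsilon>
  proof (intro exI[of _ K] conjI K(1))
    show "\<forall>\<^sub>F n in sequentially. tail K n (lam n) \<le> \<epsilon>"
      using K(2)
    proof eventually_elim
      case (elim n)
      have "tail K n (lam n) = avg n (\<lambda>i. 0)"
        unfolding tail_def by (rule avg_cong) (use elim in \<open>auto simp: clip_def abs_le_iff max_def min_def\<close>)
      then show ?case using that by (simp add: avg_def)
    qed
  qed
  fix h assume h: "3 * \<sigma> \<le> h"
  define x where "x = \<i> * complex_of_real h"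
  have x: "0 < Im x" "Im x = h" using h \<sigma> by (simp_all add: x_def)
  define e where "e = (\<integral>y. 1 / (of_real y - x) \<partial>H)"
  have e: "(\<lambda>n. stieltjes n (lam n) x) \<longlonglongrightarrow> e"
    unfolding e_def by (rule stieltjes_weak_limit[OF sym H weak x(1)])
  have Ime: "0 \<le> Im e"
    by (rule tendsto_lowerbound[OF tendsto_Im[OF e]]) (auto intro!: always_eventually Im_stieltjes_nonneg x)
  have "cmod e \<le> 1 / h"
    by (rule tendsto_upperbound[OF tendsto_norm[OF e]]) (auto intro!: always_eventually norm_stieltjes_le simp: x(2)[symmetric] x(1))
  then have "Im e \<le> 1 / h" using abs_Im_le_cmod[of e] by linarith
  also have "\<dots> \<le> 1 / (3 * \<sigma>)" using h \<sigma> by (intro divide_left_mono) auto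
  finally have "\<sigma>\<^sup>2 * Im e \<le> \<sigma>\<^sup>2 * (1 / (3 * \<sigma>))" by (intro mult_left_mono) auto
  also have "\<dots> = \<sigma> / 3" using \<sigma> by (simp add: power2_eq_square)
  finally have shift: "\<sigma>\<^sup>2 * Im e \<le> \<sigma> / 3" .
  \<comment> \<open>the point from which the equation leads to \<open>x\<close>\<close>
  define z where "z = x - of_real (\<sigma>\<^sup>2) * e"
  have zx: "z + of_real (\<sigma>\<^sup>2) * e = x" by (simp add: z_def)
  have "Im z = h - \<sigma>\<^sup>2 * Im e" by (simp add: z_def x)
  then have z: "2 * \<sigma> \<le> Im z" "0 < Im z" using shift h \<sigma> by linarith+
  let ?m = "\<lambda>n. stieltjes n (mu n) z" and ?h = "\<lambda>n. stieltjes n (hat n (t n)) z"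
  have m: "(\<lambda>n. ?m n - e) \<longlonglongrightarrow> 0"
  proof (rule Lim_null_comparison[OF always_eventually, OF allI])
    show "cmod (?m n - e) \<le> 2 * (cmod (?m n - stieltjes n (lam n) (z + of_real (\<sigma>\<^sup>2) * ?m n)) + cmod (e - stieltjes n (lam n) x))" for n
      using fixed_point_stable[OF \<sigma> z(1) Im_stieltjes_nonneg[OF z(2)] Ime] unfolding zx .
    have "(\<lambda>n. 2 * (cmod (?m n - stieltjes n (lam n) (z + of_real (\<sigma>\<^sup>2) * ?m n)) + cmod (e - stieltjes n (lam n) x))) \<longlonglongrightarrow> 2 * (0 + cmod (e - e))"
      using residual_data[OF z(2)] unfolding residual_def by (intro tendsto_mult tendsto_add tendsto_const tendsto_norm tendsto_diff e)
    then show "(\<lambda>n. 2 * (cmod (?m n - stieltjes n (lam n) (z + of_real (\<sigma>\<^sup>2) * ?m n)) + cmod (e - stieltjes n (lam n) x))) \<longlonglongrightarrow> 0" by simp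
  qed
  have "(\<lambda>n. (?h n - ?m n) + (?m n - e)) \<longlonglongrightarrow> 0 + 0"
    by (intro tendsto_add m hat_close(3)[OF fit z(2)])
  then have hat: "(\<lambda>n. ?h n - e) \<longlonglongrightarrow> 0" by simp
  have T0: "0 \<le> \<sigma>\<^sup>2" by simp
  have lip: "(\<lambda>n. stieltjes n (t n) (z + of_real (\<sigma>\<^sup>2) * ?h n) - stieltjes n (t n) x) \<longlonglongrightarrow> 0"
  proof (rule Lim_null_comparison[OF always_eventually, OF allI])
    fix n
    have "Im z \<le> Im (z + of_real (\<sigma>\<^sup>2) * ?h n)" by (rule Im_shifted_ge[OF T0 z(2)])
    moreover have "Im z \<le> Im x" using Ime zx[symmetric] by simp
    ultimately have "cmod (stieltjes n (t n) (z + of_real (\<sigma>\<^sup>2) * ?h n) - stieltjes n (t n) x)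
        \<le> ((\<Sum>k<n. \<bar>t n k - t n k\<bar>) / n + cmod ((z + of_real (\<sigma>\<^sup>2) * ?h n) - x)) / (Im z)\<^sup>2"
      by (intro stieltjes_lipschitz z(2))
    also have "(z + of_real (\<sigma>\<^sup>2) * ?h n) - x = of_real (\<sigma>\<^sup>2) * (?h n - e)" by (simp add: z_def algebra_simps)
    finally show "cmod (stieltjes n (t n) (z + of_real (\<sigma>\<^sup>2) * ?h n) - stieltjes n (t n) x) \<le> cmod (of_real (\<sigma>\<^sup>2) * (?h n - e)) / (Im z)\<^sup>2"
      by simp
  next
    have "(\<lambda>n. cmod (of_real (\<sigma>\<^sup>2) * (?h n - e)) / (Im z)\<^sup>2) \<longlonglongrightarrow> cmod (of_real (\<sigma>\<^sup>2) * 0) / (Im z)\<^sup>2"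
      using z by (intro tendsto_divide tendsto_norm tendsto_mult tendsto_const hat) simp
    then show "(\<lambda>n. cmod (of_real (\<sigma>\<^sup>2) * (?h n - e)) / (Im z)\<^sup>2) \<longlonglongrightarrow> 0" by simp
  qed
  have res: "(\<lambda>n. ?h n - stieltjes n (t n) (z + of_real (\<sigma>\<^sup>2) * ?h n)) \<longlonglongrightarrow> 0"
    by (rule tendsto_norm_zero_cancel[OF residual_hat[OF t M z(2)]])
  have "(\<lambda>n. (?h n - e) - (?h n - stieltjes n (t n) (z + of_real (\<sigma>\<^sup>2) * ?h n))
      - (stieltjes n (t n) (z + of_real (\<sigma>\<^sup>2) * ?h n) - stieltjes n (t n) x) - (stieltjes n (lam n) x - e)) \<longlonglongrightarrow> 0 - 0 - 0 - (e - e)"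
    by (intro tendsto_diff hat res lip e tendsto_const)
  then show "(\<lambda>n. stieltjes n (t n) (\<i> * of_real h) - stieltjes n (lam n) (\<i> * of_real h)) \<longlonglongrightarrow> 0"
    unfolding x_def[symmetric] by simp
qed

end

section \<open>Existence of a minimizer\<close>

text \<open>
  Vectors are functions on all natural numbers, in order to use the product topology; bounding every coordinate makes the set
  compact.
\<close>
definition ordered_box :: "nat \<Rightarrow> real \<Rightarrow> (nat \<Rightarrow> real) set" where
  "ordered_box n R = {t. (\<forall>i. \<bar>t i\<bar> \<le> R) \<and> (\<forall>i j. i \<le> j \<longrightarrow> j < n \<longrightarrow> t j \<le> t i)}"

lemma compact_ordered_box: "compact (ordered_box n R)"
proof -
  have c: "continuous_on UNIV (\<lambda>t :: nat \<Rightarrow> real. t i)" for i by (rule continuous_on_product_coordinates)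
  have "compactin (product_topology (\<lambda>_. euclidean) UNIV) (PiE UNIV (\<lambda>_ :: nat. {- R..R}))"
    by (simp add: compactin_PiE)
  then have "compact (PiE UNIV (\<lambda>_ :: nat. {- R..R}))" by (simp add: euclidean_product_topology)
  moreover have "closed (\<Inter>i. \<Inter>j. {t :: nat \<Rightarrow> real. i \<le> j \<longrightarrow> j < n \<longrightarrow> t j \<le> t i})"
  proof (intro closed_INT ballI)
    fix i j
    show "closed {t :: nat \<Rightarrow> real. i \<le> j \<longrightarrow> j < n \<longrightarrow> t j \<le> t i}"
      by (cases "i \<le> j \<and> j < n") (auto intro!: closed_Collect_le c)
  qed
  ultimately have "compact (PiE UNIV (\<lambda>_ :: nat. {- R..R}) \<inter> (\<Inter>i. \<Inter>j. {t :: nat \<Rightarrow> real. i \<le> j \<longrightarrow> j < n \<longrightarrow> t j \<le> t i}))"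
    by (rule compact_Int_closed)
  also have "PiE UNIV (\<lambda>_ :: nat. {- R..R}) \<inter> (\<Inter>i. \<Inter>j. {t :: nat \<Rightarrow> real. i \<le> j \<longrightarrow> j < n \<longrightarrow> t j \<le> t i}) = ordered_box n R"
    by (auto simp: ordered_box_def PiE_def Pi_def abs_le_iff minus_le_iff)
  finally show ?thesis .
qed

lemma continuous_eig_desc_perturbed_diag:
  assumes k: "k < n"
  shows "continuous_on UNIV (\<lambda>t. eig_desc (perturbed n (mat_diag n t) s w) k)"
  unfolding continuous_on_eq_continuous_at[OF open_UNIV] continuous_at
proof (intro ballI)
  fix t :: "nat \<Rightarrow> real"
  let ?e = "\<lambda>t. eig_desc (perturbed n (mat_diag n t) s w) k"
  have c: "((\<lambda>t'. t' i) \<longlongrightarrow> t i) (at t)" for i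
  proof -
    have "continuous_on UNIV (\<lambda>t :: nat \<Rightarrow> real. t i)" by (rule continuous_on_product_coordinates)
    then show ?thesis unfolding continuous_on_eq_continuous_at[OF open_UNIV] continuous_at by blast
  qed
  have "((\<lambda>t'. ?e t' - ?e t) \<longlongrightarrow> 0) (at t)"
  proof (rule Lim_null_comparison[OF always_eventually, OF allI])
    fix t'
    let ?P = "\<lambda>t. perturbed n (mat_diag n t) s w"
    have "(?e t' - ?e t)\<^sup>2 \<le> (\<Sum>k<n. (eig_desc (?P t') k - eig_desc (?P t) k)\<^sup>2)"
      using k by (intro member_le_sum[of k "{..<n}" "\<lambda>k. (eig_desc (?P t') k - eig_desc (?P t) k)\<^sup>2"]) auto
    also have "\<dots> \<le> (\<Sum>i<n. \<Sum>j<n. (?P t' $$ (i, j) - ?P t $$ (i, j))\<^sup>2)"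
      by (intro hoffman_wielandt perturbed_symmetric real_symmetric_diag)
    also have "\<dots> = (\<Sum>i<n. \<Sum>j<n. (mat_diag n (\<lambda>i. t' i - t i) $$ (i, j))\<^sup>2)"
      by (intro sum.cong refl) (simp add: perturbed_def mat_diag_def)
    also have "\<dots> = (\<Sum>i<n. (t' i - t i)\<^sup>2)" by (rule sum_diag_squares)
    finally show "norm (?e t' - ?e t) \<le> sqrt (\<Sum>i<n. (t' i - t i)\<^sup>2)"
      by (simp add: real_le_rsqrt)
  next
    have "((\<lambda>t'. sqrt (\<Sum>i<n. (t' i - t i)\<^sup>2)) \<longlongrightarrow> sqrt (\<Sum>i<n. (t i - t i)\<^sup>2)) (at t)"
      by (intro tendsto_real_sqrt tendsto_sum tendsto_power tendsto_diff c tendsto_const)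
    then show "((\<lambda>t'. sqrt (\<Sum>i<n. (t' i - t i)\<^sup>2)) \<longlongrightarrow> 0) (at t)" by simp
  qed
  then show "(?e \<longlongrightarrow> ?e t) (at t)" by (rule LIM_zero_cancel)
qed

text \<open>
  A vector that fits at least as well as the zero vector lies in a box of known size, and a continuous function attains its
  minimum on the compact set of decreasing vectors in this box.
\<close>
theorem ordered_fit_attains_minimum:
  fixes a :: "nat \<Rightarrow> real" and w :: "nat \<times> nat \<Rightarrow> real" and \<sigma> :: real
  assumes n: "1 \<le> n"
  defines "f \<equiv> \<lambda>t. avg n (\<lambda>i. (eig_desc (perturbed n (mat_diag n t) (\<sigma> / sqrt n) w) i - a i)\<^sup>2)"
  shows "\<exists>t. (\<forall>i j. i \<le> j \<longrightarrow> j < n \<longrightarrow> t j \<le> t i) \<and> (\<forall>t'. (\<forall>i j. i \<le> j \<longrightarrow> j < n \<longrightarrow> t' j \<le> t' i) \<longrightarrow> f t \<le> f t')"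
proof -
  define F where "F = (\<Sum>i<n. \<Sum>j<n. (w (pos i j))\<^sup>2) / (real n)\<^sup>2"
  \<comment> \<open>bounds the second moment of every vector that fits at least as well as zero\<close>
  define R where "R = 2 * (2 * f (\<lambda>_. 0) + 2 * avg n (\<lambda>i. (a i)\<^sup>2)) + 2 * \<sigma>\<^sup>2 * F"
  define r where "r = sqrt (n * R)"
  have f0: "0 \<le> f t" for t unfolding f_def by (rule avg_nonneg) simp
  have R0: "0 \<le> R" unfolding R_def F_def using f0[of "\<lambda>_. 0"] by (auto intro!: add_nonneg_nonneg mult_nonneg_nonneg divide_nonneg_nonneg sum_nonneg avg_nonneg)
  have bound: "\<bar>t i\<bar> \<le> r" if le: "f t \<le> f (\<lambda>_. 0)" and i: "i < n" for t i
  proof -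
    let ?e = "eig_desc (perturbed n (mat_diag n t) (\<sigma> / sqrt n) w)"
    have "avg n (\<lambda>i. (?e i)\<^sup>2) \<le> avg n (\<lambda>i. 2 * (?e i - a i)\<^sup>2 + 2 * (a i)\<^sup>2)"
    proof (rule avg_mono)
      fix i
      have "x\<^sup>2 \<le> 2 * (x - y)\<^sup>2 + 2 * y\<^sup>2" for x y :: real
        using zero_le_power2[of "x - 2 * y"] by (simp add: power2_eq_square algebra_simps)
      then show "(?e i)\<^sup>2 \<le> 2 * (?e i - a i)\<^sup>2 + 2 * (a i)\<^sup>2" .
    qed
    also have "\<dots> = 2 * f t + 2 * avg n (\<lambda>i. (a i)\<^sup>2)" by (simp only: avg_add avg_cmult f_def)
    also have "\<dots> \<le> 2 * f (\<lambda>_. 0) + 2 * avg n (\<lambda>i. (a i)\<^sup>2)" using le by simp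
    finally have "avg n (\<lambda>i. (t i)\<^sup>2) \<le> R"
      unfolding R_def F_def by (intro order_trans[OF diag_second_moment_le[OF n, of t \<sigma> w]] add_right_mono mult_left_mono) auto
    then have "(\<Sum>i<n. (t i)\<^sup>2) \<le> n * R" using n by (simp add: avg_def divide_le_eq mult.commute)
    moreover have "(t i)\<^sup>2 \<le> (\<Sum>i<n. (t i)\<^sup>2)" using i by (intro member_le_sum) auto
    ultimately have "(t i)\<^sup>2 \<le> n * R" by linarith
    then show ?thesis unfolding r_def by (simp add: real_le_rsqrt)
  qed
  have r0: "0 \<le> r" unfolding r_def using R0 by simp
  have "continuous_on (ordered_box n r) f"
    unfolding f_def avg_def using n
    by (intro continuous_intros continuous_on_subset[OF continuous_eig_desc_perturbed_diag subset_UNIV]) auto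
  moreover have zero: "(\<lambda>_. 0) \<in> ordered_box n r" using r0 by (simp add: ordered_box_def)
  ultimately obtain t where t: "t \<in> ordered_box n r" and min: "\<And>t'. t' \<in> ordered_box n r \<Longrightarrow> f t \<le> f t'"
    using continuous_attains_inf[OF compact_ordered_box, of n r f] by blast
  have "f t \<le> f t'" if t': "\<forall>i j. i \<le> j \<longrightarrow> j < n \<longrightarrow> t' j \<le> t' i" for t'
  proof (cases "f t' \<le> f (\<lambda>_. 0)")
    case True
    define t'' where "t'' i = (if i < n then t' i else 0)" for i
    have "mat_diag n t'' = mat_diag n t'" by (auto intro!: eq_matI simp: mat_diag_def t''_def)
    then have "f t'' = f t'" by (simp add: f_def)
    moreover have "t'' \<in> ordered_box n r" using bound[OF True] t' r0 by (auto simp: ordered_box_def t''_def)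
    ultimately show ?thesis using min by metis
  next
    case False
    then show ?thesis using min[OF zero] by simp
  qed
  then show ?thesis using t by (auto simp: ordered_box_def)
qed

section \<open>The estimator is consistent\<close>

text \<open>
  A constant random vector is independent of everything. In this way the theorem for random matrices applies to a fixed
  diagonal one.
\<close>
definition diagonal_entries :: "nat \<Rightarrow> (nat \<Rightarrow> real) \<Rightarrow> nat \<times> nat \<Rightarrow> real" where
  "diagonal_entries n t = restrict (\<lambda>(i, j). if i = j then t i else 0) (upper n)"

lemma symm_diagonal_entries: "symm n (diagonal_entries n t) = mat_diag n t"
  by (rule eq_matI) (auto simp: symm_def diagonal_entries_def mat_diag_def pos_def min_def max_def upper_def)

lemma diagonal_entries_space: "diagonal_entries n t \<in> space (upper_space n)"
  by (simp add: space_PiM diagonal_entries_def)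

lemma mat_diag_cong: "(\<And>i. i < n \<Longrightarrow> t i = t' i) \<Longrightarrow> mat_diag n t = mat_diag n t'"
  by (auto intro!: eq_matI simp: mat_diag_def)

context prob_space
begin

text \<open>Countably many almost sure statements, one for each profile among others, are combined.\<close>
lemma AE_noise_path:
  assumes \<sigma>: "0 < \<sigma>"
    and sym: "\<And>n w. n \<ge> 1 \<Longrightarrow> w \<in> space M \<Longrightarrow> real_symmetric n (A n w)"
    and H: "real_distribution H" and weak: "AE w in M. weak_conv_m (\<lambda>n. esd (A n w)) H"
    and bounded: "AE w in M. \<forall>\<^sub>F n in sequentially. \<forall>k<n. eig_desc (A n w) k \<in> {h1..h2}"
    and Z: "wigner_array Z"
    and ind: "\<And>n. n \<ge> 1 \<Longrightarrow> indep_var (entry_space n) (\<lambda>w. entries n (A n w)) (entry_space n) (\<lambda>w. entries n (top_left n (Z w)))"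
    and G: "\<And>n. n \<ge> 1 \<Longrightarrow> GOE n (G n)"
  shows "AE w in M. noise_path \<sigma> (max \<bar>h1\<bar> \<bar>h2\<bar> + 1) (\<lambda>n. A n w) H
    (\<lambda>n. upper_entries n (top_left n (Z w))) (\<lambda>n. upper_entries n (G n w))"
proof -
  define \<kappa> where "\<kappa> = max 1 (expectation (\<lambda>w. Z w 0 0 ^ 4))"
  define X where "X n w = upper_entries n (A n w)" for n w
  define W where "W n w = upper_entries n (top_left n (Z w))" for n w
  define V where "V n w = upper_entries n (G n w)" for n w
  define K where "K = max \<bar>h1\<bar> \<bar>h2\<bar> + 1"
  have K: "0 < K" by (simp add: K_def add_nonneg_pos)
  have WL: "wigner_law n \<kappa> M (W n)" if "n \<ge> 1" for n
    unfolding \<kappa>_def W_def using wigner_law_array[OF Z that] .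
  have VL: "wigner_law n 12 M (V n)" if "n \<ge> 1" for n
    unfolding V_def using wigner_law_GOE[OF G[OF that] that] .
  have XW: "indep_var (upper_space n) (X n) (upper_space n) (W n)" if "n \<ge> 1" for n
    using indep_upper_entries[OF ind[OF that]] unfolding X_def W_def .
  have profV: "indep_var (upper_space n) (\<lambda>_. diagonal_entries n (profile rs n)) (upper_space n) (V n)" if "n \<ge> 1" for n rs
    using VL[OF that] by (intro indep_var_const diagonal_entries_space) (simp add: wigner_law_def)
  have residual_A: "AE w in M. \<forall>z. 0 < Im z \<longrightarrow>
      (\<lambda>n. residual n (\<sigma>\<^sup>2) z (symm n (X n w)) (perturbed n (symm n (X n w)) (\<sigma> / sqrt n) (W n w))) \<longlonglongrightarrow> 0"
    by (rule AE_residual_tendsto_zero[OF refl XW WL])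
  have "AE w in M. \<forall>z. 0 < Im z \<longrightarrow>
      (\<lambda>n. residual n (\<sigma>\<^sup>2) z (mat_diag n (profile rs n)) (perturbed n (mat_diag n (profile rs n)) (\<sigma> / sqrt n) (V n w))) \<longlonglongrightarrow> 0" for rs
    using AE_residual_tendsto_zero[where X = "\<lambda>n _. diagonal_entries n (profile rs n)" and \<sigma> = \<sigma>, OF refl profV VL]
    unfolding symm_diagonal_entries .
  then have residual_prof: "AE w in M. \<forall>rs z. 0 < Im z \<longrightarrow>
      (\<lambda>n. residual n (\<sigma>\<^sup>2) z (mat_diag n (profile rs n)) (perturbed n (mat_diag n (profile rs n)) (\<sigma> / sqrt n) (V n w))) \<longlonglongrightarrow> 0"
    unfolding AE_all_countable by blast
  have linear: "AE w in M. (\<lambda>n. of_bool ((\<Sum>i<n. \<Sum>j<n. (X n w (pos i j))\<^sup>2) \<le> K\<^sup>2 * n) *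
      \<bar>(\<Sum>i<n. \<Sum>j<n. X n w (pos i j) * W n w (pos i j)) / (n * sqrt n)\<bar>) \<longlonglongrightarrow> 0"
    by (rule AE_linear[OF XW WL]) simp_all
  have frob_W: "AE w in M. (\<lambda>n. \<bar>(\<Sum>i<n. \<Sum>j<n. (W n w (pos i j))\<^sup>2) / (real n)\<^sup>2 - 1\<bar>) \<longlonglongrightarrow> 0"
    by (rule AE_frobenius[OF WL])
  have frob_V: "AE w in M. (\<lambda>n. \<bar>(\<Sum>i<n. \<Sum>j<n. (V n w (pos i j))\<^sup>2) / (real n)\<^sup>2 - 1\<bar>) \<longlonglongrightarrow> 0"
    by (rule AE_frobenius[OF VL])
  have diag_V: "AE w in M. (\<lambda>n. (\<Sum>i<n. (V n w (i, i))\<^sup>2) / (real n)\<^sup>2) \<longlonglongrightarrow> 0"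
    by (rule AE_diagonal[OF VL])
  show ?thesis
    unfolding W_def[symmetric] V_def[symmetric] K_def[symmetric]
    using weak bounded residual_A residual_prof linear frob_W frob_V diag_V AE_space
  proof eventually_elim
    case (elim w)
    have symX: "symm n (X n w) = A n w" if "n \<ge> 1" for n
      unfolding X_def by (rule symm_upper_entries[OF sym[OF that elim(9)]])
    have Xpos: "X n w (pos i j) = A n w $$ (i, j)" if "i < n" "j < n" for n i j
      using that symmetric_entry_pos[OF sym[OF _ elim(9)], of n i j] by (simp add: X_def upper_entries_def)
    have bd: "\<forall>\<^sub>F n in sequentially. \<forall>k<n. \<bar>eig_desc (A n w) k\<bar> \<le> K"
      using elim(2) by eventually_elim (fastforce simp: K_def)
    show ?case
    proof (intro noise_path.intro)
      show "0 < \<sigma>" "0 < K" "real_distribution H" by (fact \<sigma> K H)+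
      show "real_symmetric n (A n w)" if "1 \<le> n" for n by (rule sym[OF that elim(9)])
      show "\<forall>\<^sub>F n in sequentially. \<forall>k<n. \<bar>eig_desc (A n w) k\<bar> \<le> K" by (rule bd)
      show "weak_conv_m (\<lambda>n. esd (A n w)) H" by (rule elim(1))
      show "(\<lambda>n. residual n (\<sigma>\<^sup>2) z (A n w) (perturbed n (A n w) (\<sigma> / sqrt n) (W n w))) \<longlonglongrightarrow> 0" if "0 < Im z" for z
      proof (rule Lim_transform_eventually)
        show "(\<lambda>n. residual n (\<sigma>\<^sup>2) z (symm n (X n w)) (perturbed n (symm n (X n w)) (\<sigma> / sqrt n) (W n w))) \<longlonglongrightarrow> 0"
          using elim(3) that by blast
        show "\<forall>\<^sub>F n in sequentially. residual n (\<sigma>\<^sup>2) z (symm n (X n w)) (perturbed n (symm n (X n w)) (\<sigma> / sqrt n) (W n w))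
            = residual n (\<sigma>\<^sup>2) z (A n w) (perturbed n (A n w) (\<sigma> / sqrt n) (W n w))"
          using eventually_ge_at_top[of "1 :: nat"] by eventually_elim (simp only: symX)
      qed
      show "(\<lambda>n. residual n (\<sigma>\<^sup>2) z (mat_diag n (profile rs n)) (perturbed n (mat_diag n (profile rs n)) (\<sigma> / sqrt n) (V n w))) \<longlonglongrightarrow> 0"
        if "0 < Im z" for rs z using elim(4) that by blast
      show "(\<lambda>n. (\<Sum>i<n. \<Sum>j<n. (W n w (pos i j))\<^sup>2) / (real n)\<^sup>2) \<longlonglongrightarrow> 1"
        "(\<lambda>n. (\<Sum>i<n. \<Sum>j<n. (V n w (pos i j))\<^sup>2) / (real n)\<^sup>2) \<longlonglongrightarrow> 1"
        using LIM_zero_cancel[OF tendsto_rabs_zero_cancel[OF elim(6)]] LIM_zero_cancel[OF tendsto_rabs_zero_cancel[OF elim(7)]] .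
      show "(\<lambda>n. (\<Sum>i<n. (V n w (i, i))\<^sup>2) / (real n)\<^sup>2) \<longlonglongrightarrow> 0" by (rule elim(8))
      show "(\<lambda>n. (\<Sum>i<n. \<Sum>j<n. A n w $$ (i, j) * W n w (pos i j)) / (n * sqrt n)) \<longlonglongrightarrow> 0"
      proof (rule tendsto_rabs_zero_cancel, rule Lim_transform_eventually[OF elim(5)])
        show "\<forall>\<^sub>F n in sequentially. of_bool ((\<Sum>i<n. \<Sum>j<n. (X n w (pos i j))\<^sup>2) \<le> K\<^sup>2 * n) *
            \<bar>(\<Sum>i<n. \<Sum>j<n. X n w (pos i j) * W n w (pos i j)) / (n * sqrt n)\<bar>
            = \<bar>(\<Sum>i<n. \<Sum>j<n. A n w $$ (i, j) * W n w (pos i j)) / (n * sqrt n)\<bar>"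
          using bd eventually_ge_at_top[of "1 :: nat"]
        proof eventually_elim
          case (elim n)
          have "(\<Sum>i<n. \<Sum>j<n. (X n w (pos i j))\<^sup>2) = (\<Sum>i<n. \<Sum>j<n. (A n w $$ (i, j))\<^sup>2)"
            by (intro sum.cong refl) (simp add: Xpos)
          also have "\<dots> = (\<Sum>k<n. (eig_desc (A n w) k)\<^sup>2)"
            by (rule sum_eig_desc_squares[symmetric]) (use symX[OF elim(2)] symm_symmetric[of n "X n w"] in simp)
          also have "\<dots> \<le> (\<Sum>k<n. K\<^sup>2)"
            using elim(1) K by (intro sum_mono) (simp add: abs_le_square_iff[symmetric])
          finally have "(\<Sum>i<n. \<Sum>j<n. (X n w (pos i j))\<^sup>2) \<le> K\<^sup>2 * n" by (simp add: mult.commute)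
          moreover have "(\<Sum>i<n. \<Sum>j<n. X n w (pos i j) * W n w (pos i j)) = (\<Sum>i<n. \<Sum>j<n. A n w $$ (i, j) * W n w (pos i j))"
            by (intro sum.cong refl) (simp add: Xpos)
          ultimately show ?case by simp
        qed
      qed
    qed
  qed
qed

end

lemma fit_error_avg:
  assumes A: "real_symmetric n A" and Z: "\<And>i j. Z i j = Z j i" and G: "real_symmetric n G"
  shows "fit_error n (\<sigma> \<cdot>\<^sub>m G) (A + (\<sigma> / sqrt n) \<cdot>\<^sub>m top_left n Z) T
    = avg n (\<lambda>i. (eig_desc (perturbed n (mat_diag n (vec_index T)) (\<sigma> / sqrt n) (upper_entries n G)) i
        - eig_desc (perturbed n A (\<sigma> / sqrt n) (upper_entries n (top_left n Z))) i)\<^sup>2)"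
proof -
  have "(1 / sqrt n) \<cdot>\<^sub>m (\<sigma> \<cdot>\<^sub>m G) = (\<sigma> / sqrt n) \<cdot>\<^sub>m G"
    by (auto intro!: eq_matI)
  then have "mat_diag n (vec_index T) + (1 / sqrt n) \<cdot>\<^sub>m (\<sigma> \<cdot>\<^sub>m G) = perturbed n (mat_diag n (vec_index T)) (\<sigma> / sqrt n) (upper_entries n G)"
    using perturbed_symmetric_noise[OF mat_diag_dim G] by simp
  moreover have "A + (\<sigma> / sqrt n) \<cdot>\<^sub>m top_left n Z = perturbed n A (\<sigma> / sqrt n) (upper_entries n (top_left n Z))"
    using A by (intro perturbed_symmetric_noise real_symmetric_top_left Z) (simp add: real_symmetric_def)
  ultimately show ?thesis by (simp add: fit_error_def avg_def)
qed

lemma ordered_vec_iff: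
  "vec n t \<in> ordered_vecs n \<longleftrightarrow> (\<forall>i j. i \<le> j \<longrightarrow> j < n \<longrightarrow> t j \<le> t i)"
  by (auto simp: ordered_vecs_def)

lemma mat_diag_vec: "mat_diag n (vec_index (vec n t)) = mat_diag n t"
  by (rule mat_diag_cong) simp

theorem theorem4p1:
  fixes M :: "'w measure"
    and A :: "nat \<Rightarrow> 'w \<Rightarrow> real mat"
    and Z :: "'w \<Rightarrow> nat \<Rightarrow> nat \<Rightarrow> real"
    and G Zhat Ahat :: "nat \<Rightarrow> 'w \<Rightarrow> real mat"
    and H :: "real measure"
    and \<sigma> h1 h2 :: real
  assumes "prob_space M"
    and "\<sigma> > 0"
    and "\<And>n \<omega>. n \<ge> 1 \<Longrightarrow> \<omega> \<in> space M \<Longrightarrow> real_symmetric n (A n \<omega>)"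
    and "real_distribution H"
    and "AE \<omega> in M. weak_conv_m (\<lambda>n. esd (A n \<omega>)) H"
    and "\<exists>a b. measure H {a..b} = 1"
    and "AE \<omega> in M. \<forall>\<^sub>F n in sequentially. \<forall>k<n. eig_desc (A n \<omega>) k \<in> {h1..h2}"
    and "prob_space.wigner_array M Z"
    and "\<And>n. n \<ge> 1 \<Longrightarrow>
           prob_space.indep_var M
             (entry_space n) (\<lambda>\<omega>. entries n (A n \<omega>))
             (entry_space n) (\<lambda>\<omega>. entries n (top_left n (Z \<omega>)))"
    and "\<And>n \<omega>. Ahat n \<omega> = A n \<omega> + (\<sigma> / sqrt (real n)) \<cdot>\<^sub>m top_left n (Z \<omega>)"
    and "\<And>n. n \<ge> 1 \<Longrightarrow> prob_space.GOE M n (G n)"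
    and "\<And>n \<omega>. Zhat n \<omega> = \<sigma> \<cdot>\<^sub>m G n \<omega>"
    and "\<And>n. n \<ge> 1 \<Longrightarrow>
           prob_space.indep_elements M
             (entry_space n) (\<lambda>\<omega>. entries n (Zhat n \<omega>))
             (entry_space n \<Otimes>\<^sub>M entry_space n)
             (\<lambda>\<omega>. (entries n (A n \<omega>), entries n (top_left n (Z \<omega>))))"
  shows
    "((\<forall>n\<ge>1. \<forall>\<omega>\<in>space M.
         \<exists>T. is_arg_min (fit_error n (Zhat n \<omega>) (Ahat n \<omega>)) (\<lambda>T. T \<in> ordered_vecs n) T) \<and>
      (AE \<omega> in M.
         (\<lambda>n. INF T\<in>ordered_vecs n. fit_error n (Zhat n \<omega>) (Ahat n \<omega>) T) \<longlonglongrightarrow> 0)) \<and>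
     (\<forall>Tstar :: nat \<Rightarrow> 'w \<Rightarrow> real vec.
         (\<forall>n\<ge>1. AE \<omega> in M.
            is_arg_min (fit_error n (Zhat n \<omega>) (Ahat n \<omega>)) (\<lambda>T. T \<in> ordered_vecs n) (Tstar n \<omega>)) \<longrightarrow>
         (AE \<omega> in M.
            (\<lambda>n. (1 / real n) * (\<Sum>i<n. (vec_index (Tstar n \<omega>) i - eig_desc (A n \<omega>) i)\<^sup>2))
              \<longlonglongrightarrow> 0))"
proof -
  interpret prob_space M by (rule assms(1))
  note \<sigma> = assms(2) and sym = assms(3) and Z = assms(8) and G = assms(11)
  define W where "W n w = upper_entries n (top_left n (Z w))" for n w
  define V where "V n w = upper_entries n (G n w)" for n w
  have Zsym: "Z w i j = Z w j i" if "w \<in> space M" for w i j using Z that by (auto simp: wigner_array_def)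
  have Gsym: "real_symmetric n (G n w)" if "n \<ge> 1" "w \<in> space M" for n w
    using G[OF that(1)] that(2) by (auto simp: GOE_def)
  have fit: "fit_error n (Zhat n w) (Ahat n w) T
      = avg n (\<lambda>i. (eig_desc (perturbed n (mat_diag n (vec_index T)) (\<sigma> / sqrt n) (V n w)) i
        - eig_desc (perturbed n (A n w) (\<sigma> / sqrt n) (W n w)) i)\<^sup>2)" if "n \<ge> 1" "w \<in> space M" for n w T
    unfolding assms(10) assms(12) V_def W_def
    by (rule fit_error_avg[OF sym[OF that] Zsym[OF that(2)] Gsym[OF that]])
  have fit_nonneg: "0 \<le> fit_error n Zh Ah T" for n Zh Ah T
    unfolding fit_error_def by (simp add: sum_nonneg)
  have good: "AE w in M. w \<in> space M \<and> noise_path \<sigma> (max \<bar>h1\<bar> \<bar>h2\<bar> + 1) (\<lambda>n. A n w) H (\<lambda>n. W n w) (\<lambda>n. V n w)"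
  proof -
    have "AE w in M. noise_path \<sigma> (max \<bar>h1\<bar> \<bar>h2\<bar> + 1) (\<lambda>n. A n w) H (\<lambda>n. W n w) (\<lambda>n. V n w)"
      unfolding W_def V_def by (rule AE_noise_path[OF \<sigma> sym assms(4,5,7) Z assms(9) G])
    with AE_space show ?thesis by eventually_elim simp
  qed
  define L where "L n w = vec n (eig_desc (A n w))" for n w
  have L: "L n w \<in> ordered_vecs n" if "n \<ge> 1" "w \<in> space M" for n w
    unfolding L_def ordered_vec_iff using spectral_theorem(2)[OF sym[OF that]] by blast
  have L_fit: "(\<lambda>n. fit_error n (Zhat n w) (Ahat n w) (L n w)) \<longlonglongrightarrow> 0"
    if w: "w \<in> space M" "noise_path \<sigma> (max \<bar>h1\<bar> \<bar>h2\<bar> + 1) (\<lambda>n. A n w) H (\<lambda>n. W n w) (\<lambda>n. V n w)" for w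
  proof (rule Lim_transform_eventually[OF noise_path.fit_true_spectrum[OF w(2)]])
    show "\<forall>\<^sub>F n in sequentially. avg n (\<lambda>i. (eig_desc (perturbed n (mat_diag n (eig_desc (A n w))) (\<sigma> / sqrt n) (V n w)) i
        - eig_desc (perturbed n (A n w) (\<sigma> / sqrt n) (W n w)) i)\<^sup>2) = fit_error n (Zhat n w) (Ahat n w) (L n w)"
      using eventually_ge_at_top[of "1 :: nat"]
      by eventually_elim (simp only: fit[OF _ w(1)] L_def mat_diag_vec)
  qed
  have ex: "\<exists>T. is_arg_min (fit_error n (Zhat n w) (Ahat n w)) (\<lambda>T. T \<in> ordered_vecs n) T"
    if n: "n \<ge> 1" and w: "w \<in> space M" for n w
  proof -
    obtain t where t: "\<forall>i j. i \<le> j \<longrightarrow> j < n \<longrightarrow> t j \<le> t i"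
      and min: "\<And>t'. (\<forall>i j. i \<le> j \<longrightarrow> j < n \<longrightarrow> t' j \<le> t' i) \<Longrightarrow>
        avg n (\<lambda>i. (eig_desc (perturbed n (mat_diag n t) (\<sigma> / sqrt n) (V n w)) i - eig_desc (perturbed n (A n w) (\<sigma> / sqrt n) (W n w)) i)\<^sup>2)
        \<le> avg n (\<lambda>i. (eig_desc (perturbed n (mat_diag n t') (\<sigma> / sqrt n) (V n w)) i - eig_desc (perturbed n (A n w) (\<sigma> / sqrt n) (W n w)) i)\<^sup>2)"
      using ordered_fit_attains_minimum[OF n, of \<sigma> "V n w" "eig_desc (perturbed n (A n w) (\<sigma> / sqrt n) (W n w))"] by blast
    have "fit_error n (Zhat n w) (Ahat n w) (vec n t) \<le> fit_error n (Zhat n w) (Ahat n w) T" if "T \<in> ordered_vecs n" for T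
      unfolding fit[OF n w] mat_diag_vec by (rule min) (use that in \<open>auto simp: ordered_vecs_def\<close>)
    then have "is_arg_min (fit_error n (Zhat n w) (Ahat n w)) (\<lambda>T. T \<in> ordered_vecs n) (vec n t)"
      using t unfolding is_arg_min_def ordered_vec_iff not_ex by (meson leD)
    then show ?thesis ..
  qed
  have part1: "AE w in M. (\<lambda>n. INF T\<in>ordered_vecs n. fit_error n (Zhat n w) (Ahat n w) T) \<longlonglongrightarrow> 0"
    using good
  proof eventually_elim
    case (elim w)
    have bdd: "bdd_below (fit_error n (Zhat n w) (Ahat n w) ` ordered_vecs n)" for n
      by (rule bdd_belowI2[where m = 0]) (rule fit_nonneg)
    show ?case
    proof (rule tendsto_sandwich[OF _ _ tendsto_const L_fit])
      show "w \<in> space M" "noise_path \<sigma> (max \<bar>h1\<bar> \<bar>h2\<bar> + 1) (\<lambda>n. A n w) H (\<lambda>n. W n w) (\<lambda>n. V n w)" using elim by auto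
      show "\<forall>\<^sub>F n in sequentially. 0 \<le> (INF T\<in>ordered_vecs n. fit_error n (Zhat n w) (Ahat n w) T)"
        using eventually_ge_at_top[of "1 :: nat"]
      proof eventually_elim
        case (elim n)
        show ?case by (rule cINF_greatest) (use L[OF elim] \<open>w \<in> space M\<close> fit_nonneg in auto)
      qed
      show "\<forall>\<^sub>F n in sequentially. (INF T\<in>ordered_vecs n. fit_error n (Zhat n w) (Ahat n w) T) \<le> fit_error n (Zhat n w) (Ahat n w) (L n w)"
        using eventually_ge_at_top[of "1 :: nat"]
        by eventually_elim (rule cINF_lower[OF bdd L[OF _ \<open>w \<in> space M\<close>]])
    qed
  qed
  have part2: "AE w in M. (\<lambda>n. (1 / real n) * (\<Sum>i<n. (vec_index (Tstar n w) i - eig_desc (A n w) i)\<^sup>2)) \<longlonglongrightarrow> 0"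
    if Tstar: "\<forall>n\<ge>1. AE w in M. is_arg_min (fit_error n (Zhat n w) (Ahat n w)) (\<lambda>T. T \<in> ordered_vecs n) (Tstar n w)"
    for Tstar :: "nat \<Rightarrow> 'w \<Rightarrow> real vec"
  proof -
    have "AE w in M. \<forall>n. n \<ge> 1 \<longrightarrow> is_arg_min (fit_error n (Zhat n w) (Ahat n w)) (\<lambda>T. T \<in> ordered_vecs n) (Tstar n w)"
      unfolding AE_all_countable
    proof
      fix n show "AE w in M. n \<ge> 1 \<longrightarrow> is_arg_min (fit_error n (Zhat n w) (Ahat n w)) (\<lambda>T. T \<in> ordered_vecs n) (Tstar n w)"
        using Tstar by (cases "n \<ge> 1") auto
    qed
    with good show ?thesis
    proof eventually_elim
      case (elim w)
      then have w: "w \<in> space M" and np: "noise_path \<sigma> (max \<bar>h1\<bar> \<bar>h2\<bar> + 1) (\<lambda>n. A n w) H (\<lambda>n. W n w) (\<lambda>n. V n w)" by auto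
      define t where "t n = (if n \<ge> 1 then vec_index (Tstar n w) else (\<lambda>_. 0))" for n
      have mem: "Tstar n w \<in> ordered_vecs n"
        and opt: "T \<in> ordered_vecs n \<Longrightarrow> fit_error n (Zhat n w) (Ahat n w) (Tstar n w) \<le> fit_error n (Zhat n w) (Ahat n w) T"
        if "n \<ge> 1" for n T
        using elim(2) that unfolding is_arg_min_def by (blast, meson not_le)
      have dec: "t n j \<le> t n i" if "i \<le> j" "j < n" for n i j
        using mem[of n] that by (auto simp: t_def ordered_vecs_def)
      have small: "(\<lambda>n. avg n (\<lambda>i. (eig_desc (perturbed n (mat_diag n (t n)) (\<sigma> / sqrt n) (V n w)) i
          - eig_desc (perturbed n (A n w) (\<sigma> / sqrt n) (W n w)) i)\<^sup>2)) \<longlonglongrightarrow> 0"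
      proof (rule tendsto_sandwich[OF _ _ tendsto_const L_fit[OF w np]])
        show "\<forall>\<^sub>F n in sequentially. 0 \<le> avg n (\<lambda>i. (eig_desc (perturbed n (mat_diag n (t n)) (\<sigma> / sqrt n) (V n w)) i
          - eig_desc (perturbed n (A n w) (\<sigma> / sqrt n) (W n w)) i)\<^sup>2)"
          by (intro always_eventually allI avg_nonneg) simp
        show "\<forall>\<^sub>F n in sequentially. avg n (\<lambda>i. (eig_desc (perturbed n (mat_diag n (t n)) (\<sigma> / sqrt n) (V n w)) i
          - eig_desc (perturbed n (A n w) (\<sigma> / sqrt n) (W n w)) i)\<^sup>2) \<le> fit_error n (Zhat n w) (Ahat n w) (L n w)"
          using eventually_ge_at_top[of "1 :: nat"]
        proof eventually_elim
          case (elim n)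
          then show ?case using opt[OF elim L[OF elim w]] by (simp add: fit[OF elim w] t_def)
        qed
      qed
      show ?case
      proof (rule Lim_transform_eventually[OF noise_path.good_fit_is_close[OF np dec small]])
        show "\<forall>\<^sub>F n in sequentially. avg n (\<lambda>i. (t n i - eig_desc (A n w) i)\<^sup>2)
            = (1 / real n) * (\<Sum>i<n. (vec_index (Tstar n w) i - eig_desc (A n w) i)\<^sup>2)"
          using eventually_ge_at_top[of "1 :: nat"]
          by eventually_elim (simp add: avg_def t_def)
      qed
    qed
  qed
  show ?thesis using ex part1 part2 by blast
qed

end
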